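(* Let $K$ be a field, let $Q$ be a connected quiver, and let $\mathcal{R}_Q : \mathrm{rep}(Q) \to \mathrm{rep}(Q)$ be the global tensor functor of $Q$ (defined in the context). Let $V$ be a representation of $Q$. Then: (a) $\mathcal{R}_Q$ is a tensor functor, and it commutes with duality, i.e. there is a natural isomorphism of functors $D \circ \mathcal{R}_Q \cong \mathcal{R}_{Q^{op}} \circ D$. (b) For every arrow $a$ of $Q$, the linear map $(\mathcal{R}_Q V)_a$ is an isomorphism. Thus one can define a functor (the global rank functor on $Q$) from $\mathrm{rep}(Q)$ to the category of finite dimensional $K$-vector spaces by $V \mapsto (\mathcal{R}_Q V)_x$ for a vertex $x$ of $Q$, and the isomorphism class of this functor is independent of $x$. (c) If $Q$ is a tree, then $\mathcal{R}_Q V$ is isomorphic to a direct summand of $V$.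
   Context: A quiver $Q=(Q_0,Q_1,t,h)$ has a finite vertex set $Q_0$, a finite arrow set $Q_1$, and tail and head maps $t,h:Q_1\to Q_0$; oriented cycles are allowed. All quivers are assumed connected. $Q$ is a tree if its underlying graph is a tree (removing any edge makes it disconnected). $\mathrm{rep}(Q)$ is the category of finite dimensional representations of $Q$ over $K$: a representation $V$ consists of finite dimensional $K$-vector spaces $V_x$ ($x\in Q_0$) and linear maps $V_a:V_{ta}\to V_{ha}$ ($a\in Q_1$); a morphism $V\to W$ is a family of linear maps $\varphi_x:V_x\to W_x$ with $\varphi_{ha}\circ V_a=W_a\circ\varphi_{ta}$ for all arrows $a$. The opposite quiver is $Q^{op}=(Q_0,Q_1,h,t)$. The duality functor is the contravariant functor $D:\mathrm{rep}(Q)\to\mathrm{rep}(Q^{op})$, $(DV)_x=V_x^*$, $(DV)_a=V_a^*$. The tensor product is pointwise: $(V\otimes W)_x=V_x\otimes W_x$, $(V\otimes W)_a=V_a\otimes W_a$. The identity representation $\mathbf 1_Q$ has $(\mathbf 1_Q)_x=K$ for every vertex and $(\mathbf 1_Q)_a=\mathrm{id}_K$ for every arrow. Let $\phi_{X,Y,Z}:X\otimes(Y\otimes Z)\to(X\otimes Y)\otimes Z$ and $\psi_{X,Y}:X\otimes Y\to Y\otimes X$ be the standard associativity and commutativity isomorphisms, defined pointwise. A tensor functor $\mathrm{rep}(Q)\to\mathrm{rep}(Q')$ is a pair $(F,c)$ where $F$ is an additive functor and $c_{X,Y}:F(X)\otimes F(Y)\to F(X\otimes Y)$ is a functorial isomorphism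 such that: $c$ is compatible with associativity, i.e. $F(\phi_{X,Y,Z})\circ c_{X,Y\otimes Z}\circ(\mathrm{id}\otimes c_{Y,Z})=c_{X\otimes Y,Z}\circ(c_{X,Y}\otimes\mathrm{id})\circ\phi_{F(X),F(Y),F(Z)}$; $c$ is compatible with commutativity, i.e. $c_{Y,X}\circ\psi_{F(X),F(Y)}=F(\psi_{X,Y})\circ c_{X,Y}$; and $F(\mathbf 1_Q)\cong\mathbf 1_{Q'}$. A representation $V$ is called epimorphic (resp. monomorphic) if $V_a$ is surjective (resp. injective) for every arrow $a$. Every $V\in\mathrm{rep}(Q)$ has a unique maximal epimorphic subrepresentation $\mathcal{E}_Q(V)\subseteq V$ (the sum of all epimorphic subrepresentations) and a unique maximal monomorphic quotient $V\twoheadrightarrow\mathcal{M}_Q(V)$ (every monomorphic quotient of $V$ is a quotient of $\mathcal{M}_Q(V)$ compatibly with the maps from $V$). Both $\mathcal{E}_Q$ and $\mathcal{M}_Q$ are functors $\mathrm{rep}(Q)\to\mathrm{rep}(Q)$, and the composition $\mathcal{E}_Q(V)\hookrightarrow V\twoheadrightarrow\mathcal{M}_Q(V)$ is a natural transformation $\Phi:\mathcal{E}_Q\to\mathcal{M}_Q$. The global tensor functor of $Q$ is the image functor $\mathcal{R}_Q:=\mathrm{im}(\Phi)$, i.e. $\mathcal{R}_QV=\mathrm{im}(\mathcal{E}_Q(V)\to\mathcal{M}_Q(V))$. *)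

theory Defs
  imports
    "Graph_Theory.Digraph_Component"
    "Jordan_Normal_Form.Missing_VectorSpace"
    "HOL-Algebra.AbelCoset"
begin

text \<open>
  Foundational convention.  All vector spaces of one category have their elements in one fixed
  type \<open>'u\<close>: an object is any finite dimensional space whose underlying set is some set of
  elements of \<open>'u\<close>.  For the category to contain quotients, duals and tensor products, \<open>'u\<close> has
  to be large enough for the underlying set of every finite dimensional \<open>K\<close>-space to inject into
  it.  The type \<open>('k, 's) univ\<close> below has this property (coordinates with respect to a finite
  spanning set are lists of scalars), and through the summand \<open>'s\<close>, which is arbitrary, it
  covers representations on any given type.
\<close>

type_synonym ('k, 's) univ = "'s + 'k list"

section \<open>Additive categories, tensor categories and functors\<close>

text \<open>
  Morphisms are plain values, so the operations take the objects involved as arguments: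
  \<open>Comp C X Y Z g f\<close> is the composite of \<open>f : X \<rightarrow> Y\<close> and \<open>g : Y \<rightarrow> Z\<close>, and \<open>TMap C X X' Y Y' f g\<close>
  is the tensor product of \<open>f : X \<rightarrow> X'\<close> and \<open>g : Y \<rightarrow> Y'\<close>.  \<open>Assoc C X Y Z\<close> goes from
  \<open>X \<otimes> (Y \<otimes> Z)\<close> to \<open>(X \<otimes> Y) \<otimes> Z\<close> and \<open>Braid C X Y\<close> from \<open>X \<otimes> Y\<close> to \<open>Y \<otimes> X\<close>.
\<close>

record ('o, 'm) add_cat =
  Ob :: "'o set"
  Hom :: "'o \<Rightarrow> 'o \<Rightarrow> 'm set"
  Comp :: "'o \<Rightarrow> 'o \<Rightarrow> 'o \<Rightarrow> 'm \<Rightarrow> 'm \<Rightarrow> 'm"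
  Ident :: "'o \<Rightarrow> 'm"
  Plus :: "'o \<Rightarrow> 'o \<Rightarrow> 'm \<Rightarrow> 'm \<Rightarrow> 'm"

record ('o, 'm) tensor_cat = "('o, 'm) add_cat" +
  TOb :: "'o \<Rightarrow> 'o \<Rightarrow> 'o"
  TMap :: "'o \<Rightarrow> 'o \<Rightarrow> 'o \<Rightarrow> 'o \<Rightarrow> 'm \<Rightarrow> 'm \<Rightarrow> 'm"
  Assoc :: "'o \<Rightarrow> 'o \<Rightarrow> 'o \<Rightarrow> 'm"
  Braid :: "'o \<Rightarrow> 'o \<Rightarrow> 'm"
  Unit :: "'o"

record ('o, 'm, 'p, 'n) cat_functor =
  fob :: "'o \<Rightarrow> 'p"
  fmap :: "'o \<Rightarrow> 'o \<Rightarrow> 'm \<Rightarrow> 'n"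

definition op_cat :: "('o, 'm, 'z) add_cat_scheme \<Rightarrow> ('o, 'm) add_cat" where
  "op_cat C = \<lparr>
     Ob = Ob C,
     Hom = (\<lambda>X Y. Hom C Y X),
     Comp = (\<lambda>X Y Z g f. Comp C Z Y X f g),
     Ident = Ident C,
     Plus = (\<lambda>X Y. Plus C Y X) \<rparr>"

definition op_functor :: "('o, 'm, 'p, 'n) cat_functor \<Rightarrow> ('o, 'm, 'p, 'n) cat_functor" where
  "op_functor F = \<lparr> fob = fob F, fmap = (\<lambda>X Y. fmap F Y X) \<rparr>"

definition comp_functor ::
    "('p, 'n, 'q, 'l) cat_functor \<Rightarrow> ('o, 'm, 'p, 'n) cat_functor \<Rightarrow> ('o, 'm, 'q, 'l) cat_functor" where
  "comp_functor G F = \<lparr>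
     fob = (\<lambda>X. fob G (fob F X)),
     fmap = (\<lambda>X Y f. fmap G (fob F X) (fob F Y) (fmap F X Y f)) \<rparr>"

definition iso_arr :: "('o, 'm, 'z) add_cat_scheme \<Rightarrow> 'o \<Rightarrow> 'o \<Rightarrow> 'm \<Rightarrow> bool" where
  "iso_arr C X Y f \<longleftrightarrow> f \<in> Hom C X Y \<and>
     (\<exists>g\<in>Hom C Y X. Comp C X Y X g f = Ident C X \<and> Comp C Y X Y f g = Ident C Y)"

definition isomorphic :: "('o, 'm, 'z) add_cat_scheme \<Rightarrow> 'o \<Rightarrow> 'o \<Rightarrow> bool" where
  "isomorphic C X Y \<longleftrightarrow> (\<exists>f. iso_arr C X Y f)"

definition is_functor ::
    "('o, 'm, 'y) add_cat_scheme \<Rightarrow> ('p, 'n, 'z) add_cat_scheme \<Rightarrow> ('o, 'm, 'p, 'n) cat_functor \<Rightarrow> bool" where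
  "is_functor C D F \<longleftrightarrow>
     (\<forall>X\<in>Ob C. fob F X \<in> Ob D) \<and>
     (\<forall>X\<in>Ob C. \<forall>Y\<in>Ob C. \<forall>f\<in>Hom C X Y. fmap F X Y f \<in> Hom D (fob F X) (fob F Y)) \<and>
     (\<forall>X\<in>Ob C. fmap F X X (Ident C X) = Ident D (fob F X)) \<and>
     (\<forall>X\<in>Ob C. \<forall>Y\<in>Ob C. \<forall>Z\<in>Ob C. \<forall>f\<in>Hom C X Y. \<forall>g\<in>Hom C Y Z.
        fmap F X Z (Comp C X Y Z g f) =
        Comp D (fob F X) (fob F Y) (fob F Z) (fmap F Y Z g) (fmap F X Y f))"

definition additive_functor ::
    "('o, 'm, 'y) add_cat_scheme \<Rightarrow> ('p, 'n, 'z) add_cat_scheme \<Rightarrow> ('o, 'm, 'p, 'n) cat_functor \<Rightarrow> bool" where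
  "additive_functor C D F \<longleftrightarrow> is_functor C D F \<and>
     (\<forall>X\<in>Ob C. \<forall>Y\<in>Ob C. \<forall>f\<in>Hom C X Y. \<forall>g\<in>Hom C X Y.
        fmap F X Y (Plus C X Y f g) = Plus D (fob F X) (fob F Y) (fmap F X Y f) (fmap F X Y g))"

definition naturally_isomorphic ::
    "('o, 'm, 'y) add_cat_scheme \<Rightarrow> ('p, 'n, 'z) add_cat_scheme \<Rightarrow>
     ('o, 'm, 'p, 'n) cat_functor \<Rightarrow> ('o, 'm, 'p, 'n) cat_functor \<Rightarrow> bool" where
  "naturally_isomorphic C D F G \<longleftrightarrow> (\<exists>\<eta>.
     (\<forall>X\<in>Ob C. iso_arr D (fob F X) (fob G X) (\<eta> X)) \<and>
     (\<forall>X\<in>Ob C. \<forall>Y\<in>Ob C. \<forall>f\<in>Hom C X Y.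
        Comp D (fob F X) (fob F Y) (fob G Y) (\<eta> Y) (fmap F X Y f) =
        Comp D (fob F X) (fob G X) (fob G Y) (fmap G X Y f) (\<eta> X)))"

definition tensor_functor ::
    "('o, 'm) tensor_cat \<Rightarrow> ('p, 'n) tensor_cat \<Rightarrow> ('o, 'm, 'p, 'n) cat_functor \<Rightarrow>
     ('o \<Rightarrow> 'o \<Rightarrow> 'n) \<Rightarrow> bool" where
  "tensor_functor C D F c \<longleftrightarrow>
     additive_functor C D F \<and>
     (\<forall>X\<in>Ob C. \<forall>Y\<in>Ob C.
        iso_arr D (TOb D (fob F X) (fob F Y)) (fob F (TOb C X Y)) (c X Y)) \<and>
     (\<forall>X\<in>Ob C. \<forall>X'\<in>Ob C. \<forall>Y\<in>Ob C. \<forall>Y'\<in>Ob C. \<forall>f\<in>Hom C X X'. \<forall>g\<in>Hom C Y Y'.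
        Comp D (TOb D (fob F X) (fob F Y)) (TOb D (fob F X') (fob F Y')) (fob F (TOb C X' Y'))
          (c X' Y') (TMap D (fob F X) (fob F X') (fob F Y) (fob F Y') (fmap F X X' f) (fmap F Y Y' g)) =
        Comp D (TOb D (fob F X) (fob F Y)) (fob F (TOb C X Y)) (fob F (TOb C X' Y'))
          (fmap F (TOb C X Y) (TOb C X' Y') (TMap C X X' Y Y' f g)) (c X Y)) \<and>
     (\<forall>X\<in>Ob C. \<forall>Y\<in>Ob C. \<forall>Z\<in>Ob C.
        (let FX = fob F X; FY = fob F Y; FZ = fob F Z;
             S = TOb D FX (TOb D FY FZ);
             T = fob F (TOb C (TOb C X Y) Z)
         in Comp D S (fob F (TOb C X (TOb C Y Z))) T
              (fmap F (TOb C X (TOb C Y Z)) (TOb C (TOb C X Y) Z) (Assoc C X Y Z))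
              (Comp D S (TOb D FX (fob F (TOb C Y Z))) (fob F (TOb C X (TOb C Y Z)))
                 (c X (TOb C Y Z))
                 (TMap D FX FX (TOb D FY FZ) (fob F (TOb C Y Z)) (Ident D FX) (c Y Z))) =
            Comp D S (TOb D (fob F (TOb C X Y)) FZ) T
              (c (TOb C X Y) Z)
              (Comp D S (TOb D (TOb D FX FY) FZ) (TOb D (fob F (TOb C X Y)) FZ)
                 (TMap D (TOb D FX FY) (fob F (TOb C X Y)) FZ FZ (c X Y) (Ident D FZ))
                 (Assoc D FX FY FZ)))) \<and>
     (\<forall>X\<in>Ob C. \<forall>Y\<in>Ob C.
        Comp D (TOb D (fob F X) (fob F Y)) (TOb D (fob F Y) (fob F X)) (fob F (TOb C Y X))
          (c Y X) (Braid D (fob F X) (fob F Y)) =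
        Comp D (TOb D (fob F X) (fob F Y)) (fob F (TOb C X Y)) (fob F (TOb C Y X))
          (fmap F (TOb C X Y) (TOb C Y X) (Braid C X Y)) (c X Y)) \<and>
     isomorphic D (fob F (Unit C)) (Unit D)"

section \<open>Finite dimensional vector spaces\<close>

definition fd_space :: "('k, 'z) ring_scheme \<Rightarrow> ('k, 'u) module \<Rightarrow> bool" where
  "fd_space K V \<longleftrightarrow> vectorspace K V \<and> vectorspace.fin_dim K V"

text \<open>Linear maps are extensional, so that they are equal iff they agree on the domain.\<close>

definition lin :: "('k, 'z) ring_scheme \<Rightarrow> ('k, 'u) module \<Rightarrow> ('k, 'w) module \<Rightarrow> ('u \<Rightarrow> 'w) set" where
  "lin K V W = module_hom K V W \<inter> extensional (carrier V)"

definition Vect :: "('k, 'z) ring_scheme \<Rightarrow> (('k, 'u) module, 'u \<Rightarrow> 'u) add_cat" where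
  "Vect K = \<lparr>
     Ob = {V. fd_space K V},
     Hom = lin K,
     Comp = (\<lambda>V W U g f. compose (carrier V) g f),
     Ident = (\<lambda>V. \<lambda>v\<in>carrier V. v),
     Plus = (\<lambda>V W f g. \<lambda>v\<in>carrier V. f v \<oplus>\<^bsub>W\<^esub> g v) \<rparr>"

text \<open>
  Quotients, duals and tensor products are first built in their usual form, as sets of cosets or
  functions, and then copied into \<open>'u\<close> along a fixed injection.  The fields \<open>mult\<close> and \<open>one\<close> of
  the record type \<open>module\<close> play no role in a module and are filled arbitrarily.
\<close>

definition embed :: "('k, 't) module \<Rightarrow> 't \<Rightarrow> 'u" where
  "embed M = (SOME e. inj_on e (carrier M))"

definition unembed :: "('k, 't) module \<Rightarrow> 'u \<Rightarrow> 't" where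
  "unembed M = inv_into (carrier M) (embed M)"

definition copy :: "('k, 't) module \<Rightarrow> ('k, 'u) module" where
  "copy M = \<lparr>
     carrier = embed M ` carrier M,
     mult = (\<lambda>_ _. embed M \<zero>\<^bsub>M\<^esub>),
     one = embed M \<zero>\<^bsub>M\<^esub>,
     zero = embed M \<zero>\<^bsub>M\<^esub>,
     add = (\<lambda>x y. embed M (unembed M x \<oplus>\<^bsub>M\<^esub> unembed M y)),
     smult = (\<lambda>c x. embed M (c \<odot>\<^bsub>M\<^esub> unembed M x)) \<rparr>"

definition coset_space :: "('k, 't) module \<Rightarrow> 't set \<Rightarrow> ('k, 't set) module" where
  "coset_space V N = \<lparr>
     carrier = a_rcosets\<^bsub>V\<^esub> N,
     mult = (\<lambda>_ _. N),
     one = N,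
     zero = N,
     add = (\<lambda>A B. A <+>\<^bsub>V\<^esub> B),
     smult = (\<lambda>c A. \<Union>v\<in>A. N +>\<^bsub>V\<^esub> (c \<odot>\<^bsub>V\<^esub> v)) \<rparr>"

definition quot_space :: "('k, 't) module \<Rightarrow> 't set \<Rightarrow> ('k, 'u) module" where
  "quot_space V N = copy (coset_space V N)"

definition quot_proj :: "('k, 't) module \<Rightarrow> 't set \<Rightarrow> 't \<Rightarrow> 'u" where
  "quot_proj V N = (\<lambda>v\<in>carrier V. embed (coset_space V N) (N +>\<^bsub>V\<^esub> v))"

definition self_module :: "('k, 'z) ring_scheme \<Rightarrow> ('k, 'k) module" where
  "self_module K = \<lparr>
     carrier = carrier K, mult = mult K, one = one K, zero = zero K, add = add K, smult = mult K \<rparr>"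

definition functionals :: "('k, 'z) ring_scheme \<Rightarrow> ('k, 'u) module \<Rightarrow> ('k, 'u \<Rightarrow> 'k) module" where
  "functionals K V = \<lparr>
     carrier = lin K V (self_module K),
     mult = (\<lambda>_ _. \<lambda>v\<in>carrier V. \<zero>\<^bsub>K\<^esub>),
     one = (\<lambda>v\<in>carrier V. \<zero>\<^bsub>K\<^esub>),
     zero = (\<lambda>v\<in>carrier V. \<zero>\<^bsub>K\<^esub>),
     add = (\<lambda>f g. \<lambda>v\<in>carrier V. f v \<oplus>\<^bsub>K\<^esub> g v),
     smult = (\<lambda>c f. \<lambda>v\<in>carrier V. c \<otimes>\<^bsub>K\<^esub> f v) \<rparr>"

definition dual :: "('k, 'z) ring_scheme \<Rightarrow> ('k, 'u) module \<Rightarrow> ('k, 'u) module" where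
  "dual K V = copy (functionals K V)"

definition dual_map ::
    "('k, 'z) ring_scheme \<Rightarrow> ('k, 'u) module \<Rightarrow> ('k, 'u) module \<Rightarrow> ('u \<Rightarrow> 'u) \<Rightarrow> 'u \<Rightarrow> 'u" where
  "dual_map K V W f = (\<lambda>\<xi>\<in>carrier (dual K W).
     embed (functionals K V) (compose (carrier V) (unembed (functionals K W) \<xi>) f))"

definition free_space :: "('k, 'z) ring_scheme \<Rightarrow> 'i set \<Rightarrow> ('k, 'i \<Rightarrow> 'k) module" where
  "free_space K I = \<lparr>
     carrier = {p. (\<forall>i\<in>I. p i \<in> carrier K) \<and> (\<forall>i. i \<notin> I \<longrightarrow> p i = \<zero>\<^bsub>K\<^esub>) \<and> finite {i. p i \<noteq> \<zero>\<^bsub>K\<^esub>}},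
     mult = (\<lambda>_ _ _. \<zero>\<^bsub>K\<^esub>),
     one = (\<lambda>_. \<zero>\<^bsub>K\<^esub>),
     zero = (\<lambda>_. \<zero>\<^bsub>K\<^esub>),
     add = (\<lambda>p q i. p i \<oplus>\<^bsub>K\<^esub> q i),
     smult = (\<lambda>c p i. c \<otimes>\<^bsub>K\<^esub> p i) \<rparr>"

definition free_gen :: "('k, 'z) ring_scheme \<Rightarrow> 'i \<Rightarrow> 'i \<Rightarrow> 'k" where
  "free_gen K i = (\<lambda>j. if j = i then \<one>\<^bsub>K\<^esub> else \<zero>\<^bsub>K\<^esub>)"

text \<open>\<open>V \<otimes> W\<close> is the free space on \<open>V \<times> W\<close> modulo the span of the bilinearity relations.\<close>

definition tensor_free ::
    "('k, 'z) ring_scheme \<Rightarrow> ('k, 'u) module \<Rightarrow> ('k, 'u) module \<Rightarrow> ('k, 'u \<times> 'u \<Rightarrow> 'k) module" where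
  "tensor_free K V W = free_space K (carrier V \<times> carrier W)"

definition bilin_rels ::
    "('k, 'z) ring_scheme \<Rightarrow> ('k, 'u) module \<Rightarrow> ('k, 'u) module \<Rightarrow> ('u \<times> 'u \<Rightarrow> 'k) set" where
  "bilin_rels K V W = (let F = tensor_free K V W; \<delta> = (\<lambda>v w. free_gen K (v, w)) in
     {\<delta> (v \<oplus>\<^bsub>V\<^esub> v') w \<ominus>\<^bsub>F\<^esub> (\<delta> v w \<oplus>\<^bsub>F\<^esub> \<delta> v' w) | v v' w.
        v \<in> carrier V \<and> v' \<in> carrier V \<and> w \<in> carrier W} \<union>
     {\<delta> v (w \<oplus>\<^bsub>W\<^esub> w') \<ominus>\<^bsub>F\<^esub> (\<delta> v w \<oplus>\<^bsub>F\<^esub> \<delta> v w') | v w w'.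
        v \<in> carrier V \<and> w \<in> carrier W \<and> w' \<in> carrier W} \<union>
     {\<delta> (r \<odot>\<^bsub>V\<^esub> v) w \<ominus>\<^bsub>F\<^esub> r \<odot>\<^bsub>F\<^esub> \<delta> v w | r v w.
        r \<in> carrier K \<and> v \<in> carrier V \<and> w \<in> carrier W} \<union>
     {\<delta> v (r \<odot>\<^bsub>W\<^esub> w) \<ominus>\<^bsub>F\<^esub> r \<odot>\<^bsub>F\<^esub> \<delta> v w | r v w.
        r \<in> carrier K \<and> v \<in> carrier V \<and> w \<in> carrier W})"

definition bilin_span ::
    "('k, 'z) ring_scheme \<Rightarrow> ('k, 'u) module \<Rightarrow> ('k, 'u) module \<Rightarrow> ('u \<times> 'u \<Rightarrow> 'k) set" where
  "bilin_span K V W = LinearCombinations.module.span K (tensor_free K V W) (bilin_rels K V W)"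

definition tensor ::
    "('k, 'z) ring_scheme \<Rightarrow> ('k, 'u) module \<Rightarrow> ('k, 'u) module \<Rightarrow> ('k, 'u) module" where
  "tensor K V W = quot_space (tensor_free K V W) (bilin_span K V W)"

definition pure_tensor ::
    "('k, 'z) ring_scheme \<Rightarrow> ('k, 'u) module \<Rightarrow> ('k, 'u) module \<Rightarrow> 'u \<Rightarrow> 'u \<Rightarrow> 'u" where
  "pure_tensor K V W v w = quot_proj (tensor_free K V W) (bilin_span K V W) (free_gen K (v, w))"

text \<open>
  The next three maps are given by their values on pure tensors, which span the tensor product:
  \<open>v \<otimes> w \<mapsto> f v \<otimes> g w\<close>, \<open>x \<otimes> (y \<otimes> z) \<mapsto> (x \<otimes> y) \<otimes> z\<close> and \<open>x \<otimes> y \<mapsto> y \<otimes> x\<close>.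
\<close>

definition tensor_map ::
    "('k, 'z) ring_scheme \<Rightarrow> ('k, 'u) module \<Rightarrow> ('k, 'u) module \<Rightarrow> ('k, 'u) module \<Rightarrow> ('k, 'u) module \<Rightarrow>
     ('u \<Rightarrow> 'u) \<Rightarrow> ('u \<Rightarrow> 'u) \<Rightarrow> 'u \<Rightarrow> 'u" where
  "tensor_map K V V' W W' f g = (THE h. h \<in> lin K (tensor K V W) (tensor K V' W') \<and>
     (\<forall>v\<in>carrier V. \<forall>w\<in>carrier W. h (pure_tensor K V W v w) = pure_tensor K V' W' (f v) (g w)))"

definition tensor_assoc ::
    "('k, 'z) ring_scheme \<Rightarrow> ('k, 'u) module \<Rightarrow> ('k, 'u) module \<Rightarrow> ('k, 'u) module \<Rightarrow> 'u \<Rightarrow> 'u" where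
  "tensor_assoc K X Y Z =
     (THE h. h \<in> lin K (tensor K X (tensor K Y Z)) (tensor K (tensor K X Y) Z) \<and>
       (\<forall>x\<in>carrier X. \<forall>y\<in>carrier Y. \<forall>z\<in>carrier Z.
          h (pure_tensor K X (tensor K Y Z) x (pure_tensor K Y Z y z)) =
          pure_tensor K (tensor K X Y) Z (pure_tensor K X Y x y) z))"

definition tensor_braid ::
    "('k, 'z) ring_scheme \<Rightarrow> ('k, 'u) module \<Rightarrow> ('k, 'u) module \<Rightarrow> 'u \<Rightarrow> 'u" where
  "tensor_braid K X Y = (THE h. h \<in> lin K (tensor K X Y) (tensor K Y X) \<and>
     (\<forall>x\<in>carrier X. \<forall>y\<in>carrier Y. h (pure_tensor K X Y x y) = pure_tensor K Y X y x))"

section \<open>Quivers and their representations\<close>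

text \<open>
  A quiver is a \<open>fin_digraph\<close>, which may have loops and parallel arcs.  \<open>connected\<close> is
  connectedness of the underlying undirected graph and includes that there is a vertex.  The
  notion \<open>tree\<close> of the graph library concerns symmetric digraphs and is not the one needed here.
\<close>

definition opposite :: "('v, 'a) pre_digraph \<Rightarrow> ('v, 'a) pre_digraph" where
  "opposite Q = \<lparr> verts = verts Q, arcs = arcs Q, tail = head Q, head = tail Q \<rparr>"

definition tree_quiver :: "('v, 'a) pre_digraph \<Rightarrow> bool" where
  "tree_quiver Q \<longleftrightarrow> connected Q \<and> (\<forall>a\<in>arcs Q. \<not> connected (pre_digraph.del_arc Q a))"

record ('k, 'u, 'v, 'a) quiver_rep =
  vsp :: "'v \<Rightarrow> ('k, 'u) module"
  amap :: "'a \<Rightarrow> 'u \<Rightarrow> 'u"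

definition is_rep ::
    "('k, 'z) ring_scheme \<Rightarrow> ('v, 'a) pre_digraph \<Rightarrow> ('k, 'u, 'v, 'a) quiver_rep \<Rightarrow> bool" where
  "is_rep K Q V \<longleftrightarrow>
     (\<forall>x\<in>verts Q. fd_space K (vsp V x)) \<and>
     (\<forall>a\<in>arcs Q. amap V a \<in> lin K (vsp V (tail Q a)) (vsp V (head Q a)))"

definition rep_hom ::
    "('k, 'z) ring_scheme \<Rightarrow> ('v, 'a) pre_digraph \<Rightarrow> ('k, 'u, 'v, 'a) quiver_rep \<Rightarrow>
     ('k, 'u, 'v, 'a) quiver_rep \<Rightarrow> ('v \<Rightarrow> 'u \<Rightarrow> 'u) set" where
  "rep_hom K Q V W = {\<phi> \<in> extensional (verts Q).
     (\<forall>x\<in>verts Q. \<phi> x \<in> lin K (vsp V x) (vsp W x)) \<and>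
     (\<forall>a\<in>arcs Q. \<forall>v\<in>carrier (vsp V (tail Q a)).
        \<phi> (head Q a) (amap V a v) = amap W a (\<phi> (tail Q a) v))}"

definition rep_tensor ::
    "('k, 'z) ring_scheme \<Rightarrow> ('v, 'a) pre_digraph \<Rightarrow> ('k, 'u, 'v, 'a) quiver_rep \<Rightarrow>
     ('k, 'u, 'v, 'a) quiver_rep \<Rightarrow> ('k, 'u, 'v, 'a) quiver_rep" where
  "rep_tensor K Q V W = \<lparr>
     vsp = (\<lambda>x. tensor K (vsp V x) (vsp W x)),
     amap = (\<lambda>a. tensor_map K (vsp V (tail Q a)) (vsp V (head Q a))
                   (vsp W (tail Q a)) (vsp W (head Q a)) (amap V a) (amap W a)) \<rparr>"

definition rep_unit :: "('k, 'z) ring_scheme \<Rightarrow> ('k, 'u, 'v, 'a) quiver_rep" where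
  "rep_unit K = \<lparr>
     vsp = (\<lambda>_. copy (self_module K)),
     amap = (\<lambda>_. \<lambda>v\<in>carrier (copy (self_module K)). v) \<rparr>"

definition Rep ::
    "('k, 'z) ring_scheme \<Rightarrow> ('v, 'a) pre_digraph \<Rightarrow>
     (('k, 'u, 'v, 'a) quiver_rep, 'v \<Rightarrow> 'u \<Rightarrow> 'u) tensor_cat" where
  "Rep K Q = \<lparr>
     Ob = {V. is_rep K Q V},
     Hom = rep_hom K Q,
     Comp = (\<lambda>V W U g f. \<lambda>x\<in>verts Q. compose (carrier (vsp V x)) (g x) (f x)),
     Ident = (\<lambda>V. \<lambda>x\<in>verts Q. \<lambda>v\<in>carrier (vsp V x). v),
     Plus = (\<lambda>V W f g. \<lambda>x\<in>verts Q. \<lambda>v\<in>carrier (vsp V x). f x v \<oplus>\<^bsub>vsp W x\<^esub> g x v),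
     TOb = rep_tensor K Q,
     TMap = (\<lambda>V V' W W' f g. \<lambda>x\<in>verts Q.
               tensor_map K (vsp V x) (vsp V' x) (vsp W x) (vsp W' x) (f x) (g x)),
     Assoc = (\<lambda>X Y Z. \<lambda>x\<in>verts Q. tensor_assoc K (vsp X x) (vsp Y x) (vsp Z x)),
     Braid = (\<lambda>X Y. \<lambda>x\<in>verts Q. tensor_braid K (vsp X x) (vsp Y x)),
     Unit = rep_unit K \<rparr>"

text \<open>Duality, as a covariant functor from \<open>op_cat (Rep K Q)\<close> to \<open>Rep K (opposite Q)\<close>.\<close>

definition duality ::
    "('k, 'z) ring_scheme \<Rightarrow> ('v, 'a) pre_digraph \<Rightarrow>
     (('k, 'u, 'v, 'a) quiver_rep, 'v \<Rightarrow> 'u \<Rightarrow> 'u,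
      ('k, 'u, 'v, 'a) quiver_rep, 'v \<Rightarrow> 'u \<Rightarrow> 'u) cat_functor" where
  "duality K Q = \<lparr>
     fob = (\<lambda>V. \<lparr>
       vsp = (\<lambda>x. dual K (vsp V x)),
       amap = (\<lambda>a. dual_map K (vsp V (tail Q a)) (vsp V (head Q a)) (amap V a)) \<rparr>),
     fmap = (\<lambda>V W f. \<lambda>x\<in>verts Q. dual_map K (vsp W x) (vsp V x) (f x)) \<rparr>"

section \<open>Subrepresentations and quotients\<close>

text \<open>A subrepresentation is given by the family of its underlying subspaces.\<close>

definition subrep ::
    "('k, 'z) ring_scheme \<Rightarrow> ('v, 'a) pre_digraph \<Rightarrow> ('k, 'u, 'v, 'a) quiver_rep \<Rightarrow>
     ('v \<Rightarrow> 'u set) \<Rightarrow> bool" where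
  "subrep K Q V N \<longleftrightarrow>
     (\<forall>x\<in>verts Q. VectorSpace.subspace K (N x) (vsp V x)) \<and>
     (\<forall>a\<in>arcs Q. amap V a ` N (tail Q a) \<subseteq> N (head Q a))"

definition sub_rep ::
    "('v, 'a) pre_digraph \<Rightarrow> ('k, 'u, 'v, 'a) quiver_rep \<Rightarrow> ('v \<Rightarrow> 'u set) \<Rightarrow>
     ('k, 'u, 'v, 'a) quiver_rep" where
  "sub_rep Q V N = \<lparr>
     vsp = (\<lambda>x. (vsp V x)\<lparr>carrier := N x\<rparr>),
     amap = (\<lambda>a. restrict (amap V a) (N (tail Q a))) \<rparr>"

definition quot_rep ::
    "('k, 'z) ring_scheme \<Rightarrow> ('v, 'a) pre_digraph \<Rightarrow> ('k, 'u, 'v, 'a) quiver_rep \<Rightarrow>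
     ('v \<Rightarrow> 'u set) \<Rightarrow> ('k, 'u, 'v, 'a) quiver_rep" where
  "quot_rep K Q V N = \<lparr>
     vsp = (\<lambda>x. quot_space (vsp V x) (N x)),
     amap = (\<lambda>a. THE h.
       h \<in> lin K (quot_space (vsp V (tail Q a)) (N (tail Q a)))
                 (quot_space (vsp V (head Q a)) (N (head Q a))) \<and>
       (\<forall>v\<in>carrier (vsp V (tail Q a)).
          h (quot_proj (vsp V (tail Q a)) (N (tail Q a)) v) =
          quot_proj (vsp V (head Q a)) (N (head Q a)) (amap V a v))) \<rparr>"

definition direct_summand ::
    "('k, 'z) ring_scheme \<Rightarrow> ('v, 'a) pre_digraph \<Rightarrow> ('k, 'u, 'v, 'a) quiver_rep \<Rightarrow>
     ('v \<Rightarrow> 'u set) \<Rightarrow> bool" where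
  "direct_summand K Q V N \<longleftrightarrow> subrep K Q V N \<and>
     (\<exists>N'. subrep K Q V N' \<and>
        (\<forall>x\<in>verts Q. N x \<inter> N' x = {\<zero>\<^bsub>vsp V x\<^esub>} \<and> N x <+>\<^bsub>vsp V x\<^esub> N' x = carrier (vsp V x)))"

definition epimorphic :: "('v, 'a) pre_digraph \<Rightarrow> ('k, 'u, 'v, 'a) quiver_rep \<Rightarrow> bool" where
  "epimorphic Q V \<longleftrightarrow>
     (\<forall>a\<in>arcs Q. amap V a ` carrier (vsp V (tail Q a)) = carrier (vsp V (head Q a)))"

definition monomorphic :: "('v, 'a) pre_digraph \<Rightarrow> ('k, 'u, 'v, 'a) quiver_rep \<Rightarrow> bool" where
  "monomorphic Q V \<longleftrightarrow> (\<forall>a\<in>arcs Q. inj_on (amap V a) (carrier (vsp V (tail Q a))))"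

section \<open>The global tensor functor\<close>

text \<open>
  \<open>epi_part\<close> is the sum of all epimorphic subrepresentations, and \<open>mono_ker\<close> is the intersection
  of the kernels of all monomorphic quotients, hence the kernel of the maximal one.
\<close>

definition epi_part ::
    "('k, 'z) ring_scheme \<Rightarrow> ('v, 'a) pre_digraph \<Rightarrow> ('k, 'u, 'v, 'a) quiver_rep \<Rightarrow> 'v \<Rightarrow> 'u set" where
  "epi_part K Q V x = LinearCombinations.module.span K (vsp V x)
     (\<Union>{N x | N. subrep K Q V N \<and> epimorphic Q (sub_rep Q V N)})"

definition mono_ker ::
    "('k, 'z) ring_scheme \<Rightarrow> ('v, 'a) pre_digraph \<Rightarrow> ('k, 'u, 'v, 'a) quiver_rep \<Rightarrow> 'v \<Rightarrow> 'u set" where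
  "mono_ker K Q V x = \<Inter>{N x | N. subrep K Q V N \<and> monomorphic Q (quot_rep K Q V N)}"

type_synonym ('k, 'u, 'v, 'a) rep_functor =
  "(('k, 'u, 'v, 'a) quiver_rep, 'v \<Rightarrow> 'u \<Rightarrow> 'u,
    ('k, 'u, 'v, 'a) quiver_rep, 'v \<Rightarrow> 'u \<Rightarrow> 'u) cat_functor"

type_synonym ('k, 'u, 'v, 'a) vect_functor =
  "(('k, 'u, 'v, 'a) quiver_rep, 'v \<Rightarrow> 'u \<Rightarrow> 'u, ('k, 'u) module, 'u \<Rightarrow> 'u) cat_functor"

definition epi_functor ::
    "('k, 'z) ring_scheme \<Rightarrow> ('v, 'a) pre_digraph \<Rightarrow> ('k, 'u, 'v, 'a) rep_functor" where
  "epi_functor K Q = \<lparr>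
     fob = (\<lambda>V. sub_rep Q V (epi_part K Q V)),
     fmap = (\<lambda>V W f. \<lambda>x\<in>verts Q. restrict (f x) (epi_part K Q V x)) \<rparr>"

definition mono_functor ::
    "('k, 'z) ring_scheme \<Rightarrow> ('v, 'a) pre_digraph \<Rightarrow> ('k, 'u, 'v, 'a) rep_functor" where
  "mono_functor K Q = \<lparr>
     fob = (\<lambda>V. quot_rep K Q V (mono_ker K Q V)),
     fmap = (\<lambda>V W f. \<lambda>x\<in>verts Q. THE h.
       h \<in> lin K (quot_space (vsp V x) (mono_ker K Q V x)) (quot_space (vsp W x) (mono_ker K Q W x)) \<and>
       (\<forall>v\<in>carrier (vsp V x).
          h (quot_proj (vsp V x) (mono_ker K Q V x) v) =
          quot_proj (vsp W x) (mono_ker K Q W x) (f x v))) \<rparr>"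

definition epi_to_mono ::
    "('k, 'z) ring_scheme \<Rightarrow> ('v, 'a) pre_digraph \<Rightarrow> ('k, 'u, 'v, 'a) quiver_rep \<Rightarrow> 'v \<Rightarrow> 'u \<Rightarrow> 'u" where
  "epi_to_mono K Q V = (\<lambda>x\<in>verts Q.
     restrict (quot_proj (vsp V x) (mono_ker K Q V x)) (epi_part K Q V x))"

text \<open>The image functor of a natural transformation \<open>\<Phi> : F \<rightarrow> G\<close>; on morphisms it restricts \<open>G\<close>.\<close>

definition image_functor ::
    "('v, 'a) pre_digraph \<Rightarrow> ('k, 'u, 'v, 'a) rep_functor \<Rightarrow> ('k, 'u, 'v, 'a) rep_functor \<Rightarrow>
     (('k, 'u, 'v, 'a) quiver_rep \<Rightarrow> 'v \<Rightarrow> 'u \<Rightarrow> 'u) \<Rightarrow> ('k, 'u, 'v, 'a) rep_functor" where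
  "image_functor Q F G \<Phi> = \<lparr>
     fob = (\<lambda>V. sub_rep Q (fob G V) (\<lambda>x. \<Phi> V x ` carrier (vsp (fob F V) x))),
     fmap = (\<lambda>V W f. \<lambda>x\<in>verts Q.
       restrict (fmap G V W f x) (\<Phi> V x ` carrier (vsp (fob F V) x))) \<rparr>"

definition global_tensor_functor ::
    "('k, 'z) ring_scheme \<Rightarrow> ('v, 'a) pre_digraph \<Rightarrow> ('k, 'u, 'v, 'a) rep_functor" where
  "global_tensor_functor K Q =
     image_functor Q (epi_functor K Q) (mono_functor K Q) (epi_to_mono K Q)"

definition global_rank_functor ::
    "('k, 'z) ring_scheme \<Rightarrow> ('v, 'a) pre_digraph \<Rightarrow> 'v \<Rightarrow>
     ('k, 'u, 'v, 'a) vect_functor" where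
  "global_rank_functor K Q x = \<lparr>
     fob = (\<lambda>V. vsp (fob (global_tensor_functor K Q) V) x),
     fmap = (\<lambda>V W f. fmap (global_tensor_functor K Q) V W f x) \<rparr>"

end

theory Submission
  imports Defs
begin

text \<open>
  Let \<open>E(V)\<close> be the maximal epimorphic subrepresentation of \<open>V\<close>, let \<open>M(V)\<close> be its maximal monomorphic
  quotient and \<open>Kr(V)\<close> the kernel of \<open>V \<rightarrow> M(V)\<close>.  As a family of subspaces, \<open>E(V)\<close> is the largest one that
  every arrow map carries onto itself, from tail to head, and \<open>Kr(V)\<close> is the smallest one for which the
  preimage of the subspace at the head is the subspace at the tail (such families are called saturated
  below).  At a vertex, \<open>(R V)\<^sub>x\<close> is the image of \<open>E(V)\<^sub>x\<close> in \<open>V\<^sub>x / Kr(V)\<^sub>x\<close>.  So all arrows act bijectively on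
  \<open>R V\<close>, and since the quiver is connected the rank functors at any two vertices are naturally isomorphic.

  \<^bold>\<open>Tensor products.\<close>  The class of \<open>v \<otimes> w\<close> in \<open>R (V \<otimes> W)\<close>, for \<open>v\<close> in \<open>E(V)\<close> and \<open>w\<close> in \<open>E(W)\<close>, depends only on
  the classes of \<open>v\<close> and \<open>w\<close>, because \<open>v \<otimes> w\<close> lies in \<open>Kr(V \<otimes> W)\<close> when one factor lies in the corresponding
  \<open>Kr\<close>.  This gives a natural map \<open>R V \<otimes> R W \<rightarrow> R (V \<otimes> W)\<close>.  It is injective, since a tensor product of
  injective maps is injective and hence the kernel of \<open>V \<otimes> W \<rightarrow> M(V) \<otimes> M(W)\<close> is saturated (\<open>cmap_inj\<close>).
  It is surjective if \<open>E(V \<otimes> W)\<close> is contained in \<open>Kr(V \<otimes> W) + E(V) \<otimes> E(W)\<close>, and this is the heart of the proof: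
  a saturated \<open>X\<close> that contains \<open>E(V) \<otimes> E(W)\<close> contains every epimorphic \<open>T\<close> (\<open>episub_in_satsub\<close>).  Otherwise
  there are \<open>t \<in> T\<^sub>x\<close> and a functional \<open>s\<close> on \<open>V\<^sub>x \<otimes> W\<^sub>x\<close> that vanishes on \<open>X\<^sub>x\<close> but not at \<open>t\<close>.  Contracting \<open>t\<close> with
  \<open>s\<close> gives operators \<open>p\<close> on \<open>V\<^sub>x\<close> and \<open>q\<close> on \<open>W\<^sub>x\<close> that are adjoint for the form \<open>s(v \<otimes> w)\<close>, and \<open>s(t)\<close> is the trace
  of \<open>p\<close>.  Elements of \<open>T\<close> can be lifted against the arrows, and functionals vanishing on \<open>X\<close> can be pushed
  along them; therefore the stable images of \<open>p\<close> and \<open>q\<close> lie in \<open>E(V)\<close> and \<open>E(W)\<close> (\<open>stable_in_epi\<close>).  As \<open>s\<close>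
  vanishes on \<open>E(V) \<otimes> E(W)\<close>, it vanishes at \<open>p\<^sup>m v \<otimes> w\<close> for large \<open>m\<close> and all \<open>v\<close> and \<open>w\<close>, which forces the trace
  \<open>s(t)\<close> to be zero (\<open>trace_vanish\<close>), a contradiction.

  \<^bold>\<open>Duality.\<close>  Transposition exchanges the two kinds of families: \<open>E(D V)\<close> is the annihilator of \<open>Kr(V)\<close> and
  \<open>Kr(D V)\<close> that of \<open>E(V)\<close>.  A functional on \<open>(R V)\<^sub>x\<close> extends to one on \<open>V\<^sub>x\<close> that vanishes on \<open>Kr(V)\<^sub>x\<close>, uniquely up to
  functionals that vanish on \<open>E(V)\<^sub>x\<close>; this is the isomorphism from \<open>D (R V)\<close> to \<open>R (D V)\<close>.

  \<^bold>\<open>Trees.\<close>  At one vertex choose a complement \<open>N\<close> of \<open>E \<inter> Kr\<close> in \<open>E\<close> and a complement \<open>N'\<close> of \<open>N\<close> in \<open>V\<^sub>x\<close> containing \<open>Kr\<close>.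
  Such a choice can be transported along and against an arrow (\<open>splits_forward\<close>, \<open>splits_backward\<close>), hence
  through the tree, where no two paths have to agree.  The result is a decomposition of \<open>V\<close> whose first summand
  maps isomorphically onto \<open>R V\<close>.
\<close>

section \<open>Linear algebra over a field record\<close>

text \<open>
  The base field is a record, and vector spaces are module records over it whose carrier need not be
  the whole type.  Linear maps are handled both as plain functions (\<open>module_hom\<close>, no condition outside
  the carrier) and as extensional ones (\<open>lin\<close>).
\<close>

locale base = field K for K :: "('k, 'z) ring_scheme" (structure)
begin

abbreviation vs_ok :: "('k, 'u, 'y) module_scheme \<Rightarrow> bool" where
  "vs_ok V \<equiv> vectorspace K V"

abbreviation ssp :: "'u set \<Rightarrow> ('k, 'u, 'y) module_scheme \<Rightarrow> bool" where
  "ssp N V \<equiv> VectorSpace.subspace K N V"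

abbreviation vspan :: "('k, 'u, 'y) module_scheme \<Rightarrow> 'u set \<Rightarrow> 'u set" where
  "vspan V S \<equiv> LinearCombinations.module.span K V S"

lemma vs_add [simp, intro]:
  assumes "vs_ok V" "u \<in> carrier V" "v \<in> carrier V" shows "u \<oplus>\<^bsub>V\<^esub> v \<in> carrier V"
proof - interpret V: vectorspace K V by fact show ?thesis using assms by simp qed

lemma vs_smult [simp, intro]:
  assumes "vs_ok V" "c \<in> carrier K" "v \<in> carrier V" shows "c \<odot>\<^bsub>V\<^esub> v \<in> carrier V"
proof - interpret V: vectorspace K V by fact show ?thesis using assms by simp qed

lemma vs_zero [simp, intro]:
  assumes "vs_ok V" shows "\<zero>\<^bsub>V\<^esub> \<in> carrier V"
proof - interpret V: vectorspace K V by fact show ?thesis using assms by simp qed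

lemma vs_minus [simp, intro]:
  assumes "vs_ok V" "u \<in> carrier V" "v \<in> carrier V" shows "u \<ominus>\<^bsub>V\<^esub> v \<in> carrier V"
proof - interpret V: vectorspace K V by fact show ?thesis using assms by simp qed

lemma vs_neg_smult:
  assumes "vs_ok V" "v \<in> carrier V" shows "\<ominus>\<^bsub>V\<^esub> v = (\<ominus> \<one>) \<odot>\<^bsub>V\<^esub> v"
proof - interpret V: vectorspace K V by fact show ?thesis using assms V.smult_minus_1 by simp qed

lemma vs_minus_smult:
  assumes "vs_ok V" "u \<in> carrier V" "v \<in> carrier V" shows "u \<ominus>\<^bsub>V\<^esub> v = u \<oplus>\<^bsub>V\<^esub> (\<ominus> \<one>) \<odot>\<^bsub>V\<^esub> v"
  using assms by (simp add: a_minus_def vs_neg_smult)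

lemma vs_minus_eq_zero:
  assumes "vs_ok V" "u \<in> carrier V" "v \<in> carrier V" shows "u \<ominus>\<^bsub>V\<^esub> v = \<zero>\<^bsub>V\<^esub> \<longleftrightarrow> u = v"
proof - interpret V: vectorspace K V by fact show ?thesis using assms by simp qed

lemma vs_minus_add:
  assumes "vs_ok V" "u \<in> carrier V" "v \<in> carrier V" shows "v \<oplus>\<^bsub>V\<^esub> (u \<ominus>\<^bsub>V\<^esub> v) = u"
proof -
  interpret V: vectorspace K V by fact
  show ?thesis using assms by (simp add: a_minus_def V.M.a_ac V.M.r_neg)
qed

lemma vs_add_minus:
  assumes "vs_ok V" "u \<in> carrier V" "v \<in> carrier V" shows "(v \<oplus>\<^bsub>V\<^esub> u) \<ominus>\<^bsub>V\<^esub> v = u"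
proof -
  interpret V: vectorspace K V by fact
  show ?thesis using assms by (simp add: a_minus_def V.M.a_ac V.M.r_neg2 V.M.r_neg1 V.M.r_neg)
qed

lemma vs_minus_add_swap:
  assumes "vs_ok V" "a \<in> carrier V" "b \<in> carrier V" "c \<in> carrier V" "d \<in> carrier V"
  shows "(a \<oplus>\<^bsub>V\<^esub> b) \<ominus>\<^bsub>V\<^esub> (c \<oplus>\<^bsub>V\<^esub> d) = (a \<ominus>\<^bsub>V\<^esub> c) \<oplus>\<^bsub>V\<^esub> (b \<ominus>\<^bsub>V\<^esub> d)"
proof -
  interpret V: vectorspace K V by fact
  show ?thesis using assms by (simp add: a_minus_def V.M.a_ac V.M.minus_add)
qed

subsection \<open>Linear maps\<close>

lemma hom_closed: "f \<in> module_hom K V W \<Longrightarrow> v \<in> carrier V \<Longrightarrow> f v \<in> carrier W"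
  by (auto simp: module_hom_def)

lemma hom_add: "f \<in> module_hom K V W \<Longrightarrow> u \<in> carrier V \<Longrightarrow> v \<in> carrier V \<Longrightarrow> f (u \<oplus>\<^bsub>V\<^esub> v) = f u \<oplus>\<^bsub>W\<^esub> f v"
  by (auto simp: module_hom_def)

lemma hom_smult: "f \<in> module_hom K V W \<Longrightarrow> c \<in> carrier K \<Longrightarrow> v \<in> carrier V \<Longrightarrow> f (c \<odot>\<^bsub>V\<^esub> v) = c \<odot>\<^bsub>W\<^esub> f v"
  by (auto simp: module_hom_def)

lemma homI:
  assumes "\<And>v. v \<in> carrier V \<Longrightarrow> f v \<in> carrier W"
    and "\<And>u v. u \<in> carrier V \<Longrightarrow> v \<in> carrier V \<Longrightarrow> f (u \<oplus>\<^bsub>V\<^esub> v) = f u \<oplus>\<^bsub>W\<^esub> f v"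
    and "\<And>c v. c \<in> carrier K \<Longrightarrow> v \<in> carrier V \<Longrightarrow> f (c \<odot>\<^bsub>V\<^esub> v) = c \<odot>\<^bsub>W\<^esub> f v"
  shows "f \<in> module_hom K V W"
  using assms by (auto simp: module_hom_def)

lemma hom_zero:
  assumes "vs_ok V" "vs_ok W" "f \<in> module_hom K V W" shows "f \<zero>\<^bsub>V\<^esub> = \<zero>\<^bsub>W\<^esub>"
proof -
  interpret V: vectorspace K V by fact
  interpret W: vectorspace K W by fact
  have "f (\<zero> \<odot>\<^bsub>V\<^esub> \<zero>\<^bsub>V\<^esub>) = \<zero> \<odot>\<^bsub>W\<^esub> f \<zero>\<^bsub>V\<^esub>" using assms by (intro hom_smult) auto
  then show ?thesis using hom_closed[OF assms(3)] by simp
qed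

lemma hom_minus:
  assumes "vs_ok V" "vs_ok W" "f \<in> module_hom K V W" "u \<in> carrier V" "v \<in> carrier V"
  shows "f (u \<ominus>\<^bsub>V\<^esub> v) = f u \<ominus>\<^bsub>W\<^esub> f v"
  using assms by (simp add: vs_minus_smult hom_add hom_smult hom_closed)

lemma hom_comp:
  assumes "f \<in> module_hom K V W" "g \<in> module_hom K W U" shows "(\<lambda>v. g (f v)) \<in> module_hom K V U"
  by (rule homI) (simp_all add: hom_closed[OF assms(1)] hom_closed[OF assms(2)] hom_add[OF assms(1)]
      hom_add[OF assms(2)] hom_smult[OF assms(1)] hom_smult[OF assms(2)])

lemma id_hom: "(\<lambda>v. v) \<in> module_hom K U U" by (intro homI) auto

lemma hom_cong:
  assumes "vs_ok V" "f \<in> module_hom K V W" "\<And>v. v \<in> carrier V \<Longrightarrow> g v = f v" shows "g \<in> module_hom K V W"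
  using assms by (auto simp: module_hom_def)

lemma lin_hom: "f \<in> lin K V W \<Longrightarrow> f \<in> module_hom K V W"
  by (simp add: lin_def)

lemma lin_ext: "f \<in> lin K V W \<Longrightarrow> g \<in> lin K V W' \<Longrightarrow> (\<And>v. v \<in> carrier V \<Longrightarrow> f v = g v) \<Longrightarrow> f = g"
  unfolding lin_def using extensionalityI[of f "carrier V" g] by blast

lemma lin_restrict: "vs_ok V \<Longrightarrow> f \<in> module_hom K V W \<Longrightarrow> restrict f (carrier V) \<in> lin K V W"
  unfolding lin_def by (auto simp: module_hom_def)

lemma inj_hom_iff:
  assumes "vs_ok V" "vs_ok W" "f \<in> module_hom K V W"
  shows "inj_on f (carrier V) \<longleftrightarrow> (\<forall>v\<in>carrier V. f v = \<zero>\<^bsub>W\<^esub> \<longrightarrow> v = \<zero>\<^bsub>V\<^esub>)"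
proof
  assume i: "inj_on f (carrier V)"
  show "\<forall>v\<in>carrier V. f v = \<zero>\<^bsub>W\<^esub> \<longrightarrow> v = \<zero>\<^bsub>V\<^esub>"
    using i hom_zero[OF assms] assms(1) by (metis inj_onD vs_zero)
next
  assume *: "\<forall>v\<in>carrier V. f v = \<zero>\<^bsub>W\<^esub> \<longrightarrow> v = \<zero>\<^bsub>V\<^esub>"
  show "inj_on f (carrier V)"
  proof (rule inj_onI)
    fix u v assume uv: "u \<in> carrier V" "v \<in> carrier V" "f u = f v"
    then have "f (u \<ominus>\<^bsub>V\<^esub> v) = \<zero>\<^bsub>W\<^esub>"
      using assms by (simp add: hom_minus hom_closed vs_minus_eq_zero)
    then show "u = v" using * uv assms(1) by (metis vs_minus vs_minus_eq_zero)
  qed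
qed

lemma hom_plus:
  assumes V: "vs_ok V" and U: "vs_ok U" and f: "f \<in> module_hom K V U" and g: "g \<in> module_hom K V U"
  shows "(\<lambda>s. f s \<oplus>\<^bsub>U\<^esub> g s) \<in> module_hom K V U"
proof -
  interpret U: vectorspace K U by (rule U)
  show ?thesis
    by (rule homI) (auto simp: hom_closed[OF f] hom_closed[OF g] hom_add[OF f] hom_add[OF g]
        hom_smult[OF f] hom_smult[OF g] U.M.a_ac U.smult_r_distr U V)
qed

lemma hom_scale:
  assumes V: "vs_ok V" and U: "vs_ok U" and f: "f \<in> module_hom K V U" and k: "k \<in> carrier K"
  shows "(\<lambda>s. k \<odot>\<^bsub>U\<^esub> f s) \<in> module_hom K V U"
proof -
  interpret U: vectorspace K U by (rule U)
  show ?thesis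
    using k by (intro homI) (auto simp: hom_closed[OF f] hom_add[OF f]
        hom_smult[OF f] U.smult_r_distr U V m_comm U.smult_assoc1[symmetric])
qed

subsection \<open>Subspaces\<close>

lemma ssp_iff:
  assumes "vs_ok V"
  shows "ssp N V \<longleftrightarrow> N \<subseteq> carrier V \<and> \<zero>\<^bsub>V\<^esub> \<in> N \<and> (\<forall>u\<in>N. \<forall>v\<in>N. u \<oplus>\<^bsub>V\<^esub> v \<in> N) \<and>
    (\<forall>c\<in>carrier K. \<forall>v\<in>N. c \<odot>\<^bsub>V\<^esub> v \<in> N)"
proof -
  interpret V: vectorspace K V by fact
  show ?thesis
    unfolding VectorSpace.subspace_def submodule_def
    using assms V.module_axioms by (auto simp: vectorspace_def)
qed

lemma sspI:
  assumes "vs_ok V" "N \<subseteq> carrier V" "\<zero>\<^bsub>V\<^esub> \<in> N"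
    and "\<And>u v. u \<in> N \<Longrightarrow> v \<in> N \<Longrightarrow> u \<oplus>\<^bsub>V\<^esub> v \<in> N"
    and "\<And>c v. c \<in> carrier K \<Longrightarrow> v \<in> N \<Longrightarrow> c \<odot>\<^bsub>V\<^esub> v \<in> N"
  shows "ssp N V"
  using assms by (simp add: ssp_iff)

lemma ssp_vs: "ssp N V \<Longrightarrow> vs_ok V"
  by (simp add: VectorSpace.subspace_def)

lemma ssp_sub: assumes N: "ssp N V" shows "N \<subseteq> carrier V"
  using N ssp_iff[OF ssp_vs[OF N]] by simp

lemma ssp_mem: "ssp N V \<Longrightarrow> v \<in> N \<Longrightarrow> v \<in> carrier V"
  using ssp_sub by blast

lemma ssp_zero: assumes N: "ssp N V" shows "\<zero>\<^bsub>V\<^esub> \<in> N"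
  using N ssp_iff[OF ssp_vs[OF N]] by simp

lemma ssp_add: assumes N: "ssp N V" shows "u \<in> N \<Longrightarrow> v \<in> N \<Longrightarrow> u \<oplus>\<^bsub>V\<^esub> v \<in> N"
  using N ssp_iff[OF ssp_vs[OF N]] by simp

lemma ssp_smult: assumes N: "ssp N V" shows "c \<in> carrier K \<Longrightarrow> v \<in> N \<Longrightarrow> c \<odot>\<^bsub>V\<^esub> v \<in> N"
  using N ssp_iff[OF ssp_vs[OF N]] by simp

lemma ssp_minus:
  assumes N: "ssp N V" and "u \<in> N" "v \<in> N" shows "u \<ominus>\<^bsub>V\<^esub> v \<in> N"
  using assms ssp_vs[OF N] ssp_sub[OF N]
  by (simp add: vs_minus_smult subset_iff ssp_add ssp_smult)

lemma ssp_is_vs: "ssp N V \<Longrightarrow> vs_ok (V\<lparr>carrier := N\<rparr>)"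
  using vectorspace.subspace_is_vs ssp_vs by blast

lemma ssp_full: "vs_ok V \<Longrightarrow> ssp (carrier V) V"
  by (simp add: ssp_iff)

lemma ssp_trivial:
  assumes "vs_ok V" shows "ssp {\<zero>\<^bsub>V\<^esub>} V"
proof - interpret V: vectorspace K V by fact show ?thesis using assms by (simp add: ssp_iff) qed

lemma ssp_Int: "ssp A V \<Longrightarrow> ssp B V \<Longrightarrow> ssp (A \<inter> B) V"
  using ssp_vs[of A V] by (auto simp: ssp_iff)

lemma ssp_Inter:
  assumes "vs_ok V" "\<And>N. N \<in> F \<Longrightarrow> ssp N V" "F \<noteq> {}" shows "ssp (\<Inter>F) V"
proof (rule sspI[OF assms(1)])
  show "\<Inter>F \<subseteq> carrier V" using assms(2,3) ssp_sub by blast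
qed (use assms(2) in \<open>auto intro: ssp_zero ssp_add ssp_smult\<close>)

lemma ssp_sub_iff:
  assumes N: "ssp N V" shows "ssp A (V\<lparr>carrier := N\<rparr>) \<longleftrightarrow> ssp A V \<and> A \<subseteq> N"
  using ssp_is_vs[OF N] ssp_vs[OF N] ssp_sub[OF N] by (auto simp: ssp_iff)

lemma ssp_image:
  assumes N: "ssp N V" and f: "f \<in> module_hom K V W" and W: "vs_ok W" shows "ssp (f ` N) W"
proof -
  note V = ssp_vs[OF N] and sub = ssp_mem[OF N]
  show ?thesis
  proof (rule sspI[OF W])
    show "f ` N \<subseteq> carrier W" using hom_closed[OF f] sub by auto
    show "\<zero>\<^bsub>W\<^esub> \<in> f ` N" using hom_zero[OF V W f] ssp_zero[OF N] by (metis imageI)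
  next
    fix u v assume "u \<in> f ` N" "v \<in> f ` N"
    then show "u \<oplus>\<^bsub>W\<^esub> v \<in> f ` N"
      using hom_add[OF f] sub ssp_add[OF N] by (auto simp: image_iff) metis
  next
    fix c v assume "c \<in> carrier K" "v \<in> f ` N"
    then show "c \<odot>\<^bsub>W\<^esub> v \<in> f ` N"
      using hom_smult[OF f] sub ssp_smult[OF N] by (auto simp: image_iff) metis
  qed
qed

lemma ssp_vimage:
  assumes V: "vs_ok V" and f: "f \<in> module_hom K V W" and N: "ssp N W"
  shows "ssp {v \<in> carrier V. f v \<in> N} V"
  using hom_zero[OF V ssp_vs[OF N] f] N V ssp_zero[OF N]
  by (auto intro!: sspI simp: hom_add[OF f] hom_smult[OF f] ssp_add ssp_smult)

lemma ssp_ker: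
  assumes V: "vs_ok V" and W: "vs_ok W" and f: "f \<in> module_hom K V W"
  shows "ssp {v \<in> carrier V. f v = \<zero>\<^bsub>W\<^esub>} V"
  using ssp_vimage[OF V f ssp_trivial[OF W]] by simp

lemma ssp_eq_hom:
  assumes V: "vs_ok V" and W: "vs_ok W" and f: "f \<in> module_hom K V W" and g: "g \<in> module_hom K V W"
  shows "ssp {v \<in> carrier V. f v = g v} V"
  using hom_zero[OF V W f] hom_zero[OF V W g] V
  by (auto intro!: sspI simp: hom_add[OF f] hom_smult[OF f] hom_add[OF g] hom_smult[OF g])

lemma ssp_span: "vs_ok V \<Longrightarrow> S \<subseteq> carrier V \<Longrightarrow> ssp (vspan V S) V"
  by (rule vectorspace.span_is_subspace)

lemma span_sup: "vs_ok V \<Longrightarrow> S \<subseteq> carrier V \<Longrightarrow> S \<subseteq> vspan V S"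
  by (simp add: LinearCombinations.module.in_own_span vectorspace_def)

lemma span_least: "ssp N V \<Longrightarrow> S \<subseteq> N \<Longrightarrow> vspan V S \<subseteq> N"
  by (simp add: LinearCombinations.module.span_is_subset VectorSpace.subspace_def vectorspace_def)

lemma span_mono: "vs_ok V \<Longrightarrow> S \<subseteq> T \<Longrightarrow> vspan V S \<subseteq> vspan V T"
  by (simp add: LinearCombinations.module.span_is_monotone vectorspace_def)

lemma mem_set_add: "x \<in> A <+>\<^bsub>V\<^esub> B \<longleftrightarrow> (\<exists>a\<in>A. \<exists>b\<in>B. x = a \<oplus>\<^bsub>V\<^esub> b)"
  by (auto simp: set_add_def set_mult_def)

lemma set_add_mono2: "C \<subseteq> D \<Longrightarrow> A <+>\<^bsub>V\<^esub> C \<subseteq> A <+>\<^bsub>V\<^esub> D"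
  by (rule subsetI) (unfold mem_set_add, blast)

lemma ssp_set_add:
  assumes A: "ssp A V" and B: "ssp B V" shows "ssp (A <+>\<^bsub>V\<^esub> B) V"
proof -
  note V = ssp_vs[OF A]
  interpret V: vectorspace K V by fact
  note a = ssp_mem[OF A] and b = ssp_mem[OF B]
  show ?thesis
  proof (rule sspI[OF V])
    show "A <+>\<^bsub>V\<^esub> B \<subseteq> carrier V" using a b V by (auto simp: mem_set_add)
    show "\<zero>\<^bsub>V\<^esub> \<in> A <+>\<^bsub>V\<^esub> B" unfolding mem_set_add
      using ssp_zero[OF A] ssp_zero[OF B] by (intro bexI[of _ "\<zero>\<^bsub>V\<^esub>"]) auto
  next
    fix u v assume "u \<in> A <+>\<^bsub>V\<^esub> B" "v \<in> A <+>\<^bsub>V\<^esub> B"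
    then obtain a1 b1 a2 b2 where h: "a1 \<in> A" "b1 \<in> B" "a2 \<in> A" "b2 \<in> B" "u = a1 \<oplus>\<^bsub>V\<^esub> b1" "v = a2 \<oplus>\<^bsub>V\<^esub> b2"
      by (auto simp: mem_set_add)
    have "u \<oplus>\<^bsub>V\<^esub> v = (a1 \<oplus>\<^bsub>V\<^esub> a2) \<oplus>\<^bsub>V\<^esub> (b1 \<oplus>\<^bsub>V\<^esub> b2)"
      using h a b by (simp add: V.M.a_ac)
    then show "u \<oplus>\<^bsub>V\<^esub> v \<in> A <+>\<^bsub>V\<^esub> B"
      unfolding mem_set_add using h ssp_add[OF A] ssp_add[OF B] by blast
  next
    fix c v assume c: "c \<in> carrier K" and "v \<in> A <+>\<^bsub>V\<^esub> B"
    then obtain a1 b1 where h: "a1 \<in> A" "b1 \<in> B" "v = a1 \<oplus>\<^bsub>V\<^esub> b1"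
      by (auto simp: mem_set_add)
    have "c \<odot>\<^bsub>V\<^esub> v = c \<odot>\<^bsub>V\<^esub> a1 \<oplus>\<^bsub>V\<^esub> c \<odot>\<^bsub>V\<^esub> b1"
      using h a b c by (simp add: V.smult_r_distr)
    then show "c \<odot>\<^bsub>V\<^esub> v \<in> A <+>\<^bsub>V\<^esub> B"
      unfolding mem_set_add using h c ssp_smult[OF A] ssp_smult[OF B] by blast
  qed
qed

lemma set_add_sup1:
  assumes A: "ssp A V" and B: "ssp B V" shows "A \<subseteq> A <+>\<^bsub>V\<^esub> B"
proof
  interpret V: vectorspace K V using ssp_vs[OF A] .
  fix x assume "x \<in> A" then show "x \<in> A <+>\<^bsub>V\<^esub> B"
    unfolding mem_set_add using ssp_zero[OF B] ssp_mem[OF A] by (metis V.M.r_zero)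
qed

lemma set_add_sup2:
  assumes A: "ssp A V" and B: "ssp B V" shows "B \<subseteq> A <+>\<^bsub>V\<^esub> B"
proof
  interpret V: vectorspace K V using ssp_vs[OF A] .
  fix x assume "x \<in> B" then show "x \<in> A <+>\<^bsub>V\<^esub> B"
    unfolding mem_set_add using ssp_zero[OF A] ssp_mem[OF B] by (metis V.M.l_zero)
qed

text \<open>
  The image of a vector space under a map that respects the operations is a vector space.  This is
  how the axioms are obtained for coset spaces and for copies.
\<close>

lemma hom_image_vs:
  assumes V: "vs_ok V" and im: "\<phi> ` carrier V = carrier W"
    and z: "\<phi> \<zero>\<^bsub>V\<^esub> = \<zero>\<^bsub>W\<^esub>"
    and add: "\<And>u v. u \<in> carrier V \<Longrightarrow> v \<in> carrier V \<Longrightarrow> \<phi> (u \<oplus>\<^bsub>V\<^esub> v) = \<phi> u \<oplus>\<^bsub>W\<^esub> \<phi> v"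
    and smult: "\<And>c v. c \<in> carrier K \<Longrightarrow> v \<in> carrier V \<Longrightarrow> \<phi> (c \<odot>\<^bsub>V\<^esub> v) = c \<odot>\<^bsub>W\<^esub> \<phi> v"
  shows "vs_ok W" and "\<phi> \<in> module_hom K V W"
proof -
  interpret V: vectorspace K V by fact
  note z' = z[symmetric]
  note [simp] = add[symmetric] smult[symmetric] z'
  have im': "x \<in> carrier W \<longleftrightarrow> (\<exists>v\<in>carrier V. x = \<phi> v)" for x using im by blast
  show "vs_ok W"
  proof (rule vs_criteria)
    show "field K" by (rule field_axioms)
    show "\<zero>\<^bsub>W\<^esub> \<in> carrier W" unfolding im' by (intro bexI[of _ "\<zero>\<^bsub>V\<^esub>"]) auto
    show "\<forall>v w. v \<in> carrier W \<and> w \<in> carrier W \<longrightarrow> v \<oplus>\<^bsub>W\<^esub> w \<in> carrier W"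
      unfolding im' by (auto intro!: bexI)
    show "\<forall>v\<in>carrier W. \<exists>neg_v\<in>carrier W. v \<oplus>\<^bsub>W\<^esub> neg_v = \<zero>\<^bsub>W\<^esub>"
    proof
      fix v assume "v \<in> carrier W"
      then obtain u where u: "u \<in> carrier V" "v = \<phi> u" using im' by blast
      show "\<exists>neg_v\<in>carrier W. v \<oplus>\<^bsub>W\<^esub> neg_v = \<zero>\<^bsub>W\<^esub>"
        using u im by (intro bexI[of _ "\<phi> (\<ominus>\<^bsub>V\<^esub> u)"]) (auto simp: V.M.r_neg)
    qed
    show "\<forall>c v. c \<in> carrier K \<and> v \<in> carrier W \<longrightarrow> c \<odot>\<^bsub>W\<^esub> v \<in> carrier W"
      unfolding im' by (auto intro!: bexI)
    show "\<forall>v w. v \<in> carrier W \<and> w \<in> carrier W \<longrightarrow> v \<oplus>\<^bsub>W\<^esub> w = w \<oplus>\<^bsub>W\<^esub> v"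
      unfolding im' by (auto simp: V.M.a_ac)
    show "\<forall>v w x. v \<in> carrier W \<and> w \<in> carrier W \<and> x \<in> carrier W \<longrightarrow> v \<oplus>\<^bsub>W\<^esub> w \<oplus>\<^bsub>W\<^esub> x = v \<oplus>\<^bsub>W\<^esub> (w \<oplus>\<^bsub>W\<^esub> x)"
      unfolding im' by (auto simp: V.M.a_ac)
    show "\<forall>v\<in>carrier W. v \<oplus>\<^bsub>W\<^esub> \<zero>\<^bsub>W\<^esub> = v"
      unfolding Ball_def im' z' by (auto simp only: add[symmetric] V.M.zero_closed V.M.r_zero)
    show "\<forall>a b v. a \<in> carrier K \<and> b \<in> carrier K \<and> v \<in> carrier W \<longrightarrow> (a \<otimes> b) \<odot>\<^bsub>W\<^esub> v = a \<odot>\<^bsub>W\<^esub> (b \<odot>\<^bsub>W\<^esub> v)"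
      unfolding im' by (auto simp: V.smult_assoc1)
    show "\<forall>v\<in>carrier W. \<one> \<odot>\<^bsub>W\<^esub> v = v" unfolding Ball_def im' by auto
    show "\<forall>a b v. a \<in> carrier K \<and> b \<in> carrier K \<and> v \<in> carrier W \<longrightarrow> (a \<oplus> b) \<odot>\<^bsub>W\<^esub> v = a \<odot>\<^bsub>W\<^esub> v \<oplus>\<^bsub>W\<^esub> b \<odot>\<^bsub>W\<^esub> v"
      unfolding im' by (auto simp: V.smult_l_distr)
    show "\<forall>a v w. a \<in> carrier K \<and> v \<in> carrier W \<and> w \<in> carrier W \<longrightarrow> a \<odot>\<^bsub>W\<^esub> (v \<oplus>\<^bsub>W\<^esub> w) = a \<odot>\<^bsub>W\<^esub> v \<oplus>\<^bsub>W\<^esub> a \<odot>\<^bsub>W\<^esub> w"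
      unfolding im' by (auto simp: V.smult_r_distr)
  qed
  show "\<phi> \<in> module_hom K V W"
    using im by (intro homI) auto
qed

subsection \<open>Finite dimension, complements and extension of linear maps\<close>

lemma fd_vs: "fd_space K V \<Longrightarrow> vs_ok V"
  by (simp add: fd_space_def)

text \<open>
  Finite dimension means that some finite set lies in no proper subspace; this form needs no linear
  combinations and is preserved by surjections.
\<close>

lemma fd_gens_iff:
  "fd_space K V \<longleftrightarrow> vs_ok V \<and>
     (\<exists>B. finite B \<and> B \<subseteq> carrier V \<and> (\<forall>S. ssp S V \<longrightarrow> B \<subseteq> S \<longrightarrow> S = carrier V))"
proof (cases "vs_ok V")
  case True
  interpret V: vectorspace K V by fact
  have "V.span B = carrier V \<longleftrightarrow> (\<forall>S. ssp S V \<longrightarrow> B \<subseteq> S \<longrightarrow> S = carrier V)" if B: "B \<subseteq> carrier V" for B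
    using ssp_span[OF True B] span_sup[OF True B] span_least[of _ V B] ssp_sub[of _ V] by (metis subset_antisym)
  then show ?thesis using True by (auto simp: fd_space_def V.fin_dim_def)
qed (simp add: fd_space_def)

lemma fd_image:
  assumes V: "fd_space K V" and W: "vs_ok W" and f: "f \<in> module_hom K V W" and s: "f ` carrier V = carrier W"
  shows "fd_space K W"
proof -
  obtain B where B: "finite B" "B \<subseteq> carrier V" "\<And>S. ssp S V \<Longrightarrow> B \<subseteq> S \<Longrightarrow> S = carrier V"
    using V unfolding fd_gens_iff by blast
  have "S = carrier W" if S: "ssp S W" "f ` B \<subseteq> S" for S
  proof -
    have "B \<subseteq> {v \<in> carrier V. f v \<in> S}" using S(2) B(2) by auto
    then have "{v \<in> carrier V. f v \<in> S} = carrier V"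
      by (rule B(3)[OF ssp_vimage[OF fd_vs[OF V] f S(1)]])
    then have "f ` carrier V \<subseteq> S" by auto
    then show ?thesis using s ssp_sub[OF S(1)] by auto
  qed
  then show ?thesis unfolding fd_gens_iff
    using W B(1,2) s by (intro conjI exI[of _ "f ` B"]) auto
qed

text \<open>
  Enlarge a complement inside the span of part of a generating set by one generator at a time,
  adding the line of a generator whenever it is not yet in the sum.
\<close>

lemma complement_ex:
  assumes V: "fd_space K V" and N: "ssp N V"
  shows "\<exists>C. ssp C V \<and> N \<inter> C = {\<zero>\<^bsub>V\<^esub>} \<and> N <+>\<^bsub>V\<^esub> C = carrier V"
proof -
  interpret V: vectorspace K V using fd_vs[OF V] .
  note vV = fd_vs[OF V]
  obtain B where B: "finite B" "B \<subseteq> carrier V" "\<And>S. ssp S V \<Longrightarrow> B \<subseteq> S \<Longrightarrow> S = carrier V"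
    using V unfolding fd_gens_iff by blast
  have "\<exists>C. ssp C V \<and> N \<inter> C = {\<zero>\<^bsub>V\<^esub>} \<and> F \<subseteq> N <+>\<^bsub>V\<^esub> C" if "F \<subseteq> B" for F
    using finite_subset[OF that B(1)] that
  proof (induction F rule: finite_induct)
    case empty
    show ?case using ssp_trivial[OF vV] ssp_zero[OF N] by (intro exI[of _ "{\<zero>\<^bsub>V\<^esub>}"]) auto
  next
    case (insert v F)
    then obtain C where C: "ssp C V" "N \<inter> C = {\<zero>\<^bsub>V\<^esub>}" "F \<subseteq> N <+>\<^bsub>V\<^esub> C" by auto
    have v: "v \<in> carrier V" using insert.prems B(2) by blast
    show ?case
    proof (cases "v \<in> N <+>\<^bsub>V\<^esub> C")
      case True then show ?thesis using C by blast
    next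
      case nv: False
      let ?L = "(\<lambda>c. c \<odot>\<^bsub>V\<^esub> v) ` carrier K"
      have L: "ssp ?L V"
      proof (rule sspI[OF vV])
        show "?L \<subseteq> carrier V" using v by auto
        show "\<zero>\<^bsub>V\<^esub> \<in> ?L" using v by (intro image_eqI[of _ _ \<zero>]) auto
      next
        fix a b assume "a \<in> ?L" "b \<in> ?L"
        then show "a \<oplus>\<^bsub>V\<^esub> b \<in> ?L" using v by (auto simp: V.smult_l_distr[symmetric])
      next
        fix c a assume "c \<in> carrier K" "a \<in> ?L"
        then show "c \<odot>\<^bsub>V\<^esub> a \<in> ?L" using v by (auto simp: V.smult_assoc1[symmetric])
      qed
      let ?C = "C <+>\<^bsub>V\<^esub> ?L"
      have C': "ssp ?C V" using ssp_set_add[OF C(1) L] .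
      have vL: "v \<in> ?L" using v by (intro image_eqI[of _ _ \<one>]) auto
      have disj: "x = \<zero>\<^bsub>V\<^esub>" if x: "x \<in> N" "x \<in> ?C" for x
      proof -
        obtain c k where ck: "c \<in> C" "k \<in> carrier K" "x = c \<oplus>\<^bsub>V\<^esub> k \<odot>\<^bsub>V\<^esub> v"
          using x(2) by (auto simp: mem_set_add)
        have cc: "c \<in> carrier V" "x \<in> carrier V" using ck ssp_mem[OF C(1)] ssp_mem[OF N] x by auto
        show ?thesis
        proof (cases "k = \<zero>")
          case True
          then have "x = c" using ck v cc by simp
          then show ?thesis using x ck C(2) by blast
        next
          case False
          then have k: "k \<in> Units K" using ck field_Units by auto
          have "k \<odot>\<^bsub>V\<^esub> v = x \<oplus>\<^bsub>V\<^esub> \<ominus>\<^bsub>V\<^esub> c"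
            using ck cc v by (simp add: V.M.a_ac V.M.r_neg1 V.M.r_neg2 V.M.r_neg)
          moreover have "x \<oplus>\<^bsub>V\<^esub> \<ominus>\<^bsub>V\<^esub> c \<in> N <+>\<^bsub>V\<^esub> C"
            unfolding mem_set_add using x ck cc ssp_smult[OF C(1), of "\<ominus> \<one>" c] vV
            by (auto simp: vs_neg_smult)
          ultimately have "inv k \<odot>\<^bsub>V\<^esub> (k \<odot>\<^bsub>V\<^esub> v) \<in> N <+>\<^bsub>V\<^esub> C"
            using ssp_smult[OF ssp_set_add[OF N C(1)], of "inv k"] k by auto
          moreover have "inv k \<odot>\<^bsub>V\<^esub> (k \<odot>\<^bsub>V\<^esub> v) = v"
            using k v by (simp add: V.smult_assoc1[symmetric] Units_closed)
          ultimately show ?thesis using nv by simp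
        qed
      qed
      have 1: "N \<inter> ?C = {\<zero>\<^bsub>V\<^esub>}"
      proof
        show "N \<inter> ?C \<subseteq> {\<zero>\<^bsub>V\<^esub>}" using disj by (metis IntE singletonI subsetI)
        show "{\<zero>\<^bsub>V\<^esub>} \<subseteq> N \<inter> ?C" using ssp_zero[OF N] ssp_zero[OF C'] by simp
      qed
      have "N <+>\<^bsub>V\<^esub> C \<subseteq> N <+>\<^bsub>V\<^esub> ?C" using set_add_sup1[OF C(1) L] by (rule set_add_mono2)
      then have "F \<subseteq> N <+>\<^bsub>V\<^esub> ?C" using C(3) by (rule subset_trans[rotated])
      moreover have "v \<in> N <+>\<^bsub>V\<^esub> ?C"
        by (rule subsetD[OF set_add_sup2[OF N C'] subsetD[OF set_add_sup2[OF C(1) L] vL]])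
      ultimately have "insert v F \<subseteq> N <+>\<^bsub>V\<^esub> ?C" by (rule insert_subsetI[rotated])
      then show ?thesis using C' 1 by (intro exI[of _ ?C] conjI)
    qed
  qed
  from this[of B] obtain C where C: "ssp C V" "N \<inter> C = {\<zero>\<^bsub>V\<^esub>}" "B \<subseteq> N <+>\<^bsub>V\<^esub> C" by auto
  then show ?thesis using B(3)[OF ssp_set_add[OF N C(1)]] by blast
qed

lemma projection_ex:
  assumes V: "fd_space K V" and N: "ssp N V"
  shows "\<exists>p. p \<in> module_hom K V V \<and> p ` carrier V = N \<and> (\<forall>v\<in>N. p v = v)"
proof -
  interpret V: vectorspace K V using fd_vs[OF V] .
  note vV = fd_vs[OF V]
  obtain C where C: "ssp C V" "N \<inter> C = {\<zero>\<^bsub>V\<^esub>}" "N <+>\<^bsub>V\<^esub> C = carrier V"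
    using complement_ex[OF assms] by blast
  have mN: "n \<in> N \<Longrightarrow> n \<in> carrier V" for n using ssp_mem[OF N] .
  have mC: "n \<in> C \<Longrightarrow> n \<in> carrier V" for n using ssp_mem[OF C(1)] .
  have uniq: "n = n'" if h: "n \<in> N" "n' \<in> N" "v \<ominus>\<^bsub>V\<^esub> n \<in> C" "v \<ominus>\<^bsub>V\<^esub> n' \<in> C" "v \<in> carrier V" for n n' v
  proof -
    have "(v \<ominus>\<^bsub>V\<^esub> n) \<ominus>\<^bsub>V\<^esub> (v \<ominus>\<^bsub>V\<^esub> n') = n' \<ominus>\<^bsub>V\<^esub> n"
      using h mN vs_minus_add_swap[OF vV, of v "\<ominus>\<^bsub>V\<^esub> n" v "\<ominus>\<^bsub>V\<^esub> n'"]
      by (simp add: a_minus_def V.M.r_neg V.M.a_comm)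
    then have "n' \<ominus>\<^bsub>V\<^esub> n \<in> N \<inter> C" using ssp_minus[OF C(1) h(3,4)] ssp_minus[OF N h(2,1)] by simp
    then show ?thesis using C(2) vs_minus_eq_zero[OF vV, of n' n] h mN by auto
  qed
  have ex: "\<exists>n. n \<in> N \<and> v \<ominus>\<^bsub>V\<^esub> n \<in> C" if v: "v \<in> carrier V" for v
  proof -
    obtain n c where "n \<in> N" "c \<in> C" "v = n \<oplus>\<^bsub>V\<^esub> c" using v C(3) mem_set_add[of v V N C] by blast
    then show ?thesis using vs_add_minus[OF vV, of c n] mN mC by auto
  qed
  define p where "p v = (THE n. n \<in> N \<and> v \<ominus>\<^bsub>V\<^esub> n \<in> C)" for v
  have p: "p v \<in> N \<and> v \<ominus>\<^bsub>V\<^esub> p v \<in> C" if v: "v \<in> carrier V" for v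
  proof -
    have "\<exists>!n. n \<in> N \<and> v \<ominus>\<^bsub>V\<^esub> n \<in> C" using ex[OF v] uniq[OF _ _ _ _ v] by (rule ex_ex1I) auto
    then show ?thesis unfolding p_def by (rule theI')
  qed
  have pI: "p v = n" if "v \<in> carrier V" "n \<in> N" "v \<ominus>\<^bsub>V\<^esub> n \<in> C" for v n
    using uniq[OF _ that(2) _ that(3,1)] p[OF that(1)] by auto
  have "p \<in> module_hom K V V"
  proof (rule homI)
    show "p v \<in> carrier V" if "v \<in> carrier V" for v using p[OF that] mN by blast
  next
    fix u v assume uv: "u \<in> carrier V" "v \<in> carrier V"
    show "p (u \<oplus>\<^bsub>V\<^esub> v) = p u \<oplus>\<^bsub>V\<^esub> p v"
      using uv p[OF uv(1)] p[OF uv(2)] mN ssp_add[OF C(1)] ssp_add[OF N]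
      by (intro pI) (simp_all add: vs_minus_add_swap[OF vV])
  next
    fix c v assume cv: "c \<in> carrier K" "v \<in> carrier V"
    have "c \<odot>\<^bsub>V\<^esub> v \<ominus>\<^bsub>V\<^esub> c \<odot>\<^bsub>V\<^esub> p v = c \<odot>\<^bsub>V\<^esub> (v \<ominus>\<^bsub>V\<^esub> p v)"
      using cv p[OF cv(2)] mN by (simp add: a_minus_def V.smult_r_distr V.smult_r_minus)
    then show "p (c \<odot>\<^bsub>V\<^esub> v) = c \<odot>\<^bsub>V\<^esub> p v"
      using cv p[OF cv(2)] mN ssp_smult[OF C(1)] ssp_smult[OF N]
      by (intro pI) simp_all
  qed
  moreover have pn: "\<forall>v\<in>N. p v = v"
  proof
    fix v assume v: "v \<in> N"
    then have "v \<ominus>\<^bsub>V\<^esub> v = \<zero>\<^bsub>V\<^esub>" using mN vs_minus_eq_zero[OF vV, of v v] by blast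
    then have "v \<ominus>\<^bsub>V\<^esub> v \<in> C" using ssp_zero[OF C(1)] by (simp only:)
    then show "p v = v" using v mN by (intro pI)
  qed
  moreover have "p ` carrier V = N"
  proof
    show "p ` carrier V \<subseteq> N" using p by blast
    show "N \<subseteq> p ` carrier V" using pn mN by (metis image_eqI subsetI)
  qed
  ultimately show ?thesis by blast
qed

lemma fd_ssp:
  assumes V: "fd_space K V" and N: "ssp N V" shows "fd_space K (V\<lparr>carrier := N\<rparr>)"
proof -
  obtain p where p: "p \<in> module_hom K V V" "p ` carrier V = N"
    using projection_ex[OF assms] by blast
  have "p \<in> module_hom K V (V\<lparr>carrier := N\<rparr>)" using p by (auto simp: module_hom_def)
  then show ?thesis using fd_image[OF V ssp_is_vs[OF N]] p by simp
qed

text \<open>A linear map on a subspace extends to the whole space: precompose with a projection.\<close>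

lemma hom_extend:
  assumes V: "fd_space K V" and N: "ssp N V" and f: "f \<in> module_hom K (V\<lparr>carrier := N\<rparr>) W"
  shows "\<exists>g. g \<in> module_hom K V W \<and> (\<forall>v\<in>N. g v = f v)"
proof -
  obtain p where p: "p \<in> module_hom K V V" "p ` carrier V = N" "\<forall>v\<in>N. p v = v"
    using projection_ex[OF V N] by blast
  have "p \<in> module_hom K V (V\<lparr>carrier := N\<rparr>)" using p by (auto simp: module_hom_def)
  from hom_comp[OF this f] show ?thesis using p(3) by (intro exI[of _ "\<lambda>v. f (p v)"]) auto
qed

text \<open>A linear map out of \<open>V\<close> factors through every surjection whose kernel it kills.\<close>

lemma hom_factor:
  assumes V: "vs_ok V" and U: "vs_ok U" and W: "vs_ok W" and p: "p \<in> module_hom K V U" "p ` carrier V = carrier U"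
    and f: "f \<in> module_hom K V W"
    and ker: "\<And>v. v \<in> carrier V \<Longrightarrow> p v = \<zero>\<^bsub>U\<^esub> \<Longrightarrow> f v = \<zero>\<^bsub>W\<^esub>"
  shows "\<exists>g. g \<in> lin K U W \<and> (\<forall>v\<in>carrier V. g (p v) = f v)"
proof -
  have eq: "f u = f v" if "u \<in> carrier V" "v \<in> carrier V" "p u = p v" for u v
  proof -
    have "p (u \<ominus>\<^bsub>V\<^esub> v) = \<zero>\<^bsub>U\<^esub>" using that V U p by (simp add: hom_minus hom_closed vs_minus_eq_zero)
    then have "f (u \<ominus>\<^bsub>V\<^esub> v) = \<zero>\<^bsub>W\<^esub>" using ker that V by simp
    then show ?thesis using that V W f hom_closed[OF f] by (simp add: hom_minus vs_minus_eq_zero)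
  qed
  define g where "g u = f (SOME v. v \<in> carrier V \<and> p v = u)" for u
  have g: "g (p v) = f v" if "v \<in> carrier V" for v
  proof -
    have "(SOME v'. v' \<in> carrier V \<and> p v' = p v) \<in> carrier V \<and> p (SOME v'. v' \<in> carrier V \<and> p v' = p v) = p v"
      by (rule someI[of _ v]) (simp add: that)
    then show ?thesis unfolding g_def using eq that by blast
  qed
  have "g \<in> module_hom K U W"
  proof (rule homI)
    show "g u \<in> carrier W" if "u \<in> carrier U" for u
      using that hom_closed[OF f] g unfolding p(2)[symmetric] by auto
  next
    fix u v assume "u \<in> carrier U" "v \<in> carrier U"
    then obtain a b where "a \<in> carrier V" "b \<in> carrier V" "u = p a" "v = p b" using p(2) by (metis imageE)
    then show "g (u \<oplus>\<^bsub>U\<^esub> v) = g u \<oplus>\<^bsub>W\<^esub> g v"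
      using V g by (simp add: hom_add[OF p(1), symmetric] hom_add[OF f])
  next
    fix c v assume c: "c \<in> carrier K" and "v \<in> carrier U"
    then obtain b where "b \<in> carrier V" "v = p b" using p(2) by (metis imageE)
    then show "g (c \<odot>\<^bsub>U\<^esub> v) = c \<odot>\<^bsub>W\<^esub> g v"
      using V g c by (simp add: hom_smult[OF p(1), symmetric] hom_smult[OF f])
  qed
  then have "restrict g (carrier U) \<in> lin K U W" by (rule lin_restrict[OF U])
  moreover have "\<forall>v\<in>carrier V. restrict g (carrier U) (p v) = f v"
    using g hom_closed[OF p(1)] by simp
  ultimately show ?thesis by blast
qed

end

context base
begin

section \<open>Quotients, free spaces and tensor products\<close>

subsection \<open>Copies in the universe and quotient spaces\<close>

text \<open>
  A finite dimensional space embeds into the universe by its coordinates with respect to a finite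
  spanning list.  Hence the injection chosen by \<open>embed\<close> exists.
\<close>

lemma univ_embedding:
  fixes M :: "('k, 't) module"
  assumes M: "fd_space K M" shows "\<exists>e :: 't \<Rightarrow> ('k, 's) univ. inj_on e (carrier M)"
proof -
  interpret M: vectorspace K M using fd_vs[OF M] .
  obtain B where B: "finite B" "B \<subseteq> carrier M" "M.span B = carrier M"
    using M unfolding fd_space_def M.fin_dim_def by blast
  obtain bs where bs: "set bs = B" using finite_list[OF B(1)] by blast
  have "\<forall>v\<in>carrier M. \<exists>a. a \<in> B \<rightarrow> carrier K \<and> M.lincomb a B = v"
    using M.finite_in_span[OF B(1,2)] B(3) by auto
  then obtain a where a: "\<And>v. v \<in> carrier M \<Longrightarrow> a v \<in> B \<rightarrow> carrier K \<and> M.lincomb (a v) B = v"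
    by metis
  have "inj_on (\<lambda>v. Inr (map (a v) bs) :: ('k, 's) univ) (carrier M)"
  proof (rule inj_onI)
    fix u v assume uv: "u \<in> carrier M" "v \<in> carrier M"
      and "(Inr (map (a u) bs) :: ('k, 's) univ) = Inr (map (a v) bs)"
    then have "a u b = a v b" if "b \<in> B" for b using bs that by auto
    then have "M.lincomb (a u) B = M.lincomb (a v) B"
      using a uv B by (intro M.lincomb_cong) auto
    then show "u = v" using a uv by simp
  qed
  then show ?thesis by blast
qed

lemma embed_inj:
  fixes M :: "('k, 't) module"
  assumes "fd_space K M" shows "inj_on (embed M :: 't \<Rightarrow> ('k, 's) univ) (carrier M)"
  unfolding embed_def using someI_ex[OF univ_embedding[OF assms]] .

lemma unembed_embed:
  fixes M :: "('k, 't) module"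
  assumes "fd_space K M" "v \<in> carrier M" shows "unembed M (embed M v :: ('k, 's) univ) = v"
  unfolding unembed_def using embed_inj[OF assms(1)] assms(2) by (rule inv_into_f_f)

lemma copy_facts:
  fixes M :: "('k, 't) module"
  assumes M: "fd_space K M"
  shows copy_fd: "fd_space K (copy M :: ('k, ('k, 's) univ) module)"
    and embed_hom: "(embed M :: 't \<Rightarrow> ('k, 's) univ) \<in> module_hom K M (copy M)"
    and embed_im: "(embed M :: 't \<Rightarrow> ('k, 's) univ) ` carrier M = carrier (copy M)"
proof -
  note vM = fd_vs[OF M]
  let ?e = "embed M :: 't \<Rightarrow> ('k, 's) univ"
  let ?C = "copy M :: ('k, ('k, 's) univ) module"
  have c: "?e ` carrier M = carrier ?C" by (simp add: copy_def)
  have 1: "?e \<zero>\<^bsub>M\<^esub> = \<zero>\<^bsub>?C\<^esub>" by (simp add: copy_def)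
  have 2: "?e (u \<oplus>\<^bsub>M\<^esub> v) = ?e u \<oplus>\<^bsub>?C\<^esub> ?e v" if "u \<in> carrier M" "v \<in> carrier M" for u v
    using that by (simp add: copy_def unembed_embed[OF M])
  have 3: "?e (k \<odot>\<^bsub>M\<^esub> v) = k \<odot>\<^bsub>?C\<^esub> ?e v" if "v \<in> carrier M" for k v
    using that by (simp add: copy_def unembed_embed[OF M])
  note h = hom_image_vs[OF vM c 1 2 3]
  show "fd_space K ?C" using h fd_image[OF M _ _ c] by blast
  show "?e \<in> module_hom K M ?C" using h by blast
  show "?e ` carrier M = carrier ?C" by (rule c)
qed

lemma vs_minus_zero: assumes "vs_ok V" "v \<in> carrier V" shows "v \<ominus>\<^bsub>V\<^esub> \<zero>\<^bsub>V\<^esub> = v"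
proof - interpret V: vectorspace K V by fact show ?thesis using assms by (simp add: vs_minus_smult) qed

lemma coset_mem:
  assumes N: "ssp N V" and v: "v \<in> carrier V"
  shows "x \<in> N +>\<^bsub>V\<^esub> v \<longleftrightarrow> x \<in> carrier V \<and> x \<ominus>\<^bsub>V\<^esub> v \<in> N"
proof -
  note V = ssp_vs[OF N]
  interpret V: vectorspace K V using V .
  have "x \<in> N +>\<^bsub>V\<^esub> v \<longleftrightarrow> (\<exists>n\<in>N. x = n \<oplus>\<^bsub>V\<^esub> v)" by (auto simp: a_r_coset_def')
  also have "\<dots> \<longleftrightarrow> x \<in> carrier V \<and> x \<ominus>\<^bsub>V\<^esub> v \<in> N"
  proof
    assume "\<exists>n\<in>N. x = n \<oplus>\<^bsub>V\<^esub> v"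
    then obtain n where n: "n \<in> N" "x = n \<oplus>\<^bsub>V\<^esub> v" by blast
    then have "x = v \<oplus>\<^bsub>V\<^esub> n" using ssp_mem[OF N] v by (simp add: V.M.a_comm)
    then show "x \<in> carrier V \<and> x \<ominus>\<^bsub>V\<^esub> v \<in> N"
      using n ssp_mem[OF N] v V vs_add_minus[OF V, of n v] by simp
  next
    assume x: "x \<in> carrier V \<and> x \<ominus>\<^bsub>V\<^esub> v \<in> N"
    then have "x = (x \<ominus>\<^bsub>V\<^esub> v) \<oplus>\<^bsub>V\<^esub> v"
      using vs_minus_add[OF V, of x v] v V by (simp add: V.M.a_comm)
    then show "\<exists>n\<in>N. x = n \<oplus>\<^bsub>V\<^esub> v" using x by blast
  qed
  finally show ?thesis .
qed

lemma coset_eq: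
  assumes N: "ssp N V" and u: "u \<in> carrier V" and v: "v \<in> carrier V"
  shows "N +>\<^bsub>V\<^esub> u = N +>\<^bsub>V\<^esub> v \<longleftrightarrow> u \<ominus>\<^bsub>V\<^esub> v \<in> N"
proof -
  note V = ssp_vs[OF N]
  interpret V: vectorspace K V using V .
  have z: "w \<ominus>\<^bsub>V\<^esub> w \<in> N" if "w \<in> carrier V" for w
    using vs_minus_eq_zero[OF V that that] ssp_zero[OF N] by metis
  show ?thesis
  proof
    assume "N +>\<^bsub>V\<^esub> u = N +>\<^bsub>V\<^esub> v"
    moreover have "u \<in> N +>\<^bsub>V\<^esub> u" using z u coset_mem[OF N u] by blast
    ultimately show "u \<ominus>\<^bsub>V\<^esub> v \<in> N" using coset_mem[OF N v] by blast
  next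
    assume uv: "u \<ominus>\<^bsub>V\<^esub> v \<in> N"
    have e: "x \<ominus>\<^bsub>V\<^esub> v = (x \<ominus>\<^bsub>V\<^esub> u) \<oplus>\<^bsub>V\<^esub> (u \<ominus>\<^bsub>V\<^esub> v)" if "x \<in> carrier V" for x
      using that u v by (simp add: a_minus_def V.M.a_ac V.M.r_neg1 V.M.r_neg2)
    have f: "x \<ominus>\<^bsub>V\<^esub> u = (x \<ominus>\<^bsub>V\<^esub> v) \<ominus>\<^bsub>V\<^esub> (u \<ominus>\<^bsub>V\<^esub> v)" if "x \<in> carrier V" for x
      using vs_add_minus[OF V, of "x \<ominus>\<^bsub>V\<^esub> u" "u \<ominus>\<^bsub>V\<^esub> v"] e[OF that] that u v V
      by (simp add: V.M.a_comm)
    have "x \<ominus>\<^bsub>V\<^esub> u \<in> N \<longleftrightarrow> x \<ominus>\<^bsub>V\<^esub> v \<in> N" if x: "x \<in> carrier V" for x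
      using ssp_add[OF N _ uv] ssp_minus[OF N _ uv] e[OF x] f[OF x] by metis
    then show "N +>\<^bsub>V\<^esub> u = N +>\<^bsub>V\<^esub> v" using coset_mem[OF N u] coset_mem[OF N v] by blast
  qed
qed

lemma coset_facts:
  assumes N: "ssp N V"
  shows coset_vs: "vs_ok (coset_space V N)"
    and coset_hom: "(\<lambda>v. N +>\<^bsub>V\<^esub> v) \<in> module_hom K V (coset_space V N)"
    and coset_im: "(\<lambda>v. N +>\<^bsub>V\<^esub> v) ` carrier V = carrier (coset_space V N)"
    and coset_zero: "v \<in> carrier V \<Longrightarrow> N +>\<^bsub>V\<^esub> v = \<zero>\<^bsub>coset_space V N\<^esub> \<longleftrightarrow> v \<in> N"
proof -
  note V = ssp_vs[OF N]
  interpret V: vectorspace K V using V .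
  note mem = coset_mem[OF N]
  show im: "(\<lambda>v. N +>\<^bsub>V\<^esub> v) ` carrier V = carrier (coset_space V N)"
    by (auto simp: coset_space_def A_RCOSETS_def')
  have z0: "N +>\<^bsub>V\<^esub> \<zero>\<^bsub>V\<^esub> = N"
    using mem[OF vs_zero[OF V]] ssp_mem[OF N] vs_minus_zero[OF V] by auto
  have add: "N +>\<^bsub>V\<^esub> (u \<oplus>\<^bsub>V\<^esub> v) = (N +>\<^bsub>V\<^esub> u) \<oplus>\<^bsub>coset_space V N\<^esub> (N +>\<^bsub>V\<^esub> v)"
    if uv: "u \<in> carrier V" "v \<in> carrier V" for u v
  proof -
    have "x \<in> N +>\<^bsub>V\<^esub> (u \<oplus>\<^bsub>V\<^esub> v) \<longleftrightarrow> x \<in> (N +>\<^bsub>V\<^esub> u) <+>\<^bsub>V\<^esub> (N +>\<^bsub>V\<^esub> v)" for x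
    proof
      assume "x \<in> N +>\<^bsub>V\<^esub> (u \<oplus>\<^bsub>V\<^esub> v)"
      then have x: "x \<in> carrier V" "x \<ominus>\<^bsub>V\<^esub> (u \<oplus>\<^bsub>V\<^esub> v) \<in> N" using mem uv V by auto
      have "(x \<ominus>\<^bsub>V\<^esub> v) \<ominus>\<^bsub>V\<^esub> u = x \<ominus>\<^bsub>V\<^esub> (u \<oplus>\<^bsub>V\<^esub> v)"
        using x uv by (simp add: a_minus_def V.M.a_ac V.M.minus_add)
      then have a: "x \<ominus>\<^bsub>V\<^esub> v \<in> N +>\<^bsub>V\<^esub> u" using mem[OF uv(1)] x uv V by simp
      have b: "v \<in> N +>\<^bsub>V\<^esub> v"
        using mem[OF uv(2)] uv vs_minus_eq_zero[OF V uv(2) uv(2)] ssp_zero[OF N] by metis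
      have "x = (x \<ominus>\<^bsub>V\<^esub> v) \<oplus>\<^bsub>V\<^esub> v"
        using vs_minus_add[OF V x(1) uv(2)] x uv V by (simp add: V.M.a_comm)
      then show "x \<in> (N +>\<^bsub>V\<^esub> u) <+>\<^bsub>V\<^esub> (N +>\<^bsub>V\<^esub> v)" unfolding mem_set_add using a b by blast
    next
      assume "x \<in> (N +>\<^bsub>V\<^esub> u) <+>\<^bsub>V\<^esub> (N +>\<^bsub>V\<^esub> v)"
      then obtain a b where ab: "a \<in> N +>\<^bsub>V\<^esub> u" "b \<in> N +>\<^bsub>V\<^esub> v" "x = a \<oplus>\<^bsub>V\<^esub> b"
        unfolding mem_set_add by blast
      then have h: "a \<in> carrier V" "b \<in> carrier V" "a \<ominus>\<^bsub>V\<^esub> u \<in> N" "b \<ominus>\<^bsub>V\<^esub> v \<in> N"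
        using mem[OF uv(1)] mem[OF uv(2)] by auto
      have "x \<ominus>\<^bsub>V\<^esub> (u \<oplus>\<^bsub>V\<^esub> v) \<in> N"
        unfolding ab(3) vs_minus_add_swap[OF V h(1,2) uv] using ssp_add[OF N] h by blast
      then show "x \<in> N +>\<^bsub>V\<^esub> (u \<oplus>\<^bsub>V\<^esub> v)" using mem ab h uv V by simp
    qed
    then show ?thesis by (auto simp: coset_space_def)
  qed
  have smult: "N +>\<^bsub>V\<^esub> (c \<odot>\<^bsub>V\<^esub> v) = c \<odot>\<^bsub>coset_space V N\<^esub> (N +>\<^bsub>V\<^esub> v)"
    if c: "c \<in> carrier K" and v: "v \<in> carrier V" for c v
  proof -
    have "N +>\<^bsub>V\<^esub> (c \<odot>\<^bsub>V\<^esub> x) = N +>\<^bsub>V\<^esub> (c \<odot>\<^bsub>V\<^esub> v)" if x: "x \<in> N +>\<^bsub>V\<^esub> v" for x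
    proof -
      have x': "x \<in> carrier V" "x \<ominus>\<^bsub>V\<^esub> v \<in> N" using mem[OF v] x by auto
      have "c \<odot>\<^bsub>V\<^esub> x \<ominus>\<^bsub>V\<^esub> c \<odot>\<^bsub>V\<^esub> v = c \<odot>\<^bsub>V\<^esub> (x \<ominus>\<^bsub>V\<^esub> v)"
        using c v x' by (simp add: a_minus_def V.smult_r_distr V.smult_r_minus)
      then show ?thesis using coset_eq[OF N] c v x' V ssp_smult[OF N c x'(2)] by simp
    qed
    moreover have "v \<in> N +>\<^bsub>V\<^esub> v"
      using mem[OF v] v vs_minus_eq_zero[OF V v v] ssp_zero[OF N] by metis
    ultimately have "(\<Union>x\<in>N +>\<^bsub>V\<^esub> v. N +>\<^bsub>V\<^esub> (c \<odot>\<^bsub>V\<^esub> x)) = N +>\<^bsub>V\<^esub> (c \<odot>\<^bsub>V\<^esub> v)" by blast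
    then show ?thesis by (simp add: coset_space_def)
  qed
  have z: "N +>\<^bsub>V\<^esub> \<zero>\<^bsub>V\<^esub> = \<zero>\<^bsub>coset_space V N\<^esub>" using z0 by (simp add: coset_space_def)
  note h = hom_image_vs[OF V im z add smult]
  show "vs_ok (coset_space V N)" "(\<lambda>v. N +>\<^bsub>V\<^esub> v) \<in> module_hom K V (coset_space V N)"
    using h by blast+
  show "N +>\<^bsub>V\<^esub> v = \<zero>\<^bsub>coset_space V N\<^esub> \<longleftrightarrow> v \<in> N" if "v \<in> carrier V"
    using coset_eq[OF N that vs_zero[OF V]] that z vs_minus_zero[OF V that] by simp
qed

text \<open>
  Only the coset space has to be finite dimensional: for the tensor product it is a quotient of an
  infinite dimensional free space.
\<close>

lemma quot_facts:
  fixes V :: "('k, 't) module"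
  assumes N: "ssp N V" and fd: "fd_space K (coset_space V N)"
  shows quot_fd': "fd_space K (quot_space V N :: ('k, ('k, 's) univ) module)"
    and quot_hom': "(quot_proj V N :: 't \<Rightarrow> ('k, 's) univ) \<in> module_hom K V (quot_space V N)"
    and quot_im': "(quot_proj V N :: 't \<Rightarrow> ('k, 's) univ) ` carrier V = carrier (quot_space V N)"
    and quot_zero': "v \<in> carrier V \<Longrightarrow>
      (quot_proj V N v :: ('k, 's) univ) = \<zero>\<^bsub>quot_space V N\<^esub> \<longleftrightarrow> v \<in> N"
proof -
  let ?C = "coset_space V N" and ?Q = "quot_space V N :: ('k, ('k, 's) univ) module"
  let ?e = "embed ?C :: 't set \<Rightarrow> ('k, 's) univ"
  note V = ssp_vs[OF N]
  show "fd_space K ?Q" unfolding quot_space_def by (rule copy_fd[OF fd])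
  have e: "?e \<in> module_hom K ?C ?Q" unfolding quot_space_def by (rule embed_hom[OF fd])
  show "(quot_proj V N :: 't \<Rightarrow> ('k, 's) univ) \<in> module_hom K V ?Q"
    by (rule hom_cong[OF V hom_comp[OF coset_hom[OF N] e]]) (simp add: quot_proj_def)
  show "(quot_proj V N :: 't \<Rightarrow> ('k, 's) univ) ` carrier V = carrier ?Q"
    unfolding quot_space_def embed_im[OF fd, symmetric] coset_im[OF N, symmetric] image_image
    by (simp add: quot_proj_def)
  show "(quot_proj V N v :: ('k, 's) univ) = \<zero>\<^bsub>?Q\<^esub> \<longleftrightarrow> v \<in> N" if v: "v \<in> carrier V"
  proof -
    have 1: "quot_proj V N v = ?e (N +>\<^bsub>V\<^esub> v)" using v by (simp add: quot_proj_def)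
    have 2: "\<zero>\<^bsub>?Q\<^esub> = ?e \<zero>\<^bsub>?C\<^esub>" by (simp add: quot_space_def copy_def)
    have 3: "N +>\<^bsub>V\<^esub> v \<in> carrier ?C" using coset_im[OF N] v by blast
    show ?thesis unfolding 1 2 inj_on_eq_iff[OF embed_inj[OF fd] 3 vs_zero[OF fd_vs[OF fd]]]
      using coset_zero[OF N v] .
  qed
qed

lemma coset_fd: "fd_space K V \<Longrightarrow> ssp N V \<Longrightarrow> fd_space K (coset_space V N)"
  using fd_image[OF _ coset_vs coset_hom coset_im] .

context
  fixes V :: "('k, 't) module" and N
  assumes N: "ssp N V" and V: "fd_space K V"
begin

lemma quot_fd: "fd_space K (quot_space V N :: ('k, ('k, 's) univ) module)"
  and quot_hom: "(quot_proj V N :: 't \<Rightarrow> ('k, 's) univ) \<in> module_hom K V (quot_space V N)"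
  and quot_im: "(quot_proj V N :: 't \<Rightarrow> ('k, 's) univ) ` carrier V = carrier (quot_space V N)"
  and quot_zero: "v \<in> carrier V \<Longrightarrow> (quot_proj V N v :: ('k, 's) univ) = \<zero>\<^bsub>quot_space V N\<^esub> \<longleftrightarrow> v \<in> N"
  using quot_facts[OF N coset_fd[OF V N]] by blast+

end

subsection \<open>Free spaces\<close>

lemma free_vs: "vs_ok (free_space K I)"
proof (rule vs_criteria)
  have fin: "finite {i. p i \<oplus> q i \<noteq> \<zero>}" if "finite {i. p i \<noteq> \<zero>}" "finite {i. q i \<noteq> \<zero>}"
    for p q :: "'i \<Rightarrow> 'k"
    by (rule finite_subset[OF _ finite_UnI[OF that]]) auto
  have fin2: "finite {i. c \<otimes> p i \<noteq> \<zero>}" if "finite {i. p i \<noteq> \<zero>}" "c \<in> carrier K" for p :: "'i \<Rightarrow> 'k" and c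
    by (rule finite_subset[OF _ that(1)]) (use that(2) in auto)
  let ?F = "free_space K I"
  have cl: "p i \<in> carrier K" if "p \<in> carrier ?F" for p i
    using that by (cases "i \<in> I") (auto simp: free_space_def)
  show "field K" by (rule field_axioms)
  show "\<zero>\<^bsub>?F\<^esub> \<in> carrier ?F" by (auto simp: free_space_def)
  show "\<forall>v w. v \<in> carrier ?F \<and> w \<in> carrier ?F \<longrightarrow> v \<oplus>\<^bsub>?F\<^esub> w \<in> carrier ?F"
    using fin by (auto simp: free_space_def)
  show sm: "\<forall>c v. c \<in> carrier K \<and> v \<in> carrier ?F \<longrightarrow> c \<odot>\<^bsub>?F\<^esub> v \<in> carrier ?F"
    using fin2 by (auto simp: free_space_def)
  show "\<forall>v\<in>carrier ?F. \<exists>neg_v\<in>carrier ?F. v \<oplus>\<^bsub>?F\<^esub> neg_v = \<zero>\<^bsub>?F\<^esub>"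
  proof
    fix v assume v: "v \<in> carrier ?F"
    have "v \<oplus>\<^bsub>?F\<^esub> ((\<ominus> \<one>) \<odot>\<^bsub>?F\<^esub> v) = \<zero>\<^bsub>?F\<^esub>"
      using cl[OF v] by (auto simp: free_space_def fun_eq_iff l_minus r_neg)
    then show "\<exists>neg_v\<in>carrier ?F. v \<oplus>\<^bsub>?F\<^esub> neg_v = \<zero>\<^bsub>?F\<^esub>" using sm v by (metis a_inv_closed one_closed)
  qed
  have *: "v \<oplus>\<^bsub>?F\<^esub> w = (\<lambda>i. v i \<oplus> w i)" "c \<odot>\<^bsub>?F\<^esub> v = (\<lambda>i. c \<otimes> v i)" "\<zero>\<^bsub>?F\<^esub> = (\<lambda>i. \<zero>)" for v w c
    by (simp_all add: free_space_def)
  show "\<forall>v w. v \<in> carrier ?F \<and> w \<in> carrier ?F \<longrightarrow> v \<oplus>\<^bsub>?F\<^esub> w = w \<oplus>\<^bsub>?F\<^esub> v"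
    unfolding * fun_eq_iff using cl a_comm by blast
  show "\<forall>v w x. v \<in> carrier ?F \<and> w \<in> carrier ?F \<and> x \<in> carrier ?F \<longrightarrow> v \<oplus>\<^bsub>?F\<^esub> w \<oplus>\<^bsub>?F\<^esub> x = v \<oplus>\<^bsub>?F\<^esub> (w \<oplus>\<^bsub>?F\<^esub> x)"
    unfolding * fun_eq_iff using cl a_assoc by blast
  show "\<forall>v\<in>carrier ?F. v \<oplus>\<^bsub>?F\<^esub> \<zero>\<^bsub>?F\<^esub> = v"
    unfolding * fun_eq_iff using cl r_zero by blast
  show "\<forall>a b v. a \<in> carrier K \<and> b \<in> carrier K \<and> v \<in> carrier ?F \<longrightarrow> (a \<otimes> b) \<odot>\<^bsub>?F\<^esub> v = a \<odot>\<^bsub>?F\<^esub> (b \<odot>\<^bsub>?F\<^esub> v)"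
    unfolding * fun_eq_iff using cl m_assoc by blast
  show "\<forall>v\<in>carrier ?F. \<one> \<odot>\<^bsub>?F\<^esub> v = v"
    unfolding * fun_eq_iff using cl l_one by blast
  show "\<forall>a b v. a \<in> carrier K \<and> b \<in> carrier K \<and> v \<in> carrier ?F \<longrightarrow> (a \<oplus> b) \<odot>\<^bsub>?F\<^esub> v = a \<odot>\<^bsub>?F\<^esub> v \<oplus>\<^bsub>?F\<^esub> b \<odot>\<^bsub>?F\<^esub> v"
    unfolding * fun_eq_iff using cl l_distr by blast
  show "\<forall>a v w. a \<in> carrier K \<and> v \<in> carrier ?F \<and> w \<in> carrier ?F \<longrightarrow> a \<odot>\<^bsub>?F\<^esub> (v \<oplus>\<^bsub>?F\<^esub> w) = a \<odot>\<^bsub>?F\<^esub> v \<oplus>\<^bsub>?F\<^esub> a \<odot>\<^bsub>?F\<^esub> w"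
    unfolding * fun_eq_iff using cl r_distr by blast
qed

lemma free_simps:
  "\<zero>\<^bsub>free_space K I\<^esub> = (\<lambda>_. \<zero>)" "p \<oplus>\<^bsub>free_space K I\<^esub> q = (\<lambda>i. p i \<oplus> q i)"
  "c \<odot>\<^bsub>free_space K I\<^esub> p = (\<lambda>i. c \<otimes> p i)"
  by (simp_all add: free_space_def)

lemma free_gen_mem: "i \<in> I \<Longrightarrow> free_gen K i \<in> carrier (free_space K I)"
  by (auto simp: free_space_def free_gen_def)

text \<open>A subspace that contains all generators is the whole free space, by induction on the support.\<close>

lemma free_generated:
  assumes S: "ssp S (free_space K I)" and g: "\<And>i. i \<in> I \<Longrightarrow> free_gen K i \<in> S"
  shows "S = carrier (free_space K I)"
proof
  let ?F = "free_space K I"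
  show "S \<subseteq> carrier ?F" by (rule ssp_sub[OF S])
  have "p \<in> S" if "finite A" "p \<in> carrier ?F" "{i. p i \<noteq> \<zero>} \<subseteq> A" "A \<subseteq> I" for A p
    using that
  proof (induction A arbitrary: p rule: finite_induct)
    case empty
    then have "p = \<zero>\<^bsub>?F\<^esub>" by (auto simp: free_simps)
    then show ?case using ssp_zero[OF S] by simp
  next
    case (insert k A)
    let ?q = "p(k := \<zero>)"
    have pk: "p i \<in> carrier K" for i using insert.prems(1) by (cases "i \<in> I") (auto simp: free_space_def)
    have q: "?q \<in> carrier ?F" using insert.prems by (auto simp: free_space_def intro: finite_subset)
    have "?q \<in> S" by (rule insert.IH[OF q]) (use insert.prems in auto)
    moreover have "p k \<odot>\<^bsub>?F\<^esub> free_gen K k \<in> S"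
      using ssp_smult[OF S] g[of k] insert.prems(3) pk by simp
    moreover have "p = ?q \<oplus>\<^bsub>?F\<^esub> p k \<odot>\<^bsub>?F\<^esub> free_gen K k"
      using pk by (auto simp: free_simps free_gen_def fun_eq_iff)
    ultimately show ?case using ssp_add[OF S] by metis
  qed
  note * = this
  show "carrier ?F \<subseteq> S"
  proof
    fix p assume p: "p \<in> carrier ?F"
    then have "finite {i. p i \<noteq> \<zero>}" "{i. p i \<noteq> \<zero>} \<subseteq> I" by (auto simp: free_space_def)
    then show "p \<in> S" using *[OF _ p subset_refl] by blast
  qed
qed

lemma free_lift:
  assumes U: "vs_ok U" and b: "\<And>i. i \<in> I \<Longrightarrow> b i \<in> carrier U"
  shows "\<exists>h. h \<in> module_hom K (free_space K I) U \<and> (\<forall>i\<in>I. h (free_gen K i) = b i)"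
proof -
  interpret U: vectorspace K U by fact
  let ?F = "free_space K I"
  define h where "h p = finsum U (\<lambda>i. p i \<odot>\<^bsub>U\<^esub> b i) {i. p i \<noteq> \<zero>}" for p
  have pk: "p i \<in> carrier K" if "p \<in> carrier ?F" for p i
    using that by (cases "i \<in> I") (auto simp: free_space_def)
  have hA: "h p = finsum U (\<lambda>i. p i \<odot>\<^bsub>U\<^esub> b i) A"
    if "p \<in> carrier ?F" "finite A" "{i. p i \<noteq> \<zero>} \<subseteq> A" "A \<subseteq> I" for p A
    unfolding h_def using that b pk by (intro U.M.add.finprod_mono_neutral_cong_left) auto
  have fp: "finite {i. p i \<noteq> \<zero>}" "{i. p i \<noteq> \<zero>} \<subseteq> I" if "p \<in> carrier ?F" for p
    using that by (auto simp: free_space_def)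
  have hom: "h \<in> module_hom K ?F U"
  proof (rule homI)
    fix p assume p: "p \<in> carrier ?F"
    show "h p \<in> carrier U" unfolding h_def using fp[OF p] pk[OF p] b by (intro U.M.finsum_closed) auto
    fix q assume q: "q \<in> carrier ?F"
    let ?A = "{i. p i \<noteq> \<zero>} \<union> {i. q i \<noteq> \<zero>}"
    have A: "finite ?A" "?A \<subseteq> I" using fp[OF p] fp[OF q] by auto
    have c: "p \<oplus>\<^bsub>?F\<^esub> q \<in> carrier ?F" using p q free_vs by blast
    have "h (p \<oplus>\<^bsub>?F\<^esub> q) = finsum U (\<lambda>i. (p i \<oplus> q i) \<odot>\<^bsub>U\<^esub> b i) ?A"
    proof -
      have "{i. (p \<oplus>\<^bsub>?F\<^esub> q) i \<noteq> \<zero>} \<subseteq> ?A" by (auto simp: free_simps)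
      from hA[OF c A(1) this A(2)] show ?thesis by (simp add: free_simps)
    qed
    also have "\<dots> = finsum U (\<lambda>i. p i \<odot>\<^bsub>U\<^esub> b i \<oplus>\<^bsub>U\<^esub> q i \<odot>\<^bsub>U\<^esub> b i) ?A"
      using A pk[OF p] pk[OF q] b by (intro U.M.finsum_cong') (auto simp: U.smult_l_distr subset_iff)
    also have "\<dots> = h p \<oplus>\<^bsub>U\<^esub> h q"
      using A pk[OF p] pk[OF q] b hA[OF p A(1) _ A(2)] hA[OF q A(1) _ A(2)]
      by (subst U.M.finsum_addf) (auto simp: subset_iff)
    finally show "h (p \<oplus>\<^bsub>?F\<^esub> q) = h p \<oplus>\<^bsub>U\<^esub> h q" .
  next
    fix c p assume c: "c \<in> carrier K" and p: "p \<in> carrier ?F"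
    let ?A = "{i. p i \<noteq> \<zero>}"
    have cl: "c \<odot>\<^bsub>?F\<^esub> p \<in> carrier ?F" using p c free_vs by blast
    have "h (c \<odot>\<^bsub>?F\<^esub> p) = finsum U (\<lambda>i. (c \<otimes> p i) \<odot>\<^bsub>U\<^esub> b i) ?A"
    proof -
      have "{i. (c \<odot>\<^bsub>?F\<^esub> p) i \<noteq> \<zero>} \<subseteq> ?A" using c by (auto simp: free_simps)
      from hA[OF cl fp(1)[OF p] this fp(2)[OF p]] show ?thesis by (simp add: free_simps)
    qed
    also have "\<dots> = finsum U (\<lambda>i. c \<odot>\<^bsub>U\<^esub> (p i \<odot>\<^bsub>U\<^esub> b i)) ?A"
      using fp[OF p] pk[OF p] b c by (intro U.M.finsum_cong') (auto simp: U.smult_assoc1 subset_iff)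
    also have "\<dots> = c \<odot>\<^bsub>U\<^esub> h p"
      unfolding h_def using fp[OF p] pk[OF p] b c by (subst U.finsum_smult) (auto simp: subset_iff)
    finally show "h (c \<odot>\<^bsub>?F\<^esub> p) = c \<odot>\<^bsub>U\<^esub> h p" .
  qed
  moreover have "h (free_gen K i) = b i" if i: "i \<in> I" for i
  proof -
    have "h (free_gen K i) = finsum U (\<lambda>j. free_gen K i j \<odot>\<^bsub>U\<^esub> b j) {i}"
      using i by (intro hA free_gen_mem) (auto simp: free_gen_def)
    also have "\<dots> = b i" using b[OF i] by (simp add: free_gen_def)
    finally show ?thesis .
  qed
  ultimately show ?thesis by blast
qed

subsection \<open>Tensor products\<close>

text \<open>
  Bilinear maps on \<open>V \<times> W\<close> with values in \<open>U\<close>; nothing is required outside the carriers.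
\<close>

definition bilin :: "('k, 'u, 'y) module_scheme \<Rightarrow> ('k, 'w, 'x) module_scheme \<Rightarrow> ('k, 't, 'q) module_scheme \<Rightarrow>
    ('u \<Rightarrow> 'w \<Rightarrow> 't) \<Rightarrow> bool" where
  "bilin V W U b \<longleftrightarrow>
     (\<forall>w\<in>carrier W. (\<lambda>v. b v w) \<in> module_hom K V U) \<and> (\<forall>v\<in>carrier V. b v \<in> module_hom K W U)"

lemma bilinI:
  assumes "\<And>w. w \<in> carrier W \<Longrightarrow> (\<lambda>v. b v w) \<in> module_hom K V U"
    and "\<And>v. v \<in> carrier V \<Longrightarrow> b v \<in> module_hom K W U"
  shows "bilin V W U b"
  using assms by (simp add: bilin_def)

lemma bilin_l: "bilin V W U b \<Longrightarrow> w \<in> carrier W \<Longrightarrow> (\<lambda>v. b v w) \<in> module_hom K V U"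
  and bilin_r: "bilin V W U b \<Longrightarrow> v \<in> carrier V \<Longrightarrow> b v \<in> module_hom K W U"
  by (simp_all add: bilin_def)

lemma bilin_closed: "bilin V W U b \<Longrightarrow> v \<in> carrier V \<Longrightarrow> w \<in> carrier W \<Longrightarrow> b v w \<in> carrier U"
  using hom_closed[OF bilin_r] .

lemma bilin_comp:
  assumes b: "bilin V' W' U b" and f: "f \<in> module_hom K V V'" and g: "g \<in> module_hom K W W'"
    and h: "h \<in> module_hom K U U'"
  shows "bilin V W U' (\<lambda>v w. h (b (f v) (g w)))"
  using hom_comp[OF hom_comp[OF f bilin_l[OF b]] h] hom_comp[OF hom_comp[OF g bilin_r[OF b]] h]
    hom_closed[OF f] hom_closed[OF g]
  by (intro bilinI) auto

lemma tensor_rels_sub: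
  assumes V: "vs_ok V" and W: "vs_ok W"
  shows "bilin_rels K V W \<subseteq> carrier (tensor_free K V W)"
proof -
  note F = free_vs[of "carrier V \<times> carrier W"]
  note g = free_gen_mem[of _ "carrier V \<times> carrier W"]
  show ?thesis
    unfolding bilin_rels_def tensor_free_def Let_def
    using V W by (auto intro!: vs_minus[OF F] vs_add[OF F] vs_smult[OF F] g)
qed

lemma tensor_span_ssp:
  "vs_ok V \<Longrightarrow> vs_ok W \<Longrightarrow> ssp (bilin_span K V W) (tensor_free K V W)"
  unfolding bilin_span_def using tensor_rels_sub ssp_span free_vs by (metis tensor_free_def)

lemma tensor_coset_bilin:
  assumes V: "vs_ok V" and W: "vs_ok W"
  shows "bilin V W (coset_space (tensor_free K V W) (bilin_span K V W))
     (\<lambda>v w. bilin_span K V W +>\<^bsub>tensor_free K V W\<^esub> free_gen K (v, w))"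
proof -
  let ?F = "tensor_free K V W" and ?N = "bilin_span K V W"
  note F = free_vs[of "carrier V \<times> carrier W", folded tensor_free_def]
  note N = tensor_span_ssp[OF V W]
  note c = coset_hom[OF N]
  have g: "free_gen K (v, w) \<in> carrier ?F" if "v \<in> carrier V" "w \<in> carrier W" for v w
    unfolding tensor_free_def using that by (intro free_gen_mem) auto
  have inN: "r \<in> ?N" if "r \<in> bilin_rels K V W" for r
    unfolding bilin_span_def using span_sup[OF F tensor_rels_sub[OF V W]] that by blast
  note rel = inN[unfolded bilin_rels_def Let_def]
  show ?thesis
  proof (rule bilinI; rule homI)
    fix w assume w: "w \<in> carrier W"
    show "?N +>\<^bsub>?F\<^esub> free_gen K (v, w) \<in> carrier (coset_space ?F ?N)" if "v \<in> carrier V" for v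
      using hom_closed[OF c g] that w by blast
    show "?N +>\<^bsub>?F\<^esub> free_gen K (u \<oplus>\<^bsub>V\<^esub> v, w) =
        (?N +>\<^bsub>?F\<^esub> free_gen K (u, w)) \<oplus>\<^bsub>coset_space ?F ?N\<^esub> (?N +>\<^bsub>?F\<^esub> free_gen K (v, w))"
      if uv: "u \<in> carrier V" "v \<in> carrier V" for u v
    proof -
      have "free_gen K (u \<oplus>\<^bsub>V\<^esub> v, w) \<ominus>\<^bsub>?F\<^esub> (free_gen K (u, w) \<oplus>\<^bsub>?F\<^esub> free_gen K (v, w)) \<in> ?N"
        using uv w by (intro rel) blast
      then show ?thesis using coset_eq[OF N] g uv w V F by (simp add: hom_add[OF c, symmetric])
    qed
    show "?N +>\<^bsub>?F\<^esub> free_gen K (k \<odot>\<^bsub>V\<^esub> v, w) = k \<odot>\<^bsub>coset_space ?F ?N\<^esub> (?N +>\<^bsub>?F\<^esub> free_gen K (v, w))"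
      if kv: "k \<in> carrier K" "v \<in> carrier V" for k v
    proof -
      have "free_gen K (k \<odot>\<^bsub>V\<^esub> v, w) \<ominus>\<^bsub>?F\<^esub> k \<odot>\<^bsub>?F\<^esub> free_gen K (v, w) \<in> ?N"
        using kv w by (intro rel) blast
      then show ?thesis using coset_eq[OF N] g kv w V F by (simp add: hom_smult[OF c, symmetric])
    qed
  next
    fix v assume v: "v \<in> carrier V"
    show "?N +>\<^bsub>?F\<^esub> free_gen K (v, w) \<in> carrier (coset_space ?F ?N)" if "w \<in> carrier W" for w
      using hom_closed[OF c g] that v by blast
    show "?N +>\<^bsub>?F\<^esub> free_gen K (v, u \<oplus>\<^bsub>W\<^esub> w) =
        (?N +>\<^bsub>?F\<^esub> free_gen K (v, u)) \<oplus>\<^bsub>coset_space ?F ?N\<^esub> (?N +>\<^bsub>?F\<^esub> free_gen K (v, w))"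
      if uw: "u \<in> carrier W" "w \<in> carrier W" for u w
    proof -
      have "free_gen K (v, u \<oplus>\<^bsub>W\<^esub> w) \<ominus>\<^bsub>?F\<^esub> (free_gen K (v, u) \<oplus>\<^bsub>?F\<^esub> free_gen K (v, w)) \<in> ?N"
        using uw v by (intro rel) blast
      then show ?thesis using coset_eq[OF N] g uw v W F by (simp add: hom_add[OF c, symmetric])
    qed
    show "?N +>\<^bsub>?F\<^esub> free_gen K (v, k \<odot>\<^bsub>W\<^esub> w) = k \<odot>\<^bsub>coset_space ?F ?N\<^esub> (?N +>\<^bsub>?F\<^esub> free_gen K (v, w))"
      if kw: "k \<in> carrier K" "w \<in> carrier W" for k w
    proof -
      have "free_gen K (v, k \<odot>\<^bsub>W\<^esub> w) \<ominus>\<^bsub>?F\<^esub> k \<odot>\<^bsub>?F\<^esub> free_gen K (v, w) \<in> ?N"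
        using kw v by (intro rel) blast
      then show ?thesis using coset_eq[OF N] g kw v W F by (simp add: hom_smult[OF c, symmetric])
    qed
  qed
qed

text \<open>
  The classes of \<open>a \<otimes> b\<close>, where \<open>a\<close> and \<open>b\<close> run through finite generating sets, generate: fix one factor
  and use that a subspace containing the generators of the other is everything.
\<close>

lemma tensor_coset_fd:
  assumes V: "fd_space K V" and W: "fd_space K W"
  shows "fd_space K (coset_space (tensor_free K V W) (bilin_span K V W))"
proof -
  let ?F = "tensor_free K V W" and ?N = "bilin_span K V W"
  let ?C = "coset_space ?F ?N"
  let ?d = "\<lambda>v w. ?N +>\<^bsub>?F\<^esub> free_gen K (v, w)"
  note vV = fd_vs[OF V] and vW = fd_vs[OF W]
  note F = free_vs[of "carrier V \<times> carrier W", folded tensor_free_def]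
  note N = tensor_span_ssp[OF vV vW]
  note C = coset_vs[OF N]
  note bl = tensor_coset_bilin[OF vV vW]
  obtain A where A: "finite A" "A \<subseteq> carrier V" "\<And>S. ssp S V \<Longrightarrow> A \<subseteq> S \<Longrightarrow> S = carrier V"
    using V unfolding fd_gens_iff by blast
  obtain B where B: "finite B" "B \<subseteq> carrier W" "\<And>S. ssp S W \<Longrightarrow> B \<subseteq> S \<Longrightarrow> S = carrier W"
    using W unfolding fd_gens_iff by blast
  let ?G = "(\<lambda>(v, w). ?d v w) ` (A \<times> B)"
  have "S = carrier ?C" if S: "ssp S ?C" "?G \<subseteq> S" for S
  proof -
    have 1: "?d v w \<in> S" if v: "v \<in> carrier V" and w: "w \<in> B" for v w
    proof -
      have w': "w \<in> carrier W" using w B(2) by blast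
      have "A \<subseteq> {v \<in> carrier V. ?d v w \<in> S}" using S(2) w A(2) by auto
      from A(3)[OF ssp_vimage[OF vV bilin_l[OF bl w'] S(1)] this] show ?thesis using v by blast
    qed
    have 2: "?d v w \<in> S" if v: "v \<in> carrier V" and w: "w \<in> carrier W" for v w
    proof -
      have "B \<subseteq> {w \<in> carrier W. ?d v w \<in> S}" using 1[OF v] B(2) by auto
      from B(3)[OF ssp_vimage[OF vW bilin_r[OF bl v] S(1)] this] show ?thesis using w by blast
    qed
    have "{p \<in> carrier ?F. ?N +>\<^bsub>?F\<^esub> p \<in> S} = carrier ?F"
      using ssp_vimage[OF F coset_hom[OF N] S(1)] unfolding tensor_free_def
    proof (rule free_generated)
      fix i assume "i \<in> carrier V \<times> carrier W"
      then show "free_gen K i \<in> {p \<in> carrier (free_space K (carrier V \<times> carrier W)).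
        bilin_span K V W +>\<^bsub>free_space K (carrier V \<times> carrier W)\<^esub> p \<in> S}"
        using 2 free_gen_mem[of i "carrier V \<times> carrier W"] unfolding tensor_free_def by auto
    qed
    then have "carrier ?C \<subseteq> S" unfolding coset_im[OF N, symmetric] by auto
    then show ?thesis using ssp_sub[OF S(1)] by auto
  qed
  moreover have "?G \<subseteq> carrier ?C" using A(2) B(2) bilin_closed[OF bl] by auto
  ultimately show ?thesis
    unfolding fd_gens_iff using C A(1) B(1) by (intro conjI exI[of _ ?G]) auto
qed

context
  fixes V W :: "('k, ('k, 's) univ) module"
  assumes V: "fd_space K V" and W: "fd_space K W"
begin

lemma tensor_fd: "fd_space K (tensor K V W)"
  unfolding tensor_def
  by (rule quot_fd'[OF tensor_span_ssp[OF fd_vs[OF V] fd_vs[OF W]] tensor_coset_fd[OF V W]])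

lemma pure_eq:
  assumes "v \<in> carrier V" "w \<in> carrier W"
  shows "pure_tensor K V W v w = embed (coset_space (tensor_free K V W) (bilin_span K V W))
     (bilin_span K V W +>\<^bsub>tensor_free K V W\<^esub> free_gen K (v, w))"
  using assms unfolding pure_tensor_def quot_proj_def tensor_free_def by (simp add: free_gen_mem)

lemma pure_bilin: "bilin V W (tensor K V W) (pure_tensor K V W)"
proof -
  let ?C = "coset_space (tensor_free K V W) (bilin_span K V W)"
  have e: "embed ?C \<in> module_hom K ?C (tensor K V W)"
    unfolding tensor_def quot_space_def by (rule embed_hom[OF tensor_coset_fd[OF V W]])
  note b = bilin_comp[OF tensor_coset_bilin[OF fd_vs[OF V] fd_vs[OF W]] id_hom id_hom e]
  show ?thesis
  proof (rule bilinI)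
    fix w assume w: "w \<in> carrier W"
    show "(\<lambda>v. pure_tensor K V W v w) \<in> module_hom K V (tensor K V W)"
      by (rule hom_cong[OF fd_vs[OF V] bilin_l[OF b w]]) (rule pure_eq[OF _ w])
  next
    fix v assume v: "v \<in> carrier V"
    show "pure_tensor K V W v \<in> module_hom K W (tensor K V W)"
      by (rule hom_cong[OF fd_vs[OF W] bilin_r[OF b v]]) (rule pure_eq[OF v])
  qed
qed

lemma tensor_proj_facts:
  shows tensor_proj_hom: "quot_proj (tensor_free K V W) (bilin_span K V W) \<in> module_hom K (tensor_free K V W) (tensor K V W)"
    and tensor_proj_im: "quot_proj (tensor_free K V W) (bilin_span K V W) ` carrier (tensor_free K V W) = carrier (tensor K V W)"
    and tensor_proj_zero: "p \<in> carrier (tensor_free K V W) \<Longrightarrow>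
      quot_proj (tensor_free K V W) (bilin_span K V W) p = \<zero>\<^bsub>tensor K V W\<^esub> \<longleftrightarrow> p \<in> bilin_span K V W"
  unfolding tensor_def
  using quot_facts[OF tensor_span_ssp[OF fd_vs[OF V] fd_vs[OF W]] tensor_coset_fd[OF V W]] by blast+

lemma pure_closed: "v \<in> carrier V \<Longrightarrow> w \<in> carrier W \<Longrightarrow> pure_tensor K V W v w \<in> carrier (tensor K V W)"
  by (rule bilin_closed[OF pure_bilin])

lemma tensor_generated:
  assumes S: "ssp S (tensor K V W)"
    and p: "\<And>v w. v \<in> carrier V \<Longrightarrow> w \<in> carrier W \<Longrightarrow> pure_tensor K V W v w \<in> S"
  shows "S = carrier (tensor K V W)"
proof -
  let ?F = "tensor_free K V W" and ?N = "bilin_span K V W"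
  let ?q = "quot_proj ?F ?N"
  note F = free_vs[of "carrier V \<times> carrier W", folded tensor_free_def]
  note N = tensor_span_ssp[OF fd_vs[OF V] fd_vs[OF W]]
  have "{p \<in> carrier ?F. ?q p \<in> S} = carrier ?F"
    using ssp_vimage[OF F tensor_proj_hom S] unfolding tensor_free_def
  proof (rule free_generated)
    fix i assume "i \<in> carrier V \<times> carrier W"
    then show "free_gen K i \<in> {p \<in> carrier (free_space K (carrier V \<times> carrier W)).
        quot_proj (free_space K (carrier V \<times> carrier W)) (bilin_span K V W) p \<in> S}"
      using p free_gen_mem[of i "carrier V \<times> carrier W"] unfolding tensor_free_def pure_tensor_def by auto
  qed
  then have "carrier (tensor K V W) \<subseteq> S" unfolding tensor_proj_im[symmetric] by auto
  then show ?thesis using ssp_sub[OF S] by auto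
qed

lemma tensor_ext:
  assumes U: "vs_ok U" and f: "f \<in> module_hom K (tensor K V W) U" and g: "g \<in> module_hom K (tensor K V W) U"
    and eq: "\<And>v w. v \<in> carrier V \<Longrightarrow> w \<in> carrier W \<Longrightarrow> f (pure_tensor K V W v w) = g (pure_tensor K V W v w)"
    and t: "t \<in> carrier (tensor K V W)"
  shows "f t = g t"
proof -
  have "{t \<in> carrier (tensor K V W). f t = g t} = carrier (tensor K V W)"
    by (rule tensor_generated[OF ssp_eq_hom[OF fd_vs[OF tensor_fd] U f g]]) (use eq pure_closed in auto)
  then show ?thesis using t by blast
qed

lemma tensor_lift_ex:
  assumes U: "vs_ok U" and b: "bilin V W U b"
  shows "\<exists>h. h \<in> lin K (tensor K V W) U \<and> (\<forall>v\<in>carrier V. \<forall>w\<in>carrier W. h (pure_tensor K V W v w) = b v w)"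
proof -
  let ?F = "tensor_free K V W" and ?N = "bilin_span K V W"
  note vV = fd_vs[OF V] and vW = fd_vs[OF W]
  note F = free_vs[of "carrier V \<times> carrier W", folded tensor_free_def]
  note N = tensor_span_ssp[OF vV vW]
  obtain h where h: "h \<in> module_hom K ?F U"
    "\<And>v w. v \<in> carrier V \<Longrightarrow> w \<in> carrier W \<Longrightarrow> h (free_gen K (v, w)) = b v w"
    using free_lift[OF U, of "carrier V \<times> carrier W" "\<lambda>(v, w). b v w"] bilin_closed[OF b]
    unfolding tensor_free_def by auto
  have g: "free_gen K (v, w) \<in> carrier ?F" if "v \<in> carrier V" "w \<in> carrier W" for v w
    unfolding tensor_free_def using that by (intro free_gen_mem) auto
  note [simp] = hom_minus[OF F U h(1)] hom_add[OF h(1)] hom_smult[OF h(1)] h(2) g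
    hom_add[OF bilin_l[OF b]] hom_add[OF bilin_r[OF b]] hom_smult[OF bilin_l[OF b]] hom_smult[OF bilin_r[OF b]]
    bilin_closed[OF b]
  have zz: "u \<ominus>\<^bsub>U\<^esub> u = \<zero>\<^bsub>U\<^esub>" if "u \<in> carrier U" for u using vs_minus_eq_zero[OF U that that] by simp
  have "bilin_rels K V W \<subseteq> {p \<in> carrier ?F. h p = \<zero>\<^bsub>U\<^esub>}"
  proof
    fix r assume r: "r \<in> bilin_rels K V W"
    then have "h r = \<zero>\<^bsub>U\<^esub>"
      unfolding bilin_rels_def Let_def using F U vV vW
      by (auto simp: zz)
    then show "r \<in> {p \<in> carrier ?F. h p = \<zero>\<^bsub>U\<^esub>}" using r tensor_rels_sub[OF vV vW] by blast
  qed
  then have "?N \<subseteq> {p \<in> carrier ?F. h p = \<zero>\<^bsub>U\<^esub>}"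
    unfolding bilin_span_def by (rule span_least[OF ssp_ker[OF F U h(1)]])
  then have "\<And>p. p \<in> carrier ?F \<Longrightarrow> quot_proj ?F ?N p = \<zero>\<^bsub>tensor K V W\<^esub> \<Longrightarrow> h p = \<zero>\<^bsub>U\<^esub>"
    using tensor_proj_zero by auto
  from hom_factor[OF F fd_vs[OF tensor_fd] U tensor_proj_hom tensor_proj_im h(1) this]
  obtain g where "g \<in> lin K (tensor K V W) U" "\<forall>p\<in>carrier ?F. g (quot_proj ?F ?N p) = h p" by auto
  then show ?thesis unfolding pure_tensor_def by (intro exI[of _ g]) auto
qed

end

text \<open>The linear map on \<open>V \<otimes> W\<close> induced by a bilinear map \<open>b\<close>.\<close>

definition tlift :: "('k, 'u) module \<Rightarrow> ('k, 'u) module \<Rightarrow> ('k, 't, 'q) module_scheme \<Rightarrow> ('u \<Rightarrow> 'u \<Rightarrow> 't) \<Rightarrow> 'u \<Rightarrow> 't" where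
  "tlift V W U b = (THE h. h \<in> module_hom K (tensor K V W) U \<inter> extensional (carrier (tensor K V W)) \<and>
     (\<forall>v\<in>carrier V. \<forall>w\<in>carrier W. h (pure_tensor K V W v w) = b v w))"

context
  fixes V W :: "('k, ('k, 's) univ) module" and U :: "('k, 't) module" and b
  assumes V: "fd_space K V" and W: "fd_space K W" and U: "vs_ok U" and b: "bilin V W U b"
begin

lemma tlift_unique:
  "\<exists>!h. h \<in> lin K (tensor K V W) U \<and> (\<forall>v\<in>carrier V. \<forall>w\<in>carrier W. h (pure_tensor K V W v w) = b v w)"
proof (rule ex_ex1I[OF tensor_lift_ex[OF V W U b]])
  fix f g assume f: "f \<in> lin K (tensor K V W) U \<and> (\<forall>v\<in>carrier V. \<forall>w\<in>carrier W. f (pure_tensor K V W v w) = b v w)"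
    and g: "g \<in> lin K (tensor K V W) U \<and> (\<forall>v\<in>carrier V. \<forall>w\<in>carrier W. g (pure_tensor K V W v w) = b v w)"
  have f': "f \<in> lin K (tensor K V W) U" and g': "g \<in> lin K (tensor K V W) U" using f g by auto
  show "f = g"
    by (rule lin_ext[OF f' g'], rule tensor_ext[OF V W U lin_hom[OF f'] lin_hom[OF g']]) (use f g in auto)
qed

lemma tlift: "tlift V W U b \<in> lin K (tensor K V W) U \<and>
    (\<forall>v\<in>carrier V. \<forall>w\<in>carrier W. tlift V W U b (pure_tensor K V W v w) = b v w)"
  unfolding tlift_def lin_def[symmetric] by (rule theI'[OF tlift_unique])

lemma tlift_lin: "tlift V W U b \<in> lin K (tensor K V W) U"
  and tlift_hom: "tlift V W U b \<in> module_hom K (tensor K V W) U"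
  and tlift_pure: "v \<in> carrier V \<Longrightarrow> w \<in> carrier W \<Longrightarrow> tlift V W U b (pure_tensor K V W v w) = b v w"
  using tlift lin_hom by auto

end

lemma tensor_map_tlift: "tensor_map K V V' W W' f g =
    tlift V W (tensor K V' W') (\<lambda>v w. pure_tensor K V' W' (f v) (g w))"
  unfolding tensor_map_def tlift_def lin_def ..

lemma tensor_braid_tlift: "tensor_braid K V W = tlift V W (tensor K W V) (\<lambda>v w. pure_tensor K W V w v)"
  unfolding tensor_braid_def tlift_def lin_def ..

context
  fixes V W V' W' :: "('k, ('k, 's) univ) module"
  assumes V: "fd_space K V" and W: "fd_space K W" and V': "fd_space K V'" and W': "fd_space K W'"
begin

lemma tensor_map_bilin:
  assumes f: "f \<in> module_hom K V V'" and g: "g \<in> module_hom K W W'"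
  shows "bilin V W (tensor K V' W') (\<lambda>v w. pure_tensor K V' W' (f v) (g w))"
  using bilin_comp[OF pure_bilin[OF V' W'] f g id_hom] .

lemma tensor_map_facts:
  assumes f: "f \<in> module_hom K V V'" and g: "g \<in> module_hom K W W'"
  shows tensor_map_lin: "tensor_map K V V' W W' f g \<in> lin K (tensor K V W) (tensor K V' W')"
    and tensor_map_hom: "tensor_map K V V' W W' f g \<in> module_hom K (tensor K V W) (tensor K V' W')"
    and tensor_map_pure: "v \<in> carrier V \<Longrightarrow> w \<in> carrier W \<Longrightarrow>
      tensor_map K V V' W W' f g (pure_tensor K V W v w) = pure_tensor K V' W' (f v) (g w)"
  unfolding tensor_map_tlift
  using tlift_lin[OF V W fd_vs[OF tensor_fd[OF V' W']] tensor_map_bilin[OF f g]]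
    tlift_hom[OF V W fd_vs[OF tensor_fd[OF V' W']] tensor_map_bilin[OF f g]]
    tlift_pure[OF V W fd_vs[OF tensor_fd[OF V' W']] tensor_map_bilin[OF f g]] by auto

end

lemma left_inverse:
  fixes V V' :: "('k, ('k, 's) univ) module"
  assumes V: "vs_ok V" and V': "fd_space K V'" and f: "f \<in> module_hom K V V'" and i: "inj_on f (carrier V)"
  shows "\<exists>g. g \<in> module_hom K V' V \<and> (\<forall>v\<in>carrier V. g (f v) = v)"
proof -
  let ?N = "f ` carrier V"
  note N = ssp_image[OF ssp_full[OF V] f fd_vs[OF V']]
  let ?g = "inv_into (carrier V) f"
  have gf: "?g (f v) = v" if "v \<in> carrier V" for v using i that by (rule inv_into_f_f)
  have "?g \<in> module_hom K (V'\<lparr>carrier := ?N\<rparr>) V"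
    by (rule homI) (auto simp: gf hom_add[OF f, symmetric] hom_smult[OF f, symmetric] V)
  from hom_extend[OF V' N this] show ?thesis using gf by auto
qed

text \<open>The tensor product of injective maps has a left inverse, the tensor product of left inverses.\<close>

lemma tensor_map_inj:
  fixes V W V' W' :: "('k, ('k, 's) univ) module"
  assumes V: "fd_space K V" and W: "fd_space K W" and V': "fd_space K V'" and W': "fd_space K W'"
    and f: "f \<in> module_hom K V V'" and g: "g \<in> module_hom K W W'"
    and fi: "inj_on f (carrier V)" and gi: "inj_on g (carrier W)"
  shows "inj_on (tensor_map K V V' W W' f g) (carrier (tensor K V W))"
proof -
  obtain f' where f': "f' \<in> module_hom K V' V" "\<forall>v\<in>carrier V. f' (f v) = v"
    using left_inverse[OF fd_vs[OF V] V' f fi] by blast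
  obtain g' where g': "g' \<in> module_hom K W' W" "\<forall>v\<in>carrier W. g' (g v) = v"
    using left_inverse[OF fd_vs[OF W] W' g gi] by blast
  let ?h = "tensor_map K V V' W W' f g" and ?h' = "tensor_map K V' V W' W f' g'"
  have "?h' (?h t) = t" if t: "t \<in> carrier (tensor K V W)" for t
    using hom_comp[OF tensor_map_hom[OF V W V' W' f g] tensor_map_hom[OF V' W' V W f'(1) g'(1)]] id_hom _ t
  proof (rule tensor_ext[OF V W fd_vs[OF tensor_fd[OF V W]]])
    fix v w assume "v \<in> carrier V" "w \<in> carrier W"
    then show "?h' (?h (pure_tensor K V W v w)) = pure_tensor K V W v w"
      using f' g' hom_closed[OF f] hom_closed[OF g]
      by (simp add: tensor_map_pure[OF V W V' W' f g] tensor_map_pure[OF V' W' V W f'(1) g'(1)])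
  qed
  then show ?thesis by (rule inj_on_inverseI)
qed

lemma tensor_braid_facts:
  fixes V W :: "('k, ('k, 's) univ) module"
  assumes V: "fd_space K V" and W: "fd_space K W"
  shows tensor_braid_lin: "tensor_braid K V W \<in> lin K (tensor K V W) (tensor K W V)"
    and tensor_braid_pure: "v \<in> carrier V \<Longrightarrow> w \<in> carrier W \<Longrightarrow>
      tensor_braid K V W (pure_tensor K V W v w) = pure_tensor K W V w v"
proof -
  have b: "bilin V W (tensor K W V) (\<lambda>v w. pure_tensor K W V w v)"
    using bilin_l[OF pure_bilin[OF W V]] bilin_r[OF pure_bilin[OF W V]] by (intro bilinI) auto
  show "tensor_braid K V W \<in> lin K (tensor K V W) (tensor K W V)"
    "v \<in> carrier V \<Longrightarrow> w \<in> carrier W \<Longrightarrow> tensor_braid K V W (pure_tensor K V W v w) = pure_tensor K W V w v"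
    unfolding tensor_braid_tlift
    using tlift_lin[OF V W fd_vs[OF tensor_fd[OF W V]] b] tlift_pure[OF V W fd_vs[OF tensor_fd[OF W V]] b]
    by auto
qed

lemma tensor3_ext:
  fixes X Y Z :: "('k, ('k, 's) univ) module"
  assumes X: "fd_space K X" and Y: "fd_space K Y" and Z: "fd_space K Z" and U: "vs_ok U"
    and f: "f \<in> module_hom K (tensor K X (tensor K Y Z)) U" and g: "g \<in> module_hom K (tensor K X (tensor K Y Z)) U"
    and eq: "\<And>x y z. x \<in> carrier X \<Longrightarrow> y \<in> carrier Y \<Longrightarrow> z \<in> carrier Z \<Longrightarrow>
      f (pure_tensor K X (tensor K Y Z) x (pure_tensor K Y Z y z)) =
      g (pure_tensor K X (tensor K Y Z) x (pure_tensor K Y Z y z))"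
    and t: "t \<in> carrier (tensor K X (tensor K Y Z))"
  shows "f t = g t"
  using X tensor_fd[OF Y Z] U f g _ t
proof (rule tensor_ext)
  fix x s assume x: "x \<in> carrier X" and s: "s \<in> carrier (tensor K Y Z)"
  note p = bilin_r[OF pure_bilin[OF X tensor_fd[OF Y Z]] x]
  show "f (pure_tensor K X (tensor K Y Z) x s) = g (pure_tensor K X (tensor K Y Z) x s)"
    using hom_comp[OF p f] hom_comp[OF p g] eq[OF x] s by (rule tensor_ext[OF Y Z U])
qed

lemma tensor_assoc_facts:
  fixes X Y Z :: "('k, ('k, 's) univ) module"
  assumes X: "fd_space K X" and Y: "fd_space K Y" and Z: "fd_space K Z"
  shows tensor_assoc_lin: "tensor_assoc K X Y Z \<in> lin K (tensor K X (tensor K Y Z)) (tensor K (tensor K X Y) Z)"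
    and tensor_assoc_pure: "x \<in> carrier X \<Longrightarrow> y \<in> carrier Y \<Longrightarrow> z \<in> carrier Z \<Longrightarrow>
      tensor_assoc K X Y Z (pure_tensor K X (tensor K Y Z) x (pure_tensor K Y Z y z)) =
      pure_tensor K (tensor K X Y) Z (pure_tensor K X Y x y) z"
proof -
  note YZ = tensor_fd[OF Y Z] and XY = tensor_fd[OF X Y]
  note T = fd_vs[OF tensor_fd[OF XY Z]]
  note pb = pure_bilin[OF XY Z] and pb' = pure_bilin[OF X Y]
  let ?T = "tensor K (tensor K X Y) Z"
  let ?b = "\<lambda>x y z. pure_tensor K (tensor K X Y) Z (pure_tensor K X Y x y) z"
  have b: "bilin Y Z ?T (?b x)" if x: "x \<in> carrier X" for x
    using bilin_comp[OF pb bilin_r[OF pb' x] id_hom id_hom] .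
  let ?c = "\<lambda>x. tlift Y Z ?T (?b x)"
  note ch = tlift_hom[OF Y Z T b] and cp = tlift_pure[OF Y Z T b]
  have lx: "(\<lambda>x. ?b x y z) \<in> module_hom K X ?T" if "y \<in> carrier Y" "z \<in> carrier Z" for y z
    using hom_comp[OF bilin_l[OF pb' that(1)] bilin_l[OF pb that(2)]] .
  note vX = fd_vs[OF X] and vYZ = fd_vs[OF YZ]
  have bil: "bilin X (tensor K Y Z) ?T ?c"
  proof (rule bilinI)
    show "?c x \<in> module_hom K (tensor K Y Z) ?T" if "x \<in> carrier X" for x by (rule ch[OF that])
  next
    fix s assume s: "s \<in> carrier (tensor K Y Z)"
    show "(\<lambda>x. ?c x s) \<in> module_hom K X ?T"
    proof (rule homI)
      fix x assume x: "x \<in> carrier X"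
      show "?c x s \<in> carrier ?T" using hom_closed[OF ch[OF x] s] .
      fix x' assume x': "x' \<in> carrier X"
      have xx: "x \<oplus>\<^bsub>X\<^esub> x' \<in> carrier X" using x x' vX by simp
      show "?c (x \<oplus>\<^bsub>X\<^esub> x') s = ?c x s \<oplus>\<^bsub>?T\<^esub> ?c x' s"
        by (rule tensor_ext[OF Y Z T ch[OF xx] hom_plus[OF vYZ T ch[OF x] ch[OF x']] _ s])
          (simp add: cp x x' xx hom_add[OF lx])
    next
      fix k x assume k: "k \<in> carrier K" and x: "x \<in> carrier X"
      have kx: "k \<odot>\<^bsub>X\<^esub> x \<in> carrier X" using k x vX by simp
      show "?c (k \<odot>\<^bsub>X\<^esub> x) s = k \<odot>\<^bsub>?T\<^esub> ?c x s"
        by (rule tensor_ext[OF Y Z T ch[OF kx] hom_scale[OF vYZ T ch[OF x] k] _ s])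
          (simp add: cp k x kx hom_smult[OF lx])
    qed
  qed
  define P where "P h \<longleftrightarrow> h \<in> lin K (tensor K X (tensor K Y Z)) ?T \<and>
       (\<forall>x\<in>carrier X. \<forall>y\<in>carrier Y. \<forall>z\<in>carrier Z.
          h (pure_tensor K X (tensor K Y Z) x (pure_tensor K Y Z y z)) = ?b x y z)" for h
  have "P (tlift X (tensor K Y Z) ?T ?c)"
    unfolding P_def using tlift_lin[OF X YZ T bil] tlift_pure[OF X YZ T bil] pure_closed[OF Y Z] cp by auto
  then have ex: "\<exists>h. P h" by blast
  have uq: "h = h'" if h: "P h" and h': "P h'" for h h'
  proof -
    have l: "h \<in> lin K (tensor K X (tensor K Y Z)) ?T" "h' \<in> lin K (tensor K X (tensor K Y Z)) ?T"
      using h h' unfolding P_def by auto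
    show ?thesis
      by (rule lin_ext[OF l], rule tensor3_ext[OF X Y Z T lin_hom[OF l(1)] lin_hom[OF l(2)]]) (use h h' in \<open>auto simp: P_def\<close>)
  qed
  have "\<exists>!h. P h" by (rule ex_ex1I[OF ex uq])
  then have "P (tensor_assoc K X Y Z)" unfolding tensor_assoc_def P_def[symmetric] by (rule theI')
  then show "tensor_assoc K X Y Z \<in> lin K (tensor K X (tensor K Y Z)) ?T"
    "x \<in> carrier X \<Longrightarrow> y \<in> carrier Y \<Longrightarrow> z \<in> carrier Z \<Longrightarrow>
      tensor_assoc K X Y Z (pure_tensor K X (tensor K Y Z) x (pure_tensor K Y Z y z)) = ?b x y z"
    unfolding P_def by auto
qed

end

section \<open>Representations and the global tensor functor\<close>

context base
begin

text \<open>The map between quotients that a linear map induces.\<close>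

lemma quot_map:
  fixes V W :: "('k, ('k, 's) univ) module"
  assumes V: "fd_space K V" and W: "fd_space K W" and N: "ssp N V" and M: "ssp M W"
    and f: "f \<in> module_hom K V W" and fN: "\<And>v. v \<in> N \<Longrightarrow> f v \<in> M"
    and h: "h = (THE h. h \<in> lin K (quot_space V N) (quot_space W M) \<and>
      (\<forall>v\<in>carrier V. h (quot_proj V N v) = quot_proj W M (f v)))"
  shows "h \<in> lin K (quot_space V N :: ('k, ('k, 's) univ) module) (quot_space W M)"
    and "\<And>v. v \<in> carrier V \<Longrightarrow> h (quot_proj V N v) = (quot_proj W M (f v) :: ('k, 's) univ)"
proof -
  let ?QV = "quot_space V N :: ('k, ('k, 's) univ) module" and ?QW = "quot_space W M :: ('k, ('k, 's) univ) module"
  let ?p = "quot_proj V N :: _ \<Rightarrow> ('k, 's) univ" and ?q = "quot_proj W M :: _ \<Rightarrow> ('k, 's) univ"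
  define P where "P h \<longleftrightarrow> h \<in> lin K ?QV ?QW \<and> (\<forall>v\<in>carrier V. h (?p v) = ?q (f v))" for h
  note p = quot_hom[OF N V] quot_im[OF N V]
  note QV = fd_vs[OF quot_fd[OF N V]] and QW = fd_vs[OF quot_fd[OF M W]]
  have "?q (f v) = \<zero>\<^bsub>?QW\<^esub>" if "v \<in> carrier V" "?p v = \<zero>\<^bsub>?QV\<^esub>" for v
    using that quot_zero[OF N V] quot_zero[OF M W] fN hom_closed[OF f] by blast
  from hom_factor[OF fd_vs[OF V] QV QW p hom_comp[OF f quot_hom[OF M W]] this]
  obtain g where g: "P g" unfolding P_def by blast
  have uq: "g = g'" if g: "P g" and g': "P g'" for g g'
  proof -
    have l: "g \<in> lin K ?QV ?QW" "g' \<in> lin K ?QV ?QW" using g g' unfolding P_def by auto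
    show ?thesis
    proof (rule lin_ext[OF l])
      fix u assume "u \<in> carrier ?QV"
      then obtain v where "v \<in> carrier V" "u = ?p v" unfolding p(2)[symmetric] by blast
      then show "g u = g' u" using g g' unfolding P_def by simp
    qed
  qed
  have "\<exists>!h. P h" using g uq by (intro ex_ex1I) blast+
  then have "P h" unfolding h P_def[symmetric] by (rule theI')
  then show "h \<in> lin K ?QV ?QW" "\<And>v. v \<in> carrier V \<Longrightarrow> h (?p v) = ?q (f v)"
    unfolding P_def by auto
qed

end

text \<open>
  Only the incidence axioms are needed for most of the theory; finiteness and connectedness of the
  quiver are assumed where they are used.
\<close>

locale quiver = base K for K :: "('k, 'z) ring_scheme" (structure) +
  fixes Q :: "('v, 'a) pre_digraph"
  assumes wfQ: "wf_digraph Q"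
begin

abbreviation rep :: "('k, 'u, 'v, 'a) quiver_rep \<Rightarrow> bool" where
  "rep V \<equiv> is_rep K Q V"

lemma tail_v [simp]: "a \<in> arcs Q \<Longrightarrow> tail Q a \<in> verts Q"
  and head_v [simp]: "a \<in> arcs Q \<Longrightarrow> head Q a \<in> verts Q"
  using wfQ by (simp_all add: wf_digraph.tail_in_verts wf_digraph.head_in_verts)

lemma rep_fd: "rep V \<Longrightarrow> x \<in> verts Q \<Longrightarrow> fd_space K (vsp V x)"
  by (simp add: is_rep_def)

lemma rep_vs: "rep V \<Longrightarrow> x \<in> verts Q \<Longrightarrow> vs_ok (vsp V x)"
  by (simp add: rep_fd fd_vs)

lemma rep_lin: "rep V \<Longrightarrow> a \<in> arcs Q \<Longrightarrow> amap V a \<in> lin K (vsp V (tail Q a)) (vsp V (head Q a))"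
  by (simp add: is_rep_def)

lemma rep_mhom: "rep V \<Longrightarrow> a \<in> arcs Q \<Longrightarrow> amap V a \<in> module_hom K (vsp V (tail Q a)) (vsp V (head Q a))"
  using rep_lin lin_hom by blast

lemma rhom_lin: "f \<in> rep_hom K Q V W \<Longrightarrow> x \<in> verts Q \<Longrightarrow> f x \<in> lin K (vsp V x) (vsp W x)"
  by (simp add: rep_hom_def)

lemma rhom_mhom: "f \<in> rep_hom K Q V W \<Longrightarrow> x \<in> verts Q \<Longrightarrow> f x \<in> module_hom K (vsp V x) (vsp W x)"
  using rhom_lin lin_hom by blast

lemma rhom_arr: "f \<in> rep_hom K Q V W \<Longrightarrow> a \<in> arcs Q \<Longrightarrow> v \<in> carrier (vsp V (tail Q a)) \<Longrightarrow>
    f (head Q a) (amap V a v) = amap W a (f (tail Q a) v)"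
  by (simp add: rep_hom_def)

lemma rhomI:
  assumes "\<And>x. x \<in> verts Q \<Longrightarrow> f x \<in> lin K (vsp V x) (vsp W x)"
    and "\<And>a v. a \<in> arcs Q \<Longrightarrow> v \<in> carrier (vsp V (tail Q a)) \<Longrightarrow>
      f (head Q a) (amap V a v) = amap W a (f (tail Q a) v)"
    and "\<And>x. x \<notin> verts Q \<Longrightarrow> f x = undefined"
  shows "f \<in> rep_hom K Q V W"
  using assms by (auto simp: rep_hom_def extensional_def)

subsection \<open>Epimorphic and saturated subrepresentations\<close>

text \<open>
  The two closure conditions behind \<open>E(V)\<close> and \<open>M(V)\<close>.  A subrepresentation \<open>N\<close> is epimorphic if
  \<open>V\<^sub>a N\<^sub>t\<^sub>a = N\<^sub>h\<^sub>a\<close> for all arrows; it is saturated if the preimage of \<open>N\<^sub>h\<^sub>a\<close> is \<open>N\<^sub>t\<^sub>a\<close>, that is, if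
  \<open>V / N\<close> is monomorphic.  The largest epimorphic subrepresentation is \<open>epi V\<close> and the smallest
  saturated one is \<open>mker V\<close>, the kernel of \<open>V \<rightarrow> M(V)\<close>.
\<close>

definition episub :: "('k, 'u, 'v, 'a) quiver_rep \<Rightarrow> ('v \<Rightarrow> 'u set) \<Rightarrow> bool" where
  "episub V N \<longleftrightarrow> subrep K Q V N \<and> (\<forall>a\<in>arcs Q. amap V a ` N (tail Q a) = N (head Q a))"

definition satsub :: "('k, 'u, 'v, 'a) quiver_rep \<Rightarrow> ('v \<Rightarrow> 'u set) \<Rightarrow> bool" where
  "satsub V N \<longleftrightarrow> subrep K Q V N \<and>
     (\<forall>a\<in>arcs Q. \<forall>v\<in>carrier (vsp V (tail Q a)). amap V a v \<in> N (head Q a) \<longrightarrow> v \<in> N (tail Q a))"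

abbreviation epi :: "('k, 'u, 'v, 'a) quiver_rep \<Rightarrow> 'v \<Rightarrow> 'u set" where "epi \<equiv> epi_part K Q"
abbreviation mker :: "('k, 'u, 'v, 'a) quiver_rep \<Rightarrow> 'v \<Rightarrow> 'u set" where "mker \<equiv> mono_ker K Q"

lemma subrep_ssp: "subrep K Q V N \<Longrightarrow> x \<in> verts Q \<Longrightarrow> ssp (N x) (vsp V x)"
  by (simp add: subrep_def)

lemma subrep_arr: "subrep K Q V N \<Longrightarrow> a \<in> arcs Q \<Longrightarrow> v \<in> N (tail Q a) \<Longrightarrow> amap V a v \<in> N (head Q a)"
  by (auto simp: subrep_def)

lemma subrepI:
  assumes "\<And>x. x \<in> verts Q \<Longrightarrow> ssp (N x) (vsp V x)"
    and "\<And>a v. a \<in> arcs Q \<Longrightarrow> v \<in> N (tail Q a) \<Longrightarrow> amap V a v \<in> N (head Q a)"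
  shows "subrep K Q V N"
  using assms by (auto simp: subrep_def)

lemma episub_subrep: "episub V N \<Longrightarrow> subrep K Q V N"
  and satsub_subrep: "satsub V N \<Longrightarrow> subrep K Q V N"
  by (simp_all add: episub_def satsub_def)

lemma episub_surj:
  assumes "episub V N" "a \<in> arcs Q" "w \<in> N (head Q a)" obtains v where "v \<in> N (tail Q a)" "w = amap V a v"
  using assms by (auto simp: episub_def)

lemma satsubD:
  "satsub V N \<Longrightarrow> a \<in> arcs Q \<Longrightarrow> v \<in> carrier (vsp V (tail Q a)) \<Longrightarrow> amap V a v \<in> N (head Q a) \<Longrightarrow> v \<in> N (tail Q a)"
  by (simp add: satsub_def)

lemma episubI:
  assumes "\<And>x. x \<in> verts Q \<Longrightarrow> ssp (N x) (vsp V x)"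
    and "\<And>a v. a \<in> arcs Q \<Longrightarrow> v \<in> N (tail Q a) \<Longrightarrow> amap V a v \<in> N (head Q a)"
    and "\<And>a w. a \<in> arcs Q \<Longrightarrow> w \<in> N (head Q a) \<Longrightarrow> \<exists>v\<in>N (tail Q a). w = amap V a v"
  shows "episub V N"
  unfolding episub_def using assms subrepI[of N V] by (auto simp: image_iff)

lemma satsubI:
  assumes "\<And>x. x \<in> verts Q \<Longrightarrow> ssp (N x) (vsp V x)"
    and "\<And>a v. a \<in> arcs Q \<Longrightarrow> v \<in> N (tail Q a) \<Longrightarrow> amap V a v \<in> N (head Q a)"
    and "\<And>a v. a \<in> arcs Q \<Longrightarrow> v \<in> carrier (vsp V (tail Q a)) \<Longrightarrow> amap V a v \<in> N (head Q a) \<Longrightarrow> v \<in> N (tail Q a)"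
  shows "satsub V N"
  unfolding satsub_def using assms subrepI[of N V] by auto

lemma episub_iff: "episub V N \<longleftrightarrow> subrep K Q V N \<and> epimorphic Q (sub_rep Q V N)"
  by (auto simp: episub_def epimorphic_def sub_rep_def)

text \<open>The arrow maps of \<open>V / N\<close> are injective iff \<open>N\<close> is saturated.\<close>

lemma satsub_iff:
  fixes V :: "('k, ('k, 's) univ, 'v, 'a) quiver_rep"
  assumes V: "rep V"
  shows "satsub V N \<longleftrightarrow> subrep K Q V N \<and> monomorphic Q (quot_rep K Q V N)"
proof (cases "subrep K Q V N")
  case N: True
  have "inj_on (amap (quot_rep K Q V N) a) (carrier (vsp (quot_rep K Q V N) (tail Q a))) \<longleftrightarrow>
    (\<forall>v\<in>carrier (vsp V (tail Q a)). amap V a v \<in> N (head Q a) \<longrightarrow> v \<in> N (tail Q a))" if a: "a \<in> arcs Q" for a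
  proof -
    let ?t = "tail Q a" and ?h = "head Q a"
    note T = rep_fd[OF V tail_v[OF a]] and H = rep_fd[OF V head_v[OF a]]
    note nt = subrep_ssp[OF N tail_v[OF a]] and nh = subrep_ssp[OF N head_v[OF a]]
    let ?m = "amap (quot_rep K Q V N) a"
    let ?QT = "quot_space (vsp V ?t) (N ?t) :: ('k, ('k, 's) univ) module"
    let ?QH = "quot_space (vsp V ?h) (N ?h) :: ('k, ('k, 's) univ) module"
    have m: "?m = (THE h. h \<in> lin K (quot_space (vsp V ?t) (N ?t)) (quot_space (vsp V ?h) (N ?h)) \<and>
       (\<forall>v\<in>carrier (vsp V ?t). h (quot_proj (vsp V ?t) (N ?t) v) = quot_proj (vsp V ?h) (N ?h) (amap V a v)))"
      by (simp add: quot_rep_def)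
    note q = quot_map[OF T H nt nh rep_mhom[OF V a] subrep_arr[OF N a] m]
    have "inj_on ?m (carrier ?QT) \<longleftrightarrow> (\<forall>u\<in>carrier ?QT. ?m u = \<zero>\<^bsub>?QH\<^esub> \<longrightarrow> u = \<zero>\<^bsub>?QT\<^esub>)"
      by (rule inj_hom_iff[OF fd_vs[OF quot_fd[OF nt T]] fd_vs[OF quot_fd[OF nh H]] lin_hom[OF q(1)]])
    also have "\<dots> \<longleftrightarrow> (\<forall>v\<in>carrier (vsp V ?t). amap V a v \<in> N ?h \<longrightarrow> v \<in> N ?t)"
      unfolding quot_im[OF nt T, symmetric]
      by (simp add: q(2) quot_zero[OF nt T] quot_zero[OF nh H] hom_closed[OF rep_mhom[OF V a]])
    finally show ?thesis by (simp add: quot_rep_def)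
  qed
  then show ?thesis using N by (simp add: satsub_def monomorphic_def)
qed (simp add: satsub_def)

context
  fixes V :: "('k, ('k, 's) univ, 'v, 'a) quiver_rep"
  assumes V: "rep V"
begin

lemma epi_sub_aux: "x \<in> verts Q \<Longrightarrow> \<Union>{N x | N. episub V N} \<subseteq> carrier (vsp V x)"
  using ssp_sub[OF subrep_ssp[OF episub_subrep]] by blast

lemma epi_def': "epi V x = vspan (vsp V x) (\<Union>{N x | N. episub V N})"
  by (simp add: epi_part_def episub_iff)

lemma epi_upper: "episub V N \<Longrightarrow> x \<in> verts Q \<Longrightarrow> N x \<subseteq> epi V x"
  unfolding epi_def' using span_sup[OF rep_vs[OF V] epi_sub_aux] by blast

lemma episub_epi: "episub V (epi V)"
proof (rule episubI)
  show s: "ssp (epi V x) (vsp V x)" if "x \<in> verts Q" for x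
    unfolding epi_def' using ssp_span[OF rep_vs[OF V that] epi_sub_aux[OF that]] .
  fix a assume a: "a \<in> arcs Q"
  let ?t = "tail Q a" and ?h = "head Q a"
  note f = rep_mhom[OF V a]
  note T = rep_vs[OF V tail_v[OF a]] and H = rep_vs[OF V head_v[OF a]]
  have "epi V ?t \<subseteq> {v \<in> carrier (vsp V ?t). amap V a v \<in> epi V ?h}"
    unfolding epi_def'[of ?t]
  proof (rule span_least[OF ssp_vimage[OF T f s[OF head_v[OF a]]]], safe)
    fix v N assume N: "episub V N" "v \<in> N ?t"
    then show "v \<in> carrier (vsp V ?t)" using epi_sub_aux[OF tail_v[OF a]] by blast
    show "amap V a v \<in> epi V ?h"
      using subrep_arr[OF episub_subrep[OF N(1)] a N(2)] epi_upper[OF N(1) head_v[OF a]] by blast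
  qed
  then show "v \<in> epi V ?t \<Longrightarrow> amap V a v \<in> epi V ?h" for v by blast
  have "epi V ?h \<subseteq> amap V a ` epi V ?t"
    unfolding epi_def'[of ?h]
  proof (rule span_least[OF ssp_image[OF s[OF tail_v[OF a]] f H]], safe)
    fix w N assume N: "episub V N" "w \<in> N ?h"
    show "w \<in> amap V a ` epi V ?t"
    proof -
      from episub_surj[OF N(1) a N(2)] obtain v where "v \<in> N ?t" "w = amap V a v" .
      then show ?thesis using epi_upper[OF N(1) tail_v[OF a]] by auto
    qed
  qed
  then show "w \<in> epi V ?h \<Longrightarrow> \<exists>v\<in>epi V ?t. w = amap V a v" for w by blast
qed

lemma mker_def': "mker V x = \<Inter>{N x | N. satsub V N}"
  by (simp add: mono_ker_def satsub_iff[OF V])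

lemma mker_iff: "v \<in> mker V x \<longleftrightarrow> (\<forall>N. satsub V N \<longrightarrow> v \<in> N x)"
  by (auto simp: mker_def')

lemma mker_lower: "satsub V N \<Longrightarrow> mker V x \<subseteq> N x"
  unfolding mker_def' by blast

lemma satsub_full: "satsub V (\<lambda>x. carrier (vsp V x))"
  using ssp_full rep_vs[OF V] hom_closed[OF rep_mhom[OF V]] by (intro satsubI) auto

lemma satsub_mker: "satsub V (mker V)"
proof (rule satsubI)
  show "ssp (mker V x) (vsp V x)" if x: "x \<in> verts Q" for x
    unfolding mker_def'
    by (rule ssp_Inter[OF rep_vs[OF V x]]) (use subrep_ssp[OF satsub_subrep x] satsub_full in auto)
  fix a assume a: "a \<in> arcs Q"
  show "v \<in> mker V (tail Q a) \<Longrightarrow> amap V a v \<in> mker V (head Q a)" for v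
    unfolding mker_iff using subrep_arr[OF satsub_subrep a] by metis
  show "v \<in> mker V (tail Q a)" if "v \<in> carrier (vsp V (tail Q a))" "amap V a v \<in> mker V (head Q a)" for v
    using that satsubD[OF _ a that(1)] unfolding mker_iff by metis
qed

lemma epi_ssp: "x \<in> verts Q \<Longrightarrow> ssp (epi V x) (vsp V x)"
  using subrep_ssp[OF episub_subrep[OF episub_epi]] .

lemma epi_mem: "x \<in> verts Q \<Longrightarrow> v \<in> epi V x \<Longrightarrow> v \<in> carrier (vsp V x)"
  using ssp_mem[OF epi_ssp] .

lemma mker_ssp: "x \<in> verts Q \<Longrightarrow> ssp (mker V x) (vsp V x)"
  using subrep_ssp[OF satsub_subrep[OF satsub_mker]] .

lemma mker_mem: "x \<in> verts Q \<Longrightarrow> v \<in> mker V x \<Longrightarrow> v \<in> carrier (vsp V x)"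
  using ssp_mem[OF mker_ssp] .

lemma epi_arr: "a \<in> arcs Q \<Longrightarrow> v \<in> epi V (tail Q a) \<Longrightarrow> amap V a v \<in> epi V (head Q a)"
  using subrep_arr[OF episub_subrep[OF episub_epi]] .

end

context
  fixes V W :: "('k, ('k, 's) univ, 'v, 'a) quiver_rep" and f
  assumes V: "rep V" and W: "rep W" and f: "f \<in> rep_hom K Q V W"
begin

lemma episub_image:
  assumes N: "episub V N" shows "episub W (\<lambda>x. f x ` N x)"
proof (rule episubI)
  note sN = subrep_ssp[OF episub_subrep[OF N]]
  show "ssp (f x ` N x) (vsp W x)" if "x \<in> verts Q" for x
    using ssp_image[OF sN[OF that] rhom_mhom[OF f that] rep_vs[OF W that]] .
  fix a assume a: "a \<in> arcs Q"
  note eq = rhom_arr[OF f a ssp_mem[OF sN[OF tail_v[OF a]]]]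
  show "w \<in> f (tail Q a) ` N (tail Q a) \<Longrightarrow> amap W a w \<in> f (head Q a) ` N (head Q a)" for w
    using subrep_arr[OF episub_subrep[OF N] a] eq by (auto intro!: image_eqI)
  fix w assume "w \<in> f (head Q a) ` N (head Q a)"
  then obtain u where u: "u \<in> N (head Q a)" "w = f (head Q a) u" by blast
  from episub_surj[OF N a u(1)] obtain v where "v \<in> N (tail Q a)" "u = amap V a v" .
  then show "\<exists>v\<in>f (tail Q a) ` N (tail Q a). w = amap W a v" using u eq by auto
qed

lemma satsub_vimage:
  assumes N: "satsub W N" shows "satsub V (\<lambda>x. {v \<in> carrier (vsp V x). f x v \<in> N x})"
proof (rule satsubI)
  show "ssp {v \<in> carrier (vsp V x). f x v \<in> N x} (vsp V x)" if "x \<in> verts Q" for x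
    using ssp_vimage[OF rep_vs[OF V that] rhom_mhom[OF f that] subrep_ssp[OF satsub_subrep[OF N] that]] .
  fix a v assume a: "a \<in> arcs Q"
  note eq = rhom_arr[OF f a]
  show "v \<in> {v \<in> carrier (vsp V (tail Q a)). f (tail Q a) v \<in> N (tail Q a)} \<Longrightarrow>
      amap V a v \<in> {v \<in> carrier (vsp V (head Q a)). f (head Q a) v \<in> N (head Q a)}"
    using eq hom_closed[OF rep_mhom[OF V a]] subrep_arr[OF satsub_subrep[OF N] a] by auto
  show "v \<in> carrier (vsp V (tail Q a)) \<Longrightarrow> amap V a v \<in> {v \<in> carrier (vsp V (head Q a)). f (head Q a) v \<in> N (head Q a)} \<Longrightarrow>
      v \<in> {v \<in> carrier (vsp V (tail Q a)). f (tail Q a) v \<in> N (tail Q a)}"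
    using eq hom_closed[OF rhom_mhom[OF f tail_v[OF a]]] satsubD[OF N a] by auto
qed

lemma rhom_epi: "x \<in> verts Q \<Longrightarrow> v \<in> epi V x \<Longrightarrow> f x v \<in> epi W x"
  using epi_upper[OF W episub_image[OF episub_epi[OF V]]] by blast

lemma rhom_mker: "v \<in> mker V x \<Longrightarrow> f x v \<in> mker W x"
  using mker_lower[OF V satsub_vimage[OF satsub_mker[OF W]]] by blast

end

subsection \<open>A model of the global tensor functor\<close>

text \<open>
  The functor in terms of \<open>epi\<close> and \<open>mker\<close>: \<open>(R V)\<^sub>x\<close> consists of the classes of the elements of \<open>epi V x\<close>
  modulo \<open>mker V x\<close>, and all maps are induced by those of \<open>V\<close>.
\<close>

abbreviation mproj :: "('k, ('k, 's) univ, 'v, 'a) quiver_rep \<Rightarrow> 'v \<Rightarrow> ('k, 's) univ \<Rightarrow> ('k, 's) univ" where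
  "mproj V x \<equiv> quot_proj (vsp V x) (mker V x)"

abbreviation GT :: "('k, ('k, 's) univ, 'v, 'a) rep_functor" where
  "GT \<equiv> global_tensor_functor K Q"

abbreviation Robj :: "('k, ('k, 's) univ, 'v, 'a) quiver_rep \<Rightarrow> ('k, ('k, 's) univ, 'v, 'a) quiver_rep" where
  "Robj V \<equiv> fob GT V"

lemma R_vsp: "x \<in> verts Q \<Longrightarrow>
   vsp (Robj V) x = (quot_space (vsp V x) (mker V x))\<lparr>carrier := mproj V x ` epi V x\<rparr>"
  by (simp add: global_tensor_functor_def image_functor_def sub_rep_def epi_functor_def mono_functor_def
      quot_rep_def epi_to_mono_def image_restrict_eq)

context
  fixes V :: "('k, ('k, 's) univ, 'v, 'a) quiver_rep"
  assumes V: "rep V"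
begin

lemma R_carrier: "x \<in> verts Q \<Longrightarrow> carrier (vsp (Robj V) x) = mproj V x ` epi V x"
  by (simp add: R_vsp)

lemma R_carrierE:
  assumes "u \<in> carrier (vsp (Robj V) x)" "x \<in> verts Q" obtains v where "v \<in> epi V x" "u = mproj V x v"
  using assms by (auto simp: R_carrier)

lemma mproj_facts:
  assumes x: "x \<in> verts Q"
  shows mproj_hom: "mproj V x \<in> module_hom K (vsp V x) (quot_space (vsp V x) (mker V x))"
    and mproj_zero: "v \<in> carrier (vsp V x) \<Longrightarrow> mproj V x v = \<zero>\<^bsub>quot_space (vsp V x) (mker V x)\<^esub> \<longleftrightarrow> v \<in> mker V x"
    and mquot_fd: "fd_space K (quot_space (vsp V x) (mker V x) :: ('k, ('k, 's) univ) module)"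
  using quot_hom[OF mker_ssp[OF V x] rep_fd[OF V x]] quot_zero[OF mker_ssp[OF V x] rep_fd[OF V x]]
    quot_fd[OF mker_ssp[OF V x] rep_fd[OF V x]] by auto

lemma R_ssp:
  assumes x: "x \<in> verts Q"
  shows "ssp (mproj V x ` epi V x) (quot_space (vsp V x) (mker V x) :: ('k, ('k, 's) univ) module)"
  using ssp_image[OF epi_ssp[OF V x] mproj_hom[OF x] fd_vs[OF mquot_fd[OF x]]] .

lemma R_fd: "x \<in> verts Q \<Longrightarrow> fd_space K (vsp (Robj V) x)"
  unfolding R_vsp by (rule fd_ssp[OF mquot_fd R_ssp])

lemma mproj_mem: "x \<in> verts Q \<Longrightarrow> v \<in> epi V x \<Longrightarrow> mproj V x v \<in> carrier (vsp (Robj V) x)"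
  by (simp add: R_carrier)

lemma R_zero: "x \<in> verts Q \<Longrightarrow> v \<in> epi V x \<Longrightarrow> mproj V x v = \<zero>\<^bsub>vsp (Robj V) x\<^esub> \<longleftrightarrow> v \<in> mker V x"
  using mproj_zero[OF _ epi_mem[OF V]] by (simp add: R_vsp)

lemma mproj_eq:
  assumes x: "x \<in> verts Q" and uv: "u \<in> carrier (vsp V x)" "v \<in> carrier (vsp V x)"
  shows "mproj V x u = mproj V x v \<longleftrightarrow> u \<ominus>\<^bsub>vsp V x\<^esub> v \<in> mker V x"
proof -
  note h = mproj_hom[OF x] and q = fd_vs[OF mquot_fd[OF x]]
  have "mproj V x u = mproj V x v \<longleftrightarrow> mproj V x (u \<ominus>\<^bsub>vsp V x\<^esub> v) = \<zero>\<^bsub>quot_space (vsp V x) (mker V x)\<^esub>"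
    using hom_minus[OF rep_vs[OF V x] q h uv] vs_minus_eq_zero[OF q hom_closed[OF h uv(1)] hom_closed[OF h uv(2)]] by simp
  then show ?thesis using mproj_zero[OF x vs_minus[OF rep_vs[OF V x] uv]] by simp
qed

lemma mprojE_hom: "x \<in> verts Q \<Longrightarrow> mproj V x \<in> module_hom K ((vsp V x)\<lparr>carrier := epi V x\<rparr>) (vsp (Robj V) x)"
  using mproj_hom[of x] epi_mem[OF V, of x] by (auto simp add: R_vsp module_hom_def)

lemma mproj_add: "x \<in> verts Q \<Longrightarrow> u \<in> epi V x \<Longrightarrow> v \<in> epi V x \<Longrightarrow>
    mproj V x (u \<oplus>\<^bsub>vsp V x\<^esub> v) = mproj V x u \<oplus>\<^bsub>vsp (Robj V) x\<^esub> mproj V x v"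
  using hom_add[OF mprojE_hom, of x u v] by simp

lemma mproj_smult: "x \<in> verts Q \<Longrightarrow> c \<in> carrier K \<Longrightarrow> v \<in> epi V x \<Longrightarrow>
    mproj V x (c \<odot>\<^bsub>vsp V x\<^esub> v) = c \<odot>\<^bsub>vsp (Robj V) x\<^esub> mproj V x v"
  using hom_smult[OF mprojE_hom, of x c v] by simp

lemma quot_amap:
  assumes a: "a \<in> arcs Q"
  shows "amap (quot_rep K Q V (mker V)) a \<in>
      lin K (quot_space (vsp V (tail Q a)) (mker V (tail Q a))) (quot_space (vsp V (head Q a)) (mker V (head Q a)))"
    and "v \<in> carrier (vsp V (tail Q a)) \<Longrightarrow>
      amap (quot_rep K Q V (mker V)) a (mproj V (tail Q a) v) = mproj V (head Q a) (amap V a v)"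
proof -
  let ?t = "tail Q a" and ?h = "head Q a"
  have m: "amap (quot_rep K Q V (mker V)) a = (THE h. h \<in> lin K (quot_space (vsp V ?t) (mker V ?t)) (quot_space (vsp V ?h) (mker V ?h)) \<and>
       (\<forall>v\<in>carrier (vsp V ?t). h (quot_proj (vsp V ?t) (mker V ?t) v) = quot_proj (vsp V ?h) (mker V ?h) (amap V a v)))"
    by (simp add: quot_rep_def)
  note q = quot_map[OF rep_fd[OF V tail_v[OF a]] rep_fd[OF V head_v[OF a]] mker_ssp[OF V tail_v[OF a]]
      mker_ssp[OF V head_v[OF a]] rep_mhom[OF V a] subrep_arr[OF satsub_subrep[OF satsub_mker[OF V]] a] m]
  show "amap (quot_rep K Q V (mker V)) a \<in> lin K (quot_space (vsp V ?t) (mker V ?t)) (quot_space (vsp V ?h) (mker V ?h))"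
    "v \<in> carrier (vsp V ?t) \<Longrightarrow> amap (quot_rep K Q V (mker V)) a (mproj V ?t v) = mproj V ?h (amap V a v)"
    using q by auto
qed

lemma R_amap_eq: "a \<in> arcs Q \<Longrightarrow> amap (Robj V) a = restrict (amap (quot_rep K Q V (mker V)) a) (mproj V (tail Q a) ` epi V (tail Q a))"
  by (simp add: global_tensor_functor_def image_functor_def sub_rep_def epi_functor_def mono_functor_def
      epi_to_mono_def image_restrict_eq)

lemma R_amap:
  assumes a: "a \<in> arcs Q" and v: "v \<in> epi V (tail Q a)"
  shows "amap (Robj V) a (mproj V (tail Q a) v) = mproj V (head Q a) (amap V a v)"
  using quot_amap(2)[OF a epi_mem[OF V tail_v[OF a] v]] v by (simp add: R_amap_eq[OF a])

lemma R_amap_lin: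
  assumes a: "a \<in> arcs Q"
  shows "amap (Robj V) a \<in> lin K (vsp (Robj V) (tail Q a)) (vsp (Robj V) (head Q a))"
proof -
  note t = tail_v[OF a] and h = head_v[OF a]
  have "amap (Robj V) a \<in> module_hom K (vsp (Robj V) (tail Q a)) (vsp (Robj V) (head Q a))"
  proof (rule homI)
    fix u assume "u \<in> carrier (vsp (Robj V) (tail Q a))"
    then obtain u' where u: "u' \<in> epi V (tail Q a)" "u = mproj V (tail Q a) u'" by (rule R_carrierE[OF _ t])
    show "amap (Robj V) a u \<in> carrier (vsp (Robj V) (head Q a))"
      using u R_amap[OF a] epi_arr[OF V a] mproj_mem[OF h] by simp
    {
      fix v assume "v \<in> carrier (vsp (Robj V) (tail Q a))"
      then obtain v' where v: "v' \<in> epi V (tail Q a)" "v = mproj V (tail Q a) v'" by (rule R_carrierE[OF _ t])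
      show "amap (Robj V) a (u \<oplus>\<^bsub>vsp (Robj V) (tail Q a)\<^esub> v) = amap (Robj V) a u \<oplus>\<^bsub>vsp (Robj V) (head Q a)\<^esub> amap (Robj V) a v"
        using u v epi_arr[OF V a] ssp_add[OF epi_ssp[OF V t]] epi_mem[OF V t]
        by (simp add: R_amap[OF a] mproj_add[OF t, symmetric] mproj_add[OF h, symmetric] hom_add[OF rep_mhom[OF V a]])
    }
    fix c assume c: "c \<in> carrier K"
    show "amap (Robj V) a (c \<odot>\<^bsub>vsp (Robj V) (tail Q a)\<^esub> u) = c \<odot>\<^bsub>vsp (Robj V) (head Q a)\<^esub> amap (Robj V) a u"
      using u c epi_arr[OF V a] ssp_smult[OF epi_ssp[OF V t]] epi_mem[OF V t]
      by (simp add: R_amap[OF a] mproj_smult[OF t, symmetric] mproj_smult[OF h, symmetric] hom_smult[OF rep_mhom[OF V a]])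
  qed
  then show ?thesis unfolding lin_def by (auto simp: R_amap_eq[OF a] R_carrier[OF t])
qed

lemma R_rep: "rep (Robj V)"
  unfolding is_rep_def using R_fd R_amap_lin by blast

text \<open>
  Every arrow acts bijectively on \<open>R V\<close>: injectively because \<open>mker V\<close> is saturated, and surjectively because
  \<open>epi V\<close> is epimorphic.
\<close>

lemma R_bij:
  assumes a: "a \<in> arcs Q"
  shows "bij_betw (amap (Robj V) a) (carrier (vsp (Robj V) (tail Q a))) (carrier (vsp (Robj V) (head Q a)))"
proof -
  note t = tail_v[OF a] and h = head_v[OF a]
  note f = lin_hom[OF R_amap_lin[OF a]]
  have "inj_on (amap (Robj V) a) (carrier (vsp (Robj V) (tail Q a)))"
    unfolding inj_hom_iff[OF fd_vs[OF R_fd[OF t]] fd_vs[OF R_fd[OF h]] f]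
  proof (intro ballI impI)
    fix u assume "u \<in> carrier (vsp (Robj V) (tail Q a))" and z: "amap (Robj V) a u = \<zero>\<^bsub>vsp (Robj V) (head Q a)\<^esub>"
    then obtain v where v: "v \<in> epi V (tail Q a)" "u = mproj V (tail Q a) v" by (auto elim: R_carrierE[OF _ t])
    then have "amap V a v \<in> mker V (head Q a)" using z R_amap[OF a] R_zero[OF h epi_arr[OF V a]] by simp
    then have "v \<in> mker V (tail Q a)" using satsubD[OF satsub_mker[OF V] a] epi_mem[OF V t] v by blast
    then show "u = \<zero>\<^bsub>vsp (Robj V) (tail Q a)\<^esub>" using R_zero[OF t] v by simp
  qed
  moreover have "amap (Robj V) a ` carrier (vsp (Robj V) (tail Q a)) = carrier (vsp (Robj V) (head Q a))"
  proof
    show "amap (Robj V) a ` carrier (vsp (Robj V) (tail Q a)) \<subseteq> carrier (vsp (Robj V) (head Q a))"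
      using hom_closed[OF f] by blast
    show "carrier (vsp (Robj V) (head Q a)) \<subseteq> amap (Robj V) a ` carrier (vsp (Robj V) (tail Q a))"
    proof
      fix w assume "w \<in> carrier (vsp (Robj V) (head Q a))"
      then obtain u where u: "u \<in> epi V (head Q a)" "w = mproj V (head Q a) u" by (rule R_carrierE[OF _ h])
      from episub_surj[OF episub_epi[OF V] a u(1)] obtain v where v: "v \<in> epi V (tail Q a)" "u = amap V a v" .
      then show "w \<in> amap (Robj V) a ` carrier (vsp (Robj V) (tail Q a))"
        using u R_amap[OF a v(1)] mproj_mem[OF t v(1)] by (metis image_eqI)
    qed
  qed
  ultimately show ?thesis by (simp add: bij_betw_def)
qed

end

context
  fixes V W :: "('k, ('k, 's) univ, 'v, 'a) quiver_rep" and f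
  assumes V: "rep V" and W: "rep W" and f: "f \<in> rep_hom K Q V W"
begin

lemma R_fmap:
  assumes x: "x \<in> verts Q" and v: "v \<in> epi V x"
  shows "fmap GT V W f x (mproj V x v) = mproj W x (f x v)"
proof -
  define m :: "('k, 's) univ \<Rightarrow> ('k, 's) univ" where "m = (THE h. h \<in> lin K (quot_space (vsp V x) (mker V x)) (quot_space (vsp W x) (mker W x)) \<and>
       (\<forall>v\<in>carrier (vsp V x). h (quot_proj (vsp V x) (mker V x) v) = (quot_proj (vsp W x) (mker W x) (f x v) :: ('k, 's) univ)))"
  note q = quot_map[OF rep_fd[OF V x] rep_fd[OF W x] mker_ssp[OF V x] mker_ssp[OF W x] rhom_mhom[OF f x] rhom_mker[OF V W f] m_def]
  have "fmap GT V W f x (mproj V x v) = m (mproj V x v)"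
    using x v by (simp add: global_tensor_functor_def image_functor_def epi_functor_def mono_functor_def
      epi_to_mono_def sub_rep_def m_def image_restrict_eq)
  then show ?thesis using q(2) epi_mem[OF V x v] by simp
qed

lemma R_fmap_ext: "x \<in> verts Q \<Longrightarrow> fmap GT V W f x \<in> extensional (carrier (vsp (Robj V) x))"
  by (simp add: R_carrier[OF V]) (simp add: global_tensor_functor_def image_functor_def epi_functor_def mono_functor_def
      epi_to_mono_def sub_rep_def image_restrict_eq)

lemma R_fmap_rhom: "fmap GT V W f \<in> rep_hom K Q (Robj V) (Robj W)"
proof (rule rhomI)
  fix x assume x: "x \<in> verts Q"
  note cE = R_carrierE[OF V _ x]
  note fe = rhom_epi[OF V W f x] and fm = R_fmap[OF x]
  have "fmap GT V W f x \<in> module_hom K (vsp (Robj V) x) (vsp (Robj W) x)"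
  proof (rule homI)
    fix u assume "u \<in> carrier (vsp (Robj V) x)"
    then obtain u' where u: "u' \<in> epi V x" "u = mproj V x u'" by (rule cE)
    show "fmap GT V W f x u \<in> carrier (vsp (Robj W) x)"
      using u fm fe mproj_mem[OF W x] by simp
    {
      fix v assume "v \<in> carrier (vsp (Robj V) x)"
      then obtain v' where v: "v' \<in> epi V x" "v = mproj V x v'" by (rule cE)
      show "fmap GT V W f x (u \<oplus>\<^bsub>vsp (Robj V) x\<^esub> v) = fmap GT V W f x u \<oplus>\<^bsub>vsp (Robj W) x\<^esub> fmap GT V W f x v"
        using u v fe ssp_add[OF epi_ssp[OF V x]] epi_mem[OF V x]
        by (simp add: fm mproj_add[OF V x, symmetric] mproj_add[OF W x, symmetric] hom_add[OF rhom_mhom[OF f x]])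
    }
    fix c assume c: "c \<in> carrier K"
    show "fmap GT V W f x (c \<odot>\<^bsub>vsp (Robj V) x\<^esub> u) = c \<odot>\<^bsub>vsp (Robj W) x\<^esub> fmap GT V W f x u"
      using u c fe ssp_smult[OF epi_ssp[OF V x]] epi_mem[OF V x]
      by (simp add: fm mproj_smult[OF V x, symmetric] mproj_smult[OF W x, symmetric] hom_smult[OF rhom_mhom[OF f x]])
  qed
  then show "fmap GT V W f x \<in> lin K (vsp (Robj V) x) (vsp (Robj W) x)"
    unfolding lin_def using R_fmap_ext[OF x] by blast
next
  fix a u assume a: "a \<in> arcs Q" and "u \<in> carrier (vsp (Robj V) (tail Q a))"
  note t = tail_v[OF a] and h = head_v[OF a]
  then obtain v where v: "v \<in> epi V (tail Q a)" "u = mproj V (tail Q a) v"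
    using \<open>u \<in> _\<close> by (auto elim: R_carrierE[OF V _ t])
  then show "fmap GT V W f (head Q a) (amap (Robj V) a u) = amap (Robj W) a (fmap GT V W f (tail Q a) u)"
    by (simp add: R_amap[OF V a] R_amap[OF W a] R_fmap[OF h] R_fmap[OF t] epi_arr[OF V a] rhom_epi[OF V W f t]
        rhom_arr[OF f a] epi_mem[OF V t])
next
  fix x assume "x \<notin> verts Q"
  then show "fmap GT V W f x = undefined" by (simp add: global_tensor_functor_def image_functor_def)
qed

end

end

section \<open>Functionals, nilpotent matrices and stable images\<close>

context base
begin

text \<open>The field as a one dimensional space, the target of functionals.\<close>

abbreviation KK :: "('k, 'k) module" where "KK \<equiv> self_module K"

lemma KK_simps [simp]:
  "carrier KK = carrier K" "\<zero>\<^bsub>KK\<^esub> = \<zero>" "x \<oplus>\<^bsub>KK\<^esub> y = x \<oplus> y" "x \<odot>\<^bsub>KK\<^esub> y = x \<otimes> y"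
  by (simp_all add: self_module_def)

lemma KK_vs: "vs_ok KK"
proof (rule vs_criteria)
  show "\<forall>v\<in>carrier KK. \<exists>neg_v\<in>carrier KK. v \<oplus>\<^bsub>KK\<^esub> neg_v = \<zero>\<^bsub>KK\<^esub>"
    using r_neg a_inv_closed by (metis KK_simps(1,2,3))
qed (auto simp: field_axioms a_ac m_assoc l_distr r_distr)

lemma KK_finsum: "finsum KK f A = finsum K f A"
  by (simp add: finsum_def finprod_def self_module_def)

lemma hom_scaler:
  assumes V: "vs_ok V" and U: "vs_ok U" and f: "f \<in> module_hom K V KK" and u: "u \<in> carrier U"
  shows "(\<lambda>s. f s \<odot>\<^bsub>U\<^esub> u) \<in> module_hom K V U"
proof -
  interpret U: vectorspace K U by (rule U)
  have c: "f v \<in> carrier K" if "v \<in> carrier V" for v using hom_closed[OF f that] by simp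
  show ?thesis
    using u by (intro homI) (auto simp: c hom_add[OF f] hom_smult[OF f] U.smult_l_distr U V U.smult_assoc1)
qed

lemma hom_smult_r:
  assumes U: "vs_ok U" and k: "k \<in> carrier K"
  shows "(\<lambda>u. k \<odot>\<^bsub>U\<^esub> u) \<in> module_hom K U U"
  using hom_scale[OF U U id_hom k] .

lemma hom_finsum:
  assumes V: "vs_ok V" and U: "vs_ok U" and f: "f \<in> module_hom K V U" and g: "\<And>i. i \<in> A \<Longrightarrow> g i \<in> carrier V"
    and A: "finite A"
  shows "f (finsum V g A) = finsum U (\<lambda>i. f (g i)) A"
proof -
  interpret V: vectorspace K V by (rule V)
  interpret U: vectorspace K U by (rule U)
  show ?thesis
    using A g
  proof (induction A rule: finite_induct)
    case empty
    then show ?case using hom_zero[OF V U f] by simp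
  next
    case (insert a A)
    then show ?case
      by (simp add: Pi_def V.M.finsum_insert U.M.finsum_insert hom_closed[OF f] hom_add[OF f])
  qed
qed

text \<open>
  A functional that vanishes on a subspace but not at a given vector outside it: \<open>d = id - p\<close> for a
  projection \<open>p\<close> onto the subspace, followed by a functional that is \<open>1\<close> at \<open>d v\<close>.
\<close>

lemma separation:
  assumes V: "fd_space K V" and N: "ssp N V" and v: "v \<in> carrier V" "v \<notin> N"
  shows "\<exists>\<xi>. \<xi> \<in> module_hom K V KK \<and> (\<forall>n\<in>N. \<xi> n = \<zero>) \<and> \<xi> v \<noteq> \<zero>"
proof -
  note vV = fd_vs[OF V]
  interpret V: vectorspace K V by (rule vV)
  obtain p where p: "p \<in> module_hom K V V" "p ` carrier V = N" "\<forall>v\<in>N. p v = v"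
    using projection_ex[OF V N] by blast
  define d where "d w = w \<ominus>\<^bsub>V\<^esub> p w" for w
  have d: "d \<in> module_hom K V V"
    by (rule hom_cong[OF vV hom_plus[OF vV vV id_hom hom_scale[OF vV vV p(1), of "\<ominus> \<one>"]]])
      (auto simp: d_def vs_minus_smult vV hom_closed[OF p(1)])
  have pv: "p v \<in> N" using p(2) v(1) by blast
  have nz: "d v \<noteq> \<zero>\<^bsub>V\<^esub>"
  proof
    assume "d v = \<zero>\<^bsub>V\<^esub>"
    then have "v = p v" unfolding d_def using vs_minus_eq_zero[OF vV v(1) hom_closed[OF p(1) v(1)]] by blast
    then show False using pv v(2) by metis
  qed
  let ?L = "(\<lambda>c. c \<odot>\<^bsub>V\<^esub> d v) ` carrier K"
  have dv: "d v \<in> carrier V" using hom_closed[OF d v(1)] .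
  note lh = hom_scaler[OF KK_vs vV id_hom dv]
  have L: "ssp ?L V" using ssp_image[OF ssp_full[OF KK_vs] lh vV] by simp
  have li: "inj_on (\<lambda>c. c \<odot>\<^bsub>V\<^esub> d v) (carrier K)"
  proof -
    have "c = \<zero>" if "c \<in> carrier K" "c \<odot>\<^bsub>V\<^esub> d v = \<zero>\<^bsub>V\<^esub>" for c
    proof (rule ccontr)
      assume "c \<noteq> \<zero>"
      then have "d v = inv c \<odot>\<^bsub>V\<^esub> \<zero>\<^bsub>V\<^esub>" using V.mult_inverse[OF that(1) dv that(2)] by simp
      then show False using nz that(1) \<open>c \<noteq> \<zero>\<close> by simp
    qed
    then show ?thesis using inj_hom_iff[OF KK_vs vV lh] by simp
  qed
  define f where "f = inv_into (carrier K) (\<lambda>c. c \<odot>\<^bsub>V\<^esub> d v)"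
  have f: "f (c \<odot>\<^bsub>V\<^esub> d v) = c" if "c \<in> carrier K" for c
    unfolding f_def using inv_into_f_f[OF li that] by simp
  have "f \<in> module_hom K (V\<lparr>carrier := ?L\<rparr>) KK"
    using dv by (intro homI) (auto simp: f V.smult_l_distr[symmetric] V.smult_assoc1[symmetric])
  from hom_extend[OF V L this] obtain g where g: "g \<in> module_hom K V KK" "\<forall>v\<in>?L. g v = f v" by blast
  have "d v = \<one> \<odot>\<^bsub>V\<^esub> d v" using dv by simp
  then have "g (d v) = \<one>" using g(2) f[of \<one>] by (metis imageI one_closed)
  moreover have "g (d n) = \<zero>" if "n \<in> N" for n
  proof -
    have "d n = \<zero>\<^bsub>V\<^esub>" unfolding d_def using p(3) that vs_minus_eq_zero[OF vV, of n n] ssp_mem[OF N that] by metis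
    then show ?thesis using hom_zero[OF vV KK_vs g(1)] by simp
  qed
  ultimately show ?thesis using hom_comp[OF d g(1)] by (intro exI[of _ "\<lambda>w. g (d w)"]) simp
qed

text \<open>
  A functional on \<open>A\<close> that vanishes on the preimage of \<open>X\<close> under \<open>f : A \<rightarrow> B\<close> comes from a functional on \<open>B\<close>
  that vanishes on \<open>X\<close>.  Along the arrows of a representation this pushes functionals vanishing on a
  saturated subrepresentation from tail to head.
\<close>

lemma functional_push:
  fixes B :: "('k, ('k, 's) univ) module"
  assumes A: "vs_ok A" and B: "fd_space K B" and X: "ssp X B" and f: "f \<in> module_hom K A B"
    and s: "s \<in> module_hom K A KK" and van: "\<And>a. a \<in> carrier A \<Longrightarrow> f a \<in> X \<Longrightarrow> s a = \<zero>"
  shows "\<exists>r. r \<in> module_hom K B KK \<and> (\<forall>b\<in>X. r b = \<zero>) \<and> (\<forall>a\<in>carrier A. r (f a) = s a)"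
proof -
  let ?C = "quot_space B X :: ('k, ('k, 's) univ) module"
  let ?\<pi> = "quot_proj B X :: _ \<Rightarrow> ('k, 's) univ"
  note C = quot_fd[OF X B] and \<pi> = quot_hom[OF X B]
  note g = hom_comp[OF f \<pi>]
  let ?I = "(\<lambda>a. ?\<pi> (f a)) ` carrier A"
  have I: "ssp ?I ?C" using ssp_image[OF ssp_full[OF A] g fd_vs[OF C]] .
  have g': "(\<lambda>a. ?\<pi> (f a)) \<in> module_hom K A (?C\<lparr>carrier := ?I\<rparr>)" using g by (auto simp: module_hom_def)
  have "\<exists>h. h \<in> lin K (?C\<lparr>carrier := ?I\<rparr>) KK \<and> (\<forall>a\<in>carrier A. h (?\<pi> (f a)) = s a)"
    by (rule hom_factor[OF A ssp_is_vs[OF I] KK_vs g' _ s])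
      (auto simp: quot_zero[OF X B] hom_closed[OF f] van)
  then obtain h where h: "h \<in> lin K (?C\<lparr>carrier := ?I\<rparr>) KK" "\<forall>a\<in>carrier A. h (?\<pi> (f a)) = s a" by blast
  from hom_extend[OF C I lin_hom[OF h(1)]]
  obtain k where k: "k \<in> module_hom K ?C KK" "\<forall>v\<in>?I. k v = h v" by blast
  have "k (?\<pi> b) = \<zero>" if "b \<in> X" for b
  proof -
    have "?\<pi> b = \<zero>\<^bsub>?C\<^esub>" using quot_zero[OF X B ssp_mem[OF X that]] that by blast
    then show ?thesis using hom_zero[OF fd_vs[OF C] KK_vs k(1)] by simp
  qed
  then show ?thesis using hom_comp[OF \<pi> k(1)] k(2) h(2) by (intro exI[of _ "\<lambda>b. k (?\<pi> b)"]) auto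
qed

text \<open>The action of a square matrix with index set \<open>I\<close> on coefficient vectors.\<close>

definition mat_op :: "'i set \<Rightarrow> ('i \<Rightarrow> 'i \<Rightarrow> 'k) \<Rightarrow> ('i \<Rightarrow> 'k) \<Rightarrow> 'i \<Rightarrow> 'k" where
  "mat_op I M x i = (\<Oplus>j\<in>I. M i j \<otimes> x j)"

lemma mat_op_closed:
  assumes "\<And>i j. i \<in> I \<Longrightarrow> j \<in> I \<Longrightarrow> M i j \<in> carrier K" "\<And>j. j \<in> I \<Longrightarrow> x j \<in> carrier K" "i \<in> I"
  shows "(mat_op I M ^^ n) x i \<in> carrier K"
  using assms(3)
proof (induction n arbitrary: i)
  case (Suc n)
  show ?case using Suc assms(1) by (auto simp: mat_op_def intro!: finsum_closed)
qed (use assms(2) in auto)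

lemma mat_op_cong:
  assumes "\<And>i j. i \<in> I \<Longrightarrow> j \<in> I \<Longrightarrow> M i j \<in> carrier K" "\<And>j. j \<in> I \<Longrightarrow> y j \<in> carrier K"
    "\<And>j. j \<in> I \<Longrightarrow> x j = y j" "i \<in> I"
  shows "mat_op I M x i = mat_op I M y i"
  unfolding mat_op_def using assms by (intro finsum_cong') auto

text \<open>
  A nilpotent matrix has trace zero.  Take a kernel vector \<open>c\<close>, scaled so that \<open>c\<^sub>k = 1\<close>.  The quotient by
  \<open>c\<close> has the coordinates other than \<open>k\<close>; the matrix \<open>M'\<close> induced there is nilpotent and has the same
  trace, since the diagonal entries change by \<open>- M\<^sub>k\<^sub>i c\<^sub>i\<close>, which add up to \<open>- (M c)\<^sub>k = 0\<close>.
\<close>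

lemma nilpotent_trace:
  fixes M :: "'i \<Rightarrow> 'i \<Rightarrow> 'k"
  assumes "finite I" and "\<And>i j. i \<in> I \<Longrightarrow> j \<in> I \<Longrightarrow> M i j \<in> carrier K"
    and "\<And>x i. (\<And>j. j \<in> I \<Longrightarrow> x j \<in> carrier K) \<Longrightarrow> i \<in> I \<Longrightarrow> (mat_op I M ^^ m) x i = \<zero>"
  shows "(\<Oplus>i\<in>I. M i i) = \<zero>"
  using assms
proof (induction "card I" arbitrary: I M)
  case 0
  then show ?case by simp
next
  case (Suc r)
  note fin = Suc.prems(1) and M = Suc.prems(2) and nil = Suc.prems(3)
  let ?A = "mat_op I M"
  note Acl = mat_op_closed[of I M, OF M]
  have "I \<noteq> {}" using Suc.hyps(2) by auto
  define e where "e = (\<lambda>_::'i. \<one>)"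
  have e: "\<And>j. j \<in> I \<Longrightarrow> e j \<in> carrier K" by (simp add: e_def)
  define n where "n = (LEAST n. \<forall>i\<in>I. (?A ^^ n) e i = \<zero>)"
  have n: "\<forall>i\<in>I. (?A ^^ n) e i = \<zero>" unfolding n_def by (rule LeastI[where k = m]) (intro ballI nil e)
  have "n \<noteq> 0" using n \<open>I \<noteq> {}\<close> by (auto simp: e_def)
  then obtain n' where n': "n = Suc n'" by (cases n) auto
  then have "\<not> (\<forall>i\<in>I. (?A ^^ n') e i = \<zero>)" unfolding n_def by (intro not_less_Least) auto
  then obtain k where k: "k \<in> I" "(?A ^^ n') e k \<noteq> \<zero>" by blast
  define c' where "c' = (?A ^^ n') e"
  have c': "\<And>i. i \<in> I \<Longrightarrow> c' i \<in> carrier K" "c' k \<noteq> \<zero>" "\<And>i. i \<in> I \<Longrightarrow> ?A c' i = \<zero>"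
    using Acl[OF _ _ e] k n n' by (auto simp: c'_def)
  define c where "c i = inv (c' k) \<otimes> c' i" for i
  have u: "c' k \<in> Units K" using c' k field_Units by auto
  have c: "\<And>i. i \<in> I \<Longrightarrow> c i \<in> carrier K" "c k = \<one>" using c' u by (auto simp: c_def k)
  have Ac: "?A c i = \<zero>" if i: "i \<in> I" for i
  proof -
    have "?A c i = (\<Oplus>j\<in>I. inv (c' k) \<otimes> (M i j \<otimes> c' j))"
      unfolding mat_op_def c_def using i M c' u by (intro finsum_cong') (auto simp: m_ac)
    also have "\<dots> = inv (c' k) \<otimes> ?A c' i"
      unfolding mat_op_def using i M c' u fin by (subst finsum_rdistr) auto
    finally show ?thesis using c'(3)[OF i] u by simp
  qed
  let ?J = "I - {k}"
  define d where "d i = \<ominus> c i" for i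
  have d: "\<And>i. i \<in> I \<Longrightarrow> d i \<in> carrier K" using c by (simp add: d_def)
  define M' where "M' i j = M i j \<oplus> d i \<otimes> M k j" for i j
  define \<pi> where "\<pi> x i = x i \<oplus> d i \<otimes> x k" for x :: "'i \<Rightarrow> 'k" and i
  have M': "\<And>i j. i \<in> I \<Longrightarrow> j \<in> I \<Longrightarrow> M' i j \<in> carrier K" using M d k by (simp add: M'_def)
  have \<pi>cl: "\<pi> x i \<in> carrier K" if "\<And>j. j \<in> I \<Longrightarrow> x j \<in> carrier K" "i \<in> I" for x i
    using that d k by (simp add: \<pi>_def)
  have \<pi>k: "\<pi> x k = \<zero>" if "x k \<in> carrier K" for x using that c(2) by (simp add: \<pi>_def d_def l_minus r_neg)
  have drop: "(\<Oplus>j\<in>?J. g j) = (\<Oplus>j\<in>I. g j)" if "\<And>j. j \<in> I \<Longrightarrow> g j \<in> carrier K" "g k = \<zero>" for g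
    using that fin k by (intro add.finprod_mono_neutral_cong_left) auto
  have step: "mat_op ?J M' (\<pi> x) i = \<pi> (?A x) i" if x: "\<And>j. j \<in> I \<Longrightarrow> x j \<in> carrier K" and i: "i \<in> I" for x i
  proof -
    have "mat_op ?J M' (\<pi> x) i = (\<Oplus>j\<in>I. M' i j \<otimes> \<pi> x j)"
      unfolding mat_op_def using \<pi>k[of x] x k i M' \<pi>cl[OF x] by (intro drop) auto
    also have "\<dots> = (\<Oplus>j\<in>I. (M i j \<otimes> x j \<oplus> d i \<otimes> (M k j \<otimes> x j)) \<oplus>
        ((\<ominus> x k) \<otimes> (M i j \<otimes> c j) \<oplus> (\<ominus> (d i \<otimes> x k)) \<otimes> (M k j \<otimes> c j)))"
    proof (intro finsum_cong' refl)
      fix j assume j: "j \<in> I"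
      have cl: "M i j \<in> carrier K" "M k j \<in> carrier K" "x j \<in> carrier K" "x k \<in> carrier K" "c j \<in> carrier K" "d i \<in> carrier K"
        using i j k M x c d by auto
      show "M' i j \<otimes> \<pi> x j = (M i j \<otimes> x j \<oplus> d i \<otimes> (M k j \<otimes> x j)) \<oplus>
        ((\<ominus> x k) \<otimes> (M i j \<otimes> c j) \<oplus> (\<ominus> (d i \<otimes> x k)) \<otimes> (M k j \<otimes> c j))"
        unfolding M'_def \<pi>_def d_def[of j] using cl
        by (simp add: l_distr r_distr a_ac m_ac l_minus r_minus)
    qed (use M c d x i k in auto)
    also have "\<dots> = (?A x i \<oplus> d i \<otimes> ?A x k) \<oplus> ((\<ominus> x k) \<otimes> ?A c i \<oplus> (\<ominus> (d i \<otimes> x k)) \<otimes> ?A c k)"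
      unfolding mat_op_def using M c d x i k fin by (simp add: finsum_addf finsum_rdistr Pi_def)
    also have "\<dots> = \<pi> (?A x) i"
      using Ac[OF i] Ac[OF k(1)] d[OF i] x[OF k(1)] mat_op_closed[of I M x _ 1, OF M x] i k by (simp add: \<pi>_def)
    finally show ?thesis .
  qed
  have nil': "(mat_op ?J M' ^^ m) y i = \<zero>" if y: "\<And>j. j \<in> ?J \<Longrightarrow> y j \<in> carrier K" and i: "i \<in> ?J" for y i
  proof -
    define x where "x = y(k := \<zero>)"
    have x: "\<And>j. j \<in> I \<Longrightarrow> x j \<in> carrier K" using y by (simp add: x_def)
    have xy: "\<And>j. j \<in> ?J \<Longrightarrow> \<pi> x j = y j" using y d by (simp add: x_def \<pi>_def)
    have "(mat_op ?J M' ^^ n) y i = \<pi> ((?A ^^ n) x) i" if "i \<in> ?J" for n i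
      using that
    proof (induction n arbitrary: i)
      case (Suc n)
      have "(mat_op ?J M' ^^ Suc n) y i = mat_op ?J M' (\<pi> ((?A ^^ n) x)) i"
        using Suc M' \<pi>cl[OF Acl[OF _ _ x]] by (simp, intro mat_op_cong) auto
      also have "\<dots> = \<pi> (?A ((?A ^^ n) x)) i"
        using Suc.prems by (intro step Acl[OF _ _ x]) auto
      finally show ?case by simp
    qed (simp add: xy)
    then show ?thesis using nil[OF x] i k d by (simp add: \<pi>_def)
  qed
  have "(\<Oplus>i\<in>?J. M' i i) = \<zero>"
    using Suc.hyps(2) fin k(1) M' nil' by (intro Suc.hyps(1)) auto
  moreover have "(\<Oplus>i\<in>?J. M' i i) = (\<Oplus>i\<in>I. M i i)"
  proof -
    have "(\<Oplus>i\<in>?J. M' i i) = (\<Oplus>i\<in>I. M i i \<oplus> (\<ominus> \<one>) \<otimes> (M k i \<otimes> c i))"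
      using M M' c d k fin drop[of "\<lambda>i. M' i i"]
      by (simp add: M'_def d_def l_minus r_neg) (intro finsum_cong', auto simp: l_minus r_minus m_comm)
    also have "\<dots> = (\<Oplus>i\<in>I. M i i) \<oplus> (\<ominus> \<one>) \<otimes> ?A c k"
      unfolding mat_op_def using M c k fin by (simp add: finsum_addf finsum_rdistr Pi_def)
    finally show ?thesis using Ac[OF k(1)] M by (simp add: Pi_def)
  qed
  ultimately show ?case by simp
qed

text \<open>Nested subspaces are equal if the dimension does not grow.\<close>

lemma ssp_dim_eq:
  assumes V: "fd_space K V" and N: "ssp N V" and N': "ssp N' V" and sub: "N \<subseteq> N'"
    and d: "vectorspace.dim K (V\<lparr>carrier := N'\<rparr>) \<le> vectorspace.dim K (V\<lparr>carrier := N\<rparr>)"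
  shows "N = N'"
proof -
  interpret V: vectorspace K V using fd_vs[OF V] .
  interpret N: vectorspace K "V\<lparr>carrier := N\<rparr>" by (rule ssp_is_vs[OF N])
  interpret N': vectorspace K "V\<lparr>carrier := N'\<rparr>" by (rule ssp_is_vs[OF N'])
  have fN: "N.fin_dim" and fN': "N'.fin_dim" using fd_ssp[OF V N] fd_ssp[OF V N'] by (simp_all add: fd_space_def)
  obtain B where B: "finite B" "N.basis B" using N.finite_basis_exists[OF fN] by blast
  have BN: "B \<subseteq> N" "\<not> N.lin_dep B" "N.span B = N" using B(2) by (auto simp: N.basis_def)
  have sN: "submodule K N V" and sN': "submodule K N' V" using N N' by (auto simp: VectorSpace.subspace_def)
  have li': "\<not> N'.lin_dep B"
    using BN V.span_li_not_depend(2)[OF BN(1) sN] V.span_li_not_depend(2)[OF _ sN', of B] sub by auto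
  have "N'.basis B"
    using N'.dim_li_is_basis[OF fN' B(1) _ li'] d N.dim_basis[OF B] BN(1) sub by simp
  then have "N'.span B = N'" by (auto simp: N'.basis_def)
  then show ?thesis
    using BN V.span_li_not_depend(1)[OF BN(1) sN] V.span_li_not_depend(1)[OF _ sN', of B] sub by auto
qed

lemma funpow_hom: "p \<in> module_hom K V V \<Longrightarrow> (p ^^ n) \<in> module_hom K V V"
proof (induction n)
  case 0 then show ?case by (auto simp: module_hom_def)
next
  case (Suc n)
  then show ?case using hom_comp[of "p ^^ n" V V p V] by (simp add: comp_def)
qed

text \<open>The images of the powers of an endomorphism become stationary: take one of least dimension.\<close>

lemma stable_image:
  assumes V: "fd_space K V" and p: "p \<in> module_hom K V V"
  shows "\<exists>n. p ` ((p ^^ n) ` carrier V) = (p ^^ n) ` carrier V"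
proof -
  let ?I = "\<lambda>n. (p ^^ n) ` carrier V"
  let ?d = "\<lambda>n. vectorspace.dim K (V\<lparr>carrier := ?I n\<rparr>)"
  have s: "ssp (?I n) V" for n using ssp_image[OF ssp_full[OF fd_vs[OF V]] funpow_hom[OF p] fd_vs[OF V]] .
  obtain n where n: "\<And>k. ?d n \<le> ?d k" using ex_has_least_nat[of "\<lambda>_. True" 0 ?d] by auto
  have "?I (Suc n) \<subseteq> ?I n"
  proof
    fix v assume "v \<in> ?I (Suc n)"
    then obtain w where "w \<in> carrier V" "v = (p ^^ n) (p w)" by (auto simp: funpow_swap1)
    then show "v \<in> ?I n" using hom_closed[OF p] by auto
  qed
  from ssp_dim_eq[OF V s s this n] have "?I (Suc n) = ?I n" .
  then show ?thesis by (intro exI[of _ n]) (simp add: image_comp)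
qed

subsection \<open>Contractions of a tensor with a bilinear form\<close>

text \<open>
  A tensor \<open>t = \<Sum> v\<^sub>i \<otimes> w\<^sub>i\<close> in \<open>V \<otimes> W\<close> and a bilinear form \<open>b\<close> on \<open>V' \<times> W\<close> give the map
  \<open>v' \<mapsto> \<Sum> b(v', w\<^sub>i) v\<^sub>i\<close> from \<open>V'\<close> to \<open>V\<close>.  \<open>opR\<close> is the same with the factors exchanged, for a form on
  \<open>V \<times> W'\<close>.
\<close>

definition opL where
  "opL V W b t v' = tlift V W V (\<lambda>v w. b v' w \<odot>\<^bsub>V\<^esub> v) t"

definition opR where
  "opR V W b t = opL W V (\<lambda>w v. b v w) (tensor_braid K V W t)"

lemma tlift_cong:
  assumes "\<And>v w. v \<in> carrier V \<Longrightarrow> w \<in> carrier W \<Longrightarrow> b v w = b' v w"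
  shows "tlift V W U b = tlift V W U b'"
  unfolding tlift_def using assms by (intro arg_cong[of _ _ The] ext) auto

lemma opL_cong: "(\<And>w. w \<in> carrier W \<Longrightarrow> b v' w = b' u' w) \<Longrightarrow> opL V W b t v' = opL V W b' t u'"
  unfolding opL_def by (intro fun_cong[OF tlift_cong]) simp

context
  fixes V W :: "('k, ('k, 's) univ) module"
  assumes V: "fd_space K V" and W: "fd_space K W"
begin

lemma contrL_bilin: "\<beta> \<in> module_hom K W KK \<Longrightarrow> bilin V W V (\<lambda>v w. \<beta> w \<odot>\<^bsub>V\<^esub> v)"
  using hom_smult_r[OF fd_vs[OF V]] hom_closed[of \<beta> W KK] hom_scaler[OF fd_vs[OF W] fd_vs[OF V]]
  by (intro bilinI) auto

lemma opL_facts: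
  fixes V' :: "('k, 't) module"
  assumes V': "vs_ok V'" and b: "bilin V' W KK b"
  shows opL_hom_t: "v' \<in> carrier V' \<Longrightarrow> (\<lambda>t. opL V W b t v') \<in> module_hom K (tensor K V W) V"
    and opL_pure: "v' \<in> carrier V' \<Longrightarrow> v \<in> carrier V \<Longrightarrow> w \<in> carrier W \<Longrightarrow>
      opL V W b (pure_tensor K V W v w) v' = b v' w \<odot>\<^bsub>V\<^esub> v"
    and opL_hom: "t \<in> carrier (tensor K V W) \<Longrightarrow> opL V W b t \<in> module_hom K V' V"
proof -
  note vV = fd_vs[OF V] and T = fd_vs[OF tensor_fd[OF V W]]
  interpret V: vectorspace K V by (rule vV)
  note c = contrL_bilin[OF bilin_r[OF b]]
  show h: "(\<lambda>t. opL V W b t v') \<in> module_hom K (tensor K V W) V" if "v' \<in> carrier V'" for v'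
    unfolding opL_def by (rule tlift_hom[OF V W vV c[OF that]])
  show p: "opL V W b (pure_tensor K V W v w) v' = b v' w \<odot>\<^bsub>V\<^esub> v"
    if "v' \<in> carrier V'" "v \<in> carrier V" "w \<in> carrier W" for v' v w
    unfolding opL_def by (rule tlift_pure[OF V W vV c[OF that(1)] that(2,3)])
  have bc: "b v w \<in> carrier K" if "v \<in> carrier V'" "w \<in> carrier W" for v w
    using bilin_closed[OF b that] by simp
  show "opL V W b t \<in> module_hom K V' V" if t: "t \<in> carrier (tensor K V W)"
  proof (rule homI)
    fix u assume u: "u \<in> carrier V'"
    show "opL V W b t u \<in> carrier V" using hom_closed[OF h[OF u] t] .
    {
      fix v assume v: "v \<in> carrier V'"
      have uv: "u \<oplus>\<^bsub>V'\<^esub> v \<in> carrier V'" using V' u v by simp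
      show "opL V W b t (u \<oplus>\<^bsub>V'\<^esub> v) = opL V W b t u \<oplus>\<^bsub>V\<^esub> opL V W b t v"
        by (rule tensor_ext[OF V W vV h[OF uv] hom_plus[OF T vV h[OF u] h[OF v]] _ t])
          (simp add: p u v uv hom_add[OF bilin_l[OF b]] V.smult_l_distr bc)
    }
    fix k assume k: "k \<in> carrier K"
    have ku: "k \<odot>\<^bsub>V'\<^esub> u \<in> carrier V'" using V' k u by simp
    show "opL V W b t (k \<odot>\<^bsub>V'\<^esub> u) = k \<odot>\<^bsub>V\<^esub> opL V W b t u"
      by (rule tensor_ext[OF V W vV h[OF ku] hom_scale[OF T vV h[OF u] k] _ t])
        (simp add: p k u ku hom_smult[OF bilin_l[OF b]] V.smult_assoc1 bc)
  qed
qed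

end

context
  fixes V W :: "('k, ('k, 's) univ) module"
  assumes V: "fd_space K V" and W: "fd_space K W"
begin

lemma opR_facts:
  fixes W' :: "('k, 't) module"
  assumes W': "vs_ok W'" and b: "bilin V W' KK b"
  shows opR_hom_t: "w' \<in> carrier W' \<Longrightarrow> (\<lambda>t. opR V W b t w') \<in> module_hom K (tensor K V W) W"
    and opR_pure: "w' \<in> carrier W' \<Longrightarrow> v \<in> carrier V \<Longrightarrow> w \<in> carrier W \<Longrightarrow>
      opR V W b (pure_tensor K V W v w) w' = b v w' \<odot>\<^bsub>W\<^esub> w"
    and opR_hom: "t \<in> carrier (tensor K V W) \<Longrightarrow> opR V W b t \<in> module_hom K W' W"
proof -
  have b': "bilin W' V KK (\<lambda>w v. b v w)" using bilin_l[OF b] bilin_r[OF b] by (intro bilinI) auto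
  note br = lin_hom[OF tensor_braid_lin[OF V W]]
  show "w' \<in> carrier W' \<Longrightarrow> (\<lambda>t. opR V W b t w') \<in> module_hom K (tensor K V W) W"
    unfolding opR_def by (rule hom_comp[OF br opL_hom_t[OF W V W' b']])
  show "w' \<in> carrier W' \<Longrightarrow> v \<in> carrier V \<Longrightarrow> w \<in> carrier W \<Longrightarrow> opR V W b (pure_tensor K V W v w) w' = b v w' \<odot>\<^bsub>W\<^esub> w"
    by (simp add: opR_def tensor_braid_pure[OF V W] opL_pure[OF W V W' b'])
  show "t \<in> carrier (tensor K V W) \<Longrightarrow> opR V W b t \<in> module_hom K W' W"
    unfolding opR_def by (rule opL_hom[OF W V W' b' hom_closed[OF br]])
qed

text \<open>
  The operators on \<open>V\<close> and \<open>W\<close> given by \<open>t\<close> and \<open>b(v, w) = s(v \<otimes> w)\<close> are adjoint for \<open>b\<close>.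
\<close>

lemma op_adjoint:
  assumes s: "s \<in> module_hom K (tensor K V W) KK" and t: "t \<in> carrier (tensor K V W)"
    and v: "v \<in> carrier V" and w: "w \<in> carrier W"
  shows "s (pure_tensor K V W (opL V W (\<lambda>v w. s (pure_tensor K V W v w)) t v) w) =
         s (pure_tensor K V W v (opR V W (\<lambda>v w. s (pure_tensor K V W v w)) t w))"
proof -
  let ?b = "\<lambda>v w. s (pure_tensor K V W v w)"
  note vV = fd_vs[OF V] and vW = fd_vs[OF W] and pb = pure_bilin[OF V W]
  have b: "bilin V W KK ?b" using bilin_comp[OF pb id_hom id_hom s] .
  have bc: "?b v w \<in> carrier K" if "v \<in> carrier V" "w \<in> carrier W" for v w
    using bilin_closed[OF b that] by simp
  note f = hom_comp[OF opL_hom_t[OF V W vV b v] bilin_l[OF b w]]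
  note g = hom_comp[OF opR_hom_t[OF vW b w] bilin_r[OF b v]]
  show ?thesis
    by (rule tensor_ext[OF V W KK_vs f g _ t])
      (simp add: opL_pure[OF V W vV b] opR_pure[OF vW b] v w bc hom_smult[OF bilin_l[OF b]] hom_smult[OF bilin_r[OF b]] m_comm)
qed

text \<open>Every tensor is a finite sum of pure tensors.\<close>

lemma tensor_finsum:
  assumes t: "t \<in> carrier (tensor K V W)"
  shows "\<exists>(n::nat) a b. (\<forall>i<n. a i \<in> carrier V) \<and> (\<forall>i<n. b i \<in> carrier W) \<and>
     t = finsum (tensor K V W) (\<lambda>i. pure_tensor K V W (a i) (b i)) {..<n}"
proof -
  let ?T = "tensor K V W" and ?p = "pure_tensor K V W"
  note T = fd_vs[OF tensor_fd[OF V W]] and pc = pure_closed[OF V W] and pb = pure_bilin[OF V W]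
  interpret T: vectorspace K ?T by (rule T)
  let ?R = "\<lambda>(n::nat) a b t. (\<forall>i<n. a i \<in> carrier V) \<and> (\<forall>i<n. b i \<in> carrier W) \<and> t = finsum ?T (\<lambda>i. ?p (a i) (b i)) {..<n}"
  define S where "S = {t. \<exists>(n::nat) a b. ?R n a b t}"
  have cl: "finsum ?T (\<lambda>i. ?p (a i) (b i)) {..<n} \<in> carrier ?T"
    if "\<forall>i<n. a i \<in> carrier V" "\<forall>i<n. b i \<in> carrier W" for a b and n :: nat
    using that pc by (intro T.M.finsum_closed) auto
  have ins: "t \<oplus>\<^bsub>?T\<^esub> ?p v w \<in> S" if tS: "t \<in> S" and v: "v \<in> carrier V" and w: "w \<in> carrier W" for t v w
  proof -
    obtain n a b where r: "?R n a b t" using tS unfolding S_def by blast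
    let ?a = "a(n := v)" and ?b = "b(n := w)"
    have "finsum ?T (\<lambda>i. ?p (?a i) (?b i)) {..<Suc n} = ?p v w \<oplus>\<^bsub>?T\<^esub> finsum ?T (\<lambda>i. ?p (?a i) (?b i)) {..<n}"
      unfolding lessThan_Suc using r v w pc by (subst T.M.finsum_insert) auto
    also have "finsum ?T (\<lambda>i. ?p (?a i) (?b i)) {..<n} = t"
      using r pc by (auto intro!: T.M.finsum_cong')
    also have "?p v w \<oplus>\<^bsub>?T\<^esub> t = t \<oplus>\<^bsub>?T\<^esub> ?p v w" using r cl v w pc by (intro T.M.a_comm) auto
    finally have "?R (Suc n) ?a ?b (t \<oplus>\<^bsub>?T\<^esub> ?p v w)" using r v w by (auto simp: less_Suc_eq)
    then show ?thesis unfolding S_def by blast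
  qed
  have ScT: "S \<subseteq> carrier ?T" unfolding S_def using cl by auto
  have zS: "\<zero>\<^bsub>?T\<^esub> \<in> S" unfolding S_def by (auto intro!: exI[of _ 0])
  have "ssp S ?T"
  proof (rule sspI[OF T ScT zS])
    fix t t' assume t: "t \<in> S" and "t' \<in> S"
    then obtain n a b where r: "?R n a b t'" unfolding S_def by blast
    have "t \<oplus>\<^bsub>?T\<^esub> finsum ?T (\<lambda>i. ?p (a i) (b i)) {..<k} \<in> S" if "k \<le> n" for k
      using that
    proof (induction k)
      case 0
      then show ?case using t ScT by (auto simp: subset_iff)
    next
      case (Suc k)
      have rk: "\<forall>i<k. a i \<in> carrier V" "\<forall>i<k. b i \<in> carrier W" "a k \<in> carrier V" "b k \<in> carrier W"
        using r Suc.prems by auto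
      have "finsum ?T (\<lambda>i. ?p (a i) (b i)) {..<Suc k} = ?p (a k) (b k) \<oplus>\<^bsub>?T\<^esub> finsum ?T (\<lambda>i. ?p (a i) (b i)) {..<k}"
        unfolding lessThan_Suc using rk pc by (subst T.M.finsum_insert) auto
      then have "t \<oplus>\<^bsub>?T\<^esub> finsum ?T (\<lambda>i. ?p (a i) (b i)) {..<Suc k} =
          (t \<oplus>\<^bsub>?T\<^esub> finsum ?T (\<lambda>i. ?p (a i) (b i)) {..<k}) \<oplus>\<^bsub>?T\<^esub> ?p (a k) (b k)"
        using t ScT cl[OF rk(1,2)] pc[OF rk(3,4)] by (auto simp: T.M.a_ac subset_iff)
      then show ?case using ins[OF _ rk(3,4)] Suc by simp
    qed
    then show "t \<oplus>\<^bsub>?T\<^esub> t' \<in> S" using r by blast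
  next
    fix k t assume k: "k \<in> carrier K" and "t \<in> S"
    then obtain n a b where r: "?R n a b t" unfolding S_def by blast
    have "k \<odot>\<^bsub>?T\<^esub> t = finsum ?T (\<lambda>i. k \<odot>\<^bsub>?T\<^esub> ?p (a i) (b i)) {..<n}"
      using r k pc by (simp add: T.finsum_smult Pi_def)
    also have "\<dots> = finsum ?T (\<lambda>i. ?p (k \<odot>\<^bsub>V\<^esub> a i) (b i)) {..<n}"
      using r k pc fd_vs[OF V] hom_smult[OF bilin_l[OF pb]] by (intro T.M.finsum_cong') auto
    finally have "?R n (\<lambda>i. k \<odot>\<^bsub>V\<^esub> a i) b (k \<odot>\<^bsub>?T\<^esub> t)" using r k fd_vs[OF V] by auto
    then show "k \<odot>\<^bsub>?T\<^esub> t \<in> S" unfolding S_def by (intro CollectI exI)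
  qed
  moreover have "?p v w \<in> S" if "v \<in> carrier V" "w \<in> carrier W" for v w
    using ins[OF zS that] pc[OF that] by simp
  ultimately have "S = carrier ?T" by (rule tensor_generated[OF V W])
  then show ?thesis using t unfolding S_def by blast
qed

text \<open>
  Let \<open>p\<close> and \<open>q\<close> be the operators on \<open>V\<close> and \<open>W\<close> that a functional \<open>s\<close> and a tensor \<open>t\<close> induce, so that
  \<open>s t\<close> is the trace of \<open>p\<close>.  Suppose that the sets \<open>L\<close> with \<open>p L = L\<close> lie in \<open>A\<close>, those with \<open>q L = L\<close>
  lie in \<open>B\<close>, and \<open>s\<close> vanishes on the pure tensors of \<open>A\<close> and \<open>B\<close>.  The images of large powers of \<open>p\<close> and
  \<open>q\<close> lie in \<open>A\<close> and \<open>B\<close>, and by adjointness \<open>s(p\<^sup>m v \<otimes> w) = 0\<close> for large \<open>m\<close> and all \<open>v\<close>, \<open>w\<close>.  So the matrix of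
  \<open>p\<close> on the coefficients of a presentation \<open>t = \<Sum> a\<^sub>i \<otimes> c\<^sub>i\<close> is nilpotent, and its trace is \<open>s t\<close>.
\<close>

lemma trace_vanish:
  assumes s: "s \<in> module_hom K (tensor K V W) KK" and t: "t \<in> carrier (tensor K V W)"
    and HL: "\<And>L. L \<subseteq> carrier V \<Longrightarrow> opL V W (\<lambda>v w. s (pure_tensor K V W v w)) t ` L = L \<Longrightarrow> L \<subseteq> A"
    and HR: "\<And>L. L \<subseteq> carrier W \<Longrightarrow> opR V W (\<lambda>v w. s (pure_tensor K V W v w)) t ` L = L \<Longrightarrow> L \<subseteq> B"
    and van: "\<And>v w. v \<in> A \<Longrightarrow> w \<in> B \<Longrightarrow> s (pure_tensor K V W v w) = \<zero>"
  shows "s t = \<zero>"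
proof -
  let ?T = "tensor K V W" and ?p = "pure_tensor K V W"
  let ?b = "\<lambda>v w. s (?p v w)"
  note vV = fd_vs[OF V] and vW = fd_vs[OF W] and pb = pure_bilin[OF V W] and T = fd_vs[OF tensor_fd[OF V W]]
  interpret V: vectorspace K V by (rule vV)
  have b: "bilin V W KK ?b" using bilin_comp[OF pb id_hom id_hom s] .
  have bc: "?b v w \<in> carrier K" if "v \<in> carrier V" "w \<in> carrier W" for v w
    using bilin_closed[OF b that] by simp
  define p where "p = opL V W ?b t"
  define q where "q = opR V W ?b t"
  have p: "p \<in> module_hom K V V" unfolding p_def by (rule opL_hom[OF V W vV b t])
  have q: "q \<in> module_hom K W W" unfolding q_def by (rule opR_hom[OF vW b t])
  have adj1: "?b (p v) w = ?b v (q w)" if "v \<in> carrier V" "w \<in> carrier W" for v w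
    unfolding p_def q_def by (rule op_adjoint[OF s t that])
  have pn: "(p ^^ n) v \<in> carrier V" if "v \<in> carrier V" for n v using hom_closed[OF funpow_hom[OF p] that] .
  have qn: "(q ^^ n) w \<in> carrier W" if "w \<in> carrier W" for n w using hom_closed[OF funpow_hom[OF q] that] .
  have adj: "?b ((p ^^ n) v) w = ?b v ((q ^^ n) w)" if "v \<in> carrier V" "w \<in> carrier W" for n v w
    using that
  proof (induction n arbitrary: w)
    case (Suc n)
    have "?b ((p ^^ Suc n) v) w = ?b ((p ^^ n) v) (q w)" using Suc.prems adj1 pn by simp
    also have "\<dots> = ?b v ((q ^^ n) (q w))" using Suc hom_closed[OF q] by simp
    finally show ?case by (simp add: funpow_swap1)
  qed simp
  obtain m1 where m1: "p ` ((p ^^ m1) ` carrier V) = (p ^^ m1) ` carrier V" using stable_image[OF V p] by blast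
  obtain m2 where m2: "q ` ((q ^^ m2) ` carrier W) = (q ^^ m2) ` carrier W" using stable_image[OF W q] by blast
  have A: "(p ^^ m1) ` carrier V \<subseteq> A" by (rule HL) (use m1 pn in \<open>auto simp: p_def\<close>)
  have B: "(q ^^ m2) ` carrier W \<subseteq> B" by (rule HR) (use m2 qn in \<open>auto simp: q_def\<close>)
  define m where "m = m2 + m1"
  have z: "?b ((p ^^ m) v) w = \<zero>" if v: "v \<in> carrier V" and w: "w \<in> carrier W" for v w
  proof -
    have "(p ^^ m) v = (p ^^ m2) ((p ^^ m1) v)" unfolding m_def by (simp add: funpow_add)
    then have "?b ((p ^^ m) v) w = ?b ((p ^^ m1) v) ((q ^^ m2) w)" using adj[OF pn[OF v] w] by simp
    also have "\<dots> = \<zero>" using van A B v w by blast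
    finally show ?thesis .
  qed
  obtain n :: nat and a c where ac: "\<forall>i<n. a i \<in> carrier V" "\<forall>i<n. c i \<in> carrier W"
    and teq: "t = finsum ?T (\<lambda>i. ?p (a i) (c i)) {..<n}"
    using tensor_finsum[OF t] by blast
  let ?I = "{..<n}"
  \<comment> \<open>The \<open>a\<^sub>i\<close> need not be independent: \<open>M\<close> acts on coefficient vectors, and \<open>vec\<close> intertwines it with \<open>p\<close>.\<close>
  define M where "M i j = ?b (a j) (c i)" for i j
  have M: "M i j \<in> carrier K" if "i \<in> ?I" "j \<in> ?I" for i j using that ac bc by (simp add: M_def)
  define vec where "vec x = finsum V (\<lambda>j. x j \<odot>\<^bsub>V\<^esub> a j) ?I" for x
  have pv: "p v = finsum V (\<lambda>i. ?b v (c i) \<odot>\<^bsub>V\<^esub> a i) ?I" if v: "v \<in> carrier V" for v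
  proof -
    have "p v = finsum V (\<lambda>i. opL V W ?b (?p (a i) (c i)) v) ?I"
      unfolding p_def teq using ac pure_closed[OF V W] by (intro hom_finsum[OF T vV opL_hom_t[OF V W vV b v]]) auto
    also have "\<dots> = finsum V (\<lambda>i. ?b v (c i) \<odot>\<^bsub>V\<^esub> a i) ?I"
      using ac bc v by (intro V.M.finsum_cong') (auto simp: opL_pure[OF V W vV b])
    finally show ?thesis .
  qed
  have vecc: "vec x \<in> carrier V" if "\<And>j. j \<in> ?I \<Longrightarrow> x j \<in> carrier K" for x
    unfolding vec_def using that ac by (intro V.M.finsum_closed) auto
  have bvec: "?b (vec x) (c i) = mat_op ?I M x i" if x: "\<And>j. j \<in> ?I \<Longrightarrow> x j \<in> carrier K" and i: "i \<in> ?I" for x i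
  proof -
    have ci: "c i \<in> carrier W" using ac i by simp
    have "?b (vec x) (c i) = finsum KK (\<lambda>j. ?b (x j \<odot>\<^bsub>V\<^esub> a j) (c i)) ?I"
      unfolding vec_def using x ac by (intro hom_finsum[OF vV KK_vs bilin_l[OF b ci]]) auto
    also have "\<dots> = mat_op ?I M x i"
      unfolding KK_finsum mat_op_def using x ac ci bc hom_smult[OF bilin_l[OF b ci]]
      by (intro finsum_cong') (auto simp: M_def m_comm)
    finally show ?thesis .
  qed
  have matc: "(mat_op ?I M ^^ k) x i \<in> carrier K" if x: "\<And>j. j \<in> ?I \<Longrightarrow> x j \<in> carrier K" and i: "i \<in> ?I" for x i k
    by (rule mat_op_closed) (use M x i in auto)
  have matc1: "mat_op ?I M x i \<in> carrier K" if x: "\<And>j. j \<in> ?I \<Longrightarrow> x j \<in> carrier K" and i: "i \<in> ?I" for x i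
    using matc[of x i 1] x i by simp
  have pvec: "p (vec x) = vec (mat_op ?I M x)" if x: "\<And>j. j \<in> ?I \<Longrightarrow> x j \<in> carrier K" for x
  proof -
    have vx: "vec x \<in> carrier V" by (rule vecc) (rule x)
    show ?thesis
      unfolding pv[OF vx] vec_def[of "mat_op _ _ _"]
    proof (intro V.M.finsum_cong' refl)
      show "(\<lambda>j. mat_op ?I M x j \<odot>\<^bsub>V\<^esub> a j) \<in> ?I \<rightarrow> carrier V" using ac matc1[of x] x by auto
      show "?b (vec x) (c i) \<odot>\<^bsub>V\<^esub> a i = mat_op ?I M x i \<odot>\<^bsub>V\<^esub> a i" if "i \<in> ?I" for i
        using bvec[of x i] x that by simp
    qed
  qed
  have pvecn: "(p ^^ k) (vec x) = vec ((mat_op ?I M ^^ k) x)" if x: "\<And>j. j \<in> ?I \<Longrightarrow> x j \<in> carrier K" for x k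
  proof (induction k)
    case (Suc k)
    then show ?case using pvec[of "(mat_op ?I M ^^ k) x"] matc[of x] x by simp
  qed simp
  have nil: "(mat_op ?I M ^^ Suc m) x i = \<zero>" if x: "\<And>j. j \<in> ?I \<Longrightarrow> x j \<in> carrier K" and i: "i \<in> ?I" for x i
  proof -
    have pn': "(p ^^ m) (vec x) = vec ((mat_op ?I M ^^ m) x)" by (rule pvecn) (rule x)
    have "?b (vec ((mat_op ?I M ^^ m) x)) (c i) = mat_op ?I M ((mat_op ?I M ^^ m) x) i"
      by (rule bvec[OF _ i]) (rule matc, rule x)
    then have "(mat_op ?I M ^^ Suc m) x i = ?b ((p ^^ m) (vec x)) (c i)" unfolding pn' by simp
    moreover have "vec x \<in> carrier V" by (rule vecc) (rule x)
    ultimately show ?thesis using z ac i by simp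
  qed
  have "s t = finsum KK (\<lambda>i. ?b (a i) (c i)) ?I"
    unfolding teq using ac pure_closed[OF V W] by (intro hom_finsum[OF T KK_vs s]) auto
  also have "\<dots> = (\<Oplus>i\<in>?I. M i i)" unfolding KK_finsum M_def ..
  also have "\<dots> = \<zero>" using nilpotent_trace[OF _ M nil] by simp
  finally show ?thesis .
qed

end

text \<open>
  Naturality of the contraction: applying \<open>f \<otimes> g\<close> to the tensor amounts to pulling the form back along
  \<open>g\<close> and applying \<open>f\<close> to the result.
\<close>

lemma opL_arrow:
  fixes V W V2 W2 :: "('k, ('k, 's) univ) module" and V' :: "('k, 't) module"
  assumes V: "fd_space K V" and W: "fd_space K W" and V2: "fd_space K V2" and W2: "fd_space K W2"
    and f: "f \<in> module_hom K V V2" and g: "g \<in> module_hom K W W2"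
    and V': "vs_ok V'" and b: "bilin V' W2 KK b" and t: "t \<in> carrier (tensor K V W)" and v': "v' \<in> carrier V'"
  shows "opL V2 W2 b (tensor_map K V V2 W W2 f g t) v' = f (opL V W (\<lambda>v w. b v (g w)) t v')"
proof -
  have b': "bilin V' W KK (\<lambda>v w. b v (g w))" using bilin_comp[OF b id_hom g id_hom] .
  have bc: "b v w \<in> carrier K" if "v \<in> carrier V'" "w \<in> carrier W2" for v w
    using bilin_closed[OF b that] by simp
  show ?thesis
    by (rule tensor_ext[OF V W fd_vs[OF V2] hom_comp[OF tensor_map_hom[OF V W V2 W2 f g] opL_hom_t[OF V2 W2 V' b v']]
          hom_comp[OF opL_hom_t[OF V W V' b' v'] f] _ t])
      (simp add: tensor_map_pure[OF V W V2 W2 f g] opL_pure[OF V2 W2 V' b] opL_pure[OF V W V' b'] v'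
        hom_closed[OF f] hom_closed[OF g] hom_smult[OF f] bc)
qed

end

section \<open>The maximal epimorphic subrepresentation of a tensor product\<close>

context quiver
begin

text \<open>
  A criterion for lying in the maximal epimorphic subrepresentation.  Given are operators \<open>Op x\<close> on the
  \<open>V\<^sub>x\<close> and, for each arrow \<open>a\<close>, maps \<open>U a\<close> from \<open>V\<^sub>h\<^sub>a\<close> back to \<open>V\<^sub>t\<^sub>a\<close> such that the operators at the tail are
  exactly the \<open>u V\<^sub>a\<close> and those at the head exactly the \<open>V\<^sub>a u\<close>.  Let \<open>\<Phi>\<^sub>x(L)\<close> be the span of the images of \<open>L\<close> under
  the operators at \<open>x\<close>.  The largest \<open>G\<^sub>x\<close> with \<open>\<Phi>\<^sub>x(G\<^sub>x) = G\<^sub>x\<close> form an epimorphic subrepresentation, and \<open>G\<^sub>x\<close>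
  contains every set that some operator at \<open>x\<close> maps onto itself.
\<close>

lemma stable_in_epi:
  fixes V :: "('k, ('k, 's) univ, 'v, 'a) quiver_rep"
    and Op :: "'v \<Rightarrow> (('k, 's) univ \<Rightarrow> ('k, 's) univ) set" and U :: "'a \<Rightarrow> (('k, 's) univ \<Rightarrow> ('k, 's) univ) set"
  assumes V: "rep V"
    and Oh: "\<And>x f. x \<in> verts Q \<Longrightarrow> f \<in> Op x \<Longrightarrow> f \<in> module_hom K (vsp V x) (vsp V x)"
    and Uh: "\<And>a u. a \<in> arcs Q \<Longrightarrow> u \<in> U a \<Longrightarrow> u \<in> module_hom K (vsp V (head Q a)) (vsp V (tail Q a))"
    and OtU: "\<And>a f. a \<in> arcs Q \<Longrightarrow> f \<in> Op (tail Q a) \<Longrightarrow> \<exists>u\<in>U a. \<forall>v\<in>carrier (vsp V (tail Q a)). f v = u (amap V a v)"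
    and UOt: "\<And>a u. a \<in> arcs Q \<Longrightarrow> u \<in> U a \<Longrightarrow> \<exists>f\<in>Op (tail Q a). \<forall>v\<in>carrier (vsp V (tail Q a)). f v = u (amap V a v)"
    and OhU: "\<And>a f. a \<in> arcs Q \<Longrightarrow> f \<in> Op (head Q a) \<Longrightarrow> \<exists>u\<in>U a. \<forall>v\<in>carrier (vsp V (head Q a)). f v = amap V a (u v)"
    and UOh: "\<And>a u. a \<in> arcs Q \<Longrightarrow> u \<in> U a \<Longrightarrow> \<exists>f\<in>Op (head Q a). \<forall>v\<in>carrier (vsp V (head Q a)). f v = amap V a (u v)"
    and x: "x \<in> verts Q" and L: "L \<subseteq> carrier (vsp V x)" and f: "f \<in> Op x" and fL: "f ` L = L"
  shows "L \<subseteq> epi V x"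
proof -
  define S where "S x L = (\<Union>f\<in>Op x. f ` (L \<inter> carrier (vsp V x)))" for x L
  define \<Phi> where "\<Phi> x L = (if x \<in> verts Q then vspan (vsp V x) (S x L) else {})" for x L
  define G where "G x = gfp (\<Phi> x)" for x
  have Sc: "S x L \<subseteq> carrier (vsp V x)" if "x \<in> verts Q" for x L
    unfolding S_def using hom_closed[OF Oh[OF that]] by blast
  have mono: "mono (\<Phi> x)" for x
  proof (rule monoI)
    fix A B :: "('k, 's) univ set" assume "A \<subseteq> B"
    then have "S x A \<subseteq> S x B" unfolding S_def by blast
    then show "\<Phi> x A \<subseteq> \<Phi> x B" unfolding \<Phi>_def using span_mono[OF rep_vs[OF V]] by auto
  qed
  have \<Phi>s: "ssp (\<Phi> x L) (vsp V x)" if "x \<in> verts Q" for x L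
    unfolding \<Phi>_def using ssp_span[OF rep_vs[OF V that] Sc[OF that]] that by simp
  have \<Phi>I: "f v \<in> \<Phi> x L" if "x \<in> verts Q" "f \<in> Op x" "v \<in> L" "v \<in> carrier (vsp V x)" for x f v L
  proof -
    have "f v \<in> S x L" unfolding S_def using that by blast
    then show ?thesis unfolding \<Phi>_def using span_sup[OF rep_vs[OF V that(1)] Sc[OF that(1)]] that(1) by auto
  qed
  have \<Phi>L: "\<Phi> x L \<subseteq> N" if "x \<in> verts Q" "ssp N (vsp V x)"
    "\<And>f v. f \<in> Op x \<Longrightarrow> v \<in> L \<Longrightarrow> v \<in> carrier (vsp V x) \<Longrightarrow> f v \<in> N" for x L N
    unfolding \<Phi>_def using span_least[OF that(2), of "S x L"] that by (auto simp: S_def)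
  have Gfix: "G x = \<Phi> x (G x)" for x unfolding G_def by (rule gfp_unfold[OF mono])
  have Gup: "L \<subseteq> G x" if "L \<subseteq> \<Phi> x L" for x L unfolding G_def using that by (rule gfp_upperbound)
  have Gs: "ssp (G x) (vsp V x)" if "x \<in> verts Q" for x using \<Phi>s[OF that, of "G x"] Gfix[of x] by simp
  have "episub V G"
  proof (rule episubI[OF Gs])
    fix a assume a: "a \<in> arcs Q"
    let ?t = "tail Q a" and ?h = "head Q a"
    note tv = tail_v[OF a] and hv = head_v[OF a] and m = rep_mhom[OF V a]
    have gt: "v \<in> carrier (vsp V ?t)" if "v \<in> G ?t" for v using ssp_mem[OF Gs[OF tv] that] .
    have gh: "v \<in> carrier (vsp V ?h)" if "v \<in> G ?h" for v using ssp_mem[OF Gs[OF hv] that] .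
    have "\<Phi> ?t (G ?t) \<subseteq> {v \<in> carrier (vsp V ?t). amap V a v \<in> \<Phi> ?h (amap V a ` G ?t)}"
    proof (rule \<Phi>L[OF tv ssp_vimage[OF rep_vs[OF V tv] m \<Phi>s[OF hv]]])
      fix f v assume f: "f \<in> Op ?t" and v: "v \<in> G ?t" "v \<in> carrier (vsp V ?t)"
      obtain u where u: "u \<in> U a" "\<forall>v\<in>carrier (vsp V ?t). f v = u (amap V a v)" using OtU[OF a f] by blast
      obtain g where g: "g \<in> Op ?h" "\<forall>v\<in>carrier (vsp V ?h). g v = amap V a (u v)" using UOh[OF a u(1)] by blast
      have mv: "amap V a v \<in> carrier (vsp V ?h)" using hom_closed[OF m v(2)] .
      have "amap V a (f v) = g (amap V a v)" using u g v mv by simp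
      moreover have "g (amap V a v) \<in> \<Phi> ?h (amap V a ` G ?t)" using \<Phi>I[OF hv g(1) _ mv] v by blast
      ultimately show "f v \<in> {v \<in> carrier (vsp V ?t). amap V a v \<in> \<Phi> ?h (amap V a ` G ?t)}"
        using hom_closed[OF Oh[OF tv f] v(2)] by simp
    qed
    then have "amap V a ` G ?t \<subseteq> \<Phi> ?h (amap V a ` G ?t)" using Gfix[of ?t] by auto
    from Gup[OF this] show "v \<in> G ?t \<Longrightarrow> amap V a v \<in> G ?h" for v by blast
    \<comment> \<open>For surjectivity of \<open>V\<^sub>a\<close> on \<open>G\<close>: the maps of \<open>U a\<close> carry \<open>G\<close> at the head into \<open>G\<close> at the tail.\<close>
    define L' where "L' = {u v | u v. u \<in> U a \<and> v \<in> G ?h}"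
    have L'c: "L' \<subseteq> carrier (vsp V ?t)" unfolding L'_def using hom_closed[OF Uh[OF a]] gh by blast
    have "L' \<subseteq> \<Phi> ?t L'"
    proof
      fix w assume "w \<in> L'"
      then obtain u v where u: "u \<in> U a" "v \<in> G ?h" "w = u v" unfolding L'_def by blast
      obtain f where f: "f \<in> Op ?t" "\<forall>v\<in>carrier (vsp V ?t). f v = u (amap V a v)" using UOt[OF a u(1)] by blast
      have "\<Phi> ?h (G ?h) \<subseteq> {v \<in> carrier (vsp V ?h). u v \<in> \<Phi> ?t L'}"
      proof (rule \<Phi>L[OF hv ssp_vimage[OF rep_vs[OF V hv] Uh[OF a u(1)] \<Phi>s[OF tv]]])
        fix g v assume g: "g \<in> Op ?h" and v: "v \<in> G ?h" "v \<in> carrier (vsp V ?h)"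
        obtain u' where u': "u' \<in> U a" "\<forall>v\<in>carrier (vsp V ?h). g v = amap V a (u' v)" using OhU[OF a g] by blast
        have uv: "u' v \<in> L'" "u' v \<in> carrier (vsp V ?t)" using u' v L'c unfolding L'_def by blast+
        have "u (g v) = f (u' v)" using u' f v uv by simp
        then have "u (g v) \<in> \<Phi> ?t L'" using \<Phi>I[OF tv f(1) uv] by simp
        then show "g v \<in> {v \<in> carrier (vsp V ?h). u v \<in> \<Phi> ?t L'}" using hom_closed[OF Oh[OF hv g] v(2)] by simp
      qed
      then show "w \<in> \<Phi> ?t L'" using u Gfix[of ?h] by blast
    qed
    from Gup[OF this] have L'G: "L' \<subseteq> G ?t" .
    have "\<Phi> ?h (G ?h) \<subseteq> amap V a ` G ?t"
    proof (rule \<Phi>L[OF hv ssp_image[OF Gs[OF tv] m rep_vs[OF V hv]]])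
      fix g v assume g: "g \<in> Op ?h" and v: "v \<in> G ?h" "v \<in> carrier (vsp V ?h)"
      obtain u' where u': "u' \<in> U a" "\<forall>v\<in>carrier (vsp V ?h). g v = amap V a (u' v)" using OhU[OF a g] by blast
      then have "u' v \<in> G ?t" using L'G v unfolding L'_def by blast
      then show "g v \<in> amap V a ` G ?t" using u' v by blast
    qed
    then show "w \<in> G ?h \<Longrightarrow> \<exists>v\<in>G ?t. w = amap V a v" for w using Gfix[of ?h] by blast
  qed
  moreover have "L \<subseteq> \<Phi> x L"
  proof
    fix v assume "v \<in> L"
    then obtain w where "w \<in> L" "v = f w" using fL by blast
    then show "v \<in> \<Phi> x L" using \<Phi>I[OF x f] L by blast
  qed
  ultimately show ?thesis using Gup epi_upper[OF V _ x] by blast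
qed

context
  fixes V W :: "('k, ('k, 's) univ, 'v, 'a) quiver_rep"
  assumes V: "rep V" and W: "rep W"
begin

abbreviation (input) "VW \<equiv> rep_tensor K Q V W"

lemma VW_vsp [simp]: "vsp VW x = tensor K (vsp V x) (vsp W x)"
  by (simp add: rep_tensor_def)

lemma VW_amap: "amap VW a = tensor_map K (vsp V (tail Q a)) (vsp V (head Q a))
                   (vsp W (tail Q a)) (vsp W (head Q a)) (amap V a) (amap W a)"
  by (simp add: rep_tensor_def)

lemma VW_pure:
  assumes a: "a \<in> arcs Q" and "v \<in> carrier (vsp V (tail Q a))" "w \<in> carrier (vsp W (tail Q a))"
  shows "amap VW a (pure_tensor K (vsp V (tail Q a)) (vsp W (tail Q a)) v w) =
    pure_tensor K (vsp V (head Q a)) (vsp W (head Q a)) (amap V a v) (amap W a w)"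
  unfolding VW_amap
  by (rule tensor_map_pure[OF rep_fd[OF V tail_v[OF a]] rep_fd[OF W tail_v[OF a]] rep_fd[OF V head_v[OF a]]
      rep_fd[OF W head_v[OF a]] rep_mhom[OF V a] rep_mhom[OF W a] assms(2,3)])

lemma VW_rep: "rep VW"
  unfolding is_rep_def VW_vsp VW_amap
  using tensor_fd[OF rep_fd[OF V] rep_fd[OF W]]
    tensor_map_lin[OF rep_fd[OF V tail_v] rep_fd[OF W tail_v] rep_fd[OF V head_v] rep_fd[OF W head_v] rep_mhom[OF V] rep_mhom[OF W]]
  by blast

text \<open>
  Let \<open>T\<close> be an epimorphic and \<open>X\<close> a saturated subrepresentation of \<open>V \<otimes> W\<close>.  The operators on the \<open>V\<^sub>x\<close>
  that come from \<open>t \<in> T\<^sub>x\<close> and functionals \<open>s\<close> vanishing on \<open>X\<^sub>x\<close> meet the criterion above, where \<open>U a\<close> consists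
  of the contractions of \<open>t\<close> at the tail with \<open>s\<close> at the head: tensors in \<open>T\<close> lift against an arrow and
  functionals vanishing on \<open>X\<close> are pushed along it.
\<close>

lemma stable_left:
  assumes T: "episub VW T" and X: "satsub VW X" and x: "x \<in> verts Q" and t: "t \<in> T x"
    and sh: "s \<in> module_hom K (vsp VW x) KK" and sX: "\<forall>t\<in>X x. s t = \<zero>"
    and L: "L \<subseteq> carrier (vsp V x)"
    and fL: "opL (vsp V x) (vsp W x) (\<lambda>v w. s (pure_tensor K (vsp V x) (vsp W x) v w)) t ` L = L"
  shows "L \<subseteq> epi V x"
proof -
  let ?P = "\<lambda>x. pure_tensor K (vsp V x) (vsp W x)"
  note fV = rep_fd[OF V] and fW = rep_fd[OF W]
  define F where "F x = {s. s \<in> module_hom K (vsp VW x) KK \<and> (\<forall>t\<in>X x. s t = \<zero>)}" for x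
  define B :: "'v \<Rightarrow> (('k, 's) univ \<Rightarrow> 'k) \<Rightarrow> ('k, 's) univ \<Rightarrow> ('k, 's) univ \<Rightarrow> 'k" where "B x s = (\<lambda>v w. s (?P x v w))" for x s
  have s: "s \<in> F x" using sh sX by (simp add: F_def)
  have Tc: "t \<in> carrier (tensor K (vsp V x) (vsp W x))" if "x \<in> verts Q" "t \<in> T x" for x t
    using ssp_mem[OF subrep_ssp[OF episub_subrep[OF T] that(1)] that(2)] by simp
  have Fh: "s \<in> module_hom K (tensor K (vsp V x) (vsp W x)) KK" if "s \<in> F x" for s x
    using that by (simp add: F_def)
  have Bb: "bilin (vsp V x) (vsp W x) KK (B x s)" if "x \<in> verts Q" "s \<in> F x" for x s
    unfolding B_def using bilin_comp[OF pure_bilin[OF fV fW] id_hom id_hom Fh] that by auto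
  have Fdown: "\<exists>r\<in>F (tail Q a). \<forall>t\<in>carrier (vsp VW (tail Q a)). r t = s (amap VW a t)"
    if a: "a \<in> arcs Q" and s: "s \<in> F (head Q a)" for a s
    using hom_comp[OF rep_mhom[OF VW_rep a], of s KK] s subrep_arr[OF satsub_subrep[OF X] a]
    unfolding F_def by (intro bexI[of _ "\<lambda>t. s (amap VW a t)"]) auto
  have Fup: "\<exists>r\<in>F (head Q a). \<forall>t\<in>carrier (vsp VW (tail Q a)). s t = r (amap VW a t)"
    if a: "a \<in> arcs Q" and s: "s \<in> F (tail Q a)" for a s
  proof -
    have "\<exists>r. r \<in> module_hom K (vsp VW (head Q a)) KK \<and> (\<forall>b\<in>X (head Q a). r b = \<zero>) \<and>
        (\<forall>t\<in>carrier (vsp VW (tail Q a)). r (amap VW a t) = s t)"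
      by (rule functional_push[OF rep_vs[OF VW_rep tail_v[OF a]] rep_fd[OF VW_rep head_v[OF a]]
            subrep_ssp[OF satsub_subrep[OF X] head_v[OF a]] rep_mhom[OF VW_rep a]])
        (use s satsubD[OF X a] in \<open>auto simp: F_def\<close>)
    then show ?thesis unfolding F_def by auto
  qed
  define OL where "OL x = {opL (vsp V x) (vsp W x) (B x s) t | s t. s \<in> F x \<and> t \<in> T x}" for x
  define UL where "UL a = {opL (vsp V (tail Q a)) (vsp W (tail Q a)) (\<lambda>v w. B (head Q a) s v (amap W a w)) t | s t.
     s \<in> F (head Q a) \<and> t \<in> T (tail Q a)}" for a
  have PU: "?P (tail Q a) v w \<in> carrier (vsp VW (tail Q a))"
    if "a \<in> arcs Q" "v \<in> carrier (vsp V (tail Q a))" "w \<in> carrier (vsp W (tail Q a))" for a v w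
    using pure_closed[OF fV[OF tail_v] fW[OF tail_v]] that by simp
  have e1: "opL (vsp V (tail Q a)) (vsp W (tail Q a)) (B (tail Q a) r) t v =
      opL (vsp V (tail Q a)) (vsp W (tail Q a)) (\<lambda>v w. B (head Q a) s v (amap W a w)) t (amap V a v)"
    if "a \<in> arcs Q" "\<forall>t\<in>carrier (vsp VW (tail Q a)). r t = s (amap VW a t)" "v \<in> carrier (vsp V (tail Q a))" for a r s t v
    using that PU by (intro opL_cong) (simp add: B_def VW_pure)
  have e2: "opL (vsp V (head Q a)) (vsp W (head Q a)) (B (head Q a) s) (amap VW a t) v =
      amap V a (opL (vsp V (tail Q a)) (vsp W (tail Q a)) (\<lambda>v w. B (head Q a) s v (amap W a w)) t v)"
    if a: "a \<in> arcs Q" "s \<in> F (head Q a)" "t \<in> T (tail Q a)" "v \<in> carrier (vsp V (head Q a))" for a s t v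
    unfolding VW_amap
    by (rule opL_arrow[OF fV fW fV fW rep_mhom[OF V] rep_mhom[OF W] fd_vs[OF fV] Bb Tc])
      (use a in auto)
  show ?thesis
  proof (rule stable_in_epi[OF V, of OL UL])
    show "f \<in> module_hom K (vsp V x) (vsp V x)" if "x \<in> verts Q" "f \<in> OL x" for x f
      using that opL_hom[OF fV fW fd_vs[OF fV] Bb Tc] unfolding OL_def by blast
    show "u \<in> module_hom K (vsp V (head Q a)) (vsp V (tail Q a))" if a: "a \<in> arcs Q" and u: "u \<in> UL a" for a u
    proof -
      obtain s t where st: "s \<in> F (head Q a)" "t \<in> T (tail Q a)"
        "u = opL (vsp V (tail Q a)) (vsp W (tail Q a)) (\<lambda>v w. B (head Q a) s v (amap W a w)) t"
        using u unfolding UL_def by blast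
      have "bilin (vsp V (head Q a)) (vsp W (tail Q a)) KK (\<lambda>v w. B (head Q a) s v (amap W a w))"
        using bilin_comp[OF Bb[OF head_v[OF a] st(1)] id_hom rep_mhom[OF W a] id_hom] .
      from opL_hom[OF fV[OF tail_v[OF a]] fW[OF tail_v[OF a]] fd_vs[OF fV[OF head_v[OF a]]] this Tc[OF tail_v[OF a] st(2)]]
      show ?thesis unfolding st(3) .
    qed
    show "\<exists>u\<in>UL a. \<forall>v\<in>carrier (vsp V (tail Q a)). f v = u (amap V a v)" if a: "a \<in> arcs Q" and f: "f \<in> OL (tail Q a)" for a f
    proof -
      obtain s t where st: "s \<in> F (tail Q a)" "t \<in> T (tail Q a)" "f = opL (vsp V (tail Q a)) (vsp W (tail Q a)) (B (tail Q a) s) t"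
        using f unfolding OL_def by blast
      obtain r where r: "r \<in> F (head Q a)" "\<forall>t\<in>carrier (vsp VW (tail Q a)). s t = r (amap VW a t)" using Fup[OF a st(1)] by blast
      show ?thesis unfolding UL_def st(3) using e1[OF a r(2)] r(1) st(2) by blast
    qed
    show "\<exists>f\<in>OL (tail Q a). \<forall>v\<in>carrier (vsp V (tail Q a)). f v = u (amap V a v)" if a: "a \<in> arcs Q" and u: "u \<in> UL a" for a u
    proof -
      obtain s t where st: "s \<in> F (head Q a)" "t \<in> T (tail Q a)"
        "u = opL (vsp V (tail Q a)) (vsp W (tail Q a)) (\<lambda>v w. B (head Q a) s v (amap W a w)) t"
        using u unfolding UL_def by blast
      obtain r where r: "r \<in> F (tail Q a)" "\<forall>t\<in>carrier (vsp VW (tail Q a)). r t = s (amap VW a t)" using Fdown[OF a st(1)] by blast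
      show ?thesis unfolding OL_def st(3) using e1[OF a r(2)] r(1) st(2) by blast
    qed
    show "\<exists>u\<in>UL a. \<forall>v\<in>carrier (vsp V (head Q a)). f v = amap V a (u v)" if a: "a \<in> arcs Q" and f: "f \<in> OL (head Q a)" for a f
    proof -
      obtain s t where st: "s \<in> F (head Q a)" "t \<in> T (head Q a)" "f = opL (vsp V (head Q a)) (vsp W (head Q a)) (B (head Q a) s) t"
        using f unfolding OL_def by blast
      from episub_surj[OF T a st(2)] obtain t' where t': "t' \<in> T (tail Q a)" "t = amap VW a t'" .
      show ?thesis unfolding UL_def st(3) t'(2) using e2[OF a st(1) t'(1)] st(1) t'(1) by blast
    qed
    show "\<exists>f\<in>OL (head Q a). \<forall>v\<in>carrier (vsp V (head Q a)). f v = amap V a (u v)" if a: "a \<in> arcs Q" and u: "u \<in> UL a" for a u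
    proof -
      obtain s t where st: "s \<in> F (head Q a)" "t \<in> T (tail Q a)"
        "u = opL (vsp V (tail Q a)) (vsp W (tail Q a)) (\<lambda>v w. B (head Q a) s v (amap W a w)) t"
        using u unfolding UL_def by blast
      show ?thesis unfolding OL_def st(3) using e2[OF a st(1,2)] st(1) subrep_arr[OF episub_subrep[OF T] a st(2)] by blast
    qed
    show "opL (vsp V x) (vsp W x) (B x s) t \<in> OL x" unfolding OL_def using s t unfolding B_def by blast
  qed (use L fL x in \<open>simp_all add: B_def\<close>)
qed

end

lemma rbraid_rhom:
  fixes X Y :: "('k, ('k, 's) univ, 'v, 'a) quiver_rep"
  assumes X: "rep X" and Y: "rep Y"
  shows "(\<lambda>x\<in>verts Q. tensor_braid K (vsp X x) (vsp Y x)) \<in> rep_hom K Q (rep_tensor K Q X Y) (rep_tensor K Q Y X)"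
    (is "?h \<in> _")
proof (rule rhomI)
  note tb = tensor_braid_facts[OF rep_fd[OF X] rep_fd[OF Y]]
  show "?h x \<in> lin K (vsp (rep_tensor K Q X Y) x) (vsp (rep_tensor K Q Y X) x)" if x: "x \<in> verts Q" for x
    using tb(1)[OF x x] x by (simp add: VW_vsp[OF X Y] VW_vsp[OF Y X])
  fix a t assume a: "a \<in> arcs Q" and t: "t \<in> carrier (vsp (rep_tensor K Q X Y) (tail Q a))"
  note tv = tail_v[OF a] and hv = head_v[OF a]
  let ?T = "\<lambda>x. tensor_braid K (vsp X x) (vsp Y x)"
  note l = hom_comp[OF rep_mhom[OF VW_rep[OF X Y] a, unfolded VW_vsp[OF X Y]] lin_hom[OF tb(1)[OF hv hv]]]
  note r = hom_comp[OF lin_hom[OF tb(1)[OF tv tv]] rep_mhom[OF VW_rep[OF Y X] a, unfolded VW_vsp[OF Y X]]]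
  have "?T (head Q a) (amap (rep_tensor K Q X Y) a t) = amap (rep_tensor K Q Y X) a (?T (tail Q a) t)"
  proof (rule tensor_ext[OF rep_fd[OF X tv] rep_fd[OF Y tv] fd_vs[OF tensor_fd[OF rep_fd[OF Y hv] rep_fd[OF X hv]]] l r])
    fix v w assume v: "v \<in> carrier (vsp X (tail Q a))" and w: "w \<in> carrier (vsp Y (tail Q a))"
    have cv: "amap X a v \<in> carrier (vsp X (head Q a))" "amap Y a w \<in> carrier (vsp Y (head Q a))"
      using hom_closed[OF rep_mhom[OF X a] v] hom_closed[OF rep_mhom[OF Y a] w] by auto
    show "?T (head Q a) (amap (rep_tensor K Q X Y) a (pure_tensor K (vsp X (tail Q a)) (vsp Y (tail Q a)) v w)) =
      amap (rep_tensor K Q Y X) a (?T (tail Q a) (pure_tensor K (vsp X (tail Q a)) (vsp Y (tail Q a)) v w))"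
      unfolding VW_pure[OF X Y a v w] tb(2)[OF hv hv cv] tb(2)[OF tv tv v w] VW_pure[OF Y X a w v] ..
  qed (use t in \<open>simp add: VW_vsp[OF X Y]\<close>)
  then show "?h (head Q a) (amap (rep_tensor K Q X Y) a t) = amap (rep_tensor K Q Y X) a (?h (tail Q a) t)"
    using tv hv by simp
qed simp

text \<open>The mirror image of \<open>stable_left\<close>, by transport along the braiding.\<close>

lemma stable_right:
  fixes V W :: "('k, ('k, 's) univ, 'v, 'a) quiver_rep"
  assumes V: "rep V" and W: "rep W" and T: "episub (rep_tensor K Q V W) T" and X: "satsub (rep_tensor K Q V W) X"
    and x: "x \<in> verts Q" and t: "t \<in> T x"
    and sh: "s \<in> module_hom K (vsp (rep_tensor K Q V W) x) KK" and sX: "\<forall>t\<in>X x. s t = \<zero>"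
    and L: "L \<subseteq> carrier (vsp W x)"
    and fL: "opR (vsp V x) (vsp W x) (\<lambda>v w. s (pure_tensor K (vsp V x) (vsp W x) v w)) t ` L = L"
  shows "L \<subseteq> epi W x"
proof -
  note VW = VW_rep[OF V W] and WV = VW_rep[OF W V]
  note fV = rep_fd[OF V x] and fW = rep_fd[OF W x]
  let ?s = "\<lambda>u. s (tensor_braid K (vsp W x) (vsp V x) u)"
  note T' = episub_image[OF VW WV rbraid_rhom[OF V W] T] and X' = satsub_vimage[OF WV VW rbraid_rhom[OF W V] X]
  have s': "?s \<in> module_hom K (vsp (rep_tensor K Q W V) x) KK"
    using hom_comp[OF lin_hom[OF tensor_braid_lin[OF fW fV]]] sh by (simp add: VW_vsp[OF V W] VW_vsp[OF W V])
  have eq: "opL (vsp W x) (vsp V x) (\<lambda>w v. ?s (pure_tensor K (vsp W x) (vsp V x) w v)) (tensor_braid K (vsp V x) (vsp W x) t) w =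
      opR (vsp V x) (vsp W x) (\<lambda>v w. s (pure_tensor K (vsp V x) (vsp W x) v w)) t w" if "w \<in> L" for w
    unfolding opR_def by (rule opL_cong) (use that L in \<open>auto simp: tensor_braid_pure[OF fW fV]\<close>)
  have "opL (vsp W x) (vsp V x) (\<lambda>w v. ?s (pure_tensor K (vsp W x) (vsp V x) w v)) (tensor_braid K (vsp V x) (vsp W x) t) ` L = L"
    by (rule trans[OF image_cong[OF refl] fL]) (rule eq)
  from stable_left[OF W V T' X' x _ s' _ L this] show ?thesis using t sX x by auto
qed

text \<open>
  The crucial bound: a saturated subrepresentation of \<open>V \<otimes> W\<close> that contains the pure tensors of the
  maximal epimorphic subrepresentations contains every epimorphic subrepresentation.  Otherwise a
  functional \<open>s\<close> separates some \<open>t \<in> T\<^sub>x\<close> from \<open>X\<^sub>x\<close>, and the trace argument gives \<open>s t = 0\<close>.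
\<close>

lemma episub_in_satsub:
  fixes V W :: "('k, ('k, 's) univ, 'v, 'a) quiver_rep"
  assumes V: "rep V" and W: "rep W" and T: "episub (rep_tensor K Q V W) T" and X: "satsub (rep_tensor K Q V W) X"
    and EX: "\<And>x v w. x \<in> verts Q \<Longrightarrow> v \<in> epi V x \<Longrightarrow> w \<in> epi W x \<Longrightarrow> pure_tensor K (vsp V x) (vsp W x) v w \<in> X x"
    and x: "x \<in> verts Q"
  shows "T x \<subseteq> X x"
proof
  fix t assume t: "t \<in> T x"
  note VW = VW_rep[OF V W] and vs = VW_vsp[OF V W]
  note tc = ssp_mem[OF subrep_ssp[OF episub_subrep[OF T] x] t]
  show "t \<in> X x"
  proof (rule ccontr)
    assume nt: "t \<notin> X x"
    obtain s where s: "s \<in> module_hom K (vsp (rep_tensor K Q V W) x) KK" "\<forall>t\<in>X x. s t = \<zero>" "s t \<noteq> \<zero>"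
      using separation[OF rep_fd[OF VW x] subrep_ssp[OF satsub_subrep[OF X] x] tc nt] by blast
    have "s t = \<zero>"
      by (rule trace_vanish[OF rep_fd[OF V x] rep_fd[OF W x] s(1)[unfolded vs] tc[unfolded vs]
            stable_left[OF V W T X x t s(1,2)] stable_right[OF V W T X x t s(1,2)]])
        (use EX[OF x] s(2) in auto)
    then show False using s(3) by simp
  qed
qed

end

section \<open>The category of representations\<close>

context base
begin

lemma bij_inverse:
  assumes V: "vs_ok V" and f: "f \<in> module_hom K V W" and b: "bij_betw f (carrier V) (carrier W)"
  shows "restrict (inv_into (carrier V) f) (carrier W) \<in> lin K W V"
    and "v \<in> carrier V \<Longrightarrow> restrict (inv_into (carrier V) f) (carrier W) (f v) = v"
    and "w \<in> carrier W \<Longrightarrow> f (restrict (inv_into (carrier V) f) (carrier W) w) = w"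
proof -
  let ?g = "inv_into (carrier V) f"
  have i: "inj_on f (carrier V)" and s: "f ` carrier V = carrier W" using b by (auto simp: bij_betw_def)
  have gf: "?g (f v) = v" if "v \<in> carrier V" for v using inv_into_f_f[OF i that] .
  have fg: "f (?g w) = w" if "w \<in> carrier W" for w using f_inv_into_f[of w f "carrier V"] s that by blast
  have gc: "?g w \<in> carrier V" if "w \<in> carrier W" for w using inv_into_into[of w f "carrier V"] s that by blast
  show "restrict ?g (carrier W) (f v) = v" if "v \<in> carrier V" using gf[OF that] hom_closed[OF f that] by simp
  show "f (restrict ?g (carrier W) w) = w" if "w \<in> carrier W" using fg[OF that] that by simp
  have Wc: "u \<oplus>\<^bsub>W\<^esub> w \<in> carrier W" "u \<oplus>\<^bsub>W\<^esub> w = f (?g u \<oplus>\<^bsub>V\<^esub> ?g w)" if "u \<in> carrier W" "w \<in> carrier W" for u w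
  proof -
    show eq: "u \<oplus>\<^bsub>W\<^esub> w = f (?g u \<oplus>\<^bsub>V\<^esub> ?g w)" using that fg gc by (simp add: hom_add[OF f])
    show "u \<oplus>\<^bsub>W\<^esub> w \<in> carrier W" unfolding eq using gc that V hom_closed[OF f] by simp
  qed
  have Ws: "c \<odot>\<^bsub>W\<^esub> w \<in> carrier W" "c \<odot>\<^bsub>W\<^esub> w = f (c \<odot>\<^bsub>V\<^esub> ?g w)" if "c \<in> carrier K" "w \<in> carrier W" for c w
  proof -
    show eq: "c \<odot>\<^bsub>W\<^esub> w = f (c \<odot>\<^bsub>V\<^esub> ?g w)" using that fg gc by (simp add: hom_smult[OF f])
    show "c \<odot>\<^bsub>W\<^esub> w \<in> carrier W" unfolding eq using gc that V hom_closed[OF f] by simp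
  qed
  have "restrict ?g (carrier W) \<in> module_hom K W V"
  proof (rule homI)
    fix u assume u: "u \<in> carrier W"
    show "restrict ?g (carrier W) u \<in> carrier V" using gc u by simp
    {
      fix w assume w: "w \<in> carrier W"
      have "?g (u \<oplus>\<^bsub>W\<^esub> w) = ?g u \<oplus>\<^bsub>V\<^esub> ?g w"
        unfolding Wc(2)[OF u w] using gc u w V by (intro gf) simp
      then show "restrict ?g (carrier W) (u \<oplus>\<^bsub>W\<^esub> w) = restrict ?g (carrier W) u \<oplus>\<^bsub>V\<^esub> restrict ?g (carrier W) w"
        using u w Wc(1)[OF u w] by simp
    }
    fix c assume c: "c \<in> carrier K"
    have "?g (c \<odot>\<^bsub>W\<^esub> u) = c \<odot>\<^bsub>V\<^esub> ?g u"
      unfolding Ws(2)[OF c u] using gc u c V by (intro gf) simp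
    then show "restrict ?g (carrier W) (c \<odot>\<^bsub>W\<^esub> u) = c \<odot>\<^bsub>V\<^esub> restrict ?g (carrier W) u"
      using u Ws(1)[OF c u] by simp
  qed
  then show "restrict ?g (carrier W) \<in> lin K W V" unfolding lin_def by simp
qed

lemma vect_iso:
  fixes V W :: "('k, 'u) module"
  assumes V: "vs_ok V" and f: "f \<in> lin K V W" and b: "bij_betw f (carrier V) (carrier W)"
  shows "iso_arr (Vect K) V W f"
proof -
  note g = bij_inverse[OF V lin_hom[OF f] b]
  let ?g = "restrict (inv_into (carrier V) f) (carrier W)"
  have "compose (carrier V) ?g f = (\<lambda>v\<in>carrier V. v)" "compose (carrier W) f ?g = (\<lambda>w\<in>carrier W. w)"
    using g(2,3) by (auto simp: compose_def simp del: restrict_apply intro!: restrict_ext)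
  then show ?thesis unfolding iso_arr_def using f g(1) by (auto simp: Vect_def)
qed

end

lemma isomorphic_sym: "isomorphic C X Y \<Longrightarrow> isomorphic C Y X"
  unfolding isomorphic_def iso_arr_def by blast

context quiver
begin

lemma Rep_simps [simp]:
  "Ob (Rep K Q) = {V. rep V}" "Hom (Rep K Q) = rep_hom K Q"
  "Comp (Rep K Q) V W U g f = (\<lambda>x\<in>verts Q. compose (carrier (vsp V x)) (g x) (f x))"
  "Ident (Rep K Q) V = (\<lambda>x\<in>verts Q. \<lambda>v\<in>carrier (vsp V x). v)"
  "Plus (Rep K Q) V W f g = (\<lambda>x\<in>verts Q. \<lambda>v\<in>carrier (vsp V x). f x v \<oplus>\<^bsub>vsp W x\<^esub> g x v)"
  "TOb (Rep K Q) = rep_tensor K Q"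
  "TMap (Rep K Q) V V' W W' f g = (\<lambda>x\<in>verts Q. tensor_map K (vsp V x) (vsp V' x) (vsp W x) (vsp W' x) (f x) (g x))"
  "Assoc (Rep K Q) V W U = (\<lambda>x\<in>verts Q. tensor_assoc K (vsp V x) (vsp W x) (vsp U x))"
  "Braid (Rep K Q) V W = (\<lambda>x\<in>verts Q. tensor_braid K (vsp V x) (vsp W x))"
  "Unit (Rep K Q) = rep_unit K"
  by (simp_all add: Rep_def)

lemma Vect_simps [simp]:
  "Ob (Vect K) = {V. fd_space K V}" "Hom (Vect K) = lin K"
  "Comp (Vect K) V W U g f = compose (carrier V) g f"
  "Ident (Vect K) V = (\<lambda>v\<in>carrier V. v)"
  by (simp_all add: Vect_def)

lemma rhom_eqI:
  assumes f: "f \<in> rep_hom K Q V W" and g: "g \<in> rep_hom K Q V W"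
    and eq: "\<And>x v. x \<in> verts Q \<Longrightarrow> v \<in> carrier (vsp V x) \<Longrightarrow> f x v = g x v"
  shows "f = g"
proof (rule extensionalityI)
  show "f \<in> extensional (verts Q)" "g \<in> extensional (verts Q)" using f g by (auto simp: rep_hom_def)
  show "f x = g x" if "x \<in> verts Q" for x
    by (rule lin_ext[OF rhom_lin[OF f that] rhom_lin[OF g that]]) (rule eq[OF that])
qed

lemma rhomI':
  assumes V: "rep V"
    and f: "\<And>x. x \<in> verts Q \<Longrightarrow> f x \<in> module_hom K (vsp V x) (vsp W x)"
    and n: "\<And>a v. a \<in> arcs Q \<Longrightarrow> v \<in> carrier (vsp V (tail Q a)) \<Longrightarrow>
      f (head Q a) (amap V a v) = amap W a (f (tail Q a) v)"
  shows "(\<lambda>x\<in>verts Q. restrict (f x) (carrier (vsp V x))) \<in> rep_hom K Q V W"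
proof (rule rhomI)
  show "(\<lambda>x\<in>verts Q. restrict (f x) (carrier (vsp V x))) x \<in> lin K (vsp V x) (vsp W x)" if "x \<in> verts Q" for x
    using lin_restrict[OF rep_vs[OF V that] f[OF that]] that by simp
  show "(\<lambda>x\<in>verts Q. restrict (f x) (carrier (vsp V x))) (head Q a) (amap V a v) =
      amap W a ((\<lambda>x\<in>verts Q. restrict (f x) (carrier (vsp V x))) (tail Q a) v)"
    if a: "a \<in> arcs Q" and v: "v \<in> carrier (vsp V (tail Q a))" for a v
    using n[OF a v] hom_closed[OF rep_mhom[OF V a] v] a v by simp
qed simp

lemma rcomp_rhom:
  assumes V: "rep V" and f: "f \<in> rep_hom K Q V W" and g: "g \<in> rep_hom K Q W U"
  shows "(\<lambda>x\<in>verts Q. compose (carrier (vsp V x)) (g x) (f x)) \<in> rep_hom K Q V U"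
  unfolding compose_def
  using hom_comp[OF rhom_mhom[OF f] rhom_mhom[OF g]] rhom_arr[OF f] rhom_arr[OF g] hom_closed[OF rhom_mhom[OF f]]
  by (intro rhomI'[OF V]) auto

lemma rcomp_apply: "x \<in> verts Q \<Longrightarrow> v \<in> carrier (vsp V x) \<Longrightarrow>
    (\<lambda>x\<in>verts Q. compose (carrier (vsp V x)) (g x) (f x)) x v = g x (f x v)"
  by (simp add: compose_def)

lemma rid_rhom:
  assumes V: "rep V" shows "(\<lambda>x\<in>verts Q. \<lambda>v\<in>carrier (vsp V x). v) \<in> rep_hom K Q V V"
  by (rule rhomI'[OF V]) (auto intro: id_hom)

lemma rplus_rhom:
  assumes V: "rep V" and W: "rep W" and f: "f \<in> rep_hom K Q V W" and g: "g \<in> rep_hom K Q V W"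
  shows "(\<lambda>x\<in>verts Q. \<lambda>v\<in>carrier (vsp V x). f x v \<oplus>\<^bsub>vsp W x\<^esub> g x v) \<in> rep_hom K Q V W"
  using hom_plus[OF rep_vs[OF V] rep_vs[OF W] rhom_mhom[OF f] rhom_mhom[OF g]]
    rhom_arr[OF f] rhom_arr[OF g] hom_closed[OF rhom_mhom[OF f]] hom_closed[OF rhom_mhom[OF g]]
    hom_add[OF rep_mhom[OF W]]
  by (intro rhomI'[OF V]) auto

text \<open>A morphism that is bijective at every vertex is an isomorphism.\<close>

lemma rep_iso:
  assumes V: "rep V" and f: "f \<in> rep_hom K Q V W"
    and b: "\<And>x. x \<in> verts Q \<Longrightarrow> bij_betw (f x) (carrier (vsp V x)) (carrier (vsp W x))" and W: "rep W"
  shows "iso_arr (Rep K Q) V W f"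
proof -
  define g where "g = (\<lambda>x\<in>verts Q. restrict (inv_into (carrier (vsp V x)) (f x)) (carrier (vsp W x)))"
  note i = bij_inverse[OF rep_vs[OF V] rhom_mhom[OF f] b]
  have gl: "g x \<in> lin K (vsp W x) (vsp V x)" if "x \<in> verts Q" for x using i(1)[OF that that that] that by (simp add: g_def)
  have gf: "g x (f x v) = v" if "x \<in> verts Q" "v \<in> carrier (vsp V x)" for x v
    using i(2)[OF that(1) that(1) that] that(1) by (simp add: g_def del: restrict_apply) (simp add: restrict_apply')
  have fg: "f x (g x w) = w" if "x \<in> verts Q" "w \<in> carrier (vsp W x)" for x w
    using i(3)[OF that(1) that(1) that] that(1) by (simp add: g_def del: restrict_apply) (simp add: restrict_apply')
  have g: "g \<in> rep_hom K Q W V"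
  proof (rule rhomI[OF gl])
    fix a w assume a: "a \<in> arcs Q" and w: "w \<in> carrier (vsp W (tail Q a))"
    note t = tail_v[OF a] and h = head_v[OF a]
    have gw: "g (tail Q a) w \<in> carrier (vsp V (tail Q a))" using hom_closed[OF lin_hom[OF gl[OF t]] w] .
    have "amap W a w = f (head Q a) (amap V a (g (tail Q a) w))"
      using rhom_arr[OF f a gw] fg[OF t w] by simp
    then show "g (head Q a) (amap W a w) = amap V a (g (tail Q a) w)"
      using gf[OF h hom_closed[OF rep_mhom[OF V a] gw]] by simp
  next
    show "g x = undefined" if "x \<notin> verts Q" for x using that unfolding g_def by simp
  qed
  have "Comp (Rep K Q) V W V g f = Ident (Rep K Q) V"
    unfolding Rep_simps
    by (rule rhom_eqI[OF rcomp_rhom[OF V f g] rid_rhom[OF V]]) (simp add: compose_def gf)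
  moreover have "Comp (Rep K Q) W V W f g = Ident (Rep K Q) W"
    unfolding Rep_simps
    by (rule rhom_eqI[OF rcomp_rhom[OF W g f] rid_rhom[OF W]]) (simp add: compose_def fg)
  ultimately show ?thesis unfolding iso_arr_def using f g by auto
qed

lemma Robj_iso_arr:
  assumes V: "rep V" and a: "a \<in> arcs Q"
  shows "iso_arr (Vect K) (vsp (Robj V) (tail Q a)) (vsp (Robj V) (head Q a)) (amap (Robj V) a)"
  by (rule vect_iso[OF fd_vs[OF R_fd[OF V tail_v[OF a]]] R_amap_lin[OF V a] R_bij[OF V a]])

lemma R_ident:
  assumes V: "rep V"
  shows "fmap GT V V (\<lambda>x\<in>verts Q. \<lambda>v\<in>carrier (vsp V x). v) = (\<lambda>x\<in>verts Q. \<lambda>v\<in>carrier (vsp (Robj V) x). v)"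
proof (rule rhom_eqI[OF R_fmap_rhom[OF V V rid_rhom[OF V]] rid_rhom[OF R_rep[OF V]]])
  fix x u assume x: "x \<in> verts Q" and u: "u \<in> carrier (vsp (Robj V) x)"
  from R_carrierE[OF V u x] obtain v where v: "v \<in> epi V x" "u = mproj V x v" .
  then show "fmap GT V V (\<lambda>x\<in>verts Q. \<lambda>v\<in>carrier (vsp V x). v) x u = (\<lambda>x\<in>verts Q. \<lambda>v\<in>carrier (vsp (Robj V) x). v) x u"
    using u x by (simp add: R_fmap[OF V V rid_rhom[OF V] x] epi_mem[OF V x])
qed

lemma R_comp:
  assumes V: "rep V" and W: "rep W" and U: "rep U" and f: "f \<in> rep_hom K Q V W" and g: "g \<in> rep_hom K Q W U"
  shows "fmap GT V U (\<lambda>x\<in>verts Q. compose (carrier (vsp V x)) (g x) (f x)) =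
    (\<lambda>x\<in>verts Q. compose (carrier (vsp (Robj V) x)) (fmap GT W U g x) (fmap GT V W f x))"
proof (rule rhom_eqI[OF R_fmap_rhom[OF V U rcomp_rhom[OF V f g]]
    rcomp_rhom[OF R_rep[OF V] R_fmap_rhom[OF V W f] R_fmap_rhom[OF W U g]]])
  fix x u assume x: "x \<in> verts Q" and u: "u \<in> carrier (vsp (Robj V) x)"
  from R_carrierE[OF V u x] obtain v where v: "v \<in> epi V x" "u = mproj V x v" .
  let ?gf = "\<lambda>x\<in>verts Q. compose (carrier (vsp V x)) (g x) (f x)"
  have "fmap GT V U ?gf x u = mproj U x (?gf x v)"
    unfolding v(2) by (rule R_fmap[OF V U rcomp_rhom[OF V f g] x v(1)])
  also have "\<dots> = mproj U x (g x (f x v))" by (simp only: rcomp_apply[OF x epi_mem[OF V x v(1)]])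
  also have "\<dots> = fmap GT W U g x (fmap GT V W f x u)"
    by (simp add: v R_fmap[OF V W f x] R_fmap[OF W U g x] rhom_epi[OF V W f x])
  finally show "fmap GT V U ?gf x u =
    (\<lambda>x\<in>verts Q. compose (carrier (vsp (Robj V) x)) (fmap GT W U g x) (fmap GT V W f x)) x u"
    unfolding rcomp_apply[OF x u] .
qed

lemma R_plus:
  assumes V: "rep V" and W: "rep W" and f: "f \<in> rep_hom K Q V W" and g: "g \<in> rep_hom K Q V W"
  shows "fmap GT V W (\<lambda>x\<in>verts Q. \<lambda>v\<in>carrier (vsp V x). f x v \<oplus>\<^bsub>vsp W x\<^esub> g x v) =
    (\<lambda>x\<in>verts Q. \<lambda>v\<in>carrier (vsp (Robj V) x). fmap GT V W f x v \<oplus>\<^bsub>vsp (Robj W) x\<^esub> fmap GT V W g x v)"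
proof (rule rhom_eqI[OF R_fmap_rhom[OF V W rplus_rhom[OF V W f g]]
    rplus_rhom[OF R_rep[OF V] R_rep[OF W] R_fmap_rhom[OF V W f] R_fmap_rhom[OF V W g]]])
  fix x u assume x: "x \<in> verts Q" and u: "u \<in> carrier (vsp (Robj V) x)"
  from R_carrierE[OF V u x] obtain v where v: "v \<in> epi V x" "u = mproj V x v" .
  show "fmap GT V W (\<lambda>x\<in>verts Q. \<lambda>v\<in>carrier (vsp V x). f x v \<oplus>\<^bsub>vsp W x\<^esub> g x v) x u =
    (\<lambda>x\<in>verts Q. \<lambda>v\<in>carrier (vsp (Robj V) x). fmap GT V W f x v \<oplus>\<^bsub>vsp (Robj W) x\<^esub> fmap GT V W g x v) x u"
    using u x v by (simp add: R_fmap[OF V W rplus_rhom[OF V W f g] x] R_fmap[OF V W f x] R_fmap[OF V W g x]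
        rhom_epi[OF V W f x] rhom_epi[OF V W g x] epi_mem[OF V x] mproj_add[OF W x])
qed

lemma GT_functor: "is_functor (Rep K Q) (Rep K Q) (GT :: ('k, ('k, 's) univ, 'v, 'a) rep_functor)"
  unfolding is_functor_def by (simp add: R_rep R_fmap_rhom R_ident R_comp)

lemma GT_additive: "additive_functor (Rep K Q) (Rep K Q) (GT :: ('k, ('k, 's) univ, 'v, 'a) rep_functor)"
  unfolding additive_functor_def by (simp add: GT_functor R_plus)

lemma rank_functor:
  assumes x: "x \<in> verts Q"
  shows "is_functor (Rep K Q) (Vect K) (global_rank_functor K Q x :: ('k, ('k, 's) univ, 'v, 'a) vect_functor)"
proof -
  have s: "fob (global_rank_functor K Q x) V = vsp (Robj V) x" "fmap (global_rank_functor K Q x) V W f = fmap GT V W f x"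
    for V W :: "('k, ('k, 's) univ, 'v, 'a) quiver_rep" and f
    by (simp_all add: global_rank_functor_def)
  show ?thesis
    unfolding is_functor_def s
    using x by (simp add: R_fd rhom_lin[OF R_fmap_rhom] R_ident R_comp)
qed

end

subsection \<open>The rank functor does not depend on the vertex\<close>

text \<open>
  Connectedness is used in this form: a set of vertices that contains a vertex, and with one end of an
  arrow also the other, contains all vertices; and conversely.
\<close>

lemma connected_closed_set:
  assumes c: "connected G" and x: "x \<in> S" "x \<in> verts G"
    and cl: "\<And>a. a \<in> arcs G \<Longrightarrow> tail G a \<in> S \<longleftrightarrow> head G a \<in> S"
  shows "verts G \<subseteq> S"
proof
  fix y assume y: "y \<in> verts G"
  have "(x, y) \<in> rtrancl_on (verts (with_proj (mk_symmetric G))) (arcs_ends (with_proj (mk_symmetric G)))"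
    using c x y unfolding connected_def strongly_connected_def reachable_def by (simp add: mk_symmetric_def)
  then show "y \<in> S"
  proof (induction rule: rtrancl_on_induct)
    case base show ?case by (rule x(1))
  next
    case (step y z)
    from step.hyps(2) obtain a where "a \<in> arcs G" "(y, z) = (tail G a, head G a) \<or> (y, z) = (head G a, tail G a)"
      by (auto simp: mk_symmetric_def)
    then show ?case using step.IH cl by auto
  qed
qed

lemma connectedI_closed_set:
  assumes ne: "verts G \<noteq> {}" and wf: "wf_digraph G"
    and cl: "\<And>S. S \<subseteq> verts G \<Longrightarrow> S \<noteq> {} \<Longrightarrow> (\<And>a. a \<in> arcs G \<Longrightarrow> tail G a \<in> S \<longleftrightarrow> head G a \<in> S) \<Longrightarrow> verts G \<subseteq> S"
  shows "connected G"
proof -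
  let ?r = "rtrancl_on (verts G) (\<Union>e\<in>arcs G. {(tail G e, head G e), (head G e, tail G e)})"
  have "(x, y) \<in> ?r" if xy: "x \<in> verts G" "y \<in> verts G" for x y
  proof -
    let ?S = "{y. (x, y) \<in> ?r}"
    have "verts G \<subseteq> ?S"
    proof (rule cl)
      show "?S \<subseteq> verts G" by (auto dest: in_rtrancl_on_in_F(2))
      show "?S \<noteq> {}" using xy by auto
      fix a assume a: "a \<in> arcs G"
      have tv: "tail G a \<in> verts G" and hv: "head G a \<in> verts G"
        using a wf by (auto simp: wf_digraph.tail_in_verts wf_digraph.head_in_verts)
      have e: "(tail G a, head G a) \<in> (\<Union>e\<in>arcs G. {(tail G e, head G e), (head G e, tail G e)})"
        "(head G a, tail G a) \<in> (\<Union>e\<in>arcs G. {(tail G e, head G e), (head G e, tail G e)})" using a by blast+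
      show "tail G a \<in> ?S \<longleftrightarrow> head G a \<in> ?S"
        using rtrancl_on_into_rtrancl_on[OF _ e(1) hv] rtrancl_on_into_rtrancl_on[OF _ e(2) tv] by auto
    qed
    then show ?thesis using xy by blast
  qed
  then show ?thesis
    unfolding connected_def strongly_connected_def reachable_def using ne by (simp add: mk_symmetric_def)
qed

context quiver
begin

text \<open>
  \<open>\<eta>\<close> is a natural isomorphism from the rank functor at \<open>x\<close> to the rank functor at \<open>y\<close>, written out in
  elements.  The relation is an equivalence, and each arrow relates its ends.
\<close>

definition rank_nat :: "(('k, ('k, 's) univ, 'v, 'a) quiver_rep \<Rightarrow> ('k, 's) univ \<Rightarrow> ('k, 's) univ) \<Rightarrow> 'v \<Rightarrow> 'v \<Rightarrow> bool" where
  "rank_nat \<eta> x y \<longleftrightarrow> (\<forall>V. rep V \<longrightarrow>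
     \<eta> V \<in> lin K (vsp (Robj V) x) (vsp (Robj V) y) \<and>
     bij_betw (\<eta> V) (carrier (vsp (Robj V) x)) (carrier (vsp (Robj V) y)) \<and>
     (\<forall>W f u. rep W \<longrightarrow> f \<in> rep_hom K Q V W \<longrightarrow> u \<in> carrier (vsp (Robj V) x) \<longrightarrow>
       \<eta> W (fmap GT V W f x u) = fmap GT V W f y (\<eta> V u)))"

lemma rank_natI:
  assumes "\<And>V. rep V \<Longrightarrow> \<eta> V \<in> lin K (vsp (Robj V) x) (vsp (Robj V) y)"
    and "\<And>V. rep V \<Longrightarrow> bij_betw (\<eta> V) (carrier (vsp (Robj V) x)) (carrier (vsp (Robj V) y))"
    and "\<And>V W f u. rep V \<Longrightarrow> rep W \<Longrightarrow> f \<in> rep_hom K Q V W \<Longrightarrow> u \<in> carrier (vsp (Robj V) x) \<Longrightarrow>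
       \<eta> W (fmap GT V W f x u) = fmap GT V W f y (\<eta> V u)"
  shows "rank_nat \<eta> x y"
  unfolding rank_nat_def using assms by blast

lemma rank_nat_lin: "rank_nat \<eta> x y \<Longrightarrow> rep V \<Longrightarrow> \<eta> V \<in> lin K (vsp (Robj V) x) (vsp (Robj V) y)"
  and rank_nat_bij: "rank_nat \<eta> x y \<Longrightarrow> rep V \<Longrightarrow> bij_betw (\<eta> V) (carrier (vsp (Robj V) x)) (carrier (vsp (Robj V) y))"
  and rank_nat_nat: "rank_nat \<eta> x y \<Longrightarrow> rep V \<Longrightarrow> rep W \<Longrightarrow> f \<in> rep_hom K Q V W \<Longrightarrow> u \<in> carrier (vsp (Robj V) x) \<Longrightarrow>
       \<eta> W (fmap GT V W f x u) = fmap GT V W f y (\<eta> V u)"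
  unfolding rank_nat_def by blast+

lemma rank_nat_closed: "rank_nat \<eta> x y \<Longrightarrow> rep V \<Longrightarrow> u \<in> carrier (vsp (Robj V) x) \<Longrightarrow> \<eta> V u \<in> carrier (vsp (Robj V) y)"
  using hom_closed[OF lin_hom[OF rank_nat_lin]] .

lemma rank_nat_refl:
  assumes x: "x \<in> verts Q" shows "rank_nat (\<lambda>V. \<lambda>v\<in>carrier (vsp (Robj V) x). v) x x"
proof (rule rank_natI)
  show "(\<lambda>v\<in>carrier (vsp (Robj V) x). v) \<in> lin K (vsp (Robj V) x) (vsp (Robj V) x)" if "rep V" for V
    by (rule lin_restrict[OF fd_vs[OF R_fd[OF that x]] id_hom])
  show "bij_betw (\<lambda>v\<in>carrier (vsp (Robj V) x). v) (carrier (vsp (Robj V) x)) (carrier (vsp (Robj V) x))" for V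
    by (auto simp: bij_betw_def inj_on_def)
  show "(\<lambda>v\<in>carrier (vsp (Robj W) x). v) (fmap GT V W f x u) = fmap GT V W f x ((\<lambda>v\<in>carrier (vsp (Robj V) x). v) u)"
    if "rep V" "rep W" "f \<in> rep_hom K Q V W" "u \<in> carrier (vsp (Robj V) x)" for V W f u
    using hom_closed[OF rhom_mhom[OF R_fmap_rhom[OF that(1,2,3)] x] that(4)] that(4) by simp
qed

lemma rank_nat_sym:
  assumes n: "rank_nat \<eta> x y" and x: "x \<in> verts Q"
  shows "rank_nat (\<lambda>V. restrict (inv_into (carrier (vsp (Robj V) x)) (\<eta> V)) (carrier (vsp (Robj V) y))) y x"
proof -
  define \<theta> where "\<theta> V = restrict (inv_into (carrier (vsp (Robj V) x)) (\<eta> V)) (carrier (vsp (Robj V) y))" for V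
  have \<theta>: "\<theta> V \<in> lin K (vsp (Robj V) y) (vsp (Robj V) x)"
    "\<And>v. v \<in> carrier (vsp (Robj V) x) \<Longrightarrow> \<theta> V (\<eta> V v) = v"
    "\<And>v. v \<in> carrier (vsp (Robj V) y) \<Longrightarrow> \<eta> V (\<theta> V v) = v" if V: "rep V" for V
    unfolding \<theta>_def
    by (rule bij_inverse[OF fd_vs[OF R_fd[OF V x]] lin_hom[OF rank_nat_lin[OF n V]] rank_nat_bij[OF n V]]; assumption)+
  have \<theta>c: "\<theta> V v \<in> carrier (vsp (Robj V) x)" if "rep V" "v \<in> carrier (vsp (Robj V) y)" for V v
    using hom_closed[OF lin_hom[OF \<theta>(1)]] that by blast
  have "rank_nat \<theta> y x"
  proof (rule rank_natI)
    show "bij_betw (\<theta> V) (carrier (vsp (Robj V) y)) (carrier (vsp (Robj V) x))" if V: "rep V" for V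
      by (rule bij_betw_byWitness[of _ "\<eta> V"]) (use \<theta>[OF V] \<theta>c[OF V] rank_nat_closed[OF n V] in auto)
    show "\<theta> W (fmap GT V W f y u) = fmap GT V W f x (\<theta> V u)"
      if V: "rep V" and W: "rep W" and f: "f \<in> rep_hom K Q V W" and u: "u \<in> carrier (vsp (Robj V) y)" for V W f u
    proof -
      have "fmap GT V W f y u = \<eta> W (fmap GT V W f x (\<theta> V u))"
        using rank_nat_nat[OF n V W f \<theta>c[OF V u]] \<theta>(3)[OF V u] by simp
      then show ?thesis
        using \<theta>(2)[OF W] hom_closed[OF rhom_mhom[OF R_fmap_rhom[OF V W f] x] \<theta>c[OF V u]] by simp
    qed
  qed (rule \<theta>(1))
  then show ?thesis unfolding \<theta>_def .
qed

lemma rank_nat_trans: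
  assumes n: "rank_nat \<eta> x y" and n': "rank_nat \<theta> y z" and x: "x \<in> verts Q"
  shows "rank_nat (\<lambda>V. restrict (\<lambda>v. \<theta> V (\<eta> V v)) (carrier (vsp (Robj V) x))) x z"
proof (rule rank_natI)
  show "restrict (\<lambda>v. \<theta> V (\<eta> V v)) (carrier (vsp (Robj V) x)) \<in> lin K (vsp (Robj V) x) (vsp (Robj V) z)" if V: "rep V" for V
    by (rule lin_restrict[OF fd_vs[OF R_fd[OF V x]] hom_comp[OF lin_hom[OF rank_nat_lin[OF n V]] lin_hom[OF rank_nat_lin[OF n' V]]]])
  show "bij_betw (restrict (\<lambda>v. \<theta> V (\<eta> V v)) (carrier (vsp (Robj V) x))) (carrier (vsp (Robj V) x)) (carrier (vsp (Robj V) z))"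
    if V: "rep V" for V
    using bij_betw_trans[OF rank_nat_bij[OF n V] rank_nat_bij[OF n' V]]
    by (subst bij_betw_cong[where g = "\<theta> V \<circ> \<eta> V"]) auto
  show "restrict (\<lambda>v. \<theta> W (\<eta> W v)) (carrier (vsp (Robj W) x)) (fmap GT V W f x u) =
      fmap GT V W f z (restrict (\<lambda>v. \<theta> V (\<eta> V v)) (carrier (vsp (Robj V) x)) u)"
    if V: "rep V" and W: "rep W" and f: "f \<in> rep_hom K Q V W" and u: "u \<in> carrier (vsp (Robj V) x)" for V W f u
    using hom_closed[OF rhom_mhom[OF R_fmap_rhom[OF V W f] x] u] u rank_nat_nat[OF n V W f u]
      rank_nat_nat[OF n' V W f rank_nat_closed[OF n V u]] by simp
qed

lemma rank_nat_arc:
  assumes a: "a \<in> arcs Q" shows "rank_nat (\<lambda>V. amap (Robj V) a) (tail Q a) (head Q a)"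
proof (rule rank_natI)
  show "amap (Robj W) a (fmap GT V W f (tail Q a) u) = fmap GT V W f (head Q a) (amap (Robj V) a u)"
    if "rep V" "rep W" "f \<in> rep_hom K Q V W" "u \<in> carrier (vsp (Robj V) (tail Q a))" for V W f u
    using rhom_arr[OF R_fmap_rhom[OF that(1,2,3)] a that(4)] by simp
qed (simp_all add: R_amap_lin a R_bij)

lemma rank_nat_connected:
  assumes c: "connected Q" and x: "x \<in> verts Q" and y: "y \<in> verts Q"
  shows "\<exists>\<eta> :: ('k, ('k, 's) univ, 'v, 'a) quiver_rep \<Rightarrow> ('k, 's) univ \<Rightarrow> ('k, 's) univ. rank_nat \<eta> x y"
proof -
  let ?P = "\<lambda>y. \<exists>\<eta> :: ('k, ('k, 's) univ, 'v, 'a) quiver_rep \<Rightarrow> ('k, 's) univ \<Rightarrow> ('k, 's) univ. rank_nat \<eta> x y"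
  have "verts Q \<subseteq> {y. ?P y}"
  proof (rule connected_closed_set[OF c _ x])
    show "x \<in> {y. ?P y}" using rank_nat_refl[OF x] by blast
    show "tail Q a \<in> {y. ?P y} \<longleftrightarrow> head Q a \<in> {y. ?P y}" if a: "a \<in> arcs Q" for a
      using rank_nat_trans[OF _ rank_nat_arc[OF a] x]
        rank_nat_trans[OF _ rank_nat_sym[OF rank_nat_arc[OF a] tail_v[OF a]] x] by blast
  qed
  then show ?thesis using y by blast
qed

lemma rank_functor_iso:
  assumes c: "connected Q" and x: "x \<in> verts Q" and y: "y \<in> verts Q"
  shows "naturally_isomorphic (Rep K Q) (Vect K)
         (global_rank_functor K Q x :: ('k, ('k, 's) univ, 'v, 'a) vect_functor) (global_rank_functor K Q y)"
proof -
  have sm: "fob (global_rank_functor K Q x) V = vsp (Robj V) x" "fmap (global_rank_functor K Q x) V W f = fmap GT V W f x"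
    for V W :: "('k, ('k, 's) univ, 'v, 'a) quiver_rep" and f x
    by (simp_all add: global_rank_functor_def)
  obtain \<eta> :: "('k, ('k, 's) univ, 'v, 'a) quiver_rep \<Rightarrow> ('k, 's) univ \<Rightarrow> ('k, 's) univ" where n: "rank_nat \<eta> x y" using rank_nat_connected[OF c x y] by blast
  show ?thesis
    unfolding naturally_isomorphic_def sm
  proof (intro exI[of _ \<eta>] conjI ballI)
    fix V :: "('k, ('k, 's) univ, 'v, 'a) quiver_rep" assume "V \<in> Ob (Rep K Q)"
    then have V: "rep V" by simp
    show "iso_arr (Vect K) (vsp (Robj V) x) (vsp (Robj V) y) (\<eta> V)"
      by (rule vect_iso[OF fd_vs[OF R_fd[OF V x]] rank_nat_lin[OF n V] rank_nat_bij[OF n V]])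
    fix W f assume "W \<in> Ob (Rep K Q)" "f \<in> Hom (Rep K Q) V W"
    then have W: "rep W" and f: "f \<in> rep_hom K Q V W" by simp_all
    show "Comp (Vect K) (vsp (Robj V) x) (vsp (Robj W) x) (vsp (Robj W) y) (\<eta> W) (fmap GT V W f x) =
      Comp (Vect K) (vsp (Robj V) x) (vsp (Robj V) y) (vsp (Robj W) y) (fmap GT V W f y) (\<eta> V)"
      using rank_nat_nat[OF n V W f] by (auto simp: compose_def intro!: restrict_ext)
  qed
qed

end

section \<open>The global tensor functor is a tensor functor\<close>

context quiver
begin

lemma rtens_rhom:
  fixes X X' Y Y' :: "('k, ('k, 's) univ, 'v, 'a) quiver_rep"
  assumes X: "rep X" and X': "rep X'" and Y: "rep Y" and Y': "rep Y'"
    and f: "f \<in> rep_hom K Q X X'" and g: "g \<in> rep_hom K Q Y Y'"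
  shows "(\<lambda>x\<in>verts Q. tensor_map K (vsp X x) (vsp X' x) (vsp Y x) (vsp Y' x) (f x) (g x))
    \<in> rep_hom K Q (rep_tensor K Q X Y) (rep_tensor K Q X' Y')" (is "?h \<in> _")
proof (rule rhomI)
  note tm = tensor_map_facts[OF rep_fd[OF X] rep_fd[OF Y] rep_fd[OF X'] rep_fd[OF Y'] rhom_mhom[OF f] rhom_mhom[OF g]]
  show "?h x \<in> lin K (vsp (rep_tensor K Q X Y) x) (vsp (rep_tensor K Q X' Y') x)" if x: "x \<in> verts Q" for x
    using tm(1)[OF x x x x x x] x by (simp add: VW_vsp[OF X Y] VW_vsp[OF X' Y'])
  fix a t assume a: "a \<in> arcs Q" and t: "t \<in> carrier (vsp (rep_tensor K Q X Y) (tail Q a))"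
  note tv = tail_v[OF a] and hv = head_v[OF a]
  let ?T = "\<lambda>x. tensor_map K (vsp X x) (vsp X' x) (vsp Y x) (vsp Y' x) (f x) (g x)"
  note l = hom_comp[OF rep_mhom[OF VW_rep[OF X Y] a, unfolded VW_vsp[OF X Y]] tm(2)[OF hv hv hv hv hv hv]]
  note r = hom_comp[OF tm(2)[OF tv tv tv tv tv tv] rep_mhom[OF VW_rep[OF X' Y'] a, unfolded VW_vsp[OF X' Y']]]
  have "?T (head Q a) (amap (rep_tensor K Q X Y) a t) = amap (rep_tensor K Q X' Y') a (?T (tail Q a) t)"
  proof (rule tensor_ext[OF rep_fd[OF X tv] rep_fd[OF Y tv] fd_vs[OF tensor_fd[OF rep_fd[OF X' hv] rep_fd[OF Y' hv]]] l r])
    fix v w assume v: "v \<in> carrier (vsp X (tail Q a))" and w: "w \<in> carrier (vsp Y (tail Q a))"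
    have cv: "amap X a v \<in> carrier (vsp X (head Q a))" "amap Y a w \<in> carrier (vsp Y (head Q a))"
      "f (tail Q a) v \<in> carrier (vsp X' (tail Q a))" "g (tail Q a) w \<in> carrier (vsp Y' (tail Q a))"
      using hom_closed[OF rep_mhom[OF X a] v] hom_closed[OF rep_mhom[OF Y a] w] hom_closed[OF rhom_mhom[OF f tv] v]
        hom_closed[OF rhom_mhom[OF g tv] w] by auto
    show "?T (head Q a) (amap (rep_tensor K Q X Y) a (pure_tensor K (vsp X (tail Q a)) (vsp Y (tail Q a)) v w)) =
      amap (rep_tensor K Q X' Y') a (?T (tail Q a) (pure_tensor K (vsp X (tail Q a)) (vsp Y (tail Q a)) v w))"
      unfolding VW_pure[OF X Y a v w] tm(3)[OF hv hv hv hv hv hv cv(1,2)] tm(3)[OF tv tv tv tv tv tv v w]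
        VW_pure[OF X' Y' a cv(3,4)] rhom_arr[OF f a v] rhom_arr[OF g a w] ..
  qed (use t in \<open>simp add: VW_vsp[OF X Y]\<close>)
  then show "?h (head Q a) (amap (rep_tensor K Q X Y) a t) = amap (rep_tensor K Q X' Y') a (?h (tail Q a) t)"
    using tv hv by simp
qed simp

lemma rassoc_rhom:
  fixes X Y Z :: "('k, ('k, 's) univ, 'v, 'a) quiver_rep"
  assumes X: "rep X" and Y: "rep Y" and Z: "rep Z"
  shows "(\<lambda>x\<in>verts Q. tensor_assoc K (vsp X x) (vsp Y x) (vsp Z x)) \<in>
    rep_hom K Q (rep_tensor K Q X (rep_tensor K Q Y Z)) (rep_tensor K Q (rep_tensor K Q X Y) Z)"
    (is "?h \<in> _")
proof (rule rhomI)
  note YZ = VW_rep[OF Y Z] and XY = VW_rep[OF X Y]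
  note vs = VW_vsp[OF Y Z] VW_vsp[OF X Y] VW_vsp[OF X YZ] VW_vsp[OF XY Z]
  note ta = tensor_assoc_facts[OF rep_fd[OF X] rep_fd[OF Y] rep_fd[OF Z]]
  show "?h x \<in> lin K (vsp (rep_tensor K Q X (rep_tensor K Q Y Z)) x) (vsp (rep_tensor K Q (rep_tensor K Q X Y) Z) x)"
    if x: "x \<in> verts Q" for x
    using ta(1)[OF x x x] x by (simp add: vs)
  fix a t assume a: "a \<in> arcs Q" and t: "t \<in> carrier (vsp (rep_tensor K Q X (rep_tensor K Q Y Z)) (tail Q a))"
  note tv = tail_v[OF a] and hv = head_v[OF a]
  let ?T = "\<lambda>x. tensor_assoc K (vsp X x) (vsp Y x) (vsp Z x)"
  note l = hom_comp[OF rep_mhom[OF VW_rep[OF X YZ] a, unfolded vs] lin_hom[OF ta(1)[OF hv hv hv]]]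
  note r = hom_comp[OF lin_hom[OF ta(1)[OF tv tv tv]] rep_mhom[OF VW_rep[OF XY Z] a, unfolded vs]]
  have "?T (head Q a) (amap (rep_tensor K Q X (rep_tensor K Q Y Z)) a t) = amap (rep_tensor K Q (rep_tensor K Q X Y) Z) a (?T (tail Q a) t)"
  proof (rule tensor3_ext[OF rep_fd[OF X tv] rep_fd[OF Y tv] rep_fd[OF Z tv] _ l r])
    show "vs_ok (tensor K (tensor K (vsp X (head Q a)) (vsp Y (head Q a))) (vsp Z (head Q a)))"
      using rep_vs[OF VW_rep[OF XY Z] hv] by (simp add: vs)
    fix u v w assume u: "u \<in> carrier (vsp X (tail Q a))" and v: "v \<in> carrier (vsp Y (tail Q a))" and w: "w \<in> carrier (vsp Z (tail Q a))"
    have cv: "amap X a u \<in> carrier (vsp X (head Q a))" "amap Y a v \<in> carrier (vsp Y (head Q a))" "amap Z a w \<in> carrier (vsp Z (head Q a))"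
      using hom_closed[OF rep_mhom[OF X a] u] hom_closed[OF rep_mhom[OF Y a] v] hom_closed[OF rep_mhom[OF Z a] w] by auto
    have p: "pure_tensor K (vsp Y (tail Q a)) (vsp Z (tail Q a)) v w \<in> carrier (vsp (rep_tensor K Q Y Z) (tail Q a))"
      "pure_tensor K (vsp X (tail Q a)) (vsp Y (tail Q a)) u v \<in> carrier (vsp (rep_tensor K Q X Y) (tail Q a))"
      using pure_closed[OF rep_fd[OF Y tv] rep_fd[OF Z tv] v w] pure_closed[OF rep_fd[OF X tv] rep_fd[OF Y tv] u v] by (simp_all add: vs)
    note 1 = VW_pure[OF X YZ a u p(1), unfolded vs VW_pure[OF Y Z a v w]]
    note 2 = VW_pure[OF XY Z a p(2) w, unfolded vs VW_pure[OF X Y a u v]]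
    show "?T (head Q a) (amap (rep_tensor K Q X (rep_tensor K Q Y Z)) a (pure_tensor K (vsp X (tail Q a)) (tensor K (vsp Y (tail Q a)) (vsp Z (tail Q a))) u
         (pure_tensor K (vsp Y (tail Q a)) (vsp Z (tail Q a)) v w))) =
      amap (rep_tensor K Q (rep_tensor K Q X Y) Z) a (?T (tail Q a) (pure_tensor K (vsp X (tail Q a)) (tensor K (vsp Y (tail Q a)) (vsp Z (tail Q a))) u
         (pure_tensor K (vsp Y (tail Q a)) (vsp Z (tail Q a)) v w)))"
      unfolding 1 ta(2)[OF hv hv hv cv] ta(2)[OF tv tv tv u v w] 2 ..
  qed (use t in \<open>simp add: vs\<close>)
  then show "?h (head Q a) (amap (rep_tensor K Q X (rep_tensor K Q Y Z)) a t) = amap (rep_tensor K Q (rep_tensor K Q X Y) Z) a (?h (tail Q a) t)"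
    using tv hv by simp
qed simp

text \<open>
  If \<open>v\<close> lies in the kernel of the maximal monomorphic quotient and \<open>w\<close> in the maximal epimorphic
  subrepresentation, then \<open>v \<otimes> w\<close> lies in that kernel for \<open>V \<otimes> W\<close>: the \<open>v\<close> that satisfy this for all \<open>w\<close> form a
  saturated subrepresentation, as each \<open>w\<close> at the head of an arrow lifts to the tail.
\<close>

lemma mker_pure_l:
  fixes V W :: "('k, ('k, 's) univ, 'v, 'a) quiver_rep"
  assumes V: "rep V" and W: "rep W" and x: "x \<in> verts Q" and v: "v \<in> mker V x" and w: "w \<in> epi W x"
  shows "pure_tensor K (vsp V x) (vsp W x) v w \<in> mker (rep_tensor K Q V W) x"
proof -
  let ?VT = "rep_tensor K Q V W" and ?PP = "\<lambda>x. pure_tensor K (vsp V x) (vsp W x)"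
  note VT_rep = VW_rep[OF V W]
  have PP_bilin: "bilin (vsp V x) (vsp W x) (vsp ?VT x) (?PP x)" if "x \<in> verts Q" for x
    unfolding VW_vsp[OF V W] by (rule pure_bilin[OF rep_fd[OF V that] rep_fd[OF W that]])
  note PP_closed = bilin_closed[OF PP_bilin]
  define N where "N x = {v \<in> carrier (vsp V x). \<forall>w\<in>epi W x. ?PP x v w \<in> mker ?VT x}" for x
  have "satsub V N"
  proof (rule satsubI)
    fix x assume x: "x \<in> verts Q"
    note h = bilin_l[OF PP_bilin[OF x] epi_mem[OF W x]] and m = mker_ssp[OF VT_rep x]
    show "ssp (N x) (vsp V x)"
    proof (rule sspI[OF rep_vs[OF V x]])
      show "\<zero>\<^bsub>vsp V x\<^esub> \<in> N x"
        using rep_vs[OF V x] hom_zero[OF rep_vs[OF V x] rep_vs[OF VT_rep x] h] ssp_zero[OF m] by (simp add: N_def)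
      show "u \<oplus>\<^bsub>vsp V x\<^esub> v \<in> N x" if "u \<in> N x" "v \<in> N x" for u v
        using that rep_vs[OF V x] by (simp add: N_def hom_add[OF h] ssp_add[OF m])
      show "c \<odot>\<^bsub>vsp V x\<^esub> v \<in> N x" if "c \<in> carrier K" "v \<in> N x" for c v
        using that rep_vs[OF V x] by (simp add: N_def hom_smult[OF h] ssp_smult[OF m])
    qed (auto simp: N_def)
  next
    fix a v assume a: "a \<in> arcs Q"
    note tv = tail_v[OF a] and hv = head_v[OF a]
    have eq: "?PP (head Q a) (amap V a v) (amap W a w) = amap ?VT a (?PP (tail Q a) v w)"
      if "v \<in> carrier (vsp V (tail Q a))" "w \<in> epi W (tail Q a)" for w
      using VW_pure[OF V W a that(1) epi_mem[OF W tv that(2)]] by simp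
    show "amap V a v \<in> N (head Q a)" if v: "v \<in> N (tail Q a)"
    proof -
      have vc: "v \<in> carrier (vsp V (tail Q a))" using v by (simp add: N_def)
      have "?PP (head Q a) (amap V a v) w \<in> mker ?VT (head Q a)" if w: "w \<in> epi W (head Q a)" for w
      proof -
        from episub_surj[OF episub_epi[OF W] a w] obtain w' where w': "w' \<in> epi W (tail Q a)" "w = amap W a w'" .
        show ?thesis unfolding w'(2) eq[OF vc w'(1)]
          using subrep_arr[OF satsub_subrep[OF satsub_mker[OF VT_rep]] a] v w'(1) by (simp add: N_def)
      qed
      then show ?thesis using hom_closed[OF rep_mhom[OF V a] vc] by (simp add: N_def)
    qed
    show "v \<in> N (tail Q a)" if vc: "v \<in> carrier (vsp V (tail Q a))" and av: "amap V a v \<in> N (head Q a)"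
    proof -
      have "?PP (tail Q a) v w \<in> mker ?VT (tail Q a)" if w: "w \<in> epi W (tail Q a)" for w
      proof (rule satsubD[OF satsub_mker[OF VT_rep] a PP_closed[OF tv vc epi_mem[OF W tv w]]])
        show "amap ?VT a (?PP (tail Q a) v w) \<in> mker ?VT (head Q a)"
          unfolding eq[OF vc w, symmetric] using av epi_arr[OF W a w] by (simp add: N_def)
      qed
      then show ?thesis using vc by (simp add: N_def)
    qed
  qed
  then have "v \<in> N x" using mker_lower[OF V] v by blast
  then show ?thesis using w by (simp add: N_def)
qed

lemma mker_pure_r:
  fixes V W :: "('k, ('k, 's) univ, 'v, 'a) quiver_rep"
  assumes V: "rep V" and W: "rep W" and x: "x \<in> verts Q" and v: "v \<in> epi V x" and w: "w \<in> mker W x"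
  shows "pure_tensor K (vsp V x) (vsp W x) v w \<in> mker (rep_tensor K Q V W) x"
  using rhom_mker[OF VW_rep[OF W V] VW_rep[OF V W] rbraid_rhom[OF W V] mker_pure_l[OF W V x w v]] x
    tensor_braid_pure[OF rep_fd[OF W x] rep_fd[OF V x] mker_mem[OF W x w] epi_mem[OF V x v]] by simp

text \<open>The sum of a saturated and an epimorphic subrepresentation is saturated.\<close>

lemma satsub_sum:
  fixes U :: "('k, ('k, 's) univ, 'v, 'a) quiver_rep"
  assumes U: "rep U" and T: "episub U T" and X: "satsub U X"
  shows "satsub U (\<lambda>x. X x <+>\<^bsub>vsp U x\<^esub> T x)"
proof (rule satsubI)
  note Ts = subrep_ssp[OF episub_subrep[OF T]] and Xs = subrep_ssp[OF satsub_subrep[OF X]]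
  show "ssp (X x <+>\<^bsub>vsp U x\<^esub> T x) (vsp U x)" if "x \<in> verts Q" for x
    using ssp_set_add[OF Xs[OF that] Ts[OF that]] .
  fix a u assume a: "a \<in> arcs Q"
  note tv = tail_v[OF a] and hv = head_v[OF a] and m = rep_mhom[OF U a]
  show "amap U a u \<in> X (head Q a) <+>\<^bsub>vsp U (head Q a)\<^esub> T (head Q a)"
    if "u \<in> X (tail Q a) <+>\<^bsub>vsp U (tail Q a)\<^esub> T (tail Q a)"
  proof -
    from that obtain p q where pq: "p \<in> X (tail Q a)" "q \<in> T (tail Q a)" "u = p \<oplus>\<^bsub>vsp U (tail Q a)\<^esub> q"
      unfolding mem_set_add by blast
    have "amap U a u = amap U a p \<oplus>\<^bsub>vsp U (head Q a)\<^esub> amap U a q"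
      unfolding pq(3) using hom_add[OF m ssp_mem[OF Xs[OF tv] pq(1)] ssp_mem[OF Ts[OF tv] pq(2)]] .
    then show ?thesis unfolding mem_set_add
      using subrep_arr[OF satsub_subrep[OF X] a pq(1)] subrep_arr[OF episub_subrep[OF T] a pq(2)] by blast
  qed
  show "u \<in> X (tail Q a) <+>\<^bsub>vsp U (tail Q a)\<^esub> T (tail Q a)"
    if uc: "u \<in> carrier (vsp U (tail Q a))" and au: "amap U a u \<in> X (head Q a) <+>\<^bsub>vsp U (head Q a)\<^esub> T (head Q a)"
  proof -
    interpret H: vectorspace K "vsp U (head Q a)" by (rule rep_vs[OF U hv])
    interpret T: vectorspace K "vsp U (tail Q a)" by (rule rep_vs[OF U tv])
    from au obtain p q where pq: "p \<in> X (head Q a)" "q \<in> T (head Q a)" "amap U a u = p \<oplus>\<^bsub>vsp U (head Q a)\<^esub> q"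
      unfolding mem_set_add by blast
    from episub_surj[OF T a pq(2)] obtain q' where q': "q' \<in> T (tail Q a)" "q = amap U a q'" .
    note pc = ssp_mem[OF Xs[OF hv] pq(1)] and qc = ssp_mem[OF Ts[OF hv] pq(2)] and qc' = ssp_mem[OF Ts[OF tv] q'(1)]
    have "amap U a (u \<ominus>\<^bsub>vsp U (tail Q a)\<^esub> q') = (q \<oplus>\<^bsub>vsp U (head Q a)\<^esub> p) \<ominus>\<^bsub>vsp U (head Q a)\<^esub> q"
      using hom_minus[OF rep_vs[OF U tv] rep_vs[OF U hv] m uc qc'] pq(3) q'(2) H.M.a_comm[OF pc qc] by simp
    also have "\<dots> = p" by (rule vs_add_minus[OF rep_vs[OF U hv] pc qc])
    finally have "u \<ominus>\<^bsub>vsp U (tail Q a)\<^esub> q' \<in> X (tail Q a)"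
      using satsubD[OF X a] pq(1) uc qc' rep_vs[OF U tv] by simp
    moreover have "u = (u \<ominus>\<^bsub>vsp U (tail Q a)\<^esub> q') \<oplus>\<^bsub>vsp U (tail Q a)\<^esub> q'"
      using vs_minus_add[OF rep_vs[OF U tv] uc qc'] T.M.a_comm[OF vs_minus[OF rep_vs[OF U tv] uc qc'] qc'] by simp
    ultimately show ?thesis unfolding mem_set_add using q'(1) by blast
  qed
qed

context
  fixes V W :: "('k, ('k, 's) univ, 'v, 'a) quiver_rep"
  assumes V: "rep V" and W: "rep W"
begin

abbreviation (input) "VT \<equiv> rep_tensor K Q V W"
abbreviation (input) "PP x \<equiv> pure_tensor K (vsp V x) (vsp W x)"

lemma VT_vsp: "vsp VT x = tensor K (vsp V x) (vsp W x)" by (rule VW_vsp[OF V W])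
lemma VT_rep: "rep VT" by (rule VW_rep[OF V W])
lemma PP_bilin: "x \<in> verts Q \<Longrightarrow> bilin (vsp V x) (vsp W x) (vsp VT x) (PP x)"
  unfolding VT_vsp by (rule pure_bilin[OF rep_fd[OF V] rep_fd[OF W]])
lemma PP_closed: "x \<in> verts Q \<Longrightarrow> v \<in> carrier (vsp V x) \<Longrightarrow> w \<in> carrier (vsp W x) \<Longrightarrow> PP x v w \<in> carrier (vsp VT x)"
  by (rule bilin_closed[OF PP_bilin])

lemma epi_span_sub: "x \<in> verts Q \<Longrightarrow> {PP x v w | v w. v \<in> epi V x \<and> w \<in> epi W x} \<subseteq> carrier (vsp VT x)"
  using PP_closed epi_mem[OF V] epi_mem[OF W] by blast

text \<open>
  The span of the \<open>v \<otimes> w\<close> with \<open>v\<close> and \<open>w\<close> in the maximal epimorphic subrepresentations.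
\<close>

definition epi_span :: "'v \<Rightarrow> ('k, 's) univ set" where
  "epi_span x = vspan (vsp VT x) {PP x v w | v w. v \<in> epi V x \<and> w \<in> epi W x}"

lemma epi_span_ssp: "x \<in> verts Q \<Longrightarrow> ssp (epi_span x) (vsp VT x)"
  unfolding epi_span_def by (rule ssp_span[OF rep_vs[OF VT_rep] epi_span_sub])

lemma epi_span_pure: "x \<in> verts Q \<Longrightarrow> v \<in> epi V x \<Longrightarrow> w \<in> epi W x \<Longrightarrow> PP x v w \<in> epi_span x"
  unfolding epi_span_def using span_sup[OF rep_vs[OF VT_rep] epi_span_sub] by blast

lemma epi_span_least: "ssp N (vsp VT x) \<Longrightarrow> (\<And>v w. v \<in> epi V x \<Longrightarrow> w \<in> epi W x \<Longrightarrow> PP x v w \<in> N) \<Longrightarrow> epi_span x \<subseteq> N"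
  unfolding epi_span_def by (rule span_least) auto

lemma episub_epi_span: "episub VT epi_span"
proof (rule episubI[OF epi_span_ssp])
  fix a assume a: "a \<in> arcs Q"
  note tv = tail_v[OF a] and hv = head_v[OF a]
  note m = rep_mhom[OF VT_rep a]
  have "epi_span (tail Q a) \<subseteq> {t \<in> carrier (vsp VT (tail Q a)). amap VT a t \<in> epi_span (head Q a)}"
  proof (rule epi_span_least[OF ssp_vimage[OF rep_vs[OF VT_rep tv] m epi_span_ssp[OF hv]]])
    fix v w assume v: "v \<in> epi V (tail Q a)" and w: "w \<in> epi W (tail Q a)"
    note vc = epi_mem[OF V tv v] and wc = epi_mem[OF W tv w]
    show "PP (tail Q a) v w \<in> {t \<in> carrier (vsp VT (tail Q a)). amap VT a t \<in> epi_span (head Q a)}"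
      using PP_closed[OF tv vc wc] epi_span_pure[OF hv epi_arr[OF V a v] epi_arr[OF W a w]] VW_pure[OF V W a vc wc] by simp
  qed
  then show "t \<in> epi_span (tail Q a) \<Longrightarrow> amap VT a t \<in> epi_span (head Q a)" for t by blast
  have "epi_span (head Q a) \<subseteq> amap VT a ` epi_span (tail Q a)"
  proof (rule epi_span_least[OF ssp_image[OF epi_span_ssp[OF tv] m rep_vs[OF VT_rep hv]]])
    fix v w assume v: "v \<in> epi V (head Q a)" and w: "w \<in> epi W (head Q a)"
    from episub_surj[OF episub_epi[OF V] a v] obtain v' where v': "v' \<in> epi V (tail Q a)" "v = amap V a v'" .
    from episub_surj[OF episub_epi[OF W] a w] obtain w' where w': "w' \<in> epi W (tail Q a)" "w = amap W a w'" .
    have "PP (head Q a) v w = amap VT a (PP (tail Q a) v' w')"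
      using VW_pure[OF V W a epi_mem[OF V tv v'(1)] epi_mem[OF W tv w'(1)]] v' w' by simp
    then show "PP (head Q a) v w \<in> amap VT a ` epi_span (tail Q a)" using epi_span_pure[OF tv v'(1) w'(1)] by blast
  qed
  then show "t \<in> epi_span (head Q a) \<Longrightarrow> \<exists>v\<in>epi_span (tail Q a). t = amap VT a v" for t by blast
qed

lemma epi_pure: "x \<in> verts Q \<Longrightarrow> v \<in> epi V x \<Longrightarrow> w \<in> epi W x \<Longrightarrow> PP x v w \<in> epi VT x"
  using epi_upper[OF VT_rep episub_epi_span] epi_span_pure by blast

text \<open>
  Modulo the kernel of the maximal monomorphic quotient, every element of the maximal epimorphic
  subrepresentation of \<open>V \<otimes> W\<close> is a sum of pure tensors from those of \<open>V\<close> and \<open>W\<close>.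
\<close>

lemma epi_tensor_split:
  assumes x: "x \<in> verts Q" and t: "t \<in> epi VT x"
  shows "\<exists>k\<in>mker VT x. \<exists>u\<in>epi_span x. t = k \<oplus>\<^bsub>vsp VT x\<^esub> u"
proof -
  have "epi VT x \<subseteq> mker VT x <+>\<^bsub>vsp VT x\<^esub> epi_span x"
  proof (rule episub_in_satsub[OF V W episub_epi[OF VT_rep] satsub_sum[OF VT_rep episub_epi_span satsub_mker[OF VT_rep]] _ x])
    fix x v w assume x: "x \<in> verts Q" and "v \<in> epi V x" "w \<in> epi W x"
    then show "PP x v w \<in> mker VT x <+>\<^bsub>vsp VT x\<^esub> epi_span x"
      using set_add_sup2[OF mker_ssp[OF VT_rep x] epi_span_ssp[OF x]] epi_span_pure by blast
  qed
  then show ?thesis using t unfolding subset_iff mem_set_add by blast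
qed

subsection \<open>The comparison map\<close>

text \<open>
  The comparison map \<open>R V \<otimes> R W \<rightarrow> R (V \<otimes> W)\<close> sends the tensor product of the classes of \<open>v\<close> and \<open>w\<close> to the
  class of \<open>v \<otimes> w\<close>; by \<open>mker_pure_l\<close> and its mirror image the choice of \<open>v\<close> and \<open>w\<close> does not matter.
\<close>

definition cmap :: "'v \<Rightarrow> ('k, 's) univ \<Rightarrow> ('k, 's) univ" where
  "cmap = (\<lambda>x\<in>verts Q. tlift (vsp (Robj V) x) (vsp (Robj W) x) (vsp (Robj VT) x)
     (\<lambda>p q. mproj VT x (PP x (SOME v. v \<in> epi V x \<and> mproj V x v = p) (SOME w. w \<in> epi W x \<and> mproj W x w = q))))"

lemma R_tensor_ext:
  assumes x: "x \<in> verts Q" and U: "vs_ok U" and f: "f \<in> module_hom K (tensor K (vsp (Robj V) x) (vsp (Robj W) x)) U"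
    and g: "g \<in> module_hom K (tensor K (vsp (Robj V) x) (vsp (Robj W) x)) U"
    and eq: "\<And>v w. v \<in> epi V x \<Longrightarrow> w \<in> epi W x \<Longrightarrow>
      f (pure_tensor K (vsp (Robj V) x) (vsp (Robj W) x) (mproj V x v) (mproj W x w)) =
      g (pure_tensor K (vsp (Robj V) x) (vsp (Robj W) x) (mproj V x v) (mproj W x w))"
    and t: "t \<in> carrier (tensor K (vsp (Robj V) x) (vsp (Robj W) x))"
  shows "f t = g t"
  using R_fd[OF V x] R_fd[OF W x] U f g _ t
proof (rule tensor_ext)
  fix p q assume p: "p \<in> carrier (vsp (Robj V) x)" and q: "q \<in> carrier (vsp (Robj W) x)"
  from R_carrierE[OF V p x] obtain v where "v \<in> epi V x" "p = mproj V x v" .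
  moreover from R_carrierE[OF W q x] obtain w where "w \<in> epi W x" "q = mproj W x w" .
  ultimately show "f (pure_tensor K (vsp (Robj V) x) (vsp (Robj W) x) p q) =
      g (pure_tensor K (vsp (Robj V) x) (vsp (Robj W) x) p q)" using eq by simp
qed

context
  fixes x assumes x: "x \<in> verts Q"
begin

lemma cmap_well_defined:
  assumes v: "v \<in> epi V x" "v' \<in> epi V x" "mproj V x v = mproj V x v'"
    and w: "w \<in> epi W x" "w' \<in> epi W x" "mproj W x w = mproj W x w'"
  shows "mproj VT x (PP x v w) = mproj VT x (PP x v' w')"
proof -
  note vV = rep_vs[OF V x] and vW = rep_vs[OF W x] and vT = rep_vs[OF VT_rep x]
  note b = PP_bilin[OF x]
  note c = epi_mem[OF V x v(1)] epi_mem[OF V x v(2)] epi_mem[OF W x w(1)] epi_mem[OF W x w(2)]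
  have "PP x v w \<ominus>\<^bsub>vsp VT x\<^esub> PP x v' w = PP x (v \<ominus>\<^bsub>vsp V x\<^esub> v') w"
    using hom_minus[OF vV vT bilin_l[OF b c(3)] c(1,2)] by simp
  moreover have "v \<ominus>\<^bsub>vsp V x\<^esub> v' \<in> mker V x" using mproj_eq[OF V x c(1,2)] v(3) by simp
  ultimately have "PP x v w \<ominus>\<^bsub>vsp VT x\<^esub> PP x v' w \<in> mker VT x" using mker_pure_l[OF V W x _ w(1)] by simp
  then have 1: "mproj VT x (PP x v w) = mproj VT x (PP x v' w)"
    using mproj_eq[OF VT_rep x PP_closed[OF x c(1,3)] PP_closed[OF x c(2,3)]] by simp
  have "PP x v' w \<ominus>\<^bsub>vsp VT x\<^esub> PP x v' w' = PP x v' (w \<ominus>\<^bsub>vsp W x\<^esub> w')"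
    using hom_minus[OF vW vT bilin_r[OF b c(2)] c(3,4)] by simp
  moreover have "w \<ominus>\<^bsub>vsp W x\<^esub> w' \<in> mker W x" using mproj_eq[OF W x c(3,4)] w(3) by simp
  ultimately have "PP x v' w \<ominus>\<^bsub>vsp VT x\<^esub> PP x v' w' \<in> mker VT x" using mker_pure_r[OF V W x v(2)] by simp
  then have "mproj VT x (PP x v' w) = mproj VT x (PP x v' w')"
    using mproj_eq[OF VT_rep x PP_closed[OF x c(2,3)] PP_closed[OF x c(2,4)]] by simp
  with 1 show ?thesis by simp
qed

lemma cmap_facts:
  shows cmap_lin: "cmap x \<in> lin K (tensor K (vsp (Robj V) x) (vsp (Robj W) x)) (vsp (Robj VT) x)"
    and cmap_pure: "v \<in> epi V x \<Longrightarrow> w \<in> epi W x \<Longrightarrow>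
      cmap x (pure_tensor K (vsp (Robj V) x) (vsp (Robj W) x) (mproj V x v) (mproj W x w)) = mproj VT x (PP x v w)"
proof -
  define b where "b = (\<lambda>p q. mproj VT x (PP x (SOME v. v \<in> epi V x \<and> mproj V x v = p) (SOME w. w \<in> epi W x \<and> mproj W x w = q)))"
  have b: "b (mproj V x v) (mproj W x w) = mproj VT x (PP x v w)" if v: "v \<in> epi V x" and w: "w \<in> epi W x" for v w
  proof -
    have 1: "(SOME v'. v' \<in> epi V x \<and> mproj V x v' = mproj V x v) \<in> epi V x \<and>
        mproj V x (SOME v'. v' \<in> epi V x \<and> mproj V x v' = mproj V x v) = mproj V x v"
      by (rule someI[of _ v]) (simp add: v)
    have 2: "(SOME w'. w' \<in> epi W x \<and> mproj W x w' = mproj W x w) \<in> epi W x \<and>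
        mproj W x (SOME w'. w' \<in> epi W x \<and> mproj W x w' = mproj W x w) = mproj W x w"
      by (rule someI[of _ w]) (simp add: w)
    show ?thesis unfolding b_def using 1 2 v w by (intro cmap_well_defined) auto
  qed
  note vV = rep_vs[OF V x] and vW = rep_vs[OF W x] and pb = PP_bilin[OF x]
  note eV = epi_ssp[OF V x] and eW = epi_ssp[OF W x]
  note mV = epi_mem[OF V x] and mW = epi_mem[OF W x]
  have bil: "bilin (vsp (Robj V) x) (vsp (Robj W) x) (vsp (Robj VT) x) b"
  proof (rule bilinI; rule homI)
    fix q assume "q \<in> carrier (vsp (Robj W) x)"
    then obtain w where w: "w \<in> epi W x" "q = mproj W x w" by (rule R_carrierE[OF W _ x])
    fix p assume "p \<in> carrier (vsp (Robj V) x)"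
    then obtain v where v: "v \<in> epi V x" "p = mproj V x v" by (rule R_carrierE[OF V _ x])
    show "b p q \<in> carrier (vsp (Robj VT) x)" using v w b epi_pure[OF x] mproj_mem[OF VT_rep x] by simp
    {
      fix p' assume "p' \<in> carrier (vsp (Robj V) x)"
      then obtain v' where v': "v' \<in> epi V x" "p' = mproj V x v'" by (rule R_carrierE[OF V _ x])
      show "b (p \<oplus>\<^bsub>vsp (Robj V) x\<^esub> p') q = b p q \<oplus>\<^bsub>vsp (Robj VT) x\<^esub> b p' q"
        using v v' w b ssp_add[OF eV] epi_pure[OF x] mV mW
        by (simp add: mproj_add[OF V x, symmetric] mproj_add[OF VT_rep x, symmetric] hom_add[OF bilin_l[OF pb]])
    }
    fix c assume c: "c \<in> carrier K"
    show "b (c \<odot>\<^bsub>vsp (Robj V) x\<^esub> p) q = c \<odot>\<^bsub>vsp (Robj VT) x\<^esub> b p q"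
      using v w b c ssp_smult[OF eV] epi_pure[OF x] mV mW
      by (simp add: mproj_smult[OF V x, symmetric] mproj_smult[OF VT_rep x, symmetric] hom_smult[OF bilin_l[OF pb]])
  next
    fix p assume "p \<in> carrier (vsp (Robj V) x)"
    then obtain v where v: "v \<in> epi V x" "p = mproj V x v" by (rule R_carrierE[OF V _ x])
    fix q assume "q \<in> carrier (vsp (Robj W) x)"
    then obtain w where w: "w \<in> epi W x" "q = mproj W x w" by (rule R_carrierE[OF W _ x])
    show "b p q \<in> carrier (vsp (Robj VT) x)" using v w b epi_pure[OF x] mproj_mem[OF VT_rep x] by simp
    {
      fix q' assume "q' \<in> carrier (vsp (Robj W) x)"
      then obtain w' where w': "w' \<in> epi W x" "q' = mproj W x w'" by (rule R_carrierE[OF W _ x])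
      show "b p (q \<oplus>\<^bsub>vsp (Robj W) x\<^esub> q') = b p q \<oplus>\<^bsub>vsp (Robj VT) x\<^esub> b p q'"
        using v w w' b ssp_add[OF eW] epi_pure[OF x] mV mW
        by (simp add: mproj_add[OF W x, symmetric] mproj_add[OF VT_rep x, symmetric] hom_add[OF bilin_r[OF pb]])
    }
    fix c assume c: "c \<in> carrier K"
    show "b p (c \<odot>\<^bsub>vsp (Robj W) x\<^esub> q) = c \<odot>\<^bsub>vsp (Robj VT) x\<^esub> b p q"
      using v w b c ssp_smult[OF eW] epi_pure[OF x] mV mW
      by (simp add: mproj_smult[OF W x, symmetric] mproj_smult[OF VT_rep x, symmetric] hom_smult[OF bilin_r[OF pb]])
  qed
  have c: "cmap x = tlift (vsp (Robj V) x) (vsp (Robj W) x) (vsp (Robj VT) x) b"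
    using x by (simp add: cmap_def b_def)
  note tl = R_fd[OF V x] R_fd[OF W x] fd_vs[OF R_fd[OF VT_rep x]] bil
  show "cmap x \<in> lin K (tensor K (vsp (Robj V) x) (vsp (Robj W) x)) (vsp (Robj VT) x)"
    unfolding c by (rule tlift_lin[OF tl])
  show "cmap x (pure_tensor K (vsp (Robj V) x) (vsp (Robj W) x) (mproj V x v) (mproj W x w)) = mproj VT x (PP x v w)"
    if "v \<in> epi V x" "w \<in> epi W x"
    unfolding c using tlift_pure[OF tl mproj_mem[OF V x that(1)] mproj_mem[OF W x that(2)]] b[OF that] by simp
qed

lemma cmap_surj: "cmap x ` carrier (tensor K (vsp (Robj V) x) (vsp (Robj W) x)) = carrier (vsp (Robj VT) x)"
proof
  let ?T = "tensor K (vsp (Robj V) x) (vsp (Robj W) x)"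
  note T = tensor_fd[OF R_fd[OF V x] R_fd[OF W x]]
  note h = lin_hom[OF cmap_lin]
  show "cmap x ` carrier ?T \<subseteq> carrier (vsp (Robj VT) x)" using hom_closed[OF h] by blast
  have I: "ssp (cmap x ` carrier ?T) (vsp (Robj VT) x)"
    by (rule ssp_image[OF ssp_full[OF fd_vs[OF T]] h fd_vs[OF R_fd[OF VT_rep x]]])
  then have "ssp (cmap x ` carrier ?T) (quot_space (vsp VT x) (mker VT x))"
    unfolding R_vsp[OF x] ssp_sub_iff[OF R_ssp[OF VT_rep x]] by blast
  from ssp_vimage[OF rep_vs[OF VT_rep x] mproj_hom[OF VT_rep x] this]
  have "epi_span x \<subseteq> {t \<in> carrier (vsp VT x). mproj VT x t \<in> cmap x ` carrier ?T}"
  proof (rule epi_span_least)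
    fix v w assume v: "v \<in> epi V x" and w: "w \<in> epi W x"
    have "pure_tensor K (vsp (Robj V) x) (vsp (Robj W) x) (mproj V x v) (mproj W x w) \<in> carrier ?T"
      by (rule pure_closed[OF R_fd[OF V x] R_fd[OF W x] mproj_mem[OF V x v] mproj_mem[OF W x w]])
    then show "PP x v w \<in> {t \<in> carrier (vsp VT x). mproj VT x t \<in> cmap x ` carrier ?T}"
      using cmap_pure[OF v w] PP_closed[OF x epi_mem[OF V x v] epi_mem[OF W x w]] by (metis (mono_tags, lifting) image_eqI mem_Collect_eq)
  qed
  note sp = this
  show "carrier (vsp (Robj VT) x) \<subseteq> cmap x ` carrier ?T"
  proof
    fix u assume "u \<in> carrier (vsp (Robj VT) x)"
    then obtain t where t: "t \<in> epi VT x" "u = mproj VT x t" by (rule R_carrierE[OF VT_rep _ x])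
    obtain k s where ks: "k \<in> mker VT x" "s \<in> epi_span x" "t = k \<oplus>\<^bsub>vsp VT x\<^esub> s" using epi_tensor_split[OF x t(1)] by blast
    note kc = mker_mem[OF VT_rep x ks(1)] and sc = ssp_mem[OF epi_span_ssp[OF x] ks(2)] and vT = rep_vs[OF VT_rep x]
    interpret T: vectorspace K "vsp VT x" by (rule vT)
    have "t \<ominus>\<^bsub>vsp VT x\<^esub> s = k" using vs_add_minus[OF vT kc sc] ks(3) T.M.a_comm[OF kc sc] by simp
    then have "mproj VT x t = mproj VT x s"
      using mproj_eq[OF VT_rep x epi_mem[OF VT_rep x t(1)] sc] ks(1) by simp
    then show "u \<in> cmap x ` carrier ?T" using sp ks(2) t(2) by auto
  qed
qed

text \<open>
  Followed by the map \<open>h\<close> that the projections \<open>V \<rightarrow> M(V)\<close> and \<open>W \<rightarrow> M(W)\<close> induce, the comparison map becomes the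
  inclusion of \<open>R V \<otimes> R W\<close> into \<open>M(V) \<otimes> M(W)\<close>.  For \<open>h\<close> to exist, the kernel \<open>Z\<close> of \<open>V \<otimes> W \<rightarrow> M(V) \<otimes> M(W)\<close> has to
  contain that of \<open>V \<otimes> W \<rightarrow> M(V \<otimes> W)\<close>, and it does since it is saturated.
\<close>

lemma cmap_inj: "inj_on (cmap x) (carrier (tensor K (vsp (Robj V) x) (vsp (Robj W) x)))"
proof -
  let ?q = "\<lambda>U x. quot_space (vsp U x) (mker U x) :: ('k, ('k, 's) univ) module"
  define \<mu> where "\<mu> x = tensor_map K (vsp V x) (?q V x) (vsp W x) (?q W x) (mproj V x) (mproj W x)" for x
  note tf = rep_fd[OF V] rep_fd[OF W] mquot_fd[OF V] mquot_fd[OF W] mproj_hom[OF V] mproj_hom[OF W]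
  have \<mu>h: "\<mu> x \<in> module_hom K (vsp VT x) (tensor K (?q V x) (?q W x))" if "x \<in> verts Q" for x
    unfolding \<mu>_def VT_vsp by (rule tensor_map_hom[OF tf]) (rule that)+
  have \<mu>p: "\<mu> x (PP x v w) = pure_tensor K (?q V x) (?q W x) (mproj V x v) (mproj W x w)"
    if "x \<in> verts Q" "v \<in> carrier (vsp V x)" "w \<in> carrier (vsp W x)" for x v w
    unfolding \<mu>_def by (rule tensor_map_pure[OF tf]) (use that in auto)
  have qq: "fd_space K (tensor K (?q V x) (?q W x))" if "x \<in> verts Q" for x
    using tensor_fd[OF mquot_fd[OF V that] mquot_fd[OF W that]] .
  define Z where "Z x = {t \<in> carrier (vsp VT x). \<mu> x t = \<zero>\<^bsub>tensor K (?q V x) (?q W x)\<^esub>}" for x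
  have "satsub VT Z"
  proof (rule satsubI)
    show "ssp (Z x) (vsp VT x)" if "x \<in> verts Q" for x
      unfolding Z_def using ssp_ker[OF rep_vs[OF VT_rep that] fd_vs[OF qq[OF that]] \<mu>h[OF that]] .
    fix a assume a: "a \<in> arcs Q"
    note tv = tail_v[OF a] and hv = head_v[OF a]
    define m where "m = tensor_map K (?q V (tail Q a)) (?q V (head Q a)) (?q W (tail Q a)) (?q W (head Q a))
      (amap (quot_rep K Q V (mker V)) a) (amap (quot_rep K Q W (mker W)) a)"
    note mf = mquot_fd[OF V tv] mquot_fd[OF W tv] mquot_fd[OF V hv] mquot_fd[OF W hv]
      lin_hom[OF quot_amap(1)[OF V a]] lin_hom[OF quot_amap(1)[OF W a]]
    have mh: "m \<in> module_hom K (tensor K (?q V (tail Q a)) (?q W (tail Q a))) (tensor K (?q V (head Q a)) (?q W (head Q a)))"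
      unfolding m_def by (rule tensor_map_hom[OF mf])
    have ij: "inj_on (amap (quot_rep K Q U (mker U)) a) (carrier (?q U (tail Q a)))"
      if U: "rep U" for U :: "('k, ('k, 's) univ, 'v, 'a) quiver_rep"
      using satsub_mker[OF U] unfolding satsub_iff[OF U] monomorphic_def using a by (simp add: quot_rep_def)
    have mi: "inj_on m (carrier (tensor K (?q V (tail Q a)) (?q W (tail Q a))))"
      unfolding m_def by (rule tensor_map_inj[OF mf ij[OF V] ij[OF W]])
    have eq: "\<mu> (head Q a) (amap VT a t) = m (\<mu> (tail Q a) t)" if t: "t \<in> carrier (vsp VT (tail Q a))" for t
    proof (rule tensor_ext[OF rep_fd[OF V tv] rep_fd[OF W tv] fd_vs[OF qq[OF hv]]
          hom_comp[OF rep_mhom[OF VT_rep a, unfolded VT_vsp] \<mu>h[OF hv, unfolded VT_vsp]] hom_comp[OF \<mu>h[OF tv, unfolded VT_vsp] mh]])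
      fix v w assume v: "v \<in> carrier (vsp V (tail Q a))" and w: "w \<in> carrier (vsp W (tail Q a))"
      note cv = hom_closed[OF rep_mhom[OF V a] v] hom_closed[OF rep_mhom[OF W a] w]
      show "\<mu> (head Q a) (amap VT a (PP (tail Q a) v w)) = m (\<mu> (tail Q a) (PP (tail Q a) v w))"
        unfolding VW_pure[OF V W a v w] \<mu>p[OF hv cv] \<mu>p[OF tv v w] m_def
          tensor_map_pure[OF mf hom_closed[OF mproj_hom[OF V tv] v] hom_closed[OF mproj_hom[OF W tv] w]]
          quot_amap(2)[OF V a v] quot_amap(2)[OF W a w] ..
    qed (use t in \<open>simp add: VT_vsp\<close>)
    note m0 = hom_zero[OF fd_vs[OF qq[OF tv]] fd_vs[OF qq[OF hv]] mh]
    show "amap VT a t \<in> Z (head Q a)" if "t \<in> Z (tail Q a)" for t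
      using that eq[of t] m0 hom_closed[OF rep_mhom[OF VT_rep a]] by (simp add: Z_def)
    show "t \<in> Z (tail Q a)" if t: "t \<in> carrier (vsp VT (tail Q a))" and "amap VT a t \<in> Z (head Q a)" for t
    proof -
      have "m (\<mu> (tail Q a) t) = \<zero>\<^bsub>tensor K (?q V (head Q a)) (?q W (head Q a))\<^esub>" using that eq[OF t] by (simp add: Z_def)
      then have "\<mu> (tail Q a) t = \<zero>\<^bsub>tensor K (?q V (tail Q a)) (?q W (tail Q a))\<^esub>"
        using mi inj_hom_iff[OF fd_vs[OF qq[OF tv]] fd_vs[OF qq[OF hv]] mh] hom_closed[OF \<mu>h[OF tv] t] by blast
      then show ?thesis using t by (simp add: Z_def)
    qed
  qed
  from mker_lower[OF VT_rep this] have kz: "mker VT x \<subseteq> Z x" .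
  let ?QT = "?q VT x"
  have "\<And>t. t \<in> carrier (vsp VT x) \<Longrightarrow> mproj VT x t = \<zero>\<^bsub>?QT\<^esub> \<Longrightarrow> \<mu> x t = \<zero>\<^bsub>tensor K (?q V x) (?q W x)\<^esub>"
    using mproj_zero[OF VT_rep x] kz unfolding Z_def by blast
  from hom_factor[OF rep_vs[OF VT_rep x] fd_vs[OF mquot_fd[OF VT_rep x]] fd_vs[OF qq[OF x]] mproj_hom[OF VT_rep x]
      quot_im[OF mker_ssp[OF VT_rep x] rep_fd[OF VT_rep x]] \<mu>h[OF x] this]
  obtain h where h: "h \<in> lin K ?QT (tensor K (?q V x) (?q W x))" "\<forall>t\<in>carrier (vsp VT x). h (mproj VT x t) = \<mu> x t" by blast
  have h': "h \<in> module_hom K (vsp (Robj VT) x) (tensor K (?q V x) (?q W x))"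
  proof (rule homI)
    note s = ssp_mem[OF R_ssp[OF VT_rep x]] and hh = lin_hom[OF h(1)]
    show "h v \<in> carrier (tensor K (?q V x) (?q W x))" if "v \<in> carrier (vsp (Robj VT) x)" for v
      using hom_closed[OF hh s] that by (simp add: R_vsp[OF x])
    show "h (v \<oplus>\<^bsub>vsp (Robj VT) x\<^esub> w) = h v \<oplus>\<^bsub>tensor K (?q V x) (?q W x)\<^esub> h w"
      if "v \<in> carrier (vsp (Robj VT) x)" "w \<in> carrier (vsp (Robj VT) x)" for v w
      using hom_add[OF hh s s] that by (simp add: R_vsp[OF x])
    show "h (c \<odot>\<^bsub>vsp (Robj VT) x\<^esub> v) = c \<odot>\<^bsub>tensor K (?q V x) (?q W x)\<^esub> h v"
      if "c \<in> carrier K" "v \<in> carrier (vsp (Robj VT) x)" for c v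
      using hom_smult[OF hh that(1) s] that by (simp add: R_vsp[OF x])
  qed
  have inc: "(\<lambda>v. v) \<in> module_hom K (vsp (Robj U) x) (?q U x)" if U: "rep U" for U :: "('k, ('k, 's) univ, 'v, 'a) quiver_rep"
    using ssp_sub[OF R_ssp[OF U x]] unfolding R_vsp[OF x] by (auto simp: module_hom_def)
  let ?i = "tensor_map K (vsp (Robj V) x) (?q V x) (vsp (Robj W) x) (?q W x) (\<lambda>v. v) (\<lambda>v. v)"
  note rf = R_fd[OF V x] R_fd[OF W x] mquot_fd[OF V x] mquot_fd[OF W x] inc[OF V] inc[OF W]
  have ii: "inj_on ?i (carrier (tensor K (vsp (Robj V) x) (vsp (Robj W) x)))"
    by (rule tensor_map_inj[OF rf]) auto
  have "h (cmap x t) = ?i t" if t: "t \<in> carrier (tensor K (vsp (Robj V) x) (vsp (Robj W) x))" for t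
    using x fd_vs[OF qq[OF x]] hom_comp[OF lin_hom[OF cmap_lin] h'] tensor_map_hom[OF rf] _ t
  proof (rule R_tensor_ext)
    fix v w assume v: "v \<in> epi V x" and w: "w \<in> epi W x"
    note vc = epi_mem[OF V x v] and wc = epi_mem[OF W x w]
    show "h (cmap x (pure_tensor K (vsp (Robj V) x) (vsp (Robj W) x) (mproj V x v) (mproj W x w))) =
      ?i (pure_tensor K (vsp (Robj V) x) (vsp (Robj W) x) (mproj V x v) (mproj W x w))"
      unfolding cmap_pure[OF v w] tensor_map_pure[OF rf mproj_mem[OF V x v] mproj_mem[OF W x w]]
      using h(2) PP_closed[OF x vc wc] \<mu>p[OF x vc wc] by simp
  qed
  then show ?thesis using ii unfolding inj_on_def by metis
qed

end

lemma cmap_rhom: "cmap \<in> rep_hom K Q (rep_tensor K Q (Robj V) (Robj W)) (Robj VT)"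
proof (rule rhomI)
  note RR = VW_vsp[OF R_rep[OF V] R_rep[OF W]]
  show "cmap x \<in> lin K (vsp (rep_tensor K Q (Robj V) (Robj W)) x) (vsp (Robj VT) x)" if "x \<in> verts Q" for x
    using cmap_lin[OF that] by (simp add: RR)
  fix a t assume a: "a \<in> arcs Q" and t: "t \<in> carrier (vsp (rep_tensor K Q (Robj V) (Robj W)) (tail Q a))"
  note tv = tail_v[OF a] and hv = head_v[OF a]
  note ar = rep_mhom[OF VW_rep[OF R_rep[OF V] R_rep[OF W]] a, unfolded RR]
  show "cmap (head Q a) (amap (rep_tensor K Q (Robj V) (Robj W)) a t) = amap (Robj VT) a (cmap (tail Q a) t)"
  proof (rule R_tensor_ext[OF tv fd_vs[OF R_fd[OF VT_rep hv]] hom_comp[OF ar lin_hom[OF cmap_lin[OF hv]]]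
        hom_comp[OF lin_hom[OF cmap_lin[OF tv]] rep_mhom[OF R_rep[OF VT_rep] a]]])
    fix v w assume v: "v \<in> epi V (tail Q a)" and w: "w \<in> epi W (tail Q a)"
    show "cmap (head Q a) (amap (rep_tensor K Q (Robj V) (Robj W)) a
        (pure_tensor K (vsp (Robj V) (tail Q a)) (vsp (Robj W) (tail Q a)) (mproj V (tail Q a) v) (mproj W (tail Q a) w))) =
      amap (Robj VT) a (cmap (tail Q a) (pure_tensor K (vsp (Robj V) (tail Q a)) (vsp (Robj W) (tail Q a)) (mproj V (tail Q a) v) (mproj W (tail Q a) w)))"
      unfolding VW_pure[OF R_rep[OF V] R_rep[OF W] a mproj_mem[OF V tv v] mproj_mem[OF W tv w]]
        R_amap[OF V a v] R_amap[OF W a w] cmap_pure[OF hv epi_arr[OF V a v] epi_arr[OF W a w]] cmap_pure[OF tv v w]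
        R_amap[OF VT_rep a epi_pure[OF tv v w]] VW_pure[OF V W a epi_mem[OF V tv v] epi_mem[OF W tv w]] ..
  qed (use t in \<open>simp add: RR\<close>)
qed (simp add: cmap_def)

lemma cmap_iso: "iso_arr (Rep K Q) (rep_tensor K Q (Robj V) (Robj W)) (Robj VT) cmap"
proof (rule rep_iso[OF VW_rep[OF R_rep[OF V] R_rep[OF W]] cmap_rhom _ R_rep[OF VT_rep]])
  show "bij_betw (cmap x) (carrier (vsp (rep_tensor K Q (Robj V) (Robj W)) x)) (carrier (vsp (Robj VT) x))" if "x \<in> verts Q" for x
    unfolding bij_betw_def VW_vsp[OF R_rep[OF V] R_rep[OF W]] using cmap_inj[OF that] cmap_surj[OF that] by blast
qed

end

end

subsection \<open>The tensor functor axioms\<close>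

lemma (in base) KK_fd: "fd_space K KK"
  unfolding fd_gens_iff
proof (intro conjI KK_vs exI[of _ "{\<one>}"] allI impI)
  fix S assume S: "ssp S KK" "{\<one>} \<subseteq> S"
  have "c \<in> S" if "c \<in> carrier K" for c
    using ssp_smult[OF S(1), of c \<one>] S(2) that by simp
  then show "S = carrier KK" using ssp_sub[OF S(1)] by auto
qed auto

context quiver
begin

text \<open>
  The tensor product of the classes of \<open>v\<close> and \<open>w\<close> in \<open>R V \<otimes> R W\<close>.
\<close>

abbreviation (input) Rpure :: "('k, ('k, 's) univ, 'v, 'a) quiver_rep \<Rightarrow> ('k, ('k, 's) univ, 'v, 'a) quiver_rep \<Rightarrow>
    'v \<Rightarrow> ('k, 's) univ \<Rightarrow> ('k, 's) univ \<Rightarrow> ('k, 's) univ" where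
  "Rpure V W x v w \<equiv> pure_tensor K (vsp (Robj V) x) (vsp (Robj W) x) (mproj V x v) (mproj W x w)"

text \<open>
  Morphisms out of \<open>R V \<otimes> R W\<close> that agree on tensor products of classes are equal.
\<close>

lemma RR_eqI:
  fixes V W U :: "('k, ('k, 's) univ, 'v, 'a) quiver_rep"
  assumes V: "rep V" and W: "rep W" and U: "rep U"
    and f: "f \<in> rep_hom K Q (rep_tensor K Q (Robj V) (Robj W)) U"
    and g: "g \<in> rep_hom K Q (rep_tensor K Q (Robj V) (Robj W)) U"
    and eq: "\<And>x v w. x \<in> verts Q \<Longrightarrow> v \<in> epi V x \<Longrightarrow> w \<in> epi W x \<Longrightarrow> f x (Rpure V W x v w) = g x (Rpure V W x v w)"
  shows "f = g"
proof (rule rhom_eqI[OF f g])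
  note RR = VW_vsp[OF R_rep[OF V] R_rep[OF W]]
  fix x t assume x: "x \<in> verts Q" and t: "t \<in> carrier (vsp (rep_tensor K Q (Robj V) (Robj W)) x)"
  show "f x t = g x t"
    by (rule R_tensor_ext[OF V W x rep_vs[OF U x] rhom_mhom[OF f x, unfolded RR] rhom_mhom[OF g x, unfolded RR] eq[OF x] t[unfolded RR]])
qed

lemma Rpure_mem:
  fixes V W :: "('k, ('k, 's) univ, 'v, 'a) quiver_rep"
  assumes V: "rep V" and W: "rep W" and x: "x \<in> verts Q" and v: "v \<in> epi V x" and w: "w \<in> epi W x"
  shows "Rpure V W x v w \<in> carrier (vsp (rep_tensor K Q (Robj V) (Robj W)) x)"
  unfolding VW_vsp[OF R_rep[OF V] R_rep[OF W]]
  by (rule pure_closed[OF R_fd[OF V x] R_fd[OF W x] mproj_mem[OF V x v] mproj_mem[OF W x w]])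

lemma rtens_pure:
  fixes X X' Y Y' :: "('k, ('k, 's) univ, 'v, 'a) quiver_rep"
  assumes X: "rep X" and X': "rep X'" and Y: "rep Y" and Y': "rep Y'"
    and f: "f \<in> rep_hom K Q X X'" and g: "g \<in> rep_hom K Q Y Y'"
    and x: "x \<in> verts Q" and v: "v \<in> carrier (vsp X x)" and w: "w \<in> carrier (vsp Y x)"
  shows "(\<lambda>x\<in>verts Q. tensor_map K (vsp X x) (vsp X' x) (vsp Y x) (vsp Y' x) (f x) (g x)) x
    (pure_tensor K (vsp X x) (vsp Y x) v w) = pure_tensor K (vsp X' x) (vsp Y' x) (f x v) (g x w)"
  using tensor_map_pure[OF rep_fd[OF X x] rep_fd[OF Y x] rep_fd[OF X' x] rep_fd[OF Y' x] rhom_mhom[OF f x] rhom_mhom[OF g x] v w] x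
  by simp

lemma cmap_natural:
  fixes X X' Y Y' :: "('k, ('k, 's) univ, 'v, 'a) quiver_rep"
  assumes X: "rep X" and X': "rep X'" and Y: "rep Y" and Y': "rep Y'"
    and f: "f \<in> rep_hom K Q X X'" and g: "g \<in> rep_hom K Q Y Y'"
  shows "Comp (Rep K Q) (rep_tensor K Q (Robj X) (Robj Y)) (rep_tensor K Q (Robj X') (Robj Y')) (Robj (rep_tensor K Q X' Y'))
      (cmap X' Y') (TMap (Rep K Q) (Robj X) (Robj X') (Robj Y) (Robj Y') (fmap GT X X' f) (fmap GT Y Y' g)) =
    Comp (Rep K Q) (rep_tensor K Q (Robj X) (Robj Y)) (Robj (rep_tensor K Q X Y)) (Robj (rep_tensor K Q X' Y'))
      (fmap GT (rep_tensor K Q X Y) (rep_tensor K Q X' Y') (TMap (Rep K Q) X X' Y Y' f g)) (cmap X Y)"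
  unfolding Rep_simps
proof -
  note XY = VW_rep[OF X Y] and XY' = VW_rep[OF X' Y']
  note RX = R_rep[OF X] and RY = R_rep[OF Y] and RX' = R_rep[OF X'] and RY' = R_rep[OF Y']
  note Rf = R_fmap_rhom[OF X X' f] and Rg = R_fmap_rhom[OF Y Y' g]
  note fg = rtens_rhom[OF X X' Y Y' f g]
  show "(\<lambda>x\<in>verts Q. compose (carrier (vsp (rep_tensor K Q (Robj X) (Robj Y)) x)) (cmap X' Y' x)
      ((\<lambda>x\<in>verts Q. tensor_map K (vsp (Robj X) x) (vsp (Robj X') x) (vsp (Robj Y) x) (vsp (Robj Y') x) (fmap GT X X' f x) (fmap GT Y Y' g x)) x)) =
    (\<lambda>x\<in>verts Q. compose (carrier (vsp (rep_tensor K Q (Robj X) (Robj Y)) x))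
      (fmap GT (rep_tensor K Q X Y) (rep_tensor K Q X' Y') (\<lambda>x\<in>verts Q. tensor_map K (vsp X x) (vsp X' x) (vsp Y x) (vsp Y' x) (f x) (g x)) x)
      (cmap X Y x))"
  proof (rule RR_eqI[OF X Y R_rep[OF XY'] rcomp_rhom[OF VW_rep[OF RX RY] rtens_rhom[OF RX RX' RY RY' Rf Rg] cmap_rhom[OF X' Y']]
        rcomp_rhom[OF VW_rep[OF RX RY] cmap_rhom[OF X Y] R_fmap_rhom[OF XY XY' fg]]])
    fix x v w assume x: "x \<in> verts Q" and v: "v \<in> epi X x" and w: "w \<in> epi Y x"
    show "(\<lambda>x\<in>verts Q. compose (carrier (vsp (rep_tensor K Q (Robj X) (Robj Y)) x)) (cmap X' Y' x)
      ((\<lambda>x\<in>verts Q. tensor_map K (vsp (Robj X) x) (vsp (Robj X') x) (vsp (Robj Y) x) (vsp (Robj Y') x) (fmap GT X X' f x) (fmap GT Y Y' g x)) x)) x (Rpure X Y x v w) =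
    (\<lambda>x\<in>verts Q. compose (carrier (vsp (rep_tensor K Q (Robj X) (Robj Y)) x))
      (fmap GT (rep_tensor K Q X Y) (rep_tensor K Q X' Y') (\<lambda>x\<in>verts Q. tensor_map K (vsp X x) (vsp X' x) (vsp Y x) (vsp Y' x) (f x) (g x)) x)
      (cmap X Y x)) x (Rpure X Y x v w)"
      unfolding rcomp_apply[OF x Rpure_mem[OF X Y x v w]]
        rtens_pure[OF RX RX' RY RY' Rf Rg x mproj_mem[OF X x v] mproj_mem[OF Y x w]]
        R_fmap[OF X X' f x v] R_fmap[OF Y Y' g x w]
        cmap_pure[OF X' Y' x rhom_epi[OF X X' f x v] rhom_epi[OF Y Y' g x w]] cmap_pure[OF X Y x v w]
        R_fmap[OF XY XY' fg x epi_pure[OF X Y x v w]]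
        rtens_pure[OF X X' Y Y' f g x epi_mem[OF X x v] epi_mem[OF Y x w]] ..
  qed
qed

lemma cmap_braid:
  fixes X Y :: "('k, ('k, 's) univ, 'v, 'a) quiver_rep"
  assumes X: "rep X" and Y: "rep Y"
  shows "Comp (Rep K Q) (rep_tensor K Q (Robj X) (Robj Y)) (rep_tensor K Q (Robj Y) (Robj X)) (Robj (rep_tensor K Q Y X))
      (cmap Y X) (Braid (Rep K Q) (Robj X) (Robj Y)) =
    Comp (Rep K Q) (rep_tensor K Q (Robj X) (Robj Y)) (Robj (rep_tensor K Q X Y)) (Robj (rep_tensor K Q Y X))
      (fmap GT (rep_tensor K Q X Y) (rep_tensor K Q Y X) (Braid (Rep K Q) X Y)) (cmap X Y)"
  unfolding Rep_simps
proof -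
  note XY = VW_rep[OF X Y] and YX = VW_rep[OF Y X]
  note RX = R_rep[OF X] and RY = R_rep[OF Y]
  note b = rbraid_rhom[OF X Y]
  show "(\<lambda>x\<in>verts Q. compose (carrier (vsp (rep_tensor K Q (Robj X) (Robj Y)) x)) (cmap Y X x)
      ((\<lambda>x\<in>verts Q. tensor_braid K (vsp (Robj X) x) (vsp (Robj Y) x)) x)) =
    (\<lambda>x\<in>verts Q. compose (carrier (vsp (rep_tensor K Q (Robj X) (Robj Y)) x))
      (fmap GT (rep_tensor K Q X Y) (rep_tensor K Q Y X) (\<lambda>x\<in>verts Q. tensor_braid K (vsp X x) (vsp Y x)) x) (cmap X Y x))"
  proof (rule RR_eqI[OF X Y R_rep[OF YX] rcomp_rhom[OF VW_rep[OF RX RY] rbraid_rhom[OF RX RY] cmap_rhom[OF Y X]]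
        rcomp_rhom[OF VW_rep[OF RX RY] cmap_rhom[OF X Y] R_fmap_rhom[OF XY YX b]]])
    fix x v w assume x: "x \<in> verts Q" and v: "v \<in> epi X x" and w: "w \<in> epi Y x"
    show "(\<lambda>x\<in>verts Q. compose (carrier (vsp (rep_tensor K Q (Robj X) (Robj Y)) x)) (cmap Y X x)
      ((\<lambda>x\<in>verts Q. tensor_braid K (vsp (Robj X) x) (vsp (Robj Y) x)) x)) x (Rpure X Y x v w) =
    (\<lambda>x\<in>verts Q. compose (carrier (vsp (rep_tensor K Q (Robj X) (Robj Y)) x))
      (fmap GT (rep_tensor K Q X Y) (rep_tensor K Q Y X) (\<lambda>x\<in>verts Q. tensor_braid K (vsp X x) (vsp Y x)) x) (cmap X Y x)) x (Rpure X Y x v w)"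
      unfolding rcomp_apply[OF x Rpure_mem[OF X Y x v w]] cmap_pure[OF X Y x v w] R_fmap[OF XY YX b x epi_pure[OF X Y x v w]]
      unfolding restrict_apply'[OF x] tensor_braid_pure[OF R_fd[OF X x] R_fd[OF Y x] mproj_mem[OF X x v] mproj_mem[OF Y x w]]
        tensor_braid_pure[OF rep_fd[OF X x] rep_fd[OF Y x] epi_mem[OF X x v] epi_mem[OF Y x w]] cmap_pure[OF Y X x w v] ..
  qed
qed

lemma cmap_assoc:
  fixes X Y Z :: "('k, ('k, 's) univ, 'v, 'a) quiver_rep"
  assumes X: "rep X" and Y: "rep Y" and Z: "rep Z"
  defines "S \<equiv> rep_tensor K Q (Robj X) (rep_tensor K Q (Robj Y) (Robj Z))"
    and "T \<equiv> Robj (rep_tensor K Q (rep_tensor K Q X Y) Z)"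
  shows "Comp (Rep K Q) S (Robj (rep_tensor K Q X (rep_tensor K Q Y Z))) T
      (fmap GT (rep_tensor K Q X (rep_tensor K Q Y Z)) (rep_tensor K Q (rep_tensor K Q X Y) Z) (Assoc (Rep K Q) X Y Z))
      (Comp (Rep K Q) S (rep_tensor K Q (Robj X) (Robj (rep_tensor K Q Y Z))) (Robj (rep_tensor K Q X (rep_tensor K Q Y Z)))
        (cmap X (rep_tensor K Q Y Z))
        (TMap (Rep K Q) (Robj X) (Robj X) (rep_tensor K Q (Robj Y) (Robj Z)) (Robj (rep_tensor K Q Y Z)) (Ident (Rep K Q) (Robj X)) (cmap Y Z))) =
    Comp (Rep K Q) S (rep_tensor K Q (Robj (rep_tensor K Q X Y)) (Robj Z)) T
      (cmap (rep_tensor K Q X Y) Z)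
      (Comp (Rep K Q) S (rep_tensor K Q (rep_tensor K Q (Robj X) (Robj Y)) (Robj Z)) (rep_tensor K Q (Robj (rep_tensor K Q X Y)) (Robj Z))
        (TMap (Rep K Q) (rep_tensor K Q (Robj X) (Robj Y)) (Robj (rep_tensor K Q X Y)) (Robj Z) (Robj Z) (cmap X Y) (Ident (Rep K Q) (Robj Z)))
        (Assoc (Rep K Q) (Robj X) (Robj Y) (Robj Z)))"
    (is "?L = ?R")
proof -
  note XY = VW_rep[OF X Y] and YZ = VW_rep[OF Y Z]
  note XYZ = VW_rep[OF X YZ] and XYZ' = VW_rep[OF XY Z]
  note RX = R_rep[OF X] and RY = R_rep[OF Y] and RZ = R_rep[OF Z]
  note RYZ = VW_rep[OF RY RZ] and RXY = VW_rep[OF RX RY]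
  note Srep = VW_rep[OF RX RYZ, folded S_def] and vS = VW_vsp[OF RX RYZ, folded S_def, unfolded VW_vsp[OF RY RZ]]
  note as = rassoc_rhom[OF X Y Z]
  note idc = rtens_rhom[OF RX RX RYZ R_rep[OF YZ] rid_rhom[OF RX] cmap_rhom[OF Y Z], folded S_def]
  note cid = rtens_rhom[OF RXY R_rep[OF XY] RZ RZ cmap_rhom[OF X Y] rid_rhom[OF RZ]]
  note asR = rassoc_rhom[OF RX RY RZ, folded S_def]
  note L1 = rcomp_rhom[OF Srep idc cmap_rhom[OF X YZ]]
  note L = rcomp_rhom[OF Srep L1 R_fmap_rhom[OF XYZ XYZ' as], folded T_def]
  note R1 = rcomp_rhom[OF Srep asR cid]
  note R = rcomp_rhom[OF Srep R1 cmap_rhom[OF XY Z], folded T_def]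
  have vT: "vs_ok (vsp T x)" if "x \<in> verts Q" for x unfolding T_def by (rule rep_vs[OF R_rep[OF XYZ'] that])
  show ?thesis
  proof (rule rhom_eqI)
    show L': "?L \<in> rep_hom K Q S T" unfolding Rep_simps by (rule L)
    show R': "?R \<in> rep_hom K Q S T" unfolding Rep_simps by (rule R)
    fix x s assume x: "x \<in> verts Q" and s: "s \<in> carrier (vsp S x)"
    show "?L x s = ?R x s"
    proof (rule tensor3_ext[OF R_fd[OF X x] R_fd[OF Y x] R_fd[OF Z x] vT[OF x] rhom_mhom[OF L' x, unfolded vS] rhom_mhom[OF R' x, unfolded vS] _ s[unfolded vS]])
      fix p q r assume "p \<in> carrier (vsp (Robj X) x)" "q \<in> carrier (vsp (Robj Y) x)" "r \<in> carrier (vsp (Robj Z) x)"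
      then obtain u v w where u: "u \<in> epi X x" and v: "v \<in> epi Y x" and w: "w \<in> epi Z x"
        and pqr: "p = mproj X x u" "q = mproj Y x v" "r = mproj Z x w"
        by (elim R_carrierE[OF X _ x] R_carrierE[OF Y _ x] R_carrierE[OF Z _ x])
      note pu = mproj_mem[OF X x u] and qv = mproj_mem[OF Y x v] and rw = mproj_mem[OF Z x w]
      let ?vw = "Rpure Y Z x v w"
      define t where "t = pure_tensor K (vsp (Robj X) x) (tensor K (vsp (Robj Y) x) (vsp (Robj Z) x)) (mproj X x u) ?vw"
      have t: "t \<in> carrier (vsp S x)" unfolding t_def vS
        by (rule pure_closed[OF R_fd[OF X x] tensor_fd[OF R_fd[OF Y x] R_fd[OF Z x]] pu pure_closed[OF R_fd[OF Y x] R_fd[OF Z x] qv rw]])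
      have 1: "TMap (Rep K Q) (Robj X) (Robj X) (rep_tensor K Q (Robj Y) (Robj Z)) (Robj (rep_tensor K Q Y Z)) (Ident (Rep K Q) (Robj X)) (cmap Y Z) x t =
          Rpure X (rep_tensor K Q Y Z) x u (pure_tensor K (vsp Y x) (vsp Z x) v w)"
        unfolding Rep_simps t_def
          rtens_pure[OF RX RX RYZ R_rep[OF YZ] rid_rhom[OF RX] cmap_rhom[OF Y Z] x pu Rpure_mem[OF Y Z x v w], unfolded VW_vsp[OF RY RZ]]
          VW_vsp[OF RY RZ] cmap_pure[OF Y Z x v w] using x pu by simp
      note evw = epi_pure[OF Y Z x v w] and euv = epi_pure[OF X Y x u v]
      have "?L x t = fmap GT (rep_tensor K Q X (rep_tensor K Q Y Z)) (rep_tensor K Q (rep_tensor K Q X Y) Z) (Assoc (Rep K Q) X Y Z) x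
          (cmap X (rep_tensor K Q Y Z) x (Rpure X (rep_tensor K Q Y Z) x u (pure_tensor K (vsp Y x) (vsp Z x) v w)))"
        unfolding 1[symmetric] unfolding Rep_simps rcomp_apply[OF x t] ..
      also have "\<dots> = mproj (rep_tensor K Q (rep_tensor K Q X Y) Z) x
          (pure_tensor K (tensor K (vsp X x) (vsp Y x)) (vsp Z x) (pure_tensor K (vsp X x) (vsp Y x) u v) w)"
        unfolding cmap_pure[OF X YZ x u evw] Rep_simps R_fmap[OF XYZ XYZ' as x epi_pure[OF X YZ x u evw]]
        unfolding restrict_apply'[OF x] VW_vsp[OF Y Z] tensor_assoc_pure[OF rep_fd[OF X x] rep_fd[OF Y x] rep_fd[OF Z x] epi_mem[OF X x u] epi_mem[OF Y x v] epi_mem[OF Z x w]] ..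
      finally have l: "?L x t = mproj (rep_tensor K Q (rep_tensor K Q X Y) Z) x
          (pure_tensor K (tensor K (vsp X x) (vsp Y x)) (vsp Z x) (pure_tensor K (vsp X x) (vsp Y x) u v) w)" .
      have 2: "Assoc (Rep K Q) (Robj X) (Robj Y) (Robj Z) x t =
          pure_tensor K (tensor K (vsp (Robj X) x) (vsp (Robj Y) x)) (vsp (Robj Z) x) (Rpure X Y x u v) (mproj Z x w)"
        unfolding t_def Rep_simps restrict_apply'[OF x] tensor_assoc_pure[OF R_fd[OF X x] R_fd[OF Y x] R_fd[OF Z x] pu qv rw] ..
      have 3: "TMap (Rep K Q) (rep_tensor K Q (Robj X) (Robj Y)) (Robj (rep_tensor K Q X Y)) (Robj Z) (Robj Z) (cmap X Y) (Ident (Rep K Q) (Robj Z)) x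
          (pure_tensor K (tensor K (vsp (Robj X) x) (vsp (Robj Y) x)) (vsp (Robj Z) x) (Rpure X Y x u v) (mproj Z x w)) =
          Rpure (rep_tensor K Q X Y) Z x (pure_tensor K (vsp X x) (vsp Y x) u v) w"
        unfolding Rep_simps
          rtens_pure[OF RXY R_rep[OF XY] RZ RZ cmap_rhom[OF X Y] rid_rhom[OF RZ] x Rpure_mem[OF X Y x u v] rw, unfolded VW_vsp[OF RX RY]]
          VW_vsp[OF RX RY] cmap_pure[OF X Y x u v] using x rw by simp
      have "?R x t = cmap (rep_tensor K Q X Y) Z x (TMap (Rep K Q) (rep_tensor K Q (Robj X) (Robj Y)) (Robj (rep_tensor K Q X Y)) (Robj Z) (Robj Z) (cmap X Y)
          (Ident (Rep K Q) (Robj Z)) x (Assoc (Rep K Q) (Robj X) (Robj Y) (Robj Z) x t))"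
        by (simp only: Rep_simps(3) rcomp_apply[OF x t])
      also have "\<dots> = mproj (rep_tensor K Q (rep_tensor K Q X Y) Z) x
          (pure_tensor K (tensor K (vsp X x) (vsp Y x)) (vsp Z x) (pure_tensor K (vsp X x) (vsp Y x) u v) w)"
        unfolding 2 3 cmap_pure[OF XY Z x euv w] unfolding VW_vsp[OF X Y] ..
      finally have r: "?R x t = mproj (rep_tensor K Q (rep_tensor K Q X Y) Z) x
          (pure_tensor K (tensor K (vsp X x) (vsp Y x)) (vsp Z x) (pure_tensor K (vsp X x) (vsp Y x) u v) w)" .
      show "?L x (pure_tensor K (vsp (Robj X) x) (tensor K (vsp (Robj Y) x) (vsp (Robj Z) x)) p (pure_tensor K (vsp (Robj Y) x) (vsp (Robj Z) x) q r)) =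
         ?R x (pure_tensor K (vsp (Robj X) x) (tensor K (vsp (Robj Y) x) (vsp (Robj Z) x)) p (pure_tensor K (vsp (Robj Y) x) (vsp (Robj Z) x) q r))"
        unfolding pqr t_def[symmetric] l r ..
    qed
  qed
qed

lemma unit_rep: "rep (rep_unit K :: ('k, ('k, 's) univ, 'v, 'a) quiver_rep)"
  unfolding is_rep_def rep_unit_def by (simp add: copy_fd[OF KK_fd] lin_restrict[OF fd_vs[OF copy_fd[OF KK_fd]] id_hom])

text \<open>In the unit representation everything is epimorphic and \<open>0\<close> is saturated.\<close>

lemma R_unit: "isomorphic (Rep K Q) (Robj (rep_unit K)) (rep_unit K :: ('k, ('k, 's) univ, 'v, 'a) quiver_rep)"
proof -
  let ?I = "rep_unit K :: ('k, ('k, 's) univ, 'v, 'a) quiver_rep"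
  have ur: "rep ?I" by (rule unit_rep)
  have am: "amap ?I a v = v" if "v \<in> carrier (vsp ?I x)" for a v x using that by (simp add: rep_unit_def)
  have vs: "vsp ?I x = vsp ?I y" for x y by (simp add: rep_unit_def)
  note vv = rep_vs[OF ur]
  have "episub ?I (\<lambda>x. carrier (vsp ?I x))"
  proof (rule episubI)
    show "ssp (carrier (vsp ?I x)) (vsp ?I x)" if "x \<in> verts Q" for x by (rule ssp_full[OF vv[OF that]])
  qed (use am vs in metis)+
  from epi_upper[OF ur this] have e: "epi ?I x = carrier (vsp ?I x)" if "x \<in> verts Q" for x
    using that epi_mem[OF ur] by blast
  have "satsub ?I (\<lambda>x. {\<zero>\<^bsub>vsp ?I x\<^esub>})"
  proof (rule satsubI)
    show "ssp {\<zero>\<^bsub>vsp ?I x\<^esub>} (vsp ?I x)" if "x \<in> verts Q" for x by (rule ssp_trivial[OF vv[OF that]])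
    show "amap ?I a v \<in> {\<zero>\<^bsub>vsp ?I (head Q a)\<^esub>}" if "a \<in> arcs Q" "v \<in> {\<zero>\<^bsub>vsp ?I (tail Q a)\<^esub>}" for a v
      using that(2) am[OF vs_zero[OF vv[OF tail_v[OF that(1)]]], of a] arg_cong[OF vs[of "tail Q a" "head Q a"], of zero] by simp
    show "v \<in> {\<zero>\<^bsub>vsp ?I (tail Q a)\<^esub>}"
      if "v \<in> carrier (vsp ?I (tail Q a))" "amap ?I a v \<in> {\<zero>\<^bsub>vsp ?I (head Q a)\<^esub>}" for a v
      using that am vs by (metis (full_types))
  qed
  from mker_lower[OF ur this] have k: "mker ?I x \<subseteq> {\<zero>\<^bsub>vsp ?I x\<^esub>}" for x .
  define f where "f = (\<lambda>x\<in>verts Q. restrict (mproj ?I x) (carrier (vsp ?I x)))"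
  have mh: "mproj ?I x \<in> module_hom K (vsp ?I x) (vsp (Robj ?I) x)" if x: "x \<in> verts Q" for x
    using mprojE_hom[OF ur x] e[OF x] by simp
  have f: "f \<in> rep_hom K Q ?I (Robj ?I)"
    unfolding f_def by (rule rhomI'[OF ur mh]) (use R_amap[OF ur, symmetric] e[OF tail_v] in auto)
  have "iso_arr (Rep K Q) ?I (Robj ?I) f"
  proof (rule rep_iso[OF ur f _ R_rep[OF ur]])
    fix x assume x: "x \<in> verts Q"
    have "inj_on (mproj ?I x) (carrier (vsp ?I x))"
      unfolding inj_hom_iff[OF vv[OF x] fd_vs[OF R_fd[OF ur x]] mh[OF x]]
      using R_zero[OF ur x] e[OF x] k[of x] by blast
    then show "bij_betw (f x) (carrier (vsp ?I x)) (carrier (vsp (Robj ?I) x))"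
      unfolding bij_betw_def using R_carrier[OF ur x] e[OF x] x by (simp add: f_def inj_on_def)
  qed
  then have "isomorphic (Rep K Q) ?I (Robj ?I)" unfolding isomorphic_def by blast
  then show ?thesis by (rule isomorphic_sym)
qed

theorem GT_tensor_functor:
  "tensor_functor (Rep K Q) (Rep K Q) (GT :: ('k, ('k, 's) univ, 'v, 'a) rep_functor) cmap"
  unfolding tensor_functor_def Let_def Rep_simps(1,2,6,10)
  apply (rule conjI[OF GT_additive])
  apply (rule conjI, intro ballI, (rule cmap_iso; ((unfold mem_Collect_eq)?, assumption)))
  apply (rule conjI, intro ballI, (rule cmap_natural; ((unfold mem_Collect_eq)?, assumption)))
  apply (rule conjI, intro ballI, (rule cmap_assoc; ((unfold mem_Collect_eq)?, assumption)))
  apply (rule conjI, intro ballI, (rule cmap_braid; ((unfold mem_Collect_eq)?, assumption)))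
  apply (rule R_unit)
  done

end

section \<open>Dual spaces and annihilators\<close>

context base
begin

text \<open>The space of functionals; \<open>dual K V\<close> is its copy in the universe.\<close>

abbreviation fctl :: "('k, ('k, 's) univ) module \<Rightarrow> ('k, ('k, 's) univ \<Rightarrow> 'k) module" where
  "fctl V \<equiv> functionals K V"

lemma fctl_simps:
  "carrier (fctl V) = lin K V KK" "\<zero>\<^bsub>fctl V\<^esub> = (\<lambda>v\<in>carrier V. \<zero>)"
  "f \<oplus>\<^bsub>fctl V\<^esub> g = (\<lambda>v\<in>carrier V. f v \<oplus> g v)" "c \<odot>\<^bsub>fctl V\<^esub> f = (\<lambda>v\<in>carrier V. c \<otimes> f v)"
  by (simp_all add: functionals_def)

lemma fctl_mem: "f \<in> carrier (fctl V) \<Longrightarrow> v \<in> carrier V \<Longrightarrow> f v \<in> carrier K"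
  using hom_closed[OF lin_hom, of f V KK v] by (simp add: fctl_simps)

lemma fctl_restrict: "vs_ok V \<Longrightarrow> f \<in> module_hom K V KK \<Longrightarrow> restrict f (carrier V) \<in> carrier (fctl V)"
  unfolding fctl_simps by (rule lin_restrict)

lemma fctl_ext: "f \<in> carrier (fctl V) \<Longrightarrow> g \<in> carrier (fctl V) \<Longrightarrow> (\<And>v. v \<in> carrier V \<Longrightarrow> f v = g v) \<Longrightarrow> f = g"
  unfolding fctl_simps by (rule lin_ext)

lemma fctl_vs:
  assumes V: "vs_ok V" shows "vs_ok (fctl V)"
proof -
  note m = fctl_mem[of _ V]
  have z: "(\<lambda>v. \<zero>) \<in> module_hom K V KK" by (rule homI) simp_all
  have zc: "\<zero>\<^bsub>fctl V\<^esub> \<in> carrier (fctl V)"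
    unfolding fctl_simps(2) by (rule fctl_restrict[OF V z])
  have add: "f \<oplus>\<^bsub>fctl V\<^esub> g \<in> carrier (fctl V)" if f: "f \<in> carrier (fctl V)" and g: "g \<in> carrier (fctl V)" for f g
    unfolding fctl_simps(3)
    using fctl_restrict[OF V hom_plus[OF V KK_vs lin_hom[OF f[unfolded fctl_simps]] lin_hom[OF g[unfolded fctl_simps]]]] by simp
  have sm: "c \<odot>\<^bsub>fctl V\<^esub> f \<in> carrier (fctl V)" if c: "c \<in> carrier K" and f: "f \<in> carrier (fctl V)" for c f
    unfolding fctl_simps(4)
    using fctl_restrict[OF V hom_scale[OF V KK_vs lin_hom[OF f[unfolded fctl_simps]] c]] by simp
  have neg: "f \<oplus>\<^bsub>fctl V\<^esub> ((\<ominus> \<one>) \<odot>\<^bsub>fctl V\<^esub> f) = \<zero>\<^bsub>fctl V\<^esub>" if f: "f \<in> carrier (fctl V)" for f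
    by (rule fctl_ext[of _ V]; ((simp add: that add sm zc; fail) | (simp add: fctl_simps(2-4) m that l_minus r_neg)))
  have neg': "\<exists>g\<in>carrier (fctl V). f \<oplus>\<^bsub>fctl V\<^esub> g = \<zero>\<^bsub>fctl V\<^esub>" if f: "f \<in> carrier (fctl V)" for f
    by (rule bexI[of _ "(\<ominus> \<one>) \<odot>\<^bsub>fctl V\<^esub> f"]) (use neg[OF f] sm[OF _ f] in simp_all)
  have dl: "(c \<oplus> d) \<odot>\<^bsub>fctl V\<^esub> f = c \<odot>\<^bsub>fctl V\<^esub> f \<oplus>\<^bsub>fctl V\<^esub> d \<odot>\<^bsub>fctl V\<^esub> f"
    if "c \<in> carrier K" "d \<in> carrier K" "f \<in> carrier (fctl V)" for c d f
    by (rule fctl_ext[of _ V]; ((simp add: that add sm zc; fail) | (simp add: fctl_simps(2-4) m that l_distr)))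
  have dr: "c \<odot>\<^bsub>fctl V\<^esub> (f \<oplus>\<^bsub>fctl V\<^esub> g) = c \<odot>\<^bsub>fctl V\<^esub> f \<oplus>\<^bsub>fctl V\<^esub> c \<odot>\<^bsub>fctl V\<^esub> g"
    if "c \<in> carrier K" "f \<in> carrier (fctl V)" "g \<in> carrier (fctl V)" for c f g
    by (rule fctl_ext[of _ V]; ((simp add: that add sm zc; fail) | (simp add: fctl_simps(2-4) m that r_distr)))
  have mm: "(c \<otimes> d) \<odot>\<^bsub>fctl V\<^esub> f = c \<odot>\<^bsub>fctl V\<^esub> (d \<odot>\<^bsub>fctl V\<^esub> f)"
    if "c \<in> carrier K" "d \<in> carrier K" "f \<in> carrier (fctl V)" for c d f
    by (rule fctl_ext[of _ V]; ((simp add: that add sm zc; fail) | (simp add: fctl_simps(2-4) m that m_assoc)))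
  have one: "\<one> \<odot>\<^bsub>fctl V\<^esub> f = f" if "f \<in> carrier (fctl V)" for f
    by (rule fctl_ext[of _ V]; ((simp add: that add sm zc; fail) | (simp add: fctl_simps(2-4) m that l_one)))
  have cm: "f \<oplus>\<^bsub>fctl V\<^esub> g = g \<oplus>\<^bsub>fctl V\<^esub> f" if "f \<in> carrier (fctl V)" "g \<in> carrier (fctl V)" for f g
    by (rule fctl_ext[of _ V]; ((simp add: that add sm zc; fail) | (simp add: fctl_simps(2-4) m that a_comm)))
  have as: "f \<oplus>\<^bsub>fctl V\<^esub> g \<oplus>\<^bsub>fctl V\<^esub> h = f \<oplus>\<^bsub>fctl V\<^esub> (g \<oplus>\<^bsub>fctl V\<^esub> h)"
    if "f \<in> carrier (fctl V)" "g \<in> carrier (fctl V)" "h \<in> carrier (fctl V)" for f g h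
    by (rule fctl_ext[of _ V]; ((simp add: that add sm zc; fail) | (simp add: fctl_simps(2-4) m that a_assoc)))
  have rz: "f \<oplus>\<^bsub>fctl V\<^esub> \<zero>\<^bsub>fctl V\<^esub> = f" if "f \<in> carrier (fctl V)" for f
    by (rule fctl_ext[of _ V]; ((simp add: that add sm zc; fail) | (simp add: fctl_simps(2-4) m that r_zero)))
  show ?thesis
    by (rule vs_criteria)
      (use field_axioms zc add sm neg' dl dr mm one cm as rz cm[OF zc] in \<open>auto simp del: fctl_simps\<close>)
qed

text \<open>
  A functional \<open>\<xi>\<close> that vanishes on the common kernel of finitely many functionals is a linear combination of
  them, that is, it lies in every subspace containing them.  When a functional \<open>g\<close> is added to the list,
  either the common kernel stays the same, or it contained some \<open>u\<close> with \<open>g(u) \<noteq> 0\<close>; then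
  \<open>\<xi> - (\<xi>(u) / g(u)) g\<close> vanishes on the common kernel of the others.
\<close>

lemma common_kernel:
  assumes V: "vs_ok V" and S: "ssp S (fctl V)" and I: "finite I" "I \<subseteq> S"
    and x: "\<xi> \<in> carrier (fctl V)" "\<And>v. v \<in> carrier V \<Longrightarrow> (\<And>f. f \<in> I \<Longrightarrow> f v = \<zero>) \<Longrightarrow> \<xi> v = \<zero>"
  shows "\<xi> \<in> S"
  using I x
proof (induction I arbitrary: \<xi> rule: finite_induct)
  case empty
  then have "\<xi> = \<zero>\<^bsub>fctl V\<^esub>"
    by (intro fctl_ext[OF empty(2) vs_zero[OF fctl_vs[OF V]]]) (simp add: fctl_simps)
  then show ?case using ssp_zero[OF S] by simp
next
  case (insert g I)
  note F = fctl_vs[OF V]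
  interpret V: vectorspace K V by (rule V)
  have g: "g \<in> S" "g \<in> carrier (fctl V)" using insert.prems(1) ssp_mem[OF S] by auto
  note gh = lin_hom[OF g(2)[unfolded fctl_simps]] and xh = lin_hom[OF insert.prems(2)[unfolded fctl_simps]]
  have fI: "f \<in> carrier (fctl V)" if "f \<in> I" for f using that insert.prems(1) ssp_mem[OF S] by auto
  show ?case
  proof (cases "\<forall>v\<in>carrier V. (\<forall>f\<in>I. f v = \<zero>) \<longrightarrow> g v = \<zero>")
    case True
    show ?thesis
    proof (rule insert.IH[OF _ insert.prems(2)])
      show "I \<subseteq> S" using insert.prems(1) by blast
      fix v assume "v \<in> carrier V" "\<And>f. f \<in> I \<Longrightarrow> f v = \<zero>"
      with True show "\<xi> v = \<zero>" by (intro insert.prems(3)) auto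
    qed
  next
    case False
    then obtain u where u: "u \<in> carrier V" "\<And>f. f \<in> I \<Longrightarrow> f u = \<zero>" "g u \<noteq> \<zero>" by blast
    define d where "d = inv (g u)"
    have gu: "g u \<in> Units K" using u(3) fctl_mem[OF g(2) u(1)] field_Units by simp
    have d: "d \<in> carrier K" "d \<otimes> g u = \<one>" unfolding d_def using gu by (simp_all add: Units_l_inv)
    define c where "c = d \<otimes> \<xi> u"
    have c: "c \<in> carrier K" unfolding c_def using d fctl_mem[OF insert.prems(2) u(1)] by simp
    define \<zeta> where "\<zeta> = (\<ominus> c) \<odot>\<^bsub>fctl V\<^esub> g"
    have z: "\<zeta> \<in> S" unfolding \<zeta>_def by (rule ssp_smult[OF S _ g(1)]) (use c in simp)
    have zc: "\<zeta> \<in> carrier (fctl V)" by (rule ssp_mem[OF S z])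
    interpret F: vectorspace K "fctl V" by (rule F)
    note cm = F.M.a_comm[OF insert.prems(2) zc]
    have "\<xi> \<oplus>\<^bsub>fctl V\<^esub> \<zeta> \<in> S"
    proof (rule insert.IH)
      show "I \<subseteq> S" using insert.prems(1) by blast
      show "\<xi> \<oplus>\<^bsub>fctl V\<^esub> \<zeta> \<in> carrier (fctl V)" by (rule vs_add[OF F insert.prems(2) zc])
      fix v assume v: "v \<in> carrier V" and k: "\<And>f. f \<in> I \<Longrightarrow> f v = \<zero>"
      \<comment> \<open>The vector \<open>v - (g v / g u) u\<close> lies in all kernels.\<close>
      define e where "e = \<ominus> (g v \<otimes> d)"
      have gv: "g v \<in> carrier K" by (rule fctl_mem[OF g(2) v])
      have guc: "g u \<in> carrier K" and xuc: "\<xi> u \<in> carrier K"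
        using fctl_mem[OF g(2) u(1)] fctl_mem[OF insert.prems(2) u(1)] .
      have e: "e \<in> carrier K" unfolding e_def using gv d by simp
      let ?w = "v \<oplus>\<^bsub>V\<^esub> e \<odot>\<^bsub>V\<^esub> u"
      have w: "?w \<in> carrier V" using v e u(1) by simp
      have hw: "f ?w = f v \<oplus> e \<otimes> f u" if "f \<in> module_hom K V KK" for f
        using hom_add[OF that v, of "e \<odot>\<^bsub>V\<^esub> u"] hom_smult[OF that e u(1)] e u(1) by simp
      have kw: "f ?w = \<zero>" if "f \<in> insert g I" for f
      proof (cases "f = g")
        case True
        have "e \<otimes> g u = \<ominus> g v" unfolding e_def using gv d guc by (simp add: l_minus m_assoc)
        then show ?thesis unfolding True hw[OF gh] using gv by (simp add: r_neg)
      next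
        case False
        then have "f \<in> I" using that by simp
        then show ?thesis unfolding hw[OF lin_hom[OF fI[unfolded fctl_simps, OF \<open>f \<in> I\<close>]]] using k[OF \<open>f \<in> I\<close>] u(2)[OF \<open>f \<in> I\<close>] e by simp
      qed
      have "\<xi> ?w = \<zero>" by (rule insert.prems(3)[OF w]) (erule kw)
      then have "\<xi> v \<oplus> e \<otimes> \<xi> u = \<zero>" unfolding hw[OF xh] .
      moreover have "e \<otimes> \<xi> u = \<ominus> c \<otimes> g v" unfolding e_def c_def using gv d xuc by (simp add: l_minus r_minus m_ac)
      ultimately show "(\<xi> \<oplus>\<^bsub>fctl V\<^esub> \<zeta>) v = \<zero>" using v by (simp add: fctl_simps \<zeta>_def)
    qed
    from ssp_minus[OF S this z] show ?thesis
      using vs_add_minus[OF F insert.prems(2) zc] cm by simp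
  qed
qed

text \<open>Some finite set of functionals has common kernel zero; by the previous lemma it generates.\<close>

lemma fctl_fd:
  assumes V: "fd_space K V" shows "fd_space K (fctl V)"
proof -
  note vV = fd_vs[OF V] and F = fctl_vs[OF fd_vs[OF V]]
  define k where "k I = {v \<in> carrier V. \<forall>f\<in>I. f v = \<zero>}" for I
  have ks: "ssp (k I) V" if I: "I \<subseteq> carrier (fctl V)" for I
  proof (rule sspI[OF vV])
    have h: "f \<in> module_hom K V KK" if "f \<in> I" for f
      using subsetD[OF I that] by (simp add: fctl_simps lin_hom)
    show "k I \<subseteq> carrier V" by (auto simp: k_def)
    show "\<zero>\<^bsub>V\<^esub> \<in> k I" using hom_zero[OF vV KK_vs h] vV by (simp add: k_def)
    show "u \<oplus>\<^bsub>V\<^esub> v \<in> k I" if "u \<in> k I" "v \<in> k I" for u v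
    proof -
      have "f (u \<oplus>\<^bsub>V\<^esub> v) = \<zero>" if "f \<in> I" for f
      proof -
        have "u \<in> carrier V" "v \<in> carrier V" "f u = \<zero>" "f v = \<zero>"
          using that \<open>u \<in> k I\<close> \<open>v \<in> k I\<close> unfolding k_def by blast+
        then show ?thesis using hom_add[OF h[OF that], of u v] by simp
      qed
      then show ?thesis using that vV by (simp add: k_def)
    qed
    show "c \<odot>\<^bsub>V\<^esub> v \<in> k I" if "c \<in> carrier K" "v \<in> k I" for c v
    proof -
      have "f (c \<odot>\<^bsub>V\<^esub> v) = \<zero>" if "f \<in> I" for f
      proof -
        have "v \<in> carrier V" "f v = \<zero>" using that \<open>v \<in> k I\<close> unfolding k_def by blast+
        then show ?thesis using hom_smult[OF h[OF that] \<open>c \<in> carrier K\<close>, of v] \<open>c \<in> carrier K\<close> by simp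
      qed
      then show ?thesis using that vV by (simp add: k_def)
    qed
  qed
  define P where "P I \<longleftrightarrow> finite I \<and> I \<subseteq> carrier (fctl V)" for I
  define d where "d I = vectorspace.dim K (V\<lparr>carrier := k I\<rparr>)" for I
  have "P {}" by (simp add: P_def)
  \<comment> \<open>Finitely many functionals whose common kernel has the least dimension have common kernel zero.\<close>
  from ex_has_least_nat[of P, OF this, of d] obtain I where I: "P I" "\<And>J. P J \<Longrightarrow> d I \<le> d J" by blast
  have k0: "v = \<zero>\<^bsub>V\<^esub>" if v: "v \<in> k I" for v
  proof (rule ccontr)
    assume nz: "v \<noteq> \<zero>\<^bsub>V\<^esub>"
    have vc: "v \<in> carrier V" using v by (simp add: k_def)
    from separation[OF V ssp_trivial[OF vV] vc] nz obtain x where x: "x \<in> module_hom K V KK" "x v \<noteq> \<zero>" by blast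
    let ?J = "insert (restrict x (carrier V)) I"
    have J: "P ?J" using I(1) fctl_restrict[OF vV x(1)] unfolding P_def by blast
    have "k ?J = k I"
    proof (rule ssp_dim_eq[OF V ks ks])
      show "?J \<subseteq> carrier (fctl V)" "I \<subseteq> carrier (fctl V)" using J I(1) unfolding P_def by blast+
      show "k ?J \<subseteq> k I" by (auto simp: k_def)
      show "vectorspace.dim K (V\<lparr>carrier := k I\<rparr>) \<le> vectorspace.dim K (V\<lparr>carrier := k ?J\<rparr>)"
        using I(2)[OF J] unfolding d_def .
    qed
    then have "v \<in> k ?J" using v by simp
    then show False using x(2) vc by (simp add: k_def)
  qed
  have "S = carrier (fctl V)" if S: "ssp S (fctl V)" "I \<subseteq> S" for S
  proof
    show "S \<subseteq> carrier (fctl V)" by (rule ssp_sub[OF S(1)])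
    show "carrier (fctl V) \<subseteq> S"
    proof
      fix x assume x: "x \<in> carrier (fctl V)"
      show "x \<in> S"
      proof (rule common_kernel[OF vV S(1) _ S(2) x])
        show "finite I" using I(1) by (simp add: P_def)
        fix v assume "v \<in> carrier V" "\<And>f. f \<in> I \<Longrightarrow> f v = \<zero>"
        then have "v = \<zero>\<^bsub>V\<^esub>" by (intro k0) (simp add: k_def)
        then show "x v = \<zero>" using hom_zero[OF vV KK_vs lin_hom[OF x[unfolded fctl_simps]]] by simp
      qed
    qed
  qed
  then show ?thesis unfolding fd_gens_iff using F I(1) unfolding P_def by blast
qed

text \<open>
  Functionals that vanish wherever all elements of the subspace \<open>P\<close> vanish lie in \<open>P\<close>.  Finitely many
  elements generate \<open>P\<close>, so this is again the lemma on common kernels.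
\<close>

lemma double_annihilator:
  assumes V: "fd_space K V" and P: "ssp P (fctl V)" and x: "\<xi> \<in> carrier (fctl V)"
    and v: "\<And>v. v \<in> carrier V \<Longrightarrow> (\<And>f. f \<in> P \<Longrightarrow> f v = \<zero>) \<Longrightarrow> \<xi> v = \<zero>"
  shows "\<xi> \<in> P"
proof -
  note vV = fd_vs[OF V]
  from fd_ssp[OF fctl_fd[OF V] P] obtain B where B: "finite B" "B \<subseteq> P"
    "\<And>S. ssp S ((fctl V)\<lparr>carrier := P\<rparr>) \<Longrightarrow> B \<subseteq> S \<Longrightarrow> S = P"
    unfolding fd_gens_iff by auto
  show ?thesis
  proof (rule common_kernel[OF vV P B(1,2) x])
    fix u assume u: "u \<in> carrier V" and k: "\<And>f. f \<in> B \<Longrightarrow> f u = \<zero>"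
    have "{f \<in> P. f u = \<zero>} = P"
    proof (rule B(3))
      show "ssp {f \<in> P. f u = \<zero>} ((fctl V)\<lparr>carrier := P\<rparr>)"
        unfolding ssp_sub_iff[OF P]
        using ssp_mem[OF P] ssp_zero[OF P] ssp_add[OF P] ssp_smult[OF P] u
        by (auto intro!: sspI[OF fctl_vs[OF vV]] simp: fctl_simps(2-4))
    qed (use B(2) k in auto)
    then show "\<xi> u = \<zero>" using v[OF u] by blast
  qed
qed

text \<open>The value at \<open>v\<close> of an element of the dual space, which is a copy of the space of functionals.\<close>

abbreviation ev :: "('k, ('k, 's) univ) module \<Rightarrow> ('k, 's) univ \<Rightarrow> ('k, 's) univ \<Rightarrow> 'k" where
  "ev V \<xi> v \<equiv> unembed (fctl V) \<xi> v"

lemma dual_fd: "fd_space K V \<Longrightarrow> fd_space K (dual K V :: ('k, ('k, 's) univ) module)"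
  unfolding dual_def by (rule copy_fd[OF fctl_fd])

lemma ev_fctl:
  fixes V :: "('k, ('k, 's) univ) module" and \<xi> :: "('k, 's) univ"
  assumes V: "fd_space K V" and x: "\<xi> \<in> carrier (dual K V)"
  shows "unembed (fctl V) \<xi> \<in> carrier (fctl V)" and "embed (fctl V) (unembed (fctl V) \<xi>) = \<xi>"
proof -
  from x obtain f where f: "f \<in> carrier (fctl V)" "\<xi> = embed (fctl V) f"
    unfolding dual_def embed_im[OF fctl_fd[OF V], symmetric] by blast
  then show "unembed (fctl V) \<xi> \<in> carrier (fctl V)" "embed (fctl V) (unembed (fctl V) \<xi>) = \<xi>"
    by (simp_all add: unembed_embed[OF fctl_fd[OF V]])
qed

context
  fixes V :: "('k, ('k, 's) univ) module" assumes V: "fd_space K V"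
begin

lemma ev_hom: "\<xi> \<in> carrier (dual K V) \<Longrightarrow> ev V \<xi> \<in> module_hom K V KK"
  using ev_fctl(1)[OF V] lin_hom unfolding fctl_simps by blast

lemma ev_closed [simp]: "\<xi> \<in> carrier (dual K V) \<Longrightarrow> v \<in> carrier V \<Longrightarrow> ev V \<xi> v \<in> carrier K"
  using hom_closed[OF ev_hom] by simp

lemma ev_ext:
  assumes x: "\<xi> \<in> carrier (dual K V)" and y: "\<eta> \<in> carrier (dual K V)"
    and eq: "\<And>v. v \<in> carrier V \<Longrightarrow> ev V \<xi> v = ev V \<eta> v"
  shows "\<xi> = \<eta>"
  using fctl_ext[OF ev_fctl(1)[OF V x] ev_fctl(1)[OF V y] eq] ev_fctl(2)[OF V x] ev_fctl(2)[OF V y] by metis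

lemma embed_fctl:
  assumes f: "f \<in> carrier (fctl V)"
  shows "embed (fctl V) f \<in> carrier (dual K V)" and "ev V (embed (fctl V) f) v = f v"
  using f embed_im[OF fctl_fd[OF V]] by (auto simp: dual_def unembed_embed[OF fctl_fd[OF V] f])

lemma ev_surj:
  assumes f: "f \<in> module_hom K V KK"
  obtains \<xi> where "\<xi> \<in> carrier (dual K V)" "\<And>v. v \<in> carrier V \<Longrightarrow> ev V \<xi> v = f v"
  using embed_fctl[OF fctl_restrict[OF fd_vs[OF V] f]] that by (metis restrict_apply')

lemma ev_add:
  assumes x: "\<xi> \<in> carrier (dual K V)" and y: "\<eta> \<in> carrier (dual K V)" and v: "v \<in> carrier V"
  shows "ev V (\<xi> \<oplus>\<^bsub>dual K V\<^esub> \<eta>) v = ev V \<xi> v \<oplus> ev V \<eta> v"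
proof -
  note e = hom_add[OF embed_hom[OF fctl_fd[OF V]] ev_fctl(1)[OF V x] ev_fctl(1)[OF V y]]
  note c = vs_add[OF fctl_vs[OF fd_vs[OF V]] ev_fctl(1)[OF V x] ev_fctl(1)[OF V y]]
  have "ev V (\<xi> \<oplus>\<^bsub>dual K V\<^esub> \<eta>) v = (unembed (fctl V) \<xi> \<oplus>\<^bsub>fctl V\<^esub> unembed (fctl V) \<eta>) v"
    using embed_fctl(2)[OF c] by (simp only: dual_def e ev_fctl(2)[OF V x] ev_fctl(2)[OF V y])
  then show ?thesis using v by (simp add: fctl_simps)
qed

lemma ev_smult:
  assumes x: "\<xi> \<in> carrier (dual K V)" and d: "d \<in> carrier K" and v: "v \<in> carrier V"
  shows "ev V (d \<odot>\<^bsub>dual K V\<^esub> \<xi>) v = d \<otimes> ev V \<xi> v"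
proof -
  note e = hom_smult[OF embed_hom[OF fctl_fd[OF V]] d ev_fctl(1)[OF V x]]
  note c = vs_smult[OF fctl_vs[OF fd_vs[OF V]] d ev_fctl(1)[OF V x]]
  have "ev V (d \<odot>\<^bsub>dual K V\<^esub> \<xi>) v = (d \<odot>\<^bsub>fctl V\<^esub> unembed (fctl V) \<xi>) v"
    using embed_fctl(2)[OF c] by (simp only: dual_def e ev_fctl(2)[OF V x])
  then show ?thesis using v by (simp add: fctl_simps)
qed

lemma ev_hom2: "v \<in> carrier V \<Longrightarrow> (\<lambda>\<xi>. ev V \<xi> v) \<in> module_hom K (dual K V) KK"
  by (rule homI) (simp_all add: ev_add ev_smult)

text \<open>
  Annihilators: the elements of the dual space vanishing on \<open>N\<close>, and the vectors at which all elements
  of \<open>P\<close> vanish.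
\<close>

definition perp :: "('k, 's) univ set \<Rightarrow> ('k, 's) univ set" where
  "perp N = {\<xi> \<in> carrier (dual K V). \<forall>v\<in>N. ev V \<xi> v = \<zero>}"

definition coperp :: "('k, 's) univ set \<Rightarrow> ('k, 's) univ set" where
  "coperp P = {v \<in> carrier V. \<forall>\<xi>\<in>P. ev V \<xi> v = \<zero>}"

lemma perp_ssp: assumes N: "N \<subseteq> carrier V" shows "ssp (perp N) (dual K V)"
proof (rule sspI[OF fd_vs[OF dual_fd[OF V]]])
  note dv = fd_vs[OF dual_fd[OF V]]
  show "\<zero>\<^bsub>dual K V\<^esub> \<in> perp N" using hom_zero[OF dv KK_vs ev_hom2] N dv by (auto simp: perp_def)
qed (use N fd_vs[OF dual_fd[OF V]] in \<open>auto simp: perp_def ev_add ev_smult subset_iff\<close>)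

lemma coperp_ssp: assumes P: "P \<subseteq> carrier (dual K V)" shows "ssp (coperp P) V"
proof (rule sspI[OF fd_vs[OF V]])
  note vV = fd_vs[OF V]
  show "\<zero>\<^bsub>V\<^esub> \<in> coperp P" using hom_zero[OF vV KK_vs ev_hom] P vV by (auto simp: coperp_def)
qed (use P fd_vs[OF V] hom_add[OF ev_hom] hom_smult[OF ev_hom] in \<open>auto simp: coperp_def subset_iff\<close>)

lemma perp_coperp: assumes P: "ssp P (dual K V)" shows "perp (coperp P) \<subseteq> P"
proof
  fix x assume "x \<in> perp (coperp P)"
  then have x: "x \<in> carrier (dual K V)" "\<And>v. v \<in> coperp P \<Longrightarrow> ev V x v = \<zero>" by (auto simp: perp_def)
  let ?P = "{f \<in> carrier (fctl V). embed (fctl V) f \<in> P}"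
  have "unembed (fctl V) x \<in> ?P"
  proof (rule double_annihilator[OF V ssp_vimage[OF fctl_vs[OF fd_vs[OF V]] embed_hom[OF fctl_fd[OF V]] P[unfolded dual_def]] ev_fctl(1)[OF V x(1)]])
    fix v assume v: "v \<in> carrier V" and k: "\<And>f. f \<in> ?P \<Longrightarrow> f v = \<zero>"
    have "ev V \<xi> v = \<zero>" if "\<xi> \<in> P" for \<xi>
      using k[of "unembed (fctl V) \<xi>"] ev_fctl[OF V ssp_mem[OF P that]] that by simp
    then show "ev V x v = \<zero>" using x(2) v by (simp add: coperp_def)
  qed
  then show "x \<in> P" using ev_fctl(2)[OF V x(1)] by simp
qed

end

lemma dual_map_facts:
  fixes V W :: "('k, ('k, 's) univ) module"
  assumes V: "fd_space K V" and W: "fd_space K W" and f: "f \<in> module_hom K V W"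
  shows dual_map_lin: "dual_map K V W f \<in> lin K (dual K W) (dual K V)"
    and dual_map_ev: "\<xi> \<in> carrier (dual K W) \<Longrightarrow> v \<in> carrier V \<Longrightarrow> ev V (dual_map K V W f \<xi>) v = ev W \<xi> (f v)"
proof -
  have c: "compose (carrier V) (unembed (fctl W) \<xi>) f \<in> carrier (fctl V)" if "\<xi> \<in> carrier (dual K W)" for \<xi>
    unfolding compose_def by (rule fctl_restrict[OF fd_vs[OF V] hom_comp[OF f ev_hom[OF W that]]])
  have dc: "dual_map K V W f \<xi> \<in> carrier (dual K V)" if "\<xi> \<in> carrier (dual K W)" for \<xi>
    using embed_fctl(1)[OF V c[OF that]] that by (simp add: dual_map_def)
  show e: "ev V (dual_map K V W f \<xi>) v = ev W \<xi> (f v)" if "\<xi> \<in> carrier (dual K W)" "v \<in> carrier V" for \<xi> v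
    using embed_fctl(2)[OF V c[OF that(1)]] that by (simp add: dual_map_def compose_def)
  note dW = fd_vs[OF dual_fd[OF W]] and dV = fd_vs[OF dual_fd[OF V]] and fc = hom_closed[OF f]
  have "dual_map K V W f \<in> module_hom K (dual K W) (dual K V)"
  proof (rule homI[OF dc])
    show "dual_map K V W f (\<xi> \<oplus>\<^bsub>dual K W\<^esub> \<eta>) = dual_map K V W f \<xi> \<oplus>\<^bsub>dual K V\<^esub> dual_map K V W f \<eta>"
      if "\<xi> \<in> carrier (dual K W)" "\<eta> \<in> carrier (dual K W)" for \<xi> \<eta>
      by (rule ev_ext[OF V]) (use that dc dW dV fc in \<open>simp_all add: e ev_add[OF V] ev_add[OF W]\<close>)
    show "dual_map K V W f (d \<odot>\<^bsub>dual K W\<^esub> \<xi>) = d \<odot>\<^bsub>dual K V\<^esub> dual_map K V W f \<xi>"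
      if "d \<in> carrier K" "\<xi> \<in> carrier (dual K W)" for d \<xi>
      by (rule ev_ext[OF V]) (use that dc dW dV fc in \<open>simp_all add: e ev_smult[OF V] ev_smult[OF W]\<close>)
  qed
  then show "dual_map K V W f \<in> lin K (dual K W) (dual K V)" unfolding lin_def by (simp add: dual_map_def)
qed

end

section \<open>The global tensor functor commutes with duality\<close>

context quiver
begin

lemma opp_simps [simp]:
  "verts (opposite Q) = verts Q" "arcs (opposite Q) = arcs Q" "tail (opposite Q) = head Q" "head (opposite Q) = tail Q"
  by (simp_all add: opposite_def)

lemma opp_quiver: "quiver K (opposite Q)"
  by unfold_locales simp_all

text \<open>
  The dual representation, a representation of the opposite quiver, and for the latter the names
  introduced above with the prefix \<open>o\<close>.
\<close>

abbreviation dual_rep :: "('k, ('k, 's) univ, 'v, 'a) quiver_rep \<Rightarrow> ('k, ('k, 's) univ, 'v, 'a) quiver_rep" where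
  "dual_rep V \<equiv> fob (duality K Q) V"

abbreviation oepi :: "('k, ('k, 's) univ, 'v, 'a) quiver_rep \<Rightarrow> 'v \<Rightarrow> ('k, 's) univ set" where
  "oepi \<equiv> epi_part K (opposite Q)"

abbreviation omker :: "('k, ('k, 's) univ, 'v, 'a) quiver_rep \<Rightarrow> 'v \<Rightarrow> ('k, 's) univ set" where
  "omker \<equiv> mono_ker K (opposite Q)"

abbreviation omproj :: "('k, ('k, 's) univ, 'v, 'a) quiver_rep \<Rightarrow> 'v \<Rightarrow> ('k, 's) univ \<Rightarrow> ('k, 's) univ" where
  "omproj V x \<equiv> quot_proj (vsp V x) (omker V x)"

abbreviation oGT :: "('k, ('k, 's) univ, 'v, 'a) rep_functor" where
  "oGT \<equiv> global_tensor_functor K (opposite Q)"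

lemma dual_rep_simps [simp]:
  "vsp (dual_rep V) x = dual K (vsp V x)"
  "amap (dual_rep V) a = dual_map K (vsp V (tail Q a)) (vsp V (head Q a)) (amap V a)"
  by (simp_all add: duality_def)

lemma dual_is_rep:
  fixes V :: "('k, ('k, 's) univ, 'v, 'a) quiver_rep"
  assumes V: "rep V" shows "is_rep K (opposite Q) (dual_rep V)"
  unfolding is_rep_def
  using dual_fd[OF rep_fd[OF V]] dual_map_lin[OF rep_fd[OF V tail_v] rep_fd[OF V head_v] rep_mhom[OF V]] by simp

lemma dual_rhom:
  fixes V W :: "('k, ('k, 's) univ, 'v, 'a) quiver_rep"
  assumes V: "rep V" and W: "rep W" and f: "f \<in> rep_hom K Q V W"
  shows "fmap (duality K Q) W V f \<in> rep_hom K (opposite Q) (dual_rep W) (dual_rep V)"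
    and "x \<in> verts Q \<Longrightarrow> fmap (duality K Q) W V f x = dual_map K (vsp V x) (vsp W x) (f x)"
proof -
  interpret op: quiver K "opposite Q" by (rule opp_quiver)
  let ?g = "fmap (duality K Q) W V f"
  show g: "?g x = dual_map K (vsp V x) (vsp W x) (f x)" if "x \<in> verts Q" for x using that by (simp add: duality_def)
  note dl = dual_map_lin[OF rep_fd[OF V] rep_fd[OF W] rhom_mhom[OF f]]
  note de = dual_map_ev[OF rep_fd[OF V] rep_fd[OF W] rhom_mhom[OF f]]
  show "?g \<in> rep_hom K (opposite Q) (dual_rep W) (dual_rep V)"
  proof (rule op.rhomI)
    show "?g x \<in> lin K (vsp (dual_rep W) x) (vsp (dual_rep V) x)" if "x \<in> verts (opposite Q)" for x
      using dl that g by simp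
    show "?g x = undefined" if "x \<notin> verts (opposite Q)" for x using that by (simp add: duality_def)
    fix a \<xi> assume "a \<in> arcs (opposite Q)" and x0: "\<xi> \<in> carrier (vsp (dual_rep W) (tail (opposite Q) a))"
    then have a: "a \<in> arcs Q" and x: "\<xi> \<in> carrier (dual K (vsp W (head Q a)))" by simp_all
    note t = tail_v[OF a] and h = head_v[OF a]
    note dV = dual_map_facts[OF rep_fd[OF V t] rep_fd[OF V h] rep_mhom[OF V a]]
    note dW = dual_map_facts[OF rep_fd[OF W t] rep_fd[OF W h] rep_mhom[OF W a]]
    have c1: "dual_map K (vsp V (head Q a)) (vsp W (head Q a)) (f (head Q a)) \<xi> \<in> carrier (dual K (vsp V (head Q a)))"
      by (rule hom_closed[OF lin_hom[OF dl[OF h h h]] x])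
    have c2: "dual_map K (vsp W (tail Q a)) (vsp W (head Q a)) (amap W a) \<xi> \<in> carrier (dual K (vsp W (tail Q a)))"
      by (rule hom_closed[OF lin_hom[OF dW(1)] x])
    have "dual_map K (vsp V (tail Q a)) (vsp W (tail Q a)) (f (tail Q a)) (dual_map K (vsp W (tail Q a)) (vsp W (head Q a)) (amap W a) \<xi>) =
      dual_map K (vsp V (tail Q a)) (vsp V (head Q a)) (amap V a) (dual_map K (vsp V (head Q a)) (vsp W (head Q a)) (f (head Q a)) \<xi>)"
    proof (rule ev_ext[OF rep_fd[OF V t] hom_closed[OF lin_hom[OF dl[OF t t t]] c2] hom_closed[OF lin_hom[OF dV(1)] c1]])
      fix v assume v: "v \<in> carrier (vsp V (tail Q a))"
      note fv = hom_closed[OF rhom_mhom[OF f t] v] and av = hom_closed[OF rep_mhom[OF V a] v]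
      show "ev (vsp V (tail Q a)) (dual_map K (vsp V (tail Q a)) (vsp W (tail Q a)) (f (tail Q a)) (dual_map K (vsp W (tail Q a)) (vsp W (head Q a)) (amap W a) \<xi>)) v =
        ev (vsp V (tail Q a)) (dual_map K (vsp V (tail Q a)) (vsp V (head Q a)) (amap V a) (dual_map K (vsp V (head Q a)) (vsp W (head Q a)) (f (head Q a)) \<xi>)) v"
        unfolding de[OF t t t c2 v] dW(2)[OF x fv] dV(2)[OF c1 v] de[OF h h h x av] rhom_arr[OF f a v] ..
    qed
    then show "?g (head (opposite Q) a) (amap (dual_rep W) a \<xi>) = amap (dual_rep V) a (?g (tail (opposite Q) a) \<xi>)"
      by (simp add: g[OF t] g[OF h])
  qed
qed

context
  fixes V :: "('k, ('k, 's) univ, 'v, 'a) quiver_rep"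
  assumes V: "rep V"
begin

lemma dual_arr:
  assumes a: "a \<in> arcs Q" and x: "\<xi> \<in> carrier (dual K (vsp V (head Q a)))"
  shows "amap (dual_rep V) a \<xi> \<in> carrier (dual K (vsp V (tail Q a)))"
    and "v \<in> carrier (vsp V (tail Q a)) \<Longrightarrow> ev (vsp V (tail Q a)) (amap (dual_rep V) a \<xi>) v = ev (vsp V (head Q a)) \<xi> (amap V a v)"
proof -
  note d = dual_map_facts[OF rep_fd[OF V tail_v[OF a]] rep_fd[OF V head_v[OF a]] rep_mhom[OF V a]]
  show "amap (dual_rep V) a \<xi> \<in> carrier (dual K (vsp V (tail Q a)))" using hom_closed[OF lin_hom[OF d(1)] x] by simp
  show "v \<in> carrier (vsp V (tail Q a)) \<Longrightarrow> ev (vsp V (tail Q a)) (amap (dual_rep V) a \<xi>) v = ev (vsp V (head Q a)) \<xi> (amap V a v)"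
    using d(2)[OF x] by simp
qed

lemma perp_arr:
  assumes N: "subrep K Q V N" and a: "a \<in> arcs Q" and x: "\<xi> \<in> perp (vsp V (head Q a)) (N (head Q a))"
  shows "amap (dual_rep V) a \<xi> \<in> perp (vsp V (tail Q a)) (N (tail Q a))"
proof -
  have x: "\<xi> \<in> carrier (dual K (vsp V (head Q a)))" "\<And>v. v \<in> N (head Q a) \<Longrightarrow> ev (vsp V (head Q a)) \<xi> v = \<zero>"
    using x by (auto simp: perp_def[OF rep_fd[OF V head_v[OF a]]])
  show ?thesis unfolding perp_def[OF rep_fd[OF V tail_v[OF a]]]
    using dual_arr[OF a x(1)] x(2)[OF subrep_arr[OF N a]] ssp_mem[OF subrep_ssp[OF N tail_v[OF a]]] by simp
qed

lemma coperp_arr: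
  assumes P: "subrep K (opposite Q) (dual_rep V) P" and a: "a \<in> arcs Q" and v: "v \<in> coperp (vsp V (tail Q a)) (P (tail Q a))"
  shows "amap V a v \<in> coperp (vsp V (head Q a)) (P (head Q a))"
proof -
  interpret op: quiver K "opposite Q" by (rule opp_quiver)
  have v: "v \<in> carrier (vsp V (tail Q a))" "\<And>\<xi>. \<xi> \<in> P (tail Q a) \<Longrightarrow> ev (vsp V (tail Q a)) \<xi> v = \<zero>"
    using v by (auto simp: coperp_def[OF rep_fd[OF V tail_v[OF a]]])
  have "ev (vsp V (head Q a)) \<xi> (amap V a v) = \<zero>" if x: "\<xi> \<in> P (head Q a)" for \<xi>
  proof -
    have xc: "\<xi> \<in> carrier (dual K (vsp V (head Q a)))"
      using ssp_mem[OF op.subrep_ssp[OF P, of "head Q a"]] x a by simp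
    have "amap (dual_rep V) a \<xi> \<in> P (tail Q a)" using op.subrep_arr[OF P, of a \<xi>] x a by simp
    then show ?thesis using v dual_arr(2)[OF a xc v(1)] by simp
  qed
  then show ?thesis using hom_closed[OF rep_mhom[OF V a] v(1)] by (simp add: coperp_def[OF rep_fd[OF V head_v[OF a]]])
qed

text \<open>
  The next four lemmas: annihilators turn saturated subrepresentations of \<open>V\<close> into epimorphic ones of
  \<open>D V\<close> and vice versa, in both directions.
\<close>

lemma episub_perp:
  assumes N: "satsub V N"
  shows "quiver.episub K (opposite Q) (dual_rep V) (\<lambda>x. perp (vsp V x) (N x))"
proof -
  interpret op: quiver K "opposite Q" by (rule opp_quiver)
  note sN = subrep_ssp[OF satsub_subrep[OF N]]
  show ?thesis
  proof (rule op.episubI)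
    show "ssp (perp (vsp V x) (N x)) (vsp (dual_rep V) x)" if "x \<in> verts (opposite Q)" for x
      using perp_ssp[OF rep_fd[OF V] ssp_sub[OF sN]] that by simp
    fix a assume "a \<in> arcs (opposite Q)"
    then have a: "a \<in> arcs Q" by simp
    note t = tail_v[OF a] and h = head_v[OF a]
    show "amap (dual_rep V) a \<xi> \<in> perp (vsp V (head (opposite Q) a)) (N (head (opposite Q) a))"
      if "\<xi> \<in> perp (vsp V (tail (opposite Q) a)) (N (tail (opposite Q) a))" for \<xi>
      using perp_arr[OF satsub_subrep[OF N] a] that unfolding opp_simps .
    show "\<exists>\<xi>\<in>perp (vsp V (tail (opposite Q) a)) (N (tail (opposite Q) a)). \<eta> = amap (dual_rep V) a \<xi>"
      if "\<eta> \<in> perp (vsp V (head (opposite Q) a)) (N (head (opposite Q) a))" for \<eta>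
    proof -
      have e: "\<eta> \<in> carrier (dual K (vsp V (tail Q a)))" "\<And>v. v \<in> N (tail Q a) \<Longrightarrow> ev (vsp V (tail Q a)) \<eta> v = \<zero>"
        using that by (auto simp: perp_def[OF rep_fd[OF V t]])
      have "ev (vsp V (tail Q a)) \<eta> v = \<zero>" if "v \<in> carrier (vsp V (tail Q a))" "amap V a v \<in> N (head Q a)" for v
        using e(2) satsubD[OF N a that] .
      from functional_push[OF rep_vs[OF V t] rep_fd[OF V h] sN[OF h] rep_mhom[OF V a] ev_hom[OF rep_fd[OF V t] e(1)] this]
      obtain r where r: "r \<in> module_hom K (vsp V (head Q a)) KK" "\<forall>b\<in>N (head Q a). r b = \<zero>"
        "\<forall>v\<in>carrier (vsp V (tail Q a)). r (amap V a v) = ev (vsp V (tail Q a)) \<eta> v" by blast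
      obtain \<xi> where x: "\<xi> \<in> carrier (dual K (vsp V (head Q a)))"
        "\<And>v. v \<in> carrier (vsp V (head Q a)) \<Longrightarrow> ev (vsp V (head Q a)) \<xi> v = r v"
          by (rule ev_surj[OF rep_fd[OF V h] r(1)]) (rule that)
      have "\<eta> = amap (dual_rep V) a \<xi>"
        by (rule ev_ext[OF rep_fd[OF V t] e(1) dual_arr(1)[OF a x(1)]])
          (use dual_arr(2)[OF a x(1)] x(2) r(3) hom_closed[OF rep_mhom[OF V a]] in simp)
      moreover have "\<xi> \<in> perp (vsp V (head Q a)) (N (head Q a))"
        unfolding perp_def[OF rep_fd[OF V h]] using x r(2) ssp_mem[OF sN[OF h]] by simp
      ultimately show ?thesis unfolding opp_simps by blast
    qed
  qed
qed

lemma satsub_perp: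
  assumes N: "episub V N"
  shows "quiver.satsub K (opposite Q) (dual_rep V) (\<lambda>x. perp (vsp V x) (N x))"
proof -
  interpret op: quiver K "opposite Q" by (rule opp_quiver)
  note sN = subrep_ssp[OF episub_subrep[OF N]]
  show ?thesis
  proof (rule op.satsubI)
    show "ssp (perp (vsp V x) (N x)) (vsp (dual_rep V) x)" if "x \<in> verts (opposite Q)" for x
      using perp_ssp[OF rep_fd[OF V] ssp_sub[OF sN]] that by simp
    fix a \<xi> assume "a \<in> arcs (opposite Q)"
    then have a: "a \<in> arcs Q" by simp
    note t = tail_v[OF a] and h = head_v[OF a]
    show "amap (dual_rep V) a \<xi> \<in> perp (vsp V (head (opposite Q) a)) (N (head (opposite Q) a))"
      if "\<xi> \<in> perp (vsp V (tail (opposite Q) a)) (N (tail (opposite Q) a))"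
      using perp_arr[OF episub_subrep[OF N] a] that unfolding opp_simps .
    assume x0: "\<xi> \<in> carrier (vsp (dual_rep V) (tail (opposite Q) a))"
      and p: "amap (dual_rep V) a \<xi> \<in> perp (vsp V (head (opposite Q) a)) (N (head (opposite Q) a))"
    have x: "\<xi> \<in> carrier (dual K (vsp V (head Q a)))" using x0 by simp
    have "ev (vsp V (head Q a)) \<xi> w = \<zero>" if w: "w \<in> N (head Q a)" for w
    proof -
      from episub_surj[OF N a w] obtain v where v: "v \<in> N (tail Q a)" "w = amap V a v" .
      show ?thesis
        using p v dual_arr(2)[OF a x ssp_mem[OF sN[OF t] v(1)]] by (simp add: perp_def[OF rep_fd[OF V t]] del: dual_rep_simps)
    qed
    then show "\<xi> \<in> perp (vsp V (tail (opposite Q) a)) (N (tail (opposite Q) a))"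
      using x by (simp add: perp_def[OF rep_fd[OF V h]])
  qed
qed

lemma satsub_coperp:
  assumes P: "quiver.episub K (opposite Q) (dual_rep V) P"
  shows "satsub V (\<lambda>x. coperp (vsp V x) (P x))"
proof -
  interpret op: quiver K "opposite Q" by (rule opp_quiver)
  note sP = op.subrep_ssp[OF op.episub_subrep[OF P], simplified]
  show ?thesis
  proof (rule satsubI)
    show "ssp (coperp (vsp V x) (P x)) (vsp V x)" if "x \<in> verts Q" for x
      by (rule coperp_ssp[OF rep_fd[OF V that] ssp_sub[OF sP[OF that]]])
    fix a v assume a: "a \<in> arcs Q"
    note t = tail_v[OF a] and h = head_v[OF a]
    show "v \<in> coperp (vsp V (tail Q a)) (P (tail Q a)) \<Longrightarrow> amap V a v \<in> coperp (vsp V (head Q a)) (P (head Q a))"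
      by (rule coperp_arr[OF op.episub_subrep[OF P] a])
    assume v: "v \<in> carrier (vsp V (tail Q a))" and av: "amap V a v \<in> coperp (vsp V (head Q a)) (P (head Q a))"
    have "ev (vsp V (tail Q a)) \<eta> v = \<zero>" if e: "\<eta> \<in> P (tail Q a)" for \<eta>
    proof -
      have aop: "a \<in> arcs (opposite Q)" and e': "\<eta> \<in> P (head (opposite Q) a)" using a e by simp_all
      from op.episub_surj[OF P aop e'] obtain \<xi> where x: "\<xi> \<in> P (tail (opposite Q) a)" "\<eta> = amap (dual_rep V) a \<xi>" .
      have x': "\<xi> \<in> P (head Q a)" using x by simp
      show ?thesis unfolding x(2) dual_arr(2)[OF a ssp_mem[OF sP[OF h] x'] v]
        using av x' by (simp add: coperp_def[OF rep_fd[OF V h]])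
    qed
    then show "v \<in> coperp (vsp V (tail Q a)) (P (tail Q a))" using v by (simp add: coperp_def[OF rep_fd[OF V t]])
  qed
qed

lemma episub_coperp:
  assumes P: "quiver.satsub K (opposite Q) (dual_rep V) P"
  shows "episub V (\<lambda>x. coperp (vsp V x) (P x))"
proof -
  interpret op: quiver K "opposite Q" by (rule opp_quiver)
  note sP = op.subrep_ssp[OF op.satsub_subrep[OF P], simplified]
  have cs: "ssp (coperp (vsp V x) (P x)) (vsp V x)" if "x \<in> verts Q" for x
    by (rule coperp_ssp[OF rep_fd[OF V that] ssp_sub[OF sP[OF that]]])
  show ?thesis
  proof (rule episubI[OF cs])
    fix a assume a: "a \<in> arcs Q"
    note t = tail_v[OF a] and h = head_v[OF a]
    show "v \<in> coperp (vsp V (tail Q a)) (P (tail Q a)) \<Longrightarrow> amap V a v \<in> coperp (vsp V (head Q a)) (P (head Q a))" for v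
      by (rule coperp_arr[OF op.satsub_subrep[OF P] a])
    fix w assume w: "w \<in> coperp (vsp V (head Q a)) (P (head Q a))"
    have wc: "w \<in> carrier (vsp V (head Q a))" using w by (simp add: coperp_def[OF rep_fd[OF V h]])
    let ?I = "amap V a ` coperp (vsp V (tail Q a)) (P (tail Q a))"
    have "w \<in> ?I"
    proof (rule ccontr)
      assume "w \<notin> ?I"
      \<comment> \<open>A functional separating \<open>w\<close> from the image pulls back into \<open>P\<close>, hence lies in \<open>P\<close> itself.\<close>
      from separation[OF rep_fd[OF V h] ssp_image[OF cs[OF t] rep_mhom[OF V a] rep_vs[OF V h]] wc this]
      obtain r where r: "r \<in> module_hom K (vsp V (head Q a)) KK" "\<forall>n\<in>?I. r n = \<zero>" "r w \<noteq> \<zero>" by blast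
      obtain \<xi> where x: "\<xi> \<in> carrier (dual K (vsp V (head Q a)))"
        "\<And>v. v \<in> carrier (vsp V (head Q a)) \<Longrightarrow> ev (vsp V (head Q a)) \<xi> v = r v"
          by (rule ev_surj[OF rep_fd[OF V h] r(1)]) (rule that)
      have "ev (vsp V (tail Q a)) (amap (dual_rep V) a \<xi>) v = \<zero>" if v: "v \<in> coperp (vsp V (tail Q a)) (P (tail Q a))" for v
      proof -
        note vc = ssp_mem[OF cs[OF t] v]
        show ?thesis unfolding dual_arr(2)[OF a x(1) vc] x(2)[OF hom_closed[OF rep_mhom[OF V a] vc]] using r(2) v by blast
      qed
      then have "amap (dual_rep V) a \<xi> \<in> perp (vsp V (tail Q a)) (coperp (vsp V (tail Q a)) (P (tail Q a)))"
        unfolding perp_def[OF rep_fd[OF V t]] using dual_arr(1)[OF a x(1)] by blast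
      then have "amap (dual_rep V) a \<xi> \<in> P (head (opposite Q) a)"
        using perp_coperp[OF rep_fd[OF V t] sP[OF t]] by auto
      from op.satsubD[OF P _ _ this] have "\<xi> \<in> P (head Q a)" using a x(1) by simp
      then have "ev (vsp V (head Q a)) \<xi> w = \<zero>" using w by (simp add: coperp_def[OF rep_fd[OF V h]])
      then show False using x(2)[OF wc] r(3) by simp
    qed
    then show "\<exists>v\<in>coperp (vsp V (tail Q a)) (P (tail Q a)). w = amap V a v" by blast
  qed
qed

text \<open>
  Hence the maximal epimorphic subrepresentation of \<open>D V\<close> and the kernel of its maximal monomorphic
  quotient are the annihilators of the corresponding subspaces for \<open>V\<close>, with the roles exchanged.
\<close>

lemma oepi_dual:
  assumes x: "x \<in> verts Q" shows "oepi (dual_rep V) x = perp (vsp V x) (mker V x)"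
proof
  interpret op: quiver K "opposite Q" by (rule opp_quiver)
  note D = dual_is_rep[OF V]
  have xo: "x \<in> verts (opposite Q)" using x by simp
  show "perp (vsp V x) (mker V x) \<subseteq> oepi (dual_rep V) x"
    using op.epi_upper[OF D episub_perp[OF satsub_mker[OF V]] xo] .
  have "mker V x \<subseteq> coperp (vsp V x) (oepi (dual_rep V) x)"
    using mker_lower[OF V satsub_coperp[OF op.episub_epi[OF D]]] .
  then show "oepi (dual_rep V) x \<subseteq> perp (vsp V x) (mker V x)"
    unfolding perp_def[OF rep_fd[OF V x]] coperp_def[OF rep_fd[OF V x]] using op.epi_mem[OF D xo] by auto
qed

lemma omker_dual:
  assumes x: "x \<in> verts Q" shows "omker (dual_rep V) x = perp (vsp V x) (epi V x)"
proof
  interpret op: quiver K "opposite Q" by (rule opp_quiver)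
  note D = dual_is_rep[OF V]
  have xo: "x \<in> verts (opposite Q)" using x by simp
  show "omker (dual_rep V) x \<subseteq> perp (vsp V x) (epi V x)"
    using op.mker_lower[OF D satsub_perp[OF episub_epi[OF V]]] .
  have "coperp (vsp V x) (omker (dual_rep V) x) \<subseteq> epi V x"
    using epi_upper[OF V episub_coperp[OF op.satsub_mker[OF D]] x] .
  then have "perp (vsp V x) (epi V x) \<subseteq> perp (vsp V x) (coperp (vsp V x) (omker (dual_rep V) x))"
    unfolding perp_def[OF rep_fd[OF V x]] by blast
  also have "\<dots> \<subseteq> omker (dual_rep V) x"
    using perp_coperp[OF rep_fd[OF V x]] op.mker_ssp[OF D xo] by simp
  finally show "perp (vsp V x) (epi V x) \<subseteq> omker (dual_rep V) x" .
qed

text \<open>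
  \<open>lifts x \<phi> \<xi>\<close>: the functional \<open>\<xi>\<close> on \<open>V\<^sub>x\<close> vanishes on \<open>mker V x\<close> and induces the functional \<open>\<phi>\<close> on \<open>(R V)\<^sub>x\<close>.
\<close>

definition lifts :: "'v \<Rightarrow> ('k, 's) univ \<Rightarrow> ('k, 's) univ \<Rightarrow> bool" where
  "lifts x \<phi> \<xi> \<longleftrightarrow> \<xi> \<in> oepi (dual_rep V) x \<and>
     (\<forall>e\<in>epi V x. ev (vsp V x) \<xi> e = ev (vsp (Robj V) x) \<phi> (mproj V x e))"

text \<open>
  The comparison map \<open>D (R V) \<rightarrow> R (D V)\<close> sends \<open>\<phi>\<close> to the class of any \<open>\<xi>\<close> that induces it.
\<close>

definition dmap :: "'v \<Rightarrow> ('k, 's) univ \<Rightarrow> ('k, 's) univ" where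
  "dmap = (\<lambda>x\<in>verts Q. \<lambda>\<phi>\<in>carrier (dual K (vsp (Robj V) x)). omproj (dual_rep V) x (SOME \<xi>. lifts x \<phi> \<xi>))"

lemma oepi_carrier: "x \<in> verts Q \<Longrightarrow> \<xi> \<in> oepi (dual_rep V) x \<Longrightarrow> \<xi> \<in> carrier (dual K (vsp V x))"
  using quiver.epi_mem[OF opp_quiver dual_is_rep[OF V], of x \<xi>] by simp

text \<open>
  The class of an element of the dual space modulo \<open>omker\<close> depends only on its values on \<open>epi V x\<close>.
\<close>

lemma omproj_eq:
  assumes x: "x \<in> verts Q" and p: "\<xi> \<in> carrier (dual K (vsp V x))" and q: "\<zeta> \<in> carrier (dual K (vsp V x))"
    and eq: "\<And>e. e \<in> epi V x \<Longrightarrow> ev (vsp V x) \<xi> e = ev (vsp V x) \<zeta> e"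
  shows "omproj (dual_rep V) x \<xi> = omproj (dual_rep V) x \<zeta>"
proof -
  interpret op: quiver K "opposite Q" by (rule opp_quiver)
  note D = dual_is_rep[OF V]
  have xo: "x \<in> verts (opposite Q)" using x by simp
  note dv = fd_vs[OF dual_fd[OF rep_fd[OF V x]]]
  have "\<xi> \<ominus>\<^bsub>dual K (vsp V x)\<^esub> \<zeta> \<in> perp (vsp V x) (epi V x)"
    unfolding perp_def[OF rep_fd[OF V x]]
    using vs_minus[OF dv p q] eq ev_closed[OF rep_fd[OF V x]] q epi_mem[OF V x]
    by (simp add: hom_minus[OF dv KK_vs ev_hom2[OF rep_fd[OF V x]] p q] vs_minus_eq_zero[OF KK_vs, simplified])
  then show ?thesis using op.mproj_eq[OF D xo, of \<xi> \<zeta>] p q omker_dual[OF x] by simp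
qed

lemma lifts_ex:
  assumes x: "x \<in> verts Q" and p: "\<phi> \<in> carrier (dual K (vsp (Robj V) x))"
  shows "\<exists>\<xi>. lifts x \<phi> \<xi>"
proof -
  have "ev (vsp (Robj V) x) \<phi> \<in> module_hom K ((quot_space (vsp V x) (mker V x) :: ('k, ('k, 's) univ) module)\<lparr>carrier := mproj V x ` epi V x\<rparr>) KK"
    using ev_hom[OF R_fd[OF V x] p] unfolding R_vsp[OF x] .
  from hom_extend[OF mquot_fd[OF V x] R_ssp[OF V x] this]
  obtain g where g: "g \<in> module_hom K (quot_space (vsp V x) (mker V x) :: ('k, ('k, 's) univ) module) KK"
    "\<forall>v\<in>mproj V x ` epi V x. g v = ev (vsp (Robj V) x) \<phi> v" by blast
  obtain \<xi> where
    k: "\<xi> \<in> carrier (dual K (vsp V x))" "\<And>v. v \<in> carrier (vsp V x) \<Longrightarrow> ev (vsp V x) \<xi> v = g (mproj V x v)"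
          by (rule ev_surj[OF rep_fd[OF V x] hom_comp[OF mproj_hom[OF V x] g(1)]]) (rule that)
  have "ev (vsp V x) \<xi> v = \<zero>" if "v \<in> mker V x" for v
    using k(2)[OF mker_mem[OF V x that]] mproj_zero[OF V x mker_mem[OF V x that]] that
      hom_zero[OF fd_vs[OF mquot_fd[OF V x]] KK_vs g(1)] by simp
  then have "lifts x \<phi> \<xi>"
    unfolding lifts_def oepi_dual[OF x] perp_def[OF rep_fd[OF V x]] using k g(2) epi_mem[OF V x] by auto
  then show ?thesis by blast
qed

lemma dmap_eq:
  assumes x: "x \<in> verts Q" and p: "\<phi> \<in> carrier (dual K (vsp (Robj V) x))" and k: "lifts x \<phi> \<xi>"
  shows "dmap x \<phi> = omproj (dual_rep V) x \<xi>"
proof -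
  have s: "lifts x \<phi> (SOME \<xi>. lifts x \<phi> \<xi>)" by (rule someI[of "lifts x \<phi>", OF k])
  have "omproj (dual_rep V) x (SOME \<xi>. lifts x \<phi> \<xi>) = omproj (dual_rep V) x \<xi>"
    by (rule omproj_eq[OF x]) (use s k oepi_carrier[OF x] in \<open>auto simp: lifts_def\<close>)
  then show ?thesis using x p by (simp add: dmap_def)
qed

lemma dmap_lin:
  assumes x: "x \<in> verts Q"
  shows "dmap x \<in> lin K (dual K (vsp (Robj V) x)) (vsp (fob oGT (dual_rep V)) x)"
proof -
  interpret op: quiver K "opposite Q" by (rule opp_quiver)
  note D = dual_is_rep[OF V]
  have xo: "x \<in> verts (opposite Q)" using x by simp
  note dR = fd_vs[OF dual_fd[OF R_fd[OF V x]]]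
  note oe = op.epi_ssp[OF D xo, simplified]
  note fV = rep_fd[OF V x] and fR = R_fd[OF V x]
  have "dmap x \<in> module_hom K (dual K (vsp (Robj V) x)) (vsp (fob oGT (dual_rep V)) x)"
  proof (rule homI)
    fix p assume p: "p \<in> carrier (dual K (vsp (Robj V) x))"
    from lifts_ex[OF x p] obtain s where s: "lifts x p s" by blast
    then have se: "s \<in> oepi (dual_rep V) x" by (simp add: lifts_def)
    note sc = oepi_carrier[OF x se]
    show "dmap x p \<in> carrier (vsp (fob oGT (dual_rep V)) x)"
      unfolding dmap_eq[OF x p s] by (rule op.mproj_mem[OF D xo se])
    {
      fix q assume q: "q \<in> carrier (dual K (vsp (Robj V) x))"
      from lifts_ex[OF x q] obtain t where t: "lifts x q t" by blast
      then have te: "t \<in> oepi (dual_rep V) x" by (simp add: lifts_def)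
      note tc = oepi_carrier[OF x te]
      have "lifts x (p \<oplus>\<^bsub>dual K (vsp (Robj V) x)\<^esub> q) (s \<oplus>\<^bsub>dual K (vsp V x)\<^esub> t)"
        using s t ssp_add[OF oe se te] p q sc tc epi_mem[OF V x] mproj_mem[OF V x]
        by (simp add: lifts_def ev_add[OF fV] ev_add[OF fR])
      from dmap_eq[OF x vs_add[OF dR p q] this]
      show "dmap x (p \<oplus>\<^bsub>dual K (vsp (Robj V) x)\<^esub> q) = dmap x p \<oplus>\<^bsub>vsp (fob oGT (dual_rep V)) x\<^esub> dmap x q"
        using op.mproj_add[OF D xo se te] unfolding dmap_eq[OF x p s] dmap_eq[OF x q t] by simp
    }
    fix c assume c: "c \<in> carrier K"
    have "lifts x (c \<odot>\<^bsub>dual K (vsp (Robj V) x)\<^esub> p) (c \<odot>\<^bsub>dual K (vsp V x)\<^esub> s)"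
      using s c ssp_smult[OF oe c se] p sc epi_mem[OF V x] mproj_mem[OF V x]
      by (simp add: lifts_def ev_smult[OF fV] ev_smult[OF fR])
    from dmap_eq[OF x vs_smult[OF dR c p] this]
    show "dmap x (c \<odot>\<^bsub>dual K (vsp (Robj V) x)\<^esub> p) = c \<odot>\<^bsub>vsp (fob oGT (dual_rep V)) x\<^esub> dmap x p"
      using op.mproj_smult[OF D xo c se] unfolding dmap_eq[OF x p s] by simp
  qed
  then show ?thesis unfolding lin_def using x by (simp add: dmap_def)
qed

lemma dmap_bij:
  assumes x: "x \<in> verts Q"
  shows "bij_betw (dmap x) (carrier (dual K (vsp (Robj V) x))) (carrier (vsp (fob oGT (dual_rep V)) x))"
proof -
  interpret op: quiver K "opposite Q" by (rule opp_quiver)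
  note D = dual_is_rep[OF V]
  have xo: "x \<in> verts (opposite Q)" using x by simp
  note dR = fd_vs[OF dual_fd[OF R_fd[OF V x]]]
  note fV = rep_fd[OF V x] and fR = R_fd[OF V x]
  note h = lin_hom[OF dmap_lin[OF x]]
  have "inj_on (dmap x) (carrier (dual K (vsp (Robj V) x)))"
    unfolding inj_hom_iff[OF dR fd_vs[OF op.R_fd[OF D xo]] h]
  proof (intro ballI impI)
    fix p assume p: "p \<in> carrier (dual K (vsp (Robj V) x))" and z: "dmap x p = \<zero>\<^bsub>vsp (fob oGT (dual_rep V)) x\<^esub>"
    from lifts_ex[OF x p] obtain s where s: "lifts x p s" by blast
    then have se: "s \<in> oepi (dual_rep V) x" by (simp add: lifts_def)
    have "s \<in> perp (vsp V x) (epi V x)"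
      using z op.R_zero[OF D xo se] unfolding dmap_eq[OF x p s] omker_dual[OF x] by simp
    then have k: "ev (vsp (Robj V) x) p (mproj V x e) = \<zero>" if "e \<in> epi V x" for e
      using s that by (simp add: lifts_def perp_def[OF fV])
    show "p = \<zero>\<^bsub>dual K (vsp (Robj V) x)\<^esub>"
    proof (rule ev_ext[OF fR p vs_zero[OF dR]])
      fix u assume u: "u \<in> carrier (vsp (Robj V) x)"
      then obtain e where e: "e \<in> epi V x" "u = mproj V x e" by (rule R_carrierE[OF V _ x])
      show "ev (vsp (Robj V) x) p u = ev (vsp (Robj V) x) \<zero>\<^bsub>dual K (vsp (Robj V) x)\<^esub> u"
        using k[OF e(1)] hom_zero[OF dR KK_vs ev_hom2[OF fR u]] e(2) by simp
    qed
  qed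
  moreover have "carrier (vsp (fob oGT (dual_rep V)) x) \<subseteq> dmap x ` carrier (dual K (vsp (Robj V) x))"
  proof
    fix u assume "u \<in> carrier (vsp (fob oGT (dual_rep V)) x)"
    then obtain s where s: "s \<in> oepi (dual_rep V) x" "u = omproj (dual_rep V) x s" by (rule op.R_carrierE[OF D _ xo])
    note sc = oepi_carrier[OF x s(1)]
    let ?E = "(vsp V x)\<lparr>carrier := epi V x\<rparr>"
    have sE: "ev (vsp V x) s \<in> module_hom K ?E KK"
      using ev_hom[OF fV sc] epi_mem[OF V x] by (auto simp: module_hom_def)
    have van: "ev (vsp V x) s e = \<zero>\<^bsub>KK\<^esub>" if e: "e \<in> carrier ?E" and z: "mproj V x e = \<zero>\<^bsub>vsp (Robj V) x\<^esub>" for e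
    proof -
      have "e \<in> mker V x" using R_zero[OF V x] e z by simp
      then show ?thesis using s(1) unfolding oepi_dual[OF x] perp_def[OF fV] by simp
    qed
    have im: "mproj V x ` carrier ?E = carrier (vsp (Robj V) x)" using R_carrier[OF V x] by simp
    from hom_factor[OF ssp_is_vs[OF epi_ssp[OF V x]] fd_vs[OF fR] KK_vs mprojE_hom[OF V x] im sE van]
    obtain g where g: "g \<in> lin K (vsp (Robj V) x) KK" "\<forall>e\<in>carrier ?E. g (mproj V x e) = ev (vsp V x) s e" by blast
    obtain p where p: "p \<in> carrier (dual K (vsp (Robj V) x))"
      "\<And>v. v \<in> carrier (vsp (Robj V) x) \<Longrightarrow> ev (vsp (Robj V) x) p v = g v"
          by (rule ev_surj[OF fR lin_hom[OF g(1)]]) (rule that)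
    have "lifts x p s" unfolding lifts_def using s(1) p(2) g(2) mproj_mem[OF V x] by simp
    then have "dmap x p = u" using dmap_eq[OF x p(1)] s(2) by simp
    then show "u \<in> dmap x ` carrier (dual K (vsp (Robj V) x))" using p(1) by blast
  qed
  ultimately show ?thesis unfolding bij_betw_def using hom_closed[OF h] by blast
qed

lemma dmap_rhom: "dmap \<in> rep_hom K (opposite Q) (dual_rep (Robj V)) (fob oGT (dual_rep V))"
proof -
  interpret op: quiver K "opposite Q" by (rule opp_quiver)
  note D = dual_is_rep[OF V]
  show ?thesis
  proof (rule op.rhomI)
    show "dmap x \<in> lin K (vsp (dual_rep (Robj V)) x) (vsp (fob oGT (dual_rep V)) x)" if "x \<in> verts (opposite Q)" for x
      using dmap_lin that by simp
    show "dmap x = undefined" if "x \<notin> verts (opposite Q)" for x using that by (simp add: dmap_def)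
    fix a p assume ao: "a \<in> arcs (opposite Q)" and "p \<in> carrier (vsp (dual_rep (Robj V)) (tail (opposite Q) a))"
    then have a: "a \<in> arcs Q" and p: "p \<in> carrier (dual K (vsp (Robj V) (head Q a)))" by simp_all
    note t = tail_v[OF a] and h = head_v[OF a]
    from lifts_ex[OF h p] obtain s where s: "lifts (head Q a) p s" by blast
    then have se: "s \<in> oepi (dual_rep V) (head Q a)" by (simp add: lifts_def)
    note sc = oepi_carrier[OF h se]
    note Rd = dual_map_facts[OF R_fd[OF V t] R_fd[OF V h] lin_hom[OF R_amap_lin[OF V a]]]
    have pc: "amap (dual_rep (Robj V)) a p \<in> carrier (dual K (vsp (Robj V) (tail Q a)))"
      using hom_closed[OF lin_hom[OF Rd(1)] p] by simp
    have "lifts (tail Q a) (amap (dual_rep (Robj V)) a p) (amap (dual_rep V) a s)"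
      unfolding lifts_def
    proof (intro conjI ballI)
      show "amap (dual_rep V) a s \<in> oepi (dual_rep V) (tail Q a)"
        using op.epi_arr[OF D ao, of s] se by simp
      fix e assume e: "e \<in> epi V (tail Q a)"
      show "ev (vsp V (tail Q a)) (amap (dual_rep V) a s) e =
        ev (vsp (Robj V) (tail Q a)) (amap (dual_rep (Robj V)) a p) (mproj V (tail Q a) e)"
        unfolding dual_arr(2)[OF a sc epi_mem[OF V t e]]
        using s epi_arr[OF V a e] Rd(2)[OF p mproj_mem[OF V t e]] by (simp add: lifts_def R_amap[OF V a e])
    qed
    from dmap_eq[OF t pc this]
    show "dmap (head (opposite Q) a) (amap (dual_rep (Robj V)) a p) = amap (fob oGT (dual_rep V)) a (dmap (tail (opposite Q) a) p)"
      using op.R_amap[OF D ao, of s] se dmap_eq[OF h p s] by (simp del: dual_rep_simps)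
  qed
qed

end

theorem GT_duality:
  "naturally_isomorphic (op_cat (Rep K Q)) (Rep K (opposite Q))
    (comp_functor (duality K Q) (op_functor (GT :: ('k, ('k, 's) univ, 'v, 'a) rep_functor)))
    (comp_functor oGT (duality K Q))"
proof -
  interpret op: quiver K "opposite Q" by (rule opp_quiver)
  have s: "Ob (op_cat (Rep K Q)) = {V. rep V}" "Hom (op_cat (Rep K Q)) X Y = rep_hom K Q Y X"
    "fob (comp_functor (duality K Q) (op_functor GT)) X = dual_rep (Robj X)"
    "fob (comp_functor oGT (duality K Q)) X = fob oGT (dual_rep X)"
    "fmap (comp_functor (duality K Q) (op_functor GT)) X Y f = fmap (duality K Q) (Robj X) (Robj Y) (fmap GT Y X f)"
    "fmap (comp_functor oGT (duality K Q)) X Y f = fmap oGT (dual_rep X) (dual_rep Y) (fmap (duality K Q) X Y f)"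
    for X Y :: "('k, ('k, 's) univ, 'v, 'a) quiver_rep" and f
    by (simp_all add: op_cat_def comp_functor_def op_functor_def)
  show ?thesis
    unfolding naturally_isomorphic_def s
  proof (intro exI[of _ dmap] conjI ballI)
    fix X :: "('k, ('k, 's) univ, 'v, 'a) quiver_rep" assume "X \<in> {V. rep V}"
    then have X: "rep X" by simp
    show "iso_arr (Rep K (opposite Q)) (dual_rep (Robj X)) (fob oGT (dual_rep X)) (dmap X)"
    proof (rule op.rep_iso[OF dual_is_rep[OF R_rep[OF X]] dmap_rhom[OF X] _ op.R_rep[OF dual_is_rep[OF X]]])
      show "bij_betw (dmap X x) (carrier (vsp (dual_rep (Robj X)) x)) (carrier (vsp (fob oGT (dual_rep X)) x))"
        if "x \<in> verts (opposite Q)" for x using dmap_bij[OF X, of x] that by simp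
    qed
    fix Y :: "('k, ('k, 's) univ, 'v, 'a) quiver_rep" and f assume "Y \<in> {V. rep V}" and f: "f \<in> rep_hom K Q Y X"
    then have Y: "rep Y" by simp
    note RX = R_rep[OF X] and RY = R_rep[OF Y] and Rf = R_fmap_rhom[OF Y X f]
    note DX = dual_is_rep[OF X] and DY = dual_is_rep[OF Y]
    note dRf = dual_rhom[OF RY RX Rf] and df = dual_rhom[OF Y X f]
    let ?L = "\<lambda>x\<in>verts (opposite Q). compose (carrier (vsp (dual_rep (Robj X)) x)) (dmap Y x) (fmap (duality K Q) (Robj X) (Robj Y) (fmap GT Y X f) x)"
    let ?R = "\<lambda>x\<in>verts (opposite Q). compose (carrier (vsp (dual_rep (Robj X)) x)) (fmap oGT (dual_rep X) (dual_rep Y) (fmap (duality K Q) X Y f) x) (dmap X x)"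
    have "?L = ?R"
    proof (rule op.rhom_eqI[OF op.rcomp_rhom[OF dual_is_rep[OF RX] dRf(1) dmap_rhom[OF Y]]
          op.rcomp_rhom[OF dual_is_rep[OF RX] dmap_rhom[OF X] op.R_fmap_rhom[OF DX DY df(1)]]])
      fix x p assume xo: "x \<in> verts (opposite Q)" and p0: "p \<in> carrier (vsp (dual_rep (Robj X)) x)"
      then have x: "x \<in> verts Q" and p: "p \<in> carrier (dual K (vsp (Robj X) x))" by simp_all
      from lifts_ex[OF X x p] obtain s where s: "lifts X x p s" by blast
      then have se: "s \<in> oepi (dual_rep X) x" by (simp add: lifts_def[OF X])
      note sc = oepi_carrier[OF X x se]
      let ?q = "dual_map K (vsp (Robj Y) x) (vsp (Robj X) x) (fmap GT Y X f x) p"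
      let ?t = "dual_map K (vsp Y x) (vsp X x) (f x) s"
      note dR = dual_map_facts[OF R_fd[OF Y x] R_fd[OF X x] rhom_mhom[OF Rf x]]
      note d = dual_map_facts[OF rep_fd[OF Y x] rep_fd[OF X x] rhom_mhom[OF f x]]
      have q: "?q \<in> carrier (dual K (vsp (Robj Y) x))" using hom_closed[OF lin_hom[OF dR(1)] p] .
      have "lifts Y x ?q ?t"
        unfolding lifts_def[OF Y]
      proof (intro conjI ballI)
        show "?t \<in> oepi (dual_rep Y) x"
          using op.rhom_epi[OF DX DY df(1) xo se] df(2)[OF x] by simp
        fix e assume e: "e \<in> epi Y x"
        show "ev (vsp Y x) ?t e = ev (vsp (Robj Y) x) ?q (mproj Y x e)"
          unfolding d(2)[OF sc epi_mem[OF Y x e]] dR(2)[OF p mproj_mem[OF Y x e]] R_fmap[OF Y X f x e]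
          using s rhom_epi[OF Y X f x e] by (simp add: lifts_def[OF X])
      qed
      note l = dmap_eq[OF Y x q this]
      show "?L x p = ?R x p"
        unfolding op.rcomp_apply[OF xo p0] dRf(2)[OF x] l dmap_eq[OF X x p s] op.R_fmap[OF DX DY df(1) xo se] df(2)[OF x] ..
    qed
    then show "Comp (Rep K (opposite Q)) (dual_rep (Robj X)) (dual_rep (Robj Y)) (fob oGT (dual_rep Y)) (dmap Y)
        (fmap (duality K Q) (Robj X) (Robj Y) (fmap GT Y X f)) =
      Comp (Rep K (opposite Q)) (dual_rep (Robj X)) (fob oGT (dual_rep X)) (fob oGT (dual_rep Y))
        (fmap oGT (dual_rep X) (dual_rep Y) (fmap (duality K Q) X Y f)) (dmap X)"
      unfolding op.Rep_simps .
  qed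
qed

end

section \<open>Trees: the global tensor functor gives a direct summand\<close>

lemma set_addI: "a \<in> A \<Longrightarrow> b \<in> B \<Longrightarrow> a \<oplus>\<^bsub>V\<^esub> b \<in> A <+>\<^bsub>V\<^esub> B"
  by (auto simp: set_add_def set_mult_def)

lemma set_addE: assumes "v \<in> A <+>\<^bsub>V\<^esub> B" obtains a b where "a \<in> A" "b \<in> B" "v = a \<oplus>\<^bsub>V\<^esub> b"
  using assms by (auto simp: set_add_def set_mult_def)

text \<open>
  A complement of \<open>N\<close> can be chosen to contain a given \<open>M\<close> that meets \<open>N\<close> trivially.
\<close>

lemma (in base) complement_above:
  assumes V: "fd_space K V" and N: "ssp N V" and M: "ssp M V" and disj: "N \<inter> M \<subseteq> {\<zero>\<^bsub>V\<^esub>}"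
  shows "\<exists>N'. ssp N' V \<and> M \<subseteq> N' \<and> N \<inter> N' = {\<zero>\<^bsub>V\<^esub>} \<and> N <+>\<^bsub>V\<^esub> N' = carrier V"
proof -
  note vV = fd_vs[OF V]
  interpret V: vectorspace K V by (rule vV)
  note NM = ssp_set_add[OF N M]
  obtain C where C: "ssp C V" "(N <+>\<^bsub>V\<^esub> M) \<inter> C = {\<zero>\<^bsub>V\<^esub>}" "(N <+>\<^bsub>V\<^esub> M) <+>\<^bsub>V\<^esub> C = carrier V"
    using complement_ex[OF V NM] by blast
  note n = ssp_mem[OF N] and m = ssp_mem[OF M] and c = ssp_mem[OF C(1)]
  note MC = ssp_set_add[OF M C(1)]
  have "u = \<zero>\<^bsub>V\<^esub>" if u: "u \<in> N" "u \<in> M <+>\<^bsub>V\<^esub> C" for u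
  proof -
    from u(2) obtain p q where pq: "p \<in> M" "q \<in> C" "u = p \<oplus>\<^bsub>V\<^esub> q" unfolding mem_set_add by blast
    have "q = u \<ominus>\<^bsub>V\<^esub> p" using vs_add_minus[OF vV c[OF pq(2)] m[OF pq(1)]] pq(3) by simp
    moreover have "u \<in> N <+>\<^bsub>V\<^esub> M" "p \<in> N <+>\<^bsub>V\<^esub> M"
      using set_add_sup1[OF N M] set_add_sup2[OF N M] u(1) pq(1) by auto
    ultimately have "q \<in> N <+>\<^bsub>V\<^esub> M" using ssp_minus[OF NM] by simp
    then have "q = \<zero>\<^bsub>V\<^esub>" using C(2) pq(2) by blast
    then have "u = p" using pq(3) m[OF pq(1)] by simp
    then show ?thesis using disj u(1) pq(1) by blast
  qed
  then have 1: "N \<inter> (M <+>\<^bsub>V\<^esub> C) = {\<zero>\<^bsub>V\<^esub>}" using ssp_zero[OF N] ssp_zero[OF MC] by blast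
  have "v \<in> N <+>\<^bsub>V\<^esub> (M <+>\<^bsub>V\<^esub> C)" if v: "v \<in> carrier V" for v
  proof -
    from v C(3) have "v \<in> (N <+>\<^bsub>V\<^esub> M) <+>\<^bsub>V\<^esub> C" by simp
    then obtain s r where s: "s \<in> N <+>\<^bsub>V\<^esub> M" and r: "r \<in> C" "v = s \<oplus>\<^bsub>V\<^esub> r" by (rule set_addE)
    from s obtain p q where pq: "p \<in> N" "q \<in> M" "s = p \<oplus>\<^bsub>V\<^esub> q" by (rule set_addE)
    then have "v = p \<oplus>\<^bsub>V\<^esub> (q \<oplus>\<^bsub>V\<^esub> r)" using r n m c by (simp add: V.M.a_assoc)
    then show ?thesis using pq(1,2) r(1) by (simp add: set_addI)
  qed
  then have "N <+>\<^bsub>V\<^esub> (M <+>\<^bsub>V\<^esub> C) = carrier V" using ssp_sub[OF ssp_set_add[OF N MC]] by blast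
  then show ?thesis using 1 MC set_add_sup1[OF M C(1)] by blast
qed

text \<open>A complement of \<open>Z\<close> inside the subspace \<open>L\<close>.\<close>

lemma (in base) complement_in:
  assumes V: "fd_space K V" and L: "ssp L V" and Z: "ssp Z V" and sub: "Z \<subseteq> L"
  shows "\<exists>N. ssp N V \<and> N \<subseteq> L \<and> Z \<inter> N = {\<zero>\<^bsub>V\<^esub>} \<and> (\<forall>l\<in>L. \<exists>z\<in>Z. \<exists>n\<in>N. l = z \<oplus>\<^bsub>V\<^esub> n)"
proof -
  have "ssp Z (V\<lparr>carrier := L\<rparr>)" unfolding ssp_sub_iff[OF L] using Z sub by blast
  from complement_ex[OF fd_ssp[OF V L] this] obtain N where
    N: "ssp N (V\<lparr>carrier := L\<rparr>)" "Z \<inter> N = {\<zero>\<^bsub>V\<^esub>}" "Z <+>\<^bsub>V\<lparr>carrier := L\<rparr>\<^esub> N = L" by auto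
  have "\<exists>z\<in>Z. \<exists>n\<in>N. l = z \<oplus>\<^bsub>V\<^esub> n" if "l \<in> L" for l
    using that N(3) mem_set_add[where x = l and A = Z and V = "V\<lparr>carrier := L\<rparr>" and B = N] by simp
  then show ?thesis using N(1,2) unfolding ssp_sub_iff[OF L] by blast
qed

context quiver
begin

context
  fixes V :: "('k, ('k, 's) univ, 'v, 'a) quiver_rep"
  assumes V: "rep V"
begin

text \<open>
  The conditions at a vertex: \<open>N\<close> lies in the epimorphic part \<open>E\<close> and maps onto \<open>(R V)\<^sub>x\<close>, and \<open>N'\<close> is
  a complement of \<open>N\<close> containing the kernel \<open>Kr\<close> of the maximal monomorphic quotient.
\<close>

definition splits_at :: "'v \<Rightarrow> ('k, 's) univ set \<Rightarrow> ('k, 's) univ set \<Rightarrow> bool" where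
  "splits_at x N N' \<longleftrightarrow> ssp N (vsp V x) \<and> ssp N' (vsp V x) \<and> N \<subseteq> epi V x \<and> mker V x \<subseteq> N' \<and>
     N \<inter> N' = {\<zero>\<^bsub>vsp V x\<^esub>} \<and> N <+>\<^bsub>vsp V x\<^esub> N' = carrier (vsp V x) \<and>
     (\<forall>e\<in>epi V x. \<exists>n\<in>N. \<exists>k\<in>mker V x. e = n \<oplus>\<^bsub>vsp V x\<^esub> k)"

lemma splits_atD:
  assumes "splits_at x N N'"
  shows "ssp N (vsp V x)" "ssp N' (vsp V x)" "N \<subseteq> epi V x" "mker V x \<subseteq> N'"
    "N \<inter> N' = {\<zero>\<^bsub>vsp V x\<^esub>}" "N <+>\<^bsub>vsp V x\<^esub> N' = carrier (vsp V x)"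
    "e \<in> epi V x \<Longrightarrow> \<exists>n\<in>N. \<exists>k\<in>mker V x. e = n \<oplus>\<^bsub>vsp V x\<^esub> k"
  using assms unfolding splits_at_def by blast+

lemma splits_at_ex:
  assumes x: "x \<in> verts Q" shows "\<exists>N N'. splits_at x N N'"
proof -
  note E = epi_ssp[OF V x] and M = mker_ssp[OF V x]
  interpret X: vectorspace K "vsp V x" by (rule rep_vs[OF V x])
  obtain N where N: "ssp N (vsp V x)" "N \<subseteq> epi V x" "(mker V x \<inter> epi V x) \<inter> N = {\<zero>\<^bsub>vsp V x\<^esub>}"
    "\<forall>l\<in>epi V x. \<exists>z\<in>mker V x \<inter> epi V x. \<exists>n\<in>N. l = z \<oplus>\<^bsub>vsp V x\<^esub> n"
    using complement_in[OF rep_fd[OF V x] E ssp_Int[OF M E]] by blast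
  have "N \<inter> mker V x \<subseteq> {\<zero>\<^bsub>vsp V x\<^esub>}" using N(2,3) by blast
  from complement_above[OF rep_fd[OF V x] N(1) M this] obtain N' where
    N': "ssp N' (vsp V x)" "mker V x \<subseteq> N'" "N \<inter> N' = {\<zero>\<^bsub>vsp V x\<^esub>}" "N <+>\<^bsub>vsp V x\<^esub> N' = carrier (vsp V x)" by blast
  have "\<exists>n\<in>N. \<exists>k\<in>mker V x. e = n \<oplus>\<^bsub>vsp V x\<^esub> k" if e: "e \<in> epi V x" for e
  proof -
    from N(4) e obtain z n where zn: "z \<in> mker V x" "n \<in> N" "e = z \<oplus>\<^bsub>vsp V x\<^esub> n" by blast
    then have "e = n \<oplus>\<^bsub>vsp V x\<^esub> z" using X.M.a_comm[OF ssp_mem[OF M zn(1)] ssp_mem[OF N(1) zn(2)]] by simp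
    then show ?thesis using zn by blast
  qed
  then show ?thesis unfolding splits_at_def using N(1,2) N' by blast
qed

text \<open>
  Transport of such a choice along an arrow out of the tree built so far: \<open>M\<close> is the image of \<open>N\<close>, and \<open>M'\<close>
  a complement of it containing the image of \<open>N'\<close> and \<open>Kr\<close>.  The image of \<open>N\<close> meets the sum of the latter
  two trivially, because \<open>Kr\<close> is saturated.
\<close>

lemma splits_forward:
  assumes a: "a \<in> arcs Q" and N: "splits_at (tail Q a) N N'"
  shows "\<exists>M M'. splits_at (head Q a) M M' \<and> amap V a ` N = M \<and> amap V a ` N' \<subseteq> M'"
proof -
  note t = tail_v[OF a] and h = head_v[OF a]
  note m = rep_mhom[OF V a] and vt = rep_vs[OF V t] and vh = rep_vs[OF V h]
  note D = splits_atD[OF N]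
  interpret H: vectorspace K "vsp V (head Q a)" by (rule vh)
  note iN = ssp_image[OF D(1) m vh] and iN' = ssp_image[OF D(2) m vh] and Kh = mker_ssp[OF V h]
  note M0 = ssp_set_add[OF iN' Kh]
  have "u = \<zero>\<^bsub>vsp V (head Q a)\<^esub>"
    if u: "u \<in> amap V a ` N" "u \<in> amap V a ` N' <+>\<^bsub>vsp V (head Q a)\<^esub> mker V (head Q a)" for u
  proof -
    from u obtain n n' k where n: "n \<in> N" "u = amap V a n" and n': "n' \<in> N'" and k: "k \<in> mker V (head Q a)"
      and eq: "u = amap V a n' \<oplus>\<^bsub>vsp V (head Q a)\<^esub> k" unfolding mem_set_add by blast
    note nc = ssp_mem[OF D(1) n(1)] and nc' = ssp_mem[OF D(2) n'] and kc = ssp_mem[OF Kh k]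
    have "amap V a (n \<ominus>\<^bsub>vsp V (tail Q a)\<^esub> n') = k"
      using hom_minus[OF vt vh m nc nc'] vs_add_minus[OF vh kc hom_closed[OF m nc']] eq n(2) by simp
    then have "n \<ominus>\<^bsub>vsp V (tail Q a)\<^esub> n' \<in> mker V (tail Q a)"
      using satsubD[OF satsub_mker[OF V] a vs_minus[OF vt nc nc']] k by simp
    then have "n \<ominus>\<^bsub>vsp V (tail Q a)\<^esub> n' \<in> N'" using D(4) by blast
    then have "n \<in> N'" using ssp_add[OF D(2) n'] vs_minus_add[OF vt nc nc'] by metis
    then have "n = \<zero>\<^bsub>vsp V (tail Q a)\<^esub>" using D(5) n(1) by blast
    then show ?thesis using n(2) hom_zero[OF vt vh m] by simp
  qed
  then have "amap V a ` N \<inter> (amap V a ` N' <+>\<^bsub>vsp V (head Q a)\<^esub> mker V (head Q a)) \<subseteq> {\<zero>\<^bsub>vsp V (head Q a)\<^esub>}" by blast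
  from complement_above[OF rep_fd[OF V h] iN M0 this] obtain M' where
    M': "ssp M' (vsp V (head Q a))" "amap V a ` N' <+>\<^bsub>vsp V (head Q a)\<^esub> mker V (head Q a) \<subseteq> M'"
    "amap V a ` N \<inter> M' = {\<zero>\<^bsub>vsp V (head Q a)\<^esub>}" "amap V a ` N <+>\<^bsub>vsp V (head Q a)\<^esub> M' = carrier (vsp V (head Q a))"
    by blast
  have "\<exists>n\<in>amap V a ` N. \<exists>k\<in>mker V (head Q a). e = n \<oplus>\<^bsub>vsp V (head Q a)\<^esub> k" if e: "e \<in> epi V (head Q a)" for e
  proof -
    from episub_surj[OF episub_epi[OF V] a e] obtain e' where e': "e' \<in> epi V (tail Q a)" "e = amap V a e'" .
    from D(7)[OF e'(1)] obtain n k where nk: "n \<in> N" "k \<in> mker V (tail Q a)" "e' = n \<oplus>\<^bsub>vsp V (tail Q a)\<^esub> k" by blast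
    have "e = amap V a n \<oplus>\<^bsub>vsp V (head Q a)\<^esub> amap V a k"
      unfolding e'(2) nk(3) by (rule hom_add[OF m ssp_mem[OF D(1) nk(1)] mker_mem[OF V t nk(2)]])
    moreover have "amap V a k \<in> mker V (head Q a)" by (rule subrep_arr[OF satsub_subrep[OF satsub_mker[OF V]] a nk(2)])
    ultimately show ?thesis using nk(1) by blast
  qed
  moreover have "amap V a ` N \<subseteq> epi V (head Q a)" using D(3) epi_arr[OF V a] by blast
  ultimately have "splits_at (head Q a) (amap V a ` N) M'"
    unfolding splits_at_def using iN M' set_add_sup2[OF iN' Kh] by blast
  then show ?thesis using M'(2) set_add_sup1[OF iN' Kh] by blast
qed

text \<open>
  Transport against an arrow: \<open>M'\<close> is the preimage of \<open>N'\<close>, and \<open>M\<close> is a subspace of \<open>E\<close> that the arrow maps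
  bijectively onto \<open>N\<close>.
\<close>

lemma splits_backward:
  assumes a: "a \<in> arcs Q" and N: "splits_at (head Q a) N N'"
  shows "\<exists>M M'. splits_at (tail Q a) M M' \<and> amap V a ` M = N \<and> amap V a ` M' \<subseteq> N'"
proof -
  note t = tail_v[OF a] and h = head_v[OF a]
  note m = rep_mhom[OF V a] and vt = rep_vs[OF V t] and vh = rep_vs[OF V h]
  note D = splits_atD[OF N]
  interpret T: vectorspace K "vsp V (tail Q a)" by (rule vt)
  define L where "L = epi V (tail Q a) \<inter> {v \<in> carrier (vsp V (tail Q a)). amap V a v \<in> N}"
  define Z where "Z = L \<inter> {v \<in> carrier (vsp V (tail Q a)). amap V a v = \<zero>\<^bsub>vsp V (head Q a)\<^esub>}"
  have L: "ssp L (vsp V (tail Q a))" unfolding L_def by (rule ssp_Int[OF epi_ssp[OF V t] ssp_vimage[OF vt m D(1)]])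
  have Z: "ssp Z (vsp V (tail Q a))" unfolding Z_def by (rule ssp_Int[OF L ssp_ker[OF vt vh m]])
  from complement_in[OF rep_fd[OF V t] L Z] obtain M where
    M: "ssp M (vsp V (tail Q a))" "M \<subseteq> L" "Z \<inter> M = {\<zero>\<^bsub>vsp V (tail Q a)\<^esub>}"
    "\<forall>l\<in>L. \<exists>z\<in>Z. \<exists>n\<in>M. l = z \<oplus>\<^bsub>vsp V (tail Q a)\<^esub> n" unfolding Z_def by blast
  define M' where "M' = {v \<in> carrier (vsp V (tail Q a)). amap V a v \<in> N'}"
  have M': "ssp M' (vsp V (tail Q a))" unfolding M'_def by (rule ssp_vimage[OF vt m D(2)])
  have lift: "\<exists>p\<in>M. amap V a p = n" if n: "n \<in> N" for n
  proof -
    from episub_surj[OF episub_epi[OF V] a subsetD[OF D(3) n]] obtain e where e: "e \<in> epi V (tail Q a)" "n = amap V a e" .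
    then have "e \<in> L" unfolding L_def using n epi_mem[OF V t e(1)] by blast
    with M(4) obtain z p where zp: "z \<in> Z" "p \<in> M" "e = z \<oplus>\<^bsub>vsp V (tail Q a)\<^esub> p" by blast
    have pc: "p \<in> carrier (vsp V (tail Q a))" by (rule ssp_mem[OF M(1) zp(2)])
    have z: "z \<in> carrier (vsp V (tail Q a))" "amap V a z = \<zero>\<^bsub>vsp V (head Q a)\<^esub>" using zp(1) by (auto simp: Z_def)
    interpret H: vectorspace K "vsp V (head Q a)" by (rule vh)
    have "amap V a p = n" using e(2) zp(3) hom_add[OF m z(1) pc] z(2) hom_closed[OF m pc] by simp
    then show ?thesis using zp(2) by blast
  qed
  have im: "amap V a ` M = N" using lift M(2) unfolding L_def by blast
  have "u = \<zero>\<^bsub>vsp V (tail Q a)\<^esub>" if u: "u \<in> M" "u \<in> M'" for u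
  proof -
    have "amap V a u = \<zero>\<^bsub>vsp V (head Q a)\<^esub>" using u im D(5) unfolding M'_def by blast
    then have "u \<in> Z" unfolding Z_def using u(1) M(2) ssp_mem[OF M(1)] by blast
    then show ?thesis using M(3) u(1) by blast
  qed
  then have disj: "M \<inter> M' = {\<zero>\<^bsub>vsp V (tail Q a)\<^esub>}" using ssp_zero[OF M(1)] ssp_zero[OF M'] by blast
  have split: "v = p \<oplus>\<^bsub>vsp V (tail Q a)\<^esub> (v \<ominus>\<^bsub>vsp V (tail Q a)\<^esub> p)"
      "v \<ominus>\<^bsub>vsp V (tail Q a)\<^esub> p \<in> carrier (vsp V (tail Q a))" "amap V a (v \<ominus>\<^bsub>vsp V (tail Q a)\<^esub> p) = q"
    if v: "v \<in> carrier (vsp V (tail Q a))" and p: "p \<in> M" and q: "q \<in> carrier (vsp V (head Q a))"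
      and eq: "amap V a v = amap V a p \<oplus>\<^bsub>vsp V (head Q a)\<^esub> q" for v p q
  proof -
    have pc: "p \<in> carrier (vsp V (tail Q a))" by (rule ssp_mem[OF M(1) p])
    show "v = p \<oplus>\<^bsub>vsp V (tail Q a)\<^esub> (v \<ominus>\<^bsub>vsp V (tail Q a)\<^esub> p)" using vs_minus_add[OF vt v pc] by simp
    show "v \<ominus>\<^bsub>vsp V (tail Q a)\<^esub> p \<in> carrier (vsp V (tail Q a))" by (rule vs_minus[OF vt v pc])
    show "amap V a (v \<ominus>\<^bsub>vsp V (tail Q a)\<^esub> p) = q"
      unfolding hom_minus[OF vt vh m v pc] eq by (rule vs_add_minus[OF vh q hom_closed[OF m pc]])
  qed
  have "v \<in> M <+>\<^bsub>vsp V (tail Q a)\<^esub> M'" if v: "v \<in> carrier (vsp V (tail Q a))" for v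
  proof -
    have "amap V a v \<in> N <+>\<^bsub>vsp V (head Q a)\<^esub> N'" using D(6) hom_closed[OF m v] by simp
    then obtain n n' where nn: "n \<in> N" "n' \<in> N'" "amap V a v = n \<oplus>\<^bsub>vsp V (head Q a)\<^esub> n'" unfolding mem_set_add by blast
    from lift[OF nn(1)] obtain p where p: "p \<in> M" "amap V a p = n" by blast
    note s = split[OF v p(1) ssp_mem[OF D(2) nn(2)] nn(3)[folded p(2)]]
    have "v \<ominus>\<^bsub>vsp V (tail Q a)\<^esub> p \<in> M'" unfolding M'_def using s(2,3) nn(2) by simp
    then show ?thesis unfolding mem_set_add using s(1) p(1) by blast
  qed
  then have sum: "M <+>\<^bsub>vsp V (tail Q a)\<^esub> M' = carrier (vsp V (tail Q a))" using ssp_sub[OF ssp_set_add[OF M(1) M']] by blast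
  have "\<exists>n\<in>M. \<exists>k\<in>mker V (tail Q a). e = n \<oplus>\<^bsub>vsp V (tail Q a)\<^esub> k" if e: "e \<in> epi V (tail Q a)" for e
  proof -
    from D(7)[OF epi_arr[OF V a e]] obtain n k where nk: "n \<in> N" "k \<in> mker V (head Q a)" "amap V a e = n \<oplus>\<^bsub>vsp V (head Q a)\<^esub> k" by blast
    from lift[OF nk(1)] obtain p where p: "p \<in> M" "amap V a p = n" by blast
    note s = split[OF epi_mem[OF V t e] p(1) mker_mem[OF V h nk(2)] nk(3)[folded p(2)]]
    have "e \<ominus>\<^bsub>vsp V (tail Q a)\<^esub> p \<in> mker V (tail Q a)" using satsubD[OF satsub_mker[OF V] a s(2)] s(3) nk(2) by simp
    then show ?thesis using s(1) p(1) by blast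
  qed
  moreover have "mker V (tail Q a) \<subseteq> M'"
    unfolding M'_def using mker_mem[OF V t] subrep_arr[OF satsub_subrep[OF satsub_mker[OF V]] a] D(4) by blast
  moreover have "M \<subseteq> epi V (tail Q a)" using M(2) unfolding L_def by blast
  ultimately have "splits_at (tail Q a) M M'" unfolding splits_at_def using M(1) M' disj sum by blast
  then show ?thesis using im unfolding M'_def by blast
qed

text \<open>
  A compatible choice over a subtree with vertex set \<open>S\<close> and arrow set \<open>T\<close>.  The first condition
  says that \<open>T\<close> connects the vertices of \<open>S\<close> to \<open>x\<^sub>0\<close>.
\<close>

definition splits_on :: "'v \<Rightarrow> 'v set \<Rightarrow> 'a set \<Rightarrow> ('v \<Rightarrow> ('k, 's) univ set) \<Rightarrow> ('v \<Rightarrow> ('k, 's) univ set) \<Rightarrow> bool" where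
  "splits_on x\<^sub>0 S T N N' \<longleftrightarrow>
     (\<forall>C. x\<^sub>0 \<in> C \<longrightarrow> (\<forall>a\<in>T. tail Q a \<in> C \<longleftrightarrow> head Q a \<in> C) \<longrightarrow> S \<subseteq> C) \<and>
     S \<subseteq> verts Q \<and> T \<subseteq> arcs Q \<and> (\<forall>a\<in>T. tail Q a \<in> S \<and> head Q a \<in> S) \<and>
     (\<forall>x\<in>S. splits_at x (N x) (N' x)) \<and>
     (\<forall>a\<in>T. amap V a ` N (tail Q a) = N (head Q a) \<and> amap V a ` N' (tail Q a) \<subseteq> N' (head Q a))"

lemma splits_onD:
  assumes "splits_on x\<^sub>0 S T N N'"
  shows "x\<^sub>0 \<in> C \<Longrightarrow> (\<And>a. a \<in> T \<Longrightarrow> tail Q a \<in> C \<longleftrightarrow> head Q a \<in> C) \<Longrightarrow> S \<subseteq> C"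
    and "S \<subseteq> verts Q" and "T \<subseteq> arcs Q"
    and "a \<in> T \<Longrightarrow> tail Q a \<in> S" and "a \<in> T \<Longrightarrow> head Q a \<in> S"
    and "x \<in> S \<Longrightarrow> splits_at x (N x) (N' x)"
    and "a \<in> T \<Longrightarrow> amap V a ` N (tail Q a) = N (head Q a)"
    and "a \<in> T \<Longrightarrow> amap V a ` N' (tail Q a) \<subseteq> N' (head Q a)"
  using assms unfolding splits_on_def by simp_all

lemma splits_on_extend:
  assumes S: "splits_on x\<^sub>0 S T N N'" and a: "a \<in> arcs Q" and end1: "tail Q a \<in> S \<longleftrightarrow> head Q a \<notin> S"
  shows "\<exists>y T' N1 N1'. y \<in> verts Q \<and> y \<notin> S \<and> splits_on x\<^sub>0 (insert y S) T' N1 N1'"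
proof -
  obtain y M M' where y: "y \<in> verts Q" "y \<notin> S" "tail Q a = y \<or> head Q a = y" and M: "splits_at y M M'"
    and c: "amap V a ` (N(y := M)) (tail Q a) = (N(y := M)) (head Q a)"
      "amap V a ` (N'(y := M')) (tail Q a) \<subseteq> (N'(y := M')) (head Q a)"
  proof (cases "tail Q a \<in> S")
    case True
    then have h: "head Q a \<notin> S" using end1 by blast
    have "splits_at (tail Q a) (N (tail Q a)) (N' (tail Q a))" by (rule splits_onD(6)[OF S True])
    from splits_forward[OF a this] obtain M M' where M: "splits_at (head Q a) M M'"
      "amap V a ` N (tail Q a) = M" "amap V a ` N' (tail Q a) \<subseteq> M'" by blast
    have "tail Q a \<noteq> head Q a" using True h by metis
    then show thesis using M h by (intro that[of "head Q a" M M'] head_v[OF a]) simp_all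
  next
    case False
    then have h: "head Q a \<in> S" using end1 by blast
    have "splits_at (head Q a) (N (head Q a)) (N' (head Q a))" by (rule splits_onD(6)[OF S h])
    from splits_backward[OF a this] obtain M M' where M: "splits_at (tail Q a) M M'"
      "amap V a ` M = N (head Q a)" "amap V a ` M' \<subseteq> N' (head Q a)" by blast
    have "head Q a \<noteq> tail Q a" using False h by metis
    then show thesis using M False by (intro that[of "tail Q a" M M'] tail_v[OF a]) simp_all
  qed
  have "splits_on x\<^sub>0 (insert y S) (insert a T) (N(y := M)) (N'(y := M'))"
    unfolding splits_on_def
  proof (intro conjI allI impI ballI)
    fix C assume C: "x\<^sub>0 \<in> C" "\<forall>b\<in>insert a T. tail Q b \<in> C \<longleftrightarrow> head Q b \<in> C"
    then have "S \<subseteq> C" by (intro splits_onD(1)[OF S]) simp_all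
    moreover from this have "y \<in> C" using C(2) y(2,3) end1 by blast
    ultimately show "insert y S \<subseteq> C" by blast
  next
    show "insert y S \<subseteq> verts Q" "insert a T \<subseteq> arcs Q" using splits_onD(2,3)[OF S] y(1) a by simp_all
  next
    fix b assume "b \<in> insert a T"
    then have "b = a \<or> b \<in> T" by blast
    moreover have "tail Q a \<in> insert y S" "head Q a \<in> insert y S" using y(2,3) end1 by blast+
    ultimately show "tail Q b \<in> insert y S" "head Q b \<in> insert y S"
      using splits_onD(4,5)[OF S, of b] by (metis insertCI)+
  next
    fix x assume "x \<in> insert y S"
    then show "splits_at x ((N(y := M)) x) ((N'(y := M')) x)" using splits_onD(6)[OF S] M by auto
  next
    fix b assume "b \<in> insert a T"
    then consider "b = a" | "b \<in> T" by blast
    then show "amap V b ` (N(y := M)) (tail Q b) = (N(y := M)) (head Q b)"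
    proof cases
      case 1 then show ?thesis using c(1) by (simp only:)
    next
      case 2
      then have "tail Q b \<noteq> y" "head Q b \<noteq> y" using splits_onD(4,5)[OF S 2] y(2) by metis+
      then show ?thesis using splits_onD(7)[OF S 2] by simp
    qed
  next
    fix b assume "b \<in> insert a T"
    then consider "b = a" | "b \<in> T" by blast
    then show "amap V b ` (N'(y := M')) (tail Q b) \<subseteq> (N'(y := M')) (head Q b)"
    proof cases
      case 1 then show ?thesis using c(2) by (simp only:)
    next
      case 2
      then have "tail Q b \<noteq> y" "head Q b \<noteq> y" using splits_onD(4,5)[OF S 2] y(2) by metis+
      then show ?thesis using splits_onD(8)[OF S 2] by simp
    qed
  qed
  then show ?thesis using y(1,2) by blast
qed

text \<open>
  A choice over a subtree with as many vertices as possible lives on all vertices, for otherwise some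
  arrow has exactly one end in the vertex set and the choice extends along it.
\<close>

lemma splits_on_all:
  assumes fin: "finite (verts Q)" and conn: "connected Q" and x: "x\<^sub>0 \<in> verts Q"
  shows "\<exists>T N N'. splits_on x\<^sub>0 (verts Q) T N N'"
proof -
  define P where "P S \<longleftrightarrow> x\<^sub>0 \<in> S \<and> (\<exists>T N N'. splits_on x\<^sub>0 S T N N')" for S
  obtain M M' where "splits_at x\<^sub>0 M M'" using splits_at_ex[OF x] by blast
  then have "splits_on x\<^sub>0 {x\<^sub>0} {} (\<lambda>_. M) (\<lambda>_. M')" unfolding splits_on_def using x by simp
  then have "P {x\<^sub>0}" unfolding P_def by blast
  from ex_has_least_nat[of P, OF this, of "\<lambda>S. card (verts Q - S)"]
  obtain S where S: "P S" "\<And>S'. P S' \<Longrightarrow> card (verts Q - S) \<le> card (verts Q - S')" by blast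
  from S(1) obtain T N N' where s: "x\<^sub>0 \<in> S" "splits_on x\<^sub>0 S T N N'" unfolding P_def by blast
  have "tail Q a \<in> S \<longleftrightarrow> head Q a \<in> S" if a: "a \<in> arcs Q" for a
  proof (rule ccontr)
    assume "\<not> ?thesis"
    then have "tail Q a \<in> S \<longleftrightarrow> head Q a \<notin> S" by blast
    from splits_on_extend[OF s(2) a this] obtain y where y: "y \<in> verts Q" "y \<notin> S" "P (insert y S)"
      unfolding P_def using s(1) by blast
    have "card (verts Q - insert y S) < card (verts Q - S)"
      by (rule psubset_card_mono) (use fin y(1,2) in auto)
    then show False using S(2)[OF y(3)] by simp
  qed
  from connected_closed_set[OF conn s(1) x this] have "S = verts Q" using splits_onD(2)[OF s(2)] by blast
  then show ?thesis using s(2) by blast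
qed

theorem tree_summand:
  assumes fin: "finite (verts Q)" and tree: "tree_quiver Q"
  shows "\<exists>N. direct_summand K Q V N \<and> isomorphic (Rep K Q) (Robj V) (sub_rep Q V N)"
proof -
  have conn: "connected Q" using tree by (simp add: tree_quiver_def)
  then obtain x\<^sub>0 where x: "x\<^sub>0 \<in> verts Q" unfolding connected_def strongly_connected_def by auto
  from splits_on_all[OF fin conn x] obtain T N N' where s: "splits_on x\<^sub>0 (verts Q) T N N'" by blast
  note sT = splits_onD(1)[OF s] and T = splits_onD(3)[OF s] and at = splits_onD(6)[OF s] and arr = splits_onD(7,8)[OF s]
  note D = splits_atD[OF at]
  \<comment> \<open>An arrow outside \<open>T\<close> could be deleted without disconnecting the quiver.\<close>
  have arcs: "b \<in> T" if b: "b \<in> arcs Q" for b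
  proof (rule ccontr)
    assume nb: "b \<notin> T"
    let ?G = "pre_digraph.del_arc Q b"
    have G: "verts ?G = verts Q" "arcs ?G = arcs Q - {b}" "tail ?G = tail Q" "head ?G = head Q"
      by (simp_all add: pre_digraph.del_arc_def)
    have "connected ?G"
    proof (rule connectedI_closed_set)
      show "verts ?G \<noteq> {}" using x unfolding G by blast
      show "wf_digraph ?G" by (rule wf_digraph.intro) (use tail_v head_v G in auto)
      fix C assume C: "C \<subseteq> verts ?G" "C \<noteq> {}" and cl: "\<And>a. a \<in> arcs ?G \<Longrightarrow> tail ?G a \<in> C \<longleftrightarrow> head ?G a \<in> C"
      have clT: "tail Q a \<in> C \<longleftrightarrow> head Q a \<in> C" if "a \<in> T" for a
        using cl[of a] that T nb unfolding G by blast
      show "verts ?G \<subseteq> C" unfolding G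
      proof (cases "x\<^sub>0 \<in> C")
        case True then show "verts Q \<subseteq> C" using sT clT by blast
      next
        case False
        have "verts Q \<subseteq> - C" by (rule sT) (use False clT in auto)
        then show "verts Q \<subseteq> C" using C unfolding G by blast
      qed
    qed
    then show False using tree b unfolding tree_quiver_def by blast
  qed
  have sub: "subrep K Q V N" "subrep K Q V N'"
    unfolding subrep_def using D(1,2) arr arcs by blast+
  have ds: "direct_summand K Q V N"
    unfolding direct_summand_def using sub D(5,6) by blast
  let ?W = "sub_rep Q V N"
  have W: "rep ?W"
    unfolding is_rep_def
  proof (intro conjI ballI)
    fix x assume "x \<in> verts Q"
    then show "fd_space K (vsp ?W x)" using fd_ssp[OF rep_fd[OF V] D(1)] by (simp add: sub_rep_def)
  next
    fix a assume a: "a \<in> arcs Q"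
    note t = tail_v[OF a] and h = head_v[OF a]
    have "amap V a \<in> module_hom K ((vsp V (tail Q a))\<lparr>carrier := N (tail Q a)\<rparr>) ((vsp V (head Q a))\<lparr>carrier := N (head Q a)\<rparr>)"
      using subrep_arr[OF sub(1) a] ssp_mem[OF D(1)[OF t]] hom_add[OF rep_mhom[OF V a]] hom_smult[OF rep_mhom[OF V a]]
      by (intro homI) simp_all
    from lin_restrict[OF ssp_is_vs[OF D(1)[OF t]] this]
    show "amap ?W a \<in> lin K (vsp ?W (tail Q a)) (vsp ?W (head Q a))" by (simp add: sub_rep_def)
  qed
  define f where "f = (\<lambda>x\<in>verts Q. restrict (mproj V x) (carrier (vsp ?W x)))"
  have Wv: "vsp ?W x = (vsp V x)\<lparr>carrier := N x\<rparr>" "amap ?W a = restrict (amap V a) (N (tail Q a))" for x a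
    by (simp_all add: sub_rep_def)
  have mh: "mproj V x \<in> module_hom K (vsp ?W x) (vsp (Robj V) x)" if x: "x \<in> verts Q" for x
    unfolding Wv using subsetD[OF D(3)[OF x]] mproj_mem[OF V x] mproj_add[OF V x] mproj_smult[OF V x]
    by (intro homI) simp_all
  have f: "f \<in> rep_hom K Q ?W (Robj V)"
    unfolding f_def
  proof (rule rhomI'[OF W mh])
    fix a v assume a: "a \<in> arcs Q" and v: "v \<in> carrier (vsp ?W (tail Q a))"
    then have v: "v \<in> N (tail Q a)" by (simp add: Wv)
    show "mproj V (head Q a) (amap ?W a v) = amap (Robj V) a (mproj V (tail Q a) v)"
      using R_amap[OF V a subsetD[OF D(3)[OF tail_v[OF a]] v]] v by (simp add: Wv)
  qed
  have "iso_arr (Rep K Q) ?W (Robj V) f"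
  proof (rule rep_iso[OF W f _ R_rep[OF V]])
    fix x assume x: "x \<in> verts Q"
    have "inj_on (mproj V x) (carrier (vsp ?W x))"
      unfolding inj_hom_iff[OF rep_vs[OF W x] fd_vs[OF R_fd[OF V x]] mh[OF x]]
    proof (intro ballI impI)
      fix v assume v: "v \<in> carrier (vsp ?W x)" and z: "mproj V x v = \<zero>\<^bsub>vsp (Robj V) x\<^esub>"
      have vN: "v \<in> N x" using v by (simp add: Wv)
      have "v \<in> mker V x" using R_zero[OF V x subsetD[OF D(3)[OF x] vN]] z by simp
      then show "v = \<zero>\<^bsub>vsp ?W x\<^esub>" using D(4)[OF x] D(5)[OF x] vN by (auto simp: Wv)
    qed
    moreover have "u \<in> mproj V x ` N x" if "u \<in> carrier (vsp (Robj V) x)" for u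
    proof -
      from R_carrierE[OF V that x] obtain e where e: "e \<in> epi V x" "u = mproj V x e" .
      from D(7)[OF x e(1)] obtain n k where nk: "n \<in> N x" "k \<in> mker V x" "e = n \<oplus>\<^bsub>vsp V x\<^esub> k" by blast
      note nc = ssp_mem[OF D(1)[OF x] nk(1)]
      have "e \<ominus>\<^bsub>vsp V x\<^esub> n = k" using vs_add_minus[OF rep_vs[OF V x] mker_mem[OF V x nk(2)] nc] nk(3) by simp
      then have "u = mproj V x n" using mproj_eq[OF V x epi_mem[OF V x e(1)] nc] nk(2) e(2) by simp
      then show ?thesis using nk(1) by blast
    qed
    moreover have "mproj V x ` N x \<subseteq> carrier (vsp (Robj V) x)" using mproj_mem[OF V x] D(3)[OF x] by blast
    ultimately show "bij_betw (f x) (carrier (vsp ?W x)) (carrier (vsp (Robj V) x))"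
      using x unfolding bij_betw_def by (auto simp: f_def Wv inj_on_def)
  qed
  then have "isomorphic (Rep K Q) ?W (Robj V)" unfolding isomorphic_def by blast
  from isomorphic_sym[OF this] show ?thesis using ds by blast
qed

end

end

theorem mainTheorem1:
  fixes K :: "('k, 'z) ring_scheme"
    and Q :: "('v, 'a) pre_digraph"
    and V :: "('k, ('k, 's) univ, 'v, 'a) quiver_rep"
  assumes "field K"
    and "fin_digraph Q"
    and "connected Q"
    and "V \<in> Ob (Rep K Q)"
  shows
    "((\<exists>c. tensor_functor (Rep K Q) (Rep K Q)
             (global_tensor_functor K Q :: ('k, ('k, 's) univ, 'v, 'a) rep_functor) c) \<and>
      naturally_isomorphic (op_cat (Rep K Q)) (Rep K (opposite Q))
        (comp_functor (duality K Q)
           (op_functor (global_tensor_functor K Q :: ('k, ('k, 's) univ, 'v, 'a) rep_functor)))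
        (comp_functor (global_tensor_functor K (opposite Q)) (duality K Q)))
     \<and>
     ((\<forall>a\<in>arcs Q. iso_arr (Vect K)
         (vsp (fob (global_tensor_functor K Q) V) (tail Q a))
         (vsp (fob (global_tensor_functor K Q) V) (head Q a))
         (amap (fob (global_tensor_functor K Q) V) a)) \<and>
      (\<forall>x\<in>verts Q. is_functor (Rep K Q) (Vect K)
         (global_rank_functor K Q x :: ('k, ('k, 's) univ, 'v, 'a) vect_functor)) \<and>
      (\<forall>x\<in>verts Q. \<forall>y\<in>verts Q. naturally_isomorphic (Rep K Q) (Vect K)
         (global_rank_functor K Q x :: ('k, ('k, 's) univ, 'v, 'a) vect_functor)
         (global_rank_functor K Q y)))
     \<and>
     (tree_quiver Q \<longrightarrow>
        (\<exists>N. direct_summand K Q V N \<and>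
             isomorphic (Rep K Q) (fob (global_tensor_functor K Q) V) (sub_rep Q V N)))"
proof -
  have K: "base K" using assms(1) by (simp add: base_def)
  interpret fin_digraph Q by (rule assms(2))
  interpret quiver K Q by (rule quiver.intro[OF K]) (unfold_locales)
  have V: "rep V" using assms(4) by (simp only: Rep_simps mem_Collect_eq)
  have c: "\<exists>c. tensor_functor (Rep K Q) (Rep K Q) (global_tensor_functor K Q :: ('k, ('k, 's) univ, 'v, 'a) rep_functor) c"
    by (rule exI) (rule GT_tensor_functor)
  show ?thesis
    by (intro conjI ballI impI c GT_duality Robj_iso_arr[OF V] rank_functor rank_functor_iso[OF assms(3)]
        tree_summand[OF V finite_verts])
qed

end
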